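(* For every fixed $r\geq 3$, the problem $r$-Swap is $\mathsf{W}[1]$-hard parameterized by the number of swaps $k$. Furthermore, there is no $f(k)\,n^{o(k)}$-time algorithm for $r$-Swap, for any computable function $f$, unless the Exponential Time Hypothesis fails (here $n$ is the number of vertices of the input graph).
   Context: All graphs are finite, simple and undirected. An $r$-coloring of a graph $G$ is any map $c:V(G)\to[r]$ (not necessarily proper); it is proper if adjacent vertices receive distinct colors. A swap between two distinct vertices $u,v$ assigns to $u$ the color of $v$ and to $v$ the color of $u$. $r$-Swap (for fixed $r$): given a graph $G$, an $r$-coloring $c$ of $G$ and a positive integer $k$, decide whether $c$ can be turned into a proper $r$-coloring of $G$ using at most $k$ swaps. Exponential Time Hypothesis: there is a constant $c>0$ such that 3-SAT on $n$ variables cannot be solved in time $2^{cn}\cdot\mathrm{poly}$. *)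

theory Defs
  imports Complex_Main "HOL-Library.Landau_Symbols"
begin

section \<open>Deterministic multi-tape Turing machines\<close>

text \<open>
  Tapes are infinite in both directions, over the alphabet \<open>{0, 1, blank}\<close> (\<^const>\<open>None\<close> is the
  blank). The states are \<open>0, \<dots>, num_states\<close>; \<open>0\<close> is the start state and \<open>num_states\<close> the halting
  state. Tape number 0 carries both the input and the output. All notions below are insensitive to
  replacing this model by a polynomially equivalent one.
\<close>

datatype move = MoveLeft | MoveStay | MoveRight

record tm =
  num_tapes :: nat
  num_states :: nat
  delta :: "nat \<Rightarrow> bool option list \<Rightarrow> nat \<times> (bool option \<times> move) list"

definition wf_tm :: "tm \<Rightarrow> bool" where
  "wf_tm M \<longleftrightarrow> 0 < num_tapes M \<and>
     (\<forall>q < num_states M. \<forall>ss. length ss = num_tapes M \<longrightarrow>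
        fst (delta M q ss) \<le> num_states M \<and> length (snd (delta M q ss)) = num_tapes M)"

type_synonym tape = "(int \<Rightarrow> bool option) \<times> int"
type_synonym config = "nat \<times> tape list"

fun offset :: "move \<Rightarrow> int" where
  "offset MoveLeft = -1"
| "offset MoveStay = 0"
| "offset MoveRight = 1"

fun act :: "bool option \<times> move \<Rightarrow> tape \<Rightarrow> tape" where
  "act (s, m) (c, h) = (c(h := s), h + offset m)"

fun step :: "tm \<Rightarrow> config \<Rightarrow> config" where
  "step M (q, ts) =
     (if q = num_states M then (q, ts)
      else let (q', as) = delta M q (map (\<lambda>(c, h). c h) ts) in (q', map2 act as ts))"

definition tape_content :: "bool list \<Rightarrow> int \<Rightarrow> bool option" where
  "tape_content w i = (if 0 \<le> i \<and> i < int (length w) then Some (w ! nat i) else None)"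

definition init_config :: "tm \<Rightarrow> bool list \<Rightarrow> config" where
  "init_config M w = (0, (tape_content w, 0) # replicate (num_tapes M - 1) (tape_content [], 0))"

text \<open>On input \<open>w\<close>, the machine halts after at most \<open>t\<close> steps with output \<open>w'\<close>.
  (The halting state is absorbing, so looking at the configuration after \<open>t\<close> steps suffices.)\<close>

definition computes_within :: "tm \<Rightarrow> bool list \<Rightarrow> bool list \<Rightarrow> nat \<Rightarrow> bool" where
  "computes_within M w w' t \<longleftrightarrow>
     (\<exists>ts. (step M ^^ t) (init_config M w) = (num_states M, ts) \<and> fst (hd ts) = tape_content w')"

definition computable :: "(nat \<Rightarrow> nat) \<Rightarrow> bool" where
  "computable f \<longleftrightarrow> (\<exists>M. wf_tm M \<and>
     (\<forall>n. \<exists>t. computes_within M (replicate n True) (replicate (f n) True) t))"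


section \<open>Parameterized problems and reductions\<close>

type_synonym param_problem = "(bool list \<times> nat) set"

definition enc_inst :: "bool list \<Rightarrow> nat \<Rightarrow> bool list" where
  "enc_inst x k = replicate k True @ False # x"

definition fpt_reducible :: "param_problem \<Rightarrow> param_problem \<Rightarrow> bool" where
  "fpt_reducible A B \<longleftrightarrow> (\<exists>M f g c. wf_tm M \<and> computable f \<and> computable g \<and>
     (\<forall>x k. \<exists>x' k'.
        computes_within M (enc_inst x k) (enc_inst x' k') (f k * length (enc_inst x k) ^ c) \<and>
        ((x, k) \<in> A \<longleftrightarrow> (x', k') \<in> B) \<and> k' \<le> g k))"

text \<open>Self-delimiting code of a list of numbers, each written in unary.\<close>

definition enc_nats :: "nat list \<Rightarrow> bool list" where
  "enc_nats ns = concat (map (\<lambda>m. replicate m True @ [False]) ns)"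


section \<open>Boolean circuits and the W-hierarchy\<close>

text \<open>
  A circuit is an acyclic graph given as the list of its nodes in topological order: the wires
  entering a node come from nodes occurring earlier in the list. The output is the last node.
\<close>

datatype gate = InputG | NotG nat | AndG "nat list" | OrG "nat list"

type_synonym circuit = "gate list"

fun in_wires :: "gate \<Rightarrow> nat list" where
  "in_wires InputG = []"
| "in_wires (NotG i) = [i]"
| "in_wires (AndG is) = is"
| "in_wires (OrG is) = is"

fun wf_gate :: "gate \<Rightarrow> bool" where
  "wf_gate InputG \<longleftrightarrow> True"
| "wf_gate (NotG i) \<longleftrightarrow> True"
| "wf_gate (AndG is) \<longleftrightarrow> 2 \<le> length is \<and> distinct is"
| "wf_gate (OrG is) \<longleftrightarrow> 2 \<le> length is \<and> distinct is"

definition wf_circuit :: "circuit \<Rightarrow> bool" where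
  "wf_circuit C \<longleftrightarrow> C \<noteq> [] \<and>
     (\<forall>j < length C. wf_gate (C ! j) \<and> (\<forall>i \<in> set (in_wires (C ! j)). i < j))"

fun gate_holds :: "(nat \<Rightarrow> bool) \<Rightarrow> nat \<Rightarrow> gate \<Rightarrow> bool" where
  "gate_holds v j InputG \<longleftrightarrow> True"
| "gate_holds v j (NotG i) \<longleftrightarrow> (v j \<longleftrightarrow> \<not> v i)"
| "gate_holds v j (AndG is) \<longleftrightarrow> (v j \<longleftrightarrow> (\<forall>i \<in> set is. v i))"
| "gate_holds v j (OrG is) \<longleftrightarrow> (v j \<longleftrightarrow> (\<exists>i \<in> set is. v i))"

text \<open>\<open>v\<close> gives the value of every node; it is determined by its values on the input nodes.
  The weight counts the inputs set to true.\<close>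

definition weighted_sat :: "circuit \<Rightarrow> nat \<Rightarrow> bool" where
  "weighted_sat C k \<longleftrightarrow> (\<exists>v. (\<forall>j < length C. gate_holds v j (C ! j)) \<and>
     v (length C - 1) \<and> card {j. j < length C \<and> C ! j = InputG \<and> v j} = k)"

text \<open>Paths from an input node to the output node, as lists of nodes.\<close>

definition io_path :: "circuit \<Rightarrow> nat list \<Rightarrow> bool" where
  "io_path C p \<longleftrightarrow> p \<noteq> [] \<and> (\<forall>j \<in> set p. j < length C) \<and>
     C ! hd p = InputG \<and> last p = length C - 1 \<and>
     (\<forall>l. Suc l < length p \<longrightarrow> p ! l \<in> set (in_wires (C ! (p ! Suc l))))"

definition large :: "gate \<Rightarrow> bool" where
  "large g \<longleftrightarrow> 2 < length (in_wires g)"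

definition depth_le :: "circuit \<Rightarrow> nat \<Rightarrow> bool" where
  "depth_le C d \<longleftrightarrow> (\<forall>p. io_path C p \<longrightarrow> length p - 1 \<le> d)"

definition weft_le :: "circuit \<Rightarrow> nat \<Rightarrow> bool" where
  "weft_le C t \<longleftrightarrow> (\<forall>p. io_path C p \<longrightarrow> length (filter (\<lambda>j. large (C ! j)) p) \<le> t)"

fun enc_gate :: "gate \<Rightarrow> nat list" where
  "enc_gate InputG = [0]"
| "enc_gate (NotG i) = [1, i]"
| "enc_gate (AndG is) = 2 # length is # is"
| "enc_gate (OrG is) = 3 # length is # is"

definition enc_circuit :: "circuit \<Rightarrow> bool list" where
  "enc_circuit C = enc_nats (concat (map enc_gate C))"

text \<open>Weighted circuit satisfiability for circuits of weft at most \<open>t\<close> and depth at most \<open>d\<close>.\<close>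

definition wcs :: "nat \<Rightarrow> nat \<Rightarrow> param_problem" where
  "wcs t d = {(enc_circuit C, k) | C k.
     wf_circuit C \<and> weft_le C t \<and> depth_le C d \<and> weighted_sat C k}"

definition W_class :: "nat \<Rightarrow> param_problem set" where
  "W_class t = {A. \<exists>d \<ge> 1. fpt_reducible A (wcs t d)}"

definition W_hard :: "nat \<Rightarrow> param_problem \<Rightarrow> bool" where
  "W_hard t B \<longleftrightarrow> (\<forall>A \<in> W_class t. fpt_reducible A B)"


section \<open>3-SAT and the Exponential Time Hypothesis\<close>

text \<open>A literal is a variable with its sign; a formula on \<open>n\<close> variables uses variables
  \<open>0, \<dots>, n - 1\<close>.\<close>

type_synonym literal = "nat \<times> bool"
type_synonym cnf = "literal list list"

definition is_3cnf :: "nat \<Rightarrow> cnf \<Rightarrow> bool" where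
  "is_3cnf n F \<longleftrightarrow> (\<forall>C \<in> set F. length C \<le> 3 \<and> (\<forall>(x, b) \<in> set C. x < n))"

definition satisfiable :: "cnf \<Rightarrow> bool" where
  "satisfiable F \<longleftrightarrow> (\<exists>a :: nat \<Rightarrow> bool. \<forall>C \<in> set F. \<exists>(x, b) \<in> set C. a x = b)"

definition enc_cnf :: "nat \<Rightarrow> cnf \<Rightarrow> bool list" where
  "enc_cnf n F = enc_nats (n #
     concat (map (\<lambda>C. length C # map (\<lambda>(x, b). 2 * x + of_bool b) C) F))"

definition ETH :: bool where
  "ETH \<longleftrightarrow> (\<exists>c :: real. 0 < c \<and> \<not> (\<exists>M a d. wf_tm M \<and>
     (\<forall>n F. is_3cnf n F \<longrightarrow> (\<exists>t.
        real t \<le> 2 powr (c * real n) * (real a * real (length (enc_cnf n F)) ^ d) \<and>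
        computes_within M (enc_cnf n F) [satisfiable F] t))))"


section \<open>The swap problem\<close>

text \<open>Graphs have vertex set \<open>{0..<n}\<close>; edges are two-element sets of vertices.\<close>

definition simple_graph :: "nat \<Rightarrow> nat set set \<Rightarrow> bool" where
  "simple_graph n E \<longleftrightarrow> E \<subseteq> {{u, v} | u v. u < n \<and> v < n \<and> u \<noteq> v}"

definition coloring :: "nat \<Rightarrow> nat \<Rightarrow> (nat \<Rightarrow> nat) \<Rightarrow> bool" where
  "coloring r n c \<longleftrightarrow> (\<forall>v < n. c v \<in> {1..r})"

definition proper :: "nat set set \<Rightarrow> (nat \<Rightarrow> nat) \<Rightarrow> bool" where
  "proper E c \<longleftrightarrow> (\<forall>u v. {u, v} \<in> E \<longrightarrow> c u \<noteq> c v)"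

definition swap_colors :: "nat \<times> nat \<Rightarrow> (nat \<Rightarrow> nat) \<Rightarrow> nat \<Rightarrow> nat" where
  "swap_colors = (\<lambda>(u, v) c. c(u := c v, v := c u))"

definition swappable :: "nat \<Rightarrow> nat set set \<Rightarrow> (nat \<Rightarrow> nat) \<Rightarrow> nat \<Rightarrow> bool" where
  "swappable n E c k \<longleftrightarrow> (\<exists>ss. length ss \<le> k \<and>
     (\<forall>(u, v) \<in> set ss. u < n \<and> v < n \<and> u \<noteq> v) \<and> proper E (fold swap_colors ss c))"

text \<open>The adjacency matrix, row by row, followed by the colors.\<close>

definition enc_colored_graph :: "nat \<Rightarrow> nat set set \<Rightarrow> (nat \<Rightarrow> nat) \<Rightarrow> bool list" where
  "enc_colored_graph n E c = enc_nats (n #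
     concat (map (\<lambda>u. map (\<lambda>v. of_bool ({u, v} \<in> E)) [0..<n]) [0..<n]) @ map c [0..<n])"

definition r_swap :: "nat \<Rightarrow> param_problem" where
  "r_swap r = {(enc_colored_graph n E c, k) | n E c k.
     simple_graph n E \<and> coloring r n c \<and> 0 < k \<and> swappable n E c k}"

text \<open>
  Some algorithm solves \<open>r\<close>-Swap in at most \<open>T n k\<close> steps on every instance with an \<open>n\<close>-vertex
  graph and \<open>k\<close> swaps.
\<close>

definition r_swap_solvable_in :: "nat \<Rightarrow> (nat \<Rightarrow> nat \<Rightarrow> real) \<Rightarrow> bool" where
  "r_swap_solvable_in r T \<longleftrightarrow> (\<exists>M. wf_tm M \<and>
     (\<forall>n E c k. simple_graph n E \<and> coloring r n c \<and> 0 < k \<longrightarrow> (\<exists>t. real t \<le> T n k \<and>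
        computes_within M (enc_inst (enc_colored_graph n E c) k) [swappable n E c k] t)))"

end

theory Submission
  imports Defs
begin

text \<open>
  Everything goes through the clique problem. Each vertex of a clique instance becomes three vertices
  of the swap instance such that choosing it costs exactly two swaps and moves one unit of color 3 to
  it; \<open>m\<close> special vertices must lose color 3, hence \<open>2 m\<close> swaps succeed iff \<open>m\<close> pairwise adjacent
  vertices can be chosen.

  For \<open>W[1]\<close>-hardness, a circuit of weft one and bounded depth has at most one large gate on every
  path, so that its value is determined by boundedly many local claims; a guess of \<open>k\<close> true inputs
  together with these claims can be checked pairwise.

  For the lower bound, the sparsification lemma of Impagliazzo, Paturi and Zane turns a 3-CNF with \<open>n\<close>
  variables into \<open>2 ^ (\<epsilon> n)\<close> formulas with \<open>O(n)\<close> clauses each. The clauses of such a formula are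
  split into \<open>m\<close> chunks, and the consistent choices of one literal per clause of a chunk are the
  vertices of a clique instance with \<open>2 ^ O(n / m)\<close> vertices. An \<open>f(k) N ^ o(k)\<close> algorithm for
  \<open>k = 2 m\<close> then takes time \<open>2 ^ (\<epsilon> n)\<close>, once \<open>m\<close> is a sufficiently large constant. The thresholds and
  \<open>m\<close> are hardwired, so all running times have to be polynomial with an exponent that does not depend
  on them.
\<close>

section \<open>Structured programs for Turing machines\<close>

text \<open>Swaps preserve the sizes of the color classes. The \<open>m\<close> special vertices
  must take color 1, which only vertices \<open>(1, a)\<close> can give up; so the number of chosen
  vertices is forced, and the budget only has to protect the auxiliary tripartite graph. A clique
  compares vertices in pairs, but the value of a node over small gates depends on boundedly many
  guessed inputs at once. A vertex therefore carries a whole tuple of slots, and every tuple of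
  indices must occur in the clique; this is why its size is \<open>(k + 2) ^ (2 * 2 ^ d)\<close> and
  not \<open>k\<close>. The lower bound has a circular dependency. The program for 3-SAT takes time
  polynomial, of some degree \<open>a\<close>, in its cost of about
  \<open>2 powr (\<gamma> * n)\<close>, so \<open>\<gamma>\<close> must be about
  \<open>c / a\<close>. But \<open>\<gamma>\<close> determines the thresholds and \<open>m\<close>,
  which are part of the program. Hence costs that are not polynomial are kept apart as allowances,
  and \<open>tc_tm_param\<close> yields the degree before the hardwired data are chosen.\<close>

type_synonym sym = "bool option"
type_synonym store = "nat \<Rightarrow> tape"

datatype com =
    Act nat "sym \<Rightarrow> sym \<times> move"
  | Seq com com
  | Cond nat "sym \<Rightarrow> bool" com com
  | While nat "sym \<Rightarrow> bool" com

definition read :: "tape \<Rightarrow> sym" where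
  "read t = fst t (snd t)"

text \<open>The counts are those of the compiled code: a true branch pays for the test and for the
  jump over the alternative, a false branch for the test only, and a round of a loop for the test
  and the jump back.\<close>

inductive exec :: "com \<Rightarrow> store \<Rightarrow> nat \<Rightarrow> store \<Rightarrow> bool" where
  exec_Act: "exec (Act i f) s 1 (s(i := act (f (read (s i))) (s i)))"
| exec_Seq: "exec a s m s' \<Longrightarrow> exec b s' n s'' \<Longrightarrow> exec (Seq a b) s (m + n) s''"
| exec_CondT: "p (read (s i)) \<Longrightarrow> exec a s m s' \<Longrightarrow> exec (Cond i p a b) s (m + 2) s'"
| exec_CondF: "\<not> p (read (s i)) \<Longrightarrow> exec b s m s' \<Longrightarrow> exec (Cond i p a b) s (m + 1) s'"
| exec_WhileF: "\<not> p (read (s i)) \<Longrightarrow> exec (While i p a) s 1 s"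
| exec_WhileT: "p (read (s i)) \<Longrightarrow> exec a s m s' \<Longrightarrow> exec (While i p a) s' n s'' \<Longrightarrow>
    exec (While i p a) s (m + n + 2) s''"

section \<open>Compilation of structured programs\<close>

datatype instr = IAct nat "sym \<Rightarrow> sym \<times> move" | IBranch nat "sym \<Rightarrow> bool" nat | IJump nat

fun csize :: "com \<Rightarrow> nat" where
  "csize (Act i f) = 1"
| "csize (Seq a b) = csize a + csize b"
| "csize (Cond i p a b) = csize a + csize b + 2"
| "csize (While i p a) = csize a + 2"

text \<open>The second argument is the address of the first instruction. Addresses are states of the
  machine, so jumps are absolute and the code depends on where it is placed.\<close>

fun compile :: "com \<Rightarrow> nat \<Rightarrow> instr list" where
  "compile (Act i f) q = [IAct i f]"
| "compile (Seq a b) q = compile a q @ compile b (q + csize a)"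
| "compile (Cond i p a b) q =
    IBranch i p (q + csize a + 2) # compile a (q + 1) @
    IJump (q + csize a + csize b + 2) # compile b (q + csize a + 2)"
| "compile (While i p a) q = IBranch i p (q + csize a + 2) # compile a (q + 1) @ [IJump q]"

lemma length_compile [simp]: "length (compile c q) = csize c"
  by (induction c arbitrary: q) auto

fun tapes_used :: "com \<Rightarrow> nat" where
  "tapes_used (Act i f) = Suc i"
| "tapes_used (Seq a b) = max (tapes_used a) (tapes_used b)"
| "tapes_used (Cond i p a b) = max (Suc i) (max (tapes_used a) (tapes_used b))"
| "tapes_used (While i p a) = max (Suc i) (tapes_used a)"

text \<open>Only explicit targets need a bound: falling through from an address \<open>q\<close> of
  the code leads to \<open>Suc q\<close>, which is at most its length.\<close>

fun instr_target :: "instr \<Rightarrow> nat" where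
  "instr_target (IAct i f) = 0"
| "instr_target (IBranch i p q) = q"
| "instr_target (IJump q) = q"

lemma compile_targets: "x \<in> set (compile c q) \<Longrightarrow> instr_target x \<le> q + csize c"
  by (induction c arbitrary: q) (auto, (fastforce)+)

definition instr_delta ::
  "nat \<Rightarrow> nat \<Rightarrow> instr \<Rightarrow> sym list \<Rightarrow> nat \<times> (sym \<times> move) list" where
  "instr_delta K q x ss = (case x of
     IAct i f \<Rightarrow> (Suc q, map (\<lambda>j. if j = i then f (ss ! j) else (ss ! j, MoveStay)) [0..<K])
   | IBranch i p q' \<Rightarrow> (if p (ss ! i) then Suc q else q', map (\<lambda>j. (ss ! j, MoveStay)) [0..<K])
   | IJump q' \<Rightarrow> (q', map (\<lambda>j. (ss ! j, MoveStay)) [0..<K]))"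

definition code_tm :: "nat \<Rightarrow> instr list \<Rightarrow> tm" where
  "code_tm K P = \<lparr>num_tapes = K, num_states = length P,
     delta = (\<lambda>q ss. instr_delta K q (P ! q) ss)\<rparr>"

lemma wf_code_tm:
  assumes "0 < K" "\<And>x. x \<in> set P \<Longrightarrow> instr_target x \<le> length P"
  shows "wf_tm (code_tm K P)"
proof -
  have "fst (instr_delta K q (P ! q) ss) \<le> length P" if "q < length P" for q ss
    using assms(2)[OF nth_mem[OF that]] that
    by (auto simp: instr_delta_def split: instr.splits)
  moreover have "length (snd (instr_delta K q x ss)) = K" for q x ss
    by (auto simp: instr_delta_def split: instr.splits)
  ultimately show ?thesis using assms(1) by (simp add: wf_tm_def code_tm_def)
qed

definition tapes :: "nat \<Rightarrow> store \<Rightarrow> tape list" where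
  "tapes K s = map s [0..<K]"

lemma map2_act_tapes:
  assumes "\<And>j. j < K \<Longrightarrow> act (a j) (s j) = s' j"
  shows "map2 act (map a [0..<K]) (tapes K s) = tapes K s'"
  using assms by (intro nth_equalityI) (auto simp: tapes_def)

lemma map_read_tapes: "map (\<lambda>(c, h). c h) (tapes K s) = map (\<lambda>j. read (s j)) [0..<K]"
  by (simp add: tapes_def read_def comp_def case_prod_unfold)

lemma act_read [simp]: "act (read t, MoveStay) t = t"
  by (cases t) (simp add: read_def)

declare step.simps [simp del]

lemma step_code_tm:
  assumes "q < length P"
  shows "step (code_tm K P) (q, tapes K s) =
    (let (q', as) = instr_delta K q (P ! q) (map (\<lambda>j. read (s j)) [0..<K])
     in (q', map2 act as (tapes K s)))"
  using assms by (simp add: step.simps code_tm_def map_read_tapes)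

lemma step_IAct:
  assumes "q < length P" "P ! q = IAct i f" "i < K"
  shows "step (code_tm K P) (q, tapes K s) = (Suc q, tapes K (s(i := act (f (read (s i))) (s i))))"
proof -
  let ?a = "\<lambda>j. if j = i then f (read (s i)) else (read (s j), MoveStay)"
  have "instr_delta K q (P ! q) (map (\<lambda>j. read (s j)) [0..<K]) = (Suc q, map ?a [0..<K])"
    by (auto simp: assms instr_delta_def)
  moreover have "map2 act (map ?a [0..<K]) (tapes K s) = tapes K (s(i := act (f (read (s i))) (s i)))"
    by (rule map2_act_tapes) auto
  ultimately show ?thesis unfolding step_code_tm[OF assms(1)] by simp
qed

lemma step_IBranch:
  assumes "q < length P" "P ! q = IBranch i p q'" "i < K"
  shows "step (code_tm K P) (q, tapes K s) = (if p (read (s i)) then Suc q else q', tapes K s)"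
  unfolding step_code_tm[OF assms(1)] assms(2) instr_delta_def using assms(3)
  by (auto intro!: map2_act_tapes)

lemma step_IJump:
  assumes "q < length P" "P ! q = IJump q'"
  shows "step (code_tm K P) (q, tapes K s) = (q', tapes K s)"
  unfolding step_code_tm[OF assms(1)] assms(2) instr_delta_def
  by (auto intro!: map2_act_tapes)

definition code_at :: "instr list \<Rightarrow> nat \<Rightarrow> instr list \<Rightarrow> bool" where
  "code_at P q C \<longleftrightarrow> (\<exists>A B. P = A @ C @ B \<and> length A = q)"

lemma code_at_append:
  "code_at P q (C @ D) \<longleftrightarrow> code_at P q C \<and> code_at P (q + length C) D"
proof
  assume "code_at P q (C @ D)"
  then obtain A B where "P = A @ (C @ D) @ B" "length A = q" by (auto simp: code_at_def)
  then have "P = A @ C @ (D @ B)" "P = (A @ C) @ D @ B" "length (A @ C) = q + length C" by auto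
  then show "code_at P q C \<and> code_at P (q + length C) D"
    using \<open>length A = q\<close> unfolding code_at_def by blast
next
  assume a: "code_at P q C \<and> code_at P (q + length C) D"
  then obtain A B where 1: "P = A @ C @ B" "length A = q" by (auto simp: code_at_def)
  from a obtain A' B' where 2: "P = A' @ D @ B'" "length A' = q + length C" by (auto simp: code_at_def)
  note * = 1 2
  then have "A' = A @ C" by (metis append.assoc append_eq_append_conv length_append)
  then show "code_at P q (C @ D)" using * by (auto simp: code_at_def)
qed

lemma code_at_Cons: "code_at P q (x # C) \<longleftrightarrow> q < length P \<and> P ! q = x \<and> code_at P (Suc q) C"
proof -
  have "code_at P q [x] \<longleftrightarrow> q < length P \<and> P ! q = x"
    by (auto simp: code_at_def nth_append) (metis id_take_nth_drop length_take min.absorb4 append.simps)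
  then show ?thesis using code_at_append[of P q "[x]" C] by simp
qed

lemma exec_compile:
  assumes "exec c s t s'" "code_at P q (compile c q)" "tapes_used c \<le> K"
  shows "(step (code_tm K P) ^^ t) (q, tapes K s) = (q + csize c, tapes K s')"
  using assms
proof (induction arbitrary: q rule: exec.induct)
  case (exec_Act i f s)
  then show ?case by (simp add: code_at_Cons step_IAct fun_upd_def)
next
  case (exec_Seq a s m s' b n s'')
  then show ?case
    by (simp add: funpow_add add.commute[of m] code_at_append add.assoc)
next
  case (exec_CondT p s i a m s' b)
  let ?M = "code_tm K P"
  have 1: "step ?M (q, tapes K s) = (Suc q, tapes K s)"
    using exec_CondT by (simp add: code_at_Cons step_IBranch)
  have 2: "(step ?M ^^ m) (Suc q, tapes K s) = (Suc q + csize a, tapes K s')"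
    using exec_CondT by (simp add: code_at_Cons code_at_append)
  have 3: "step ?M (Suc q + csize a, tapes K s') = (q + csize (Cond i p a b), tapes K s')"
    using exec_CondT by (intro step_IJump) (auto simp: code_at_Cons code_at_append)
  \<comment> \<open>In \<open>funpow_add\<close> the right summand runs first: the branch, then the
    body, then the jump.\<close>
  have "m + 2 = 1 + (m + 1)" by simp
  then show ?case using 1 2 3 by (simp only: funpow_add o_apply One_nat_def funpow.simps id_apply)
next
  case (exec_CondF p s i b m s' a)
  then show ?case
    by (simp del: funpow.simps add: funpow_Suc_right code_at_Cons code_at_append step_IBranch add.assoc)
next
  case (exec_WhileF p s i a)
  then show ?case by (simp add: code_at_Cons step_IBranch add.assoc)
next
  case (exec_WhileT p s i a m s' n s'')
  let ?M = "code_tm K P"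
  have 1: "step ?M (q, tapes K s) = (Suc q, tapes K s)"
    using exec_WhileT by (simp add: code_at_Cons step_IBranch)
  have 2: "(step ?M ^^ m) (Suc q, tapes K s) = (Suc q + csize a, tapes K s')"
    using exec_WhileT by (simp add: code_at_Cons code_at_append)
  have 3: "step ?M (Suc q + csize a, tapes K s') = (q, tapes K s')"
    using exec_WhileT by (intro step_IJump) (auto simp: code_at_Cons code_at_append)
  have 4: "(step ?M ^^ n) (q, tapes K s') = (q + csize (While i p a), tapes K s'')"
    using exec_WhileT.IH(2) exec_WhileT.prems by blast
  have "m + n + 2 = n + (1 + (m + 1))" by simp
  then show ?case using 1 2 3 4 by (simp only: funpow_add o_apply One_nat_def funpow.simps id_apply)
qed

lemma funpow_step_halted: "(step M ^^ t) (num_states M, ts) = (num_states M, ts)"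
  by (induction t) (auto simp: step.simps)

lemma computes_within_mono:
  assumes "computes_within M w w' t" "t \<le> t'"
  shows "computes_within M w w' t'"
proof -
  obtain d where "t' = d + t" using assms(2) le_iff_add add.commute by metis
  then show ?thesis using assms(1)
    by (auto simp: computes_within_def funpow_add funpow_step_halted)
qed

definition start_store :: "bool list \<Rightarrow> store" where
  "start_store w i = (if i = 0 then tape_content w else (\<lambda>_. None), 0)"

definition com_tm :: "com \<Rightarrow> tm" where
  "com_tm c = code_tm (tapes_used c) (compile c 0)"

lemma tapes_used_pos: "0 < tapes_used c"
  by (induction c) auto

lemma wf_com_tm: "wf_tm (com_tm c)"
  unfolding com_tm_def using tapes_used_pos compile_targets[of _ c 0] by (intro wf_code_tm) auto

text \<open>Running off the end of the code is halting, because the address after the last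
  instruction is the number of the halting state.\<close>

lemma com_tm_computes:
  assumes "exec c (start_store w) t s" "fst (s 0) = tape_content w'"
  shows "computes_within (com_tm c) w w' t"
proof -
  let ?K = "tapes_used c"
  have "tape_content [] = (\<lambda>_. None)" by (auto simp: tape_content_def)
  moreover have "0 < ?K" by (rule tapes_used_pos)
  ultimately have init: "init_config (com_tm c) w = (0, tapes ?K (start_store w))"
    by (auto simp: init_config_def com_tm_def code_tm_def tapes_def start_store_def nth_Cons'
        intro!: nth_equalityI)
  have "(step (com_tm c) ^^ t) (0, tapes ?K (start_store w)) = (csize c, tapes ?K s)"
    unfolding com_tm_def
    using exec_compile[OF assms(1), of "compile c 0" 0 ?K] by (auto simp: code_at_def)
  moreover have "hd (tapes ?K s) = s 0" using \<open>0 < ?K\<close> by (simp add: tapes_def hd_map)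
  ultimately show ?thesis
    unfolding computes_within_def init using assms(2)
    by (simp add: com_tm_def code_tm_def)
qed

section \<open>Tapes as stacks\<close>

text \<open>The stack grows to the right. The blank below the last entry marks the bottom, so that
  emptiness is visible as a blank under the head.\<close>

definition stk :: "tape \<Rightarrow> bool list \<Rightarrow> bool" where
  "stk t xs \<longleftrightarrow> (\<forall>i < length xs. fst t (snd t - int i) = Some (xs ! i)) \<and>
     fst t (snd t - int (length xs)) = None"

definition topsym :: "bool list \<Rightarrow> sym" where
  "topsym xs = (case xs of [] \<Rightarrow> None | x # _ \<Rightarrow> Some x)"

lemma topsym_simps [simp]: "topsym [] = None" "topsym (x # xs) = Some x"
  by (simp_all add: topsym_def)

text \<open>Tape 0 is used for input and output only; the other tapes are stacks whose top is under the
  head. Cells to the right of the head are garbage.\<close>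

type_synonym sstate = "tape \<times> (nat \<Rightarrow> bool list)"

definition rep :: "store \<Rightarrow> sstate \<Rightarrow> bool" where
  "rep s S \<longleftrightarrow> s 0 = fst S \<and> (\<forall>i > 0. stk (s i) (snd S i))"

lemma read_stk: "stk t xs \<Longrightarrow> read t = topsym xs"
  by (cases xs) (auto simp: stk_def read_def)

lemma stk_Cons:
  "stk (c, h) (x # xs) \<longleftrightarrow> c h = Some x \<and> stk (c, h - 1) xs"
  by (auto simp: stk_def less_Suc_eq_0_disj all_conj_distrib algebra_simps)

lemma stk_upd_above: "h < k \<Longrightarrow> stk (c(k := s), h) xs \<longleftrightarrow> stk (c, h) xs"
  by (auto simp: stk_def)

lemma stk_push: "stk t xs \<Longrightarrow> stk (act (Some b, MoveStay) (act (read t, MoveRight) t)) (b # xs)"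
  by (cases t) (simp add: stk_Cons stk_upd_above read_def)

lemma stk_pop: "stk t (x # xs) \<Longrightarrow> stk (act (read t, MoveLeft) t) xs"
  by (cases t) (simp add: stk_Cons read_def stk_upd_above)

text \<open>Quantifying over all representing stores hides head positions and the garbage above the
  stacks. An upper bound on the steps, in place of the exact count, allows rounding.\<close>

definition runs :: "com \<Rightarrow> sstate \<Rightarrow> nat \<Rightarrow> sstate \<Rightarrow> bool" where
  "runs c S t S' \<longleftrightarrow> (\<forall>s. rep s S \<longrightarrow> (\<exists>s' m. m \<le> t \<and> exec c s m s' \<and> rep s' S'))"

lemma runsI:
  "(\<And>s. rep s S \<Longrightarrow> \<exists>s' m. m \<le> t \<and> exec c s m s' \<and> rep s' S') \<Longrightarrow> runs c S t S'"
  by (simp add: runs_def)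

lemma runs_mono: "runs c S t S' \<Longrightarrow> t \<le> t' \<Longrightarrow> runs c S t' S'"
  unfolding runs_def by (meson le_trans)

lemma runs_cong: "runs c S t S' \<Longrightarrow> t \<le> t' \<Longrightarrow> S' = S'' \<Longrightarrow> runs c S t' S''"
  using runs_mono by blast

lemma runs_Seq:
  assumes "runs a S t S'" "runs b S' u S''"
  shows "runs (Seq a b) S (t + u) S''"
proof (rule runsI)
  fix s assume "rep s S"
  then obtain s' m where 1: "m \<le> t" "exec a s m s'" "rep s' S'" using assms(1) unfolding runs_def by blast
  then obtain s'' n where 2: "n \<le> u" "exec b s' n s''" "rep s'' S''" using assms(2) unfolding runs_def by blast
  show "\<exists>s' m. m \<le> t + u \<and> exec (Seq a b) s m s' \<and> rep s' S''"
    using 1 2 by (intro exI[of _ s''] exI[of _ "m + n"]) (auto intro: exec_Seq)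
qed

lemma runs_Seq_le: "runs a S t S' \<Longrightarrow> runs b S' u S'' \<Longrightarrow> t + u \<le> w \<Longrightarrow> runs (Seq a b) S w S''"
  by (blast intro: runs_mono runs_Seq)

lemma runs_Seq4:
  assumes "runs a S0 t0 S1" "runs b S1 t1 S2" "runs c S2 t2 S3" "runs d S3 t3 S4" "t0 + t1 + t2 + t3 \<le> w"
  shows "runs (Seq a (Seq b (Seq c d))) S0 w S4"
  by (rule runs_mono[OF runs_Seq[OF assms(1) runs_Seq[OF assms(2) runs_Seq[OF assms(3,4)]]]])
    (use assms(5) in simp)

definition push :: "nat \<Rightarrow> bool \<Rightarrow> com" where
  "push i b = Seq (Act i (\<lambda>s. (s, MoveRight))) (Act i (\<lambda>s. (Some b, MoveStay)))"

definition pop :: "nat \<Rightarrow> com" where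
  "pop i = Act i (\<lambda>s. (s, MoveLeft))"

definition upd :: "sstate \<Rightarrow> nat \<Rightarrow> bool list \<Rightarrow> sstate" where
  "upd S i xs = (fst S, (snd S)(i := xs))"

lemma runs_push: "0 < i \<Longrightarrow> runs (push i b) S 2 (upd S i (b # snd S i))"
proof (rule runsI)
  fix s assume i: "0 < i" and r: "rep s S"
  let ?s = "s(i := act (read (s i), MoveRight) (s i))"
  let ?s' = "?s(i := act (Some b, MoveStay) (?s i))"
  have "exec (push i b) s (1 + 1) ?s'" unfolding push_def
    by (intro exec_Seq[where s' = ?s])
      (use exec_Act[of i "\<lambda>s. (s, MoveRight)" s] exec_Act[of i "\<lambda>s. (Some b, MoveStay)" ?s] in auto)
  moreover have "rep ?s' (upd S i (b # snd S i))"
    using i r by (auto simp: rep_def upd_def simp del: act.simps intro!: stk_push)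
  ultimately show "\<exists>s' m. m \<le> 2 \<and> exec (push i b) s m s' \<and> rep s' (upd S i (b # snd S i))"
    by (intro exI[of _ ?s'] exI[of _ "1 + 1"]) auto
qed

lemma runs_pop: "0 < i \<Longrightarrow> snd S i = x # xs \<Longrightarrow> runs (pop i) S 1 (upd S i xs)"
proof (rule runsI)
  fix s assume i: "0 < i" "snd S i = x # xs" and r: "rep s S"
  let ?s' = "s(i := act (read (s i), MoveLeft) (s i))"
  have "exec (pop i) s 1 ?s'" unfolding pop_def
    using exec_Act[of i "\<lambda>s. (s, MoveLeft)" s] by auto
  moreover have "rep ?s' (upd S i xs)"
  proof -
    have "stk (s i) (snd S i)" using i(1) r by (simp add: rep_def)
    from stk_pop[OF this[unfolded i(2)]] show ?thesis using i r by (auto simp: rep_def upd_def simp del: act.simps)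
  qed
  ultimately show "\<exists>s' m. m \<le> 1 \<and> exec (pop i) s m s' \<and> rep s' (upd S i xs)"
    by (intro exI[of _ ?s'] exI[of _ 1]) auto
qed

lemma rep_read: "rep s S \<Longrightarrow> 0 < i \<Longrightarrow> read (s i) = topsym (snd S i)"
  by (simp add: rep_def read_stk)

lemma runs_CondT:
  assumes "0 < i" "p (topsym (snd S i))" "runs a S t S'"
  shows "runs (Cond i p a b) S (t + 2) S'"
proof (rule runsI)
  fix s assume r: "rep s S"
  then obtain s' m where "m \<le> t" "exec a s m s'" "rep s' S'" using assms(3) unfolding runs_def by blast
  then show "\<exists>s' m. m \<le> t + 2 \<and> exec (Cond i p a b) s m s' \<and> rep s' S'"
    using assms(1,2) rep_read[OF r] by (intro exI[of _ s'] exI[of _ "m + 2"]) (auto simp: exec_CondT simp del: add_2_eq_Suc')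
qed

lemma runs_CondF:
  assumes "0 < i" "\<not> p (topsym (snd S i))" "runs b S t S'"
  shows "runs (Cond i p a b) S (t + 2) S'"
proof (rule runsI)
  fix s assume r: "rep s S"
  then obtain s' m where "m \<le> t" "exec b s m s'" "rep s' S'" using assms(3) unfolding runs_def by blast
  then show "\<exists>s' m. m \<le> t + 2 \<and> exec (Cond i p a b) s m s' \<and> rep s' S'"
    using assms(1,2) rep_read[OF r] exec_CondF[of p s i b m s' a]
    by (intro exI[of _ s'] exI[of _ "m + 1"]) auto
qed

lemma runs_WhileF:
  assumes "0 < i" "\<not> p (topsym (snd S i))"
  shows "runs (While i p a) S 1 S"
  by (rule runsI) (metis assms exec_WhileF order_refl rep_read)

lemma runs_WhileT:
  assumes "0 < i" "p (topsym (snd S i))" "runs a S t S'" "runs (While i p a) S' u S''"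
  shows "runs (While i p a) S (t + u + 2) S''"
proof (rule runsI)
  fix s assume r: "rep s S"
  then obtain s' m where 1: "m \<le> t" "exec a s m s'" "rep s' S'" using assms(3) unfolding runs_def by blast
  then obtain s'' n where 2: "n \<le> u" "exec (While i p a) s' n s''" "rep s'' S''"
    using assms(4) unfolding runs_def by blast
  show "\<exists>s' m. m \<le> t + u + 2 \<and> exec (While i p a) s m s' \<and> rep s' S''"
    using assms(1,2) rep_read[OF r] exec_WhileT[of p s i a m s' n s''] 1 2
    by (intro exI[of _ s''] exI[of _ "m + n + 2"]) auto
qed

text \<open>Stack 2 holds the data, stacks 3 and 4 are scratch space, and stack 5 is the counter of
  the parser.\<close>

definition st :: "tape \<Rightarrow> bool list \<Rightarrow> bool list \<Rightarrow> bool list \<Rightarrow> bool list \<Rightarrow> sstate" where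
  "st T a b c d = (T, (\<lambda>_. [])(2 := a, 3 := b, 4 := c, 5 := d))"

lemma st_simps [simp]:
  "snd (st T a b c d) 2 = a" "snd (st T a b c d) 3 = b" "snd (st T a b c d) 4 = c" "snd (st T a b c d) 5 = d"
  "upd (st T a b c d) 2 x = st T x b c d" "upd (st T a b c d) 3 x = st T a x c d"
  "upd (st T a b c d) 4 x = st T a b x d" "upd (st T a b c d) 5 x = st T a b c x"
  by (simp_all add: st_def upd_def fun_upd_twist)

definition nonempty :: "sym \<Rightarrow> bool" where "nonempty s \<longleftrightarrow> s \<noteq> None"
definition istrue :: "sym \<Rightarrow> bool" where "istrue s \<longleftrightarrow> s = Some True"

lemma sym_test_simps [simp]: "nonempty (Some b)" "\<not> nonempty None" "istrue (Some b) \<longleftrightarrow> b" "\<not> istrue None"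
  by (auto simp: nonempty_def istrue_def)

section \<open>Transfers between stacks\<close>

definition mv1 :: "nat \<Rightarrow> nat \<Rightarrow> com" where
  "mv1 i j = Seq (Cond i istrue (push j True) (push j False)) (pop i)"

definition mv :: "nat \<Rightarrow> nat \<Rightarrow> com" where
  "mv i j = While i nonempty (mv1 i j)"

lemma upd_simps [simp]: "snd (upd S i x) j = (if j = i then x else snd S j)" "upd (upd S i x) i y = upd S i y"
  "upd S i (snd S i) = S"
  by (auto simp: upd_def)

lemma upd_same [simp]: "snd S i = xs \<Longrightarrow> upd S i xs = S"
  by auto

lemma upd_twist: "i \<noteq> j \<Longrightarrow> upd (upd S i x) j y = upd (upd S j y) i x"
  by (simp add: upd_def fun_upd_twist)

lemma runs_copy_bit:
  assumes "0 < i" "0 < j" "snd S i = x # xs"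
  shows "runs (Cond i istrue (push j True) (push j False)) S 4 (upd S j (x # snd S j))"
  using runs_CondT[of i istrue S "push j True" 2] runs_CondF[of i istrue S "push j False" 2]
    runs_push[OF assms(2), of True S] runs_push[OF assms(2), of False S] assms
  by (cases x) auto

lemma runs_mv1:
  assumes "0 < i" "0 < j" "i \<noteq> j" "snd S i = x # xs"
  shows "runs (mv1 i j) S 5 (upd (upd S j (x # snd S j)) i xs)"
  unfolding mv1_def
  using runs_Seq[OF runs_copy_bit[OF assms(1,2,4)] runs_pop[OF assms(1)]] assms by simp

lemma runs_mv:
  assumes "0 < i" "0 < j" "i \<noteq> j" "snd S i = xs"
  shows "runs (mv i j) S (7 * length xs + 1) (upd (upd S j (rev xs @ snd S j)) i [])"
  using assms(4)
proof (induction xs arbitrary: S)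
  case Nil
  then show ?case unfolding mv_def using runs_WhileF[of i nonempty S] assms by simp
next
  case (Cons x xs)
  let ?S = "upd (upd S j (x # snd S j)) i xs"
  have "runs (mv i j) ?S (7 * length xs + 1) (upd (upd ?S j (rev xs @ snd ?S j)) i [])"
    by (rule Cons.IH) simp
  from runs_WhileT[OF assms(1) _ runs_mv1[OF assms(1-3) Cons.prems] this[unfolded mv_def]]
  show ?case unfolding mv_def[symmetric] using Cons.prems assms
    by (simp add: upd_twist[of i j] mv_def algebra_simps)
qed

definition mv2 :: com where
  "mv2 = While 3 nonempty (Seq (Cond 3 istrue (push 2 True) (push 2 False)) (mv1 3 4))"

lemma runs_mv2: "runs mv2 (st T a b c d) (11 * length b + 1) (st T (rev b @ a) [] (rev b @ c) d)"
proof (induction b arbitrary: a c)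
  case Nil
  then show ?case unfolding mv2_def using runs_WhileF[of 3 nonempty "st T a [] c d"] by simp
next
  case (Cons x b)
  have 1: "runs (Cond 3 istrue (push 2 True) (push 2 False)) (st T a (x # b) c d) 4 (st T (x # a) (x # b) c d)"
    using runs_copy_bit[of 3 2 "st T a (x # b) c d" x b] by simp
  have 2: "runs (mv1 3 4) (st T (x # a) (x # b) c d) 5 (st T (x # a) b (x # c) d)"
    using runs_mv1[of 3 4 "st T (x # a) (x # b) c d" x b] by simp
  show ?case
    using runs_WhileT[OF _ _ runs_Seq[OF 1 2] Cons.IH[unfolded mv2_def]]
    unfolding mv2_def[symmetric] by (simp add: mv2_def algebra_simps)
qed


section \<open>Binary trees on the stack\<close>

datatype val = Nl | Cn val val

primrec venc :: "val \<Rightarrow> bool list" where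
  "venc Nl = [False]"
| "venc (Cn a b) = True # venc a @ venc b"

abbreviation vlen :: "val \<Rightarrow> nat" where "vlen v \<equiv> length (venc v)"

lemma vlen_pos: "1 \<le> vlen v" by (cases v) auto

text \<open>Stack 5 counts the trees that remain to be moved from stack 2 to stack \<open>j\<close>.\<close>

definition parse_step :: "nat \<Rightarrow> com" where
  "parse_step j = Cond 2 istrue (Seq (mv1 2 j) (push 5 True)) (Seq (mv1 2 j) (pop 5))"

definition parse :: "nat \<Rightarrow> com" where
  "parse j = Seq (push 5 True) (While 5 nonempty (parse_step j))"

text \<open>In prefix order a leaf completes one pending tree and an inner node replaces one by two,
  so the counter is empty exactly when all of \<open>vs\<close> has been moved. The induction is on
  the number of symbols, because an inner node makes the list of trees longer.\<close>

lemma runs_parse_loop: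
  assumes "j = 3 \<or> j = 4"
  shows "snd S 5 = replicate (length vs) True \<Longrightarrow> snd S 2 = concat (map venc vs) @ r \<Longrightarrow>
    runs (While 5 nonempty (parse_step j)) S (11 * length (concat (map venc vs)) + 1)
      (upd (upd (upd S 5 []) 2 r) j (rev (concat (map venc vs)) @ snd S j))"
proof (induction "length (concat (map venc vs))" arbitrary: S vs rule: less_induct)
  case less
  have j: "0 < j" "j \<noteq> 2" "j \<noteq> 5" using assms by auto
  show ?case
  proof (cases vs)
    case Nil
    then have "upd S 5 [] = S" "upd S 2 r = S" using less.prems by auto
    then show ?thesis using Nil less.prems runs_WhileF[of 5 nonempty S] by simp
  next
    case (Cons v us)
    then obtain x xs where x: "snd S 2 = x # xs" using less.prems by (cases v) auto
    let ?S1 = "upd (upd S j (x # snd S j)) 2 xs"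
    have mv: "runs (mv1 2 j) S 5 ?S1" using runs_mv1[of 2 j S x xs] j x by simp
    show ?thesis
    proof (cases v)
      case Nl
      let ?S2 = "upd ?S1 5 (replicate (length us) True)"
      have p: "runs (pop 5) ?S1 1 ?S2" using runs_pop[of 5 ?S1] less.prems Cons j by simp
      have 1: "runs (parse_step j) S 8 ?S2" unfolding parse_step_def
        by (rule runs_cong[OF runs_CondF[OF _ _ runs_Seq[OF mv p]]]) (use x Nl Cons less.prems in auto)
      have "runs (While 5 nonempty (parse_step j)) ?S2 (11 * length (concat (map venc us)) + 1)
         (upd (upd (upd ?S2 5 []) 2 r) j (rev (concat (map venc us)) @ snd ?S2 j))"
        using Cons Nl less.prems x j by (intro less.hyps) auto
      then show ?thesis
        by (intro runs_cong[OF runs_WhileT[OF _ _ 1]])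
          (use Cons Nl less.prems x j in \<open>auto simp: upd_twist[of j] upd_twist[of 5 2]\<close>)
    next
      case (Cn a b)
      let ?S2 = "upd ?S1 5 (replicate (length (a # b # us)) True)"
      have p: "runs (push 5 True) ?S1 2 ?S2" using runs_push[of 5 True ?S1] less.prems Cons j by simp
      have 1: "runs (parse_step j) S 9 ?S2" unfolding parse_step_def
        by (rule runs_cong[OF runs_CondT[OF _ _ runs_Seq[OF mv p]]]) (use x Cn Cons less.prems in auto)
      have "runs (While 5 nonempty (parse_step j)) ?S2 (11 * length (concat (map venc (a # b # us))) + 1)
         (upd (upd (upd ?S2 5 []) 2 r) j (rev (concat (map venc (a # b # us))) @ snd ?S2 j))"
        using Cons Cn less.prems x j by (intro less.hyps) auto
      then show ?thesis
        by (intro runs_cong[OF runs_WhileT[OF _ _ 1]])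
          (use Cons Cn less.prems x j in \<open>auto simp: upd_twist[of j] upd_twist[of 5 2]\<close>)
    qed
  qed
qed

lemma runs_parse:
  "runs (parse 3) (st T (venc v @ r) b c []) (11 * vlen v + 3) (st T r (rev (venc v) @ b) c [])"
  "runs (parse 4) (st T (venc v @ r) b c []) (11 * vlen v + 3) (st T r b (rev (venc v) @ c) [])"
proof -
  let ?S = "st T (venc v @ r) b c [True]"
  have 1: "runs (push 5 True) (st T (venc v @ r) b c []) 2 ?S"
    using runs_push[of 5 True "st T (venc v @ r) b c []"] by simp
  show "runs (parse 3) (st T (venc v @ r) b c []) (11 * vlen v + 3) (st T r (rev (venc v) @ b) c [])"
    using runs_mono[OF runs_Seq[OF 1 runs_parse_loop[of 3 ?S "[v]" r]], of "11 * vlen v + 3"]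
    by (simp add: parse_def)
  show "runs (parse 4) (st T (venc v @ r) b c []) (11 * vlen v + 3) (st T r b (rev (venc v) @ c) [])"
    using runs_mono[OF runs_Seq[OF 1 runs_parse_loop[of 4 ?S "[v]" r]], of "11 * vlen v + 3"]
    by (simp add: parse_def)
qed

definition vst :: "tape \<Rightarrow> bool list \<Rightarrow> sstate" where
  "vst T a = st T a [] [] []"

text \<open>Each transfer reverses a word, so a tree has its original order after an even number of
  transfers. The copy that \<open>mv2\<close> leaves on stack 4 therefore returns through stack
  3.\<close>

definition vdup :: com where "vdup = Seq (parse 3) (Seq mv2 (Seq (mv 4 3) (mv 3 2)))"
definition vswap :: com where "vswap = Seq (parse 3) (Seq (parse 4) (Seq (mv 3 2) (mv 4 2)))"
definition vdrop :: com where "vdrop = Seq (parse 3) (While 3 nonempty (pop 3))"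

lemma runs_vdup: "runs vdup (vst T (venc v @ r)) (42 * vlen v) (vst T (venc v @ venc v @ r))"
proof -
  have a: "runs (mv 4 3) (st T (venc v @ r) [] (venc v) []) (7 * vlen v + 1) (st T (venc v @ r) (rev (venc v)) [] [])"
    using runs_mv[of 4 3 "st T (venc v @ r) [] (venc v) []"] by simp
  have b: "runs (mv 3 2) (st T (venc v @ r) (rev (venc v)) [] []) (7 * vlen v + 1) (st T (venc v @ venc v @ r) [] [] [])"
    using runs_mv[of 3 2 "st T (venc v @ r) (rev (venc v)) [] []"] by simp
  have c: "runs mv2 (st T r (rev (venc v)) [] []) (11 * vlen v + 1) (st T (venc v @ r) [] (venc v) [])"
    using runs_mv2[of T r "rev (venc v)" "[]" "[]"] by simp
  have d: "runs (parse 3) (st T (venc v @ r) [] [] []) (11 * vlen v + 3) (st T r (rev (venc v)) [] [])"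
    using runs_parse(1)[of T v r "[]" "[]"] by simp
  show ?thesis unfolding vdup_def vst_def
    using vlen_pos[of v] by (intro runs_Seq4[OF d c a b]) linarith
qed

lemma runs_vswap:
  "runs vswap (vst T (venc v @ venc w @ r)) (30 * vlen v + 30 * vlen w) (vst T (venc w @ venc v @ r))"
proof -
  have a: "runs (parse 3) (st T (venc v @ venc w @ r) [] [] []) (11 * vlen v + 3) (st T (venc w @ r) (rev (venc v)) [] [])"
    using runs_parse(1)[of T v "venc w @ r" "[]" "[]"] by simp
  have b: "runs (parse 4) (st T (venc w @ r) (rev (venc v)) [] []) (11 * vlen w + 3) (st T r (rev (venc v)) (rev (venc w)) [])"
    using runs_parse(2)[of T w r "rev (venc v)" "[]"] by simp
  have c: "runs (mv 3 2) (st T r (rev (venc v)) (rev (venc w)) []) (7 * vlen v + 1) (st T (venc v @ r) [] (rev (venc w)) [])"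
    using runs_mv[of 3 2 "st T r (rev (venc v)) (rev (venc w)) []"] by simp
  have d: "runs (mv 4 2) (st T (venc v @ r) [] (rev (venc w)) []) (7 * vlen w + 1) (st T (venc w @ venc v @ r) [] [] [])"
    using runs_mv[of 4 2 "st T (venc v @ r) [] (rev (venc w)) []"] by simp
  show ?thesis unfolding vswap_def vst_def
    using vlen_pos[of v] vlen_pos[of w] by (intro runs_Seq4[OF a b c d]) linarith
qed

lemma runs_clear: "runs (While 3 nonempty (pop 3)) (st T a b c d) (3 * length b + 1) (st T a [] c d)"
proof (induction b)
  case Nil
  then show ?case using runs_WhileF[of 3 nonempty "st T a [] c d"] by simp
next
  case (Cons x b)
  have "runs (pop 3) (st T a (x # b) c d) 1 (st T a b c d)"
    using runs_pop[of 3 "st T a (x # b) c d" x b] by simp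
  from runs_WhileT[OF _ _ this Cons] show ?case by (rule runs_cong) auto
qed

lemma runs_vdrop: "runs vdrop (vst T (venc v @ r)) (20 * vlen v) (vst T r)"
proof -
  have "runs (parse 3) (st T (venc v @ r) [] [] []) (11 * vlen v + 3) (st T r (rev (venc v)) [] [])"
    using runs_parse(1)[of T v r "[]" "[]"] by simp
  from runs_Seq_le[OF this runs_clear] show ?thesis unfolding vdrop_def vst_def
    using vlen_pos[of v] by simp
qed

lemma runs_push2: "runs (push 2 b) (vst T a) 2 (vst T (b # a))"
  using runs_push[of 2 b "vst T a"] by (simp add: vst_def)

lemma runs_pop2: "runs (pop 2) (vst T (b # a)) 1 (vst T a)"
  using runs_pop[of 2 "vst T (b # a)" b a] by (simp add: vst_def)

lemma topsym_venc: "istrue (topsym (snd (vst T (venc v @ r)) 2)) \<longleftrightarrow> v \<noteq> Nl"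
  by (cases v) (auto simp: vst_def)

section \<open>Time-bounded computability of typed functions\<close>

text \<open>With all data coded as binary trees, machine code is needed only for constants, pairing,
  the two projections, the test for a leaf and control flow. Injectivity makes equality of data the
  same as equality of trees.\<close>

class codable =
  fixes tov :: "'a \<Rightarrow> val"
  assumes inj_tov: "inj tov"

lemma tov_eq_iff [simp]: "tov x = tov y \<longleftrightarrow> x = (y :: 'a :: codable)"
  using inj_tov by (auto simp: inj_def)

abbreviation code :: "'a :: codable \<Rightarrow> bool list" where "code x \<equiv> venc (tov x)"

definition sz :: "'a :: codable \<Rightarrow> nat" where "sz x = vlen (tov x)"

lemma sz_pos: "1 \<le> sz x" unfolding sz_def by (rule vlen_pos)

instantiation val :: codable
begin
definition tov_val :: "val \<Rightarrow> val" where "tov_val v = v"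
instance by standard (simp add: tov_val_def inj_def)
end

instantiation unit :: codable
begin
definition tov_unit :: "unit \<Rightarrow> val" where "tov_unit v = Nl"
instance by standard (simp add: inj_def)
end

instantiation bool :: codable
begin
definition tov_bool :: "bool \<Rightarrow> val" where "tov_bool b = (if b then Cn Nl Nl else Nl)"
instance by standard (simp add: tov_bool_def inj_def)
end

text \<open>Unary, like the numbers in the input words; a number then has the same code as a list of
  that many units.\<close>

instantiation nat :: codable
begin
primrec tov_nat :: "nat \<Rightarrow> val" where "tov_nat 0 = Nl" | "tov_nat (Suc n) = Cn Nl (tov_nat n)"
instance
proof
  have "tov x = tov y \<Longrightarrow> x = y" for x y :: nat
    by (induction x arbitrary: y; case_tac y) auto
  then show "inj (tov :: nat \<Rightarrow> val)" by (auto simp: inj_def)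
qed
end

instantiation prod :: (codable, codable) codable
begin
definition tov_prod :: "'a \<times> 'b \<Rightarrow> val" where "tov_prod p = Cn (tov (fst p)) (tov (snd p))"
instance by standard (simp add: tov_prod_def inj_def)
end

instantiation list :: (codable) codable
begin
primrec tov_list :: "'a list \<Rightarrow> val" where "tov_list [] = Nl" | "tov_list (x # xs) = Cn (tov x) (tov_list xs)"
instance
proof
  have "tov x = tov y \<Longrightarrow> x = y" for x y :: "'a list"
    by (induction x arbitrary: y; case_tac y) auto
  then show "inj (tov :: 'a list \<Rightarrow> val)" by (auto simp: inj_def)
qed
end

instantiation option :: (codable) codable
begin
definition tov_option :: "'a option \<Rightarrow> val" where
  "tov_option x = (case x of None \<Rightarrow> Nl | Some y \<Rightarrow> Cn Nl (tov y))"
instance by standard (auto simp: tov_option_def inj_def split: option.splits)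
end

lemma tov_option_simps [simp]: "tov None = Nl" "tov (Some y) = Cn Nl (tov y)"
  by (auto simp: tov_option_def)

lemma tov_prod_simp [simp]: "tov (x, y) = Cn (tov x) (tov y)"
  by (simp add: tov_prod_def)

lemma tov_bool_simps [simp]: "tov True = Cn Nl Nl" "tov False = Nl"
  by (simp_all add: tov_bool_def)

lemma sz_simps [simp]:
  "sz (x, y) = 1 + sz x + sz y"
  "sz [] = 1" "sz (z # zs) = 1 + sz z + sz zs"
  "sz None = 1" "sz (Some w) = 2 + sz w"
  by (simp_all add: sz_def)

lemma sz_nat [simp]: "sz (n :: nat) = 1 + 2 * n"
  by (induction n) (simp_all add: sz_def)

lemma sz_bool: "sz (b :: bool) \<le> 3"
  by (cases b) (simp_all add: sz_def)

lemma sz_prod: "sz p = 1 + sz (fst p) + sz (snd p)"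
  by (cases p) simp


subsection \<open>Polynomial domination\<close>

text \<open>The base is at least 2, so constants and sums are absorbed by the exponent and a single
  number describes the polynomial.\<close>

definition pbd :: "('a \<Rightarrow> bool) \<Rightarrow> ('a \<Rightarrow> nat) \<Rightarrow> ('a \<Rightarrow> nat) \<Rightarrow> bool" where
  "pbd D g h \<longleftrightarrow> (\<exists>a. \<forall>x. D x \<longrightarrow> g x \<le> (h x + 2) ^ a)"

lemma pbdI: "(\<And>x. D x \<Longrightarrow> g x \<le> (h x + 2) ^ a) \<Longrightarrow> pbd D g h"
  by (auto simp: pbd_def)

lemma pbd_le: "pbd D g h \<Longrightarrow> (\<And>x. D x \<Longrightarrow> g' x \<le> g x) \<Longrightarrow> pbd D g' h"
  unfolding pbd_def by (meson le_trans)

lemma pbd_self: "(\<And>x. D x \<Longrightarrow> g x \<le> h x) \<Longrightarrow> pbd D g h"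
  by (rule pbdI[where a = 1]) fastforce

lemma pbd_const: "pbd D (\<lambda>_. c) h"
proof (rule pbdI)
  fix x
  have "c \<le> 2 ^ c" by simp
  also have "\<dots> \<le> (h x + 2) ^ c" by (rule power_mono) auto
  finally show "c \<le> (h x + 2) ^ c" .
qed

lemma pbd_mult:
  assumes "pbd D f h" "pbd D g h"
  shows "pbd D (\<lambda>x. f x * g x) h"
proof -
  obtain a b where "\<forall>x. D x \<longrightarrow> f x \<le> (h x + 2) ^ a" "\<forall>x. D x \<longrightarrow> g x \<le> (h x + 2) ^ b"
    using assms unfolding pbd_def by blast
  then show ?thesis by (intro pbdI[where a = "a + b"]) (simp add: power_add mult_le_mono)
qed

lemma pbd_add:
  assumes "pbd D f h" "pbd D g h"
  shows "pbd D (\<lambda>x. f x + g x) h"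
proof -
  have "pbd D (\<lambda>x. (f x + 1) * (g x + 1)) h" if "pbd D (\<lambda>x. f x + 1) h" "pbd D (\<lambda>x. g x + 1) h"
    using pbd_mult[OF that] .
  moreover have S: "pbd D (\<lambda>x. f x + 1) h" if f: "pbd D f h" for f
  proof -
    obtain a where a: "\<forall>x. D x \<longrightarrow> f x \<le> (h x + 2) ^ a" using f unfolding pbd_def by blast
    show ?thesis
    proof (rule pbdI)
      fix x assume "D x"
      then have "f x + 1 \<le> (h x + 2) ^ a + (h x + 2) ^ a" using a by (intro add_mono) auto
      also have "\<dots> \<le> (h x + 2) ^ Suc a" by simp
      finally show "f x + 1 \<le> (h x + 2) ^ Suc a" .
    qed
  qed
  ultimately have "pbd D (\<lambda>x. (f x + 1) * (g x + 1)) h" using assms by blast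
  then show ?thesis by (rule pbd_le) simp
qed

lemma pbd_pow: "pbd D f h \<Longrightarrow> pbd D (\<lambda>x. f x ^ n) h"
  by (induction n) (auto intro: pbd_const pbd_mult)

lemma pbd_trans:
  assumes "pbd D f g" "pbd D g h"
  shows "pbd D f h"
proof -
  obtain a where a: "\<forall>x. D x \<longrightarrow> f x \<le> (g x + 2) ^ a" using assms(1) unfolding pbd_def by blast
  have "pbd D (\<lambda>x. (g x + 2) ^ a) h" by (intro pbd_pow pbd_add pbd_const assms(2))
  then show ?thesis by (rule pbd_le) (use a in auto)
qed

lemma pbd_subst: "pbd E g h \<Longrightarrow> (\<And>x. D x \<Longrightarrow> E (f x)) \<Longrightarrow> pbd D (\<lambda>x. g (f x)) (\<lambda>x. h (f x))"
  unfolding pbd_def by blast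

lemma pbd_dom: "pbd E g h \<Longrightarrow> (\<And>x. D x \<Longrightarrow> E x) \<Longrightarrow> pbd D g h"
  unfolding pbd_def by blast

lemma pbd_ge: "pbd D g h \<Longrightarrow> (\<And>x. D x \<Longrightarrow> h x \<le> h' x) \<Longrightarrow> pbd D g h'"
  using pbd_trans pbd_self by blast

lemma pbd_sz: "pbd D sz (\<lambda>x. sz x + T x)"
  by (rule pbd_self) simp

lemmas pbd_intros = pbd_const pbd_mult pbd_add pbd_pow


subsection \<open>Programs for the basic combinators\<close>

text \<open>The rest \<open>r\<close> of the stack stays untouched, so further values can be parked
  below the argument.\<close>

definition computes :: "com \<Rightarrow> ('a :: codable \<Rightarrow> 'b :: codable) \<Rightarrow> 'a \<Rightarrow> nat \<Rightarrow> bool" where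
  "computes c f x t \<longleftrightarrow> (\<forall>A r. runs c (vst A (code x @ r)) t (vst A (code (f x) @ r)))"

lemma computesI:
  "(\<And>A r. runs c (vst A (code x @ r)) t (vst A (code (f x) @ r))) \<Longrightarrow> t \<le> t' \<Longrightarrow> computes c f x t'"
  unfolding computes_def using runs_mono by blast

text \<open>The allowance \<open>T\<close> collects the costs that are not polynomial in the input; the polynomial that is
  applied to the sum does not depend on it.\<close>

definition tc :: "('a :: codable \<Rightarrow> 'b :: codable) \<Rightarrow> ('a \<Rightarrow> bool) \<Rightarrow> ('a \<Rightarrow> nat) \<Rightarrow> bool" where
  "tc f D T \<longleftrightarrow> (\<exists>c t. pbd D t (\<lambda>x. sz x + T x) \<and> pbd D (\<lambda>x. sz (f x)) (\<lambda>x. sz x + T x) \<and>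
     (\<forall>x. D x \<longrightarrow> computes c f x (t x)))"

lemma tcI:
  assumes "\<And>x. D x \<Longrightarrow> computes c f x (t x)" "pbd D t (\<lambda>x. sz x + T x)"
    "pbd D (\<lambda>x. sz (f x)) (\<lambda>x. sz x + T x)"
  shows "tc f D T"
  using assms unfolding tc_def by blast

lemma tcE:
  assumes "tc f D T"
  obtains c t where "\<And>x. D x \<Longrightarrow> computes c f x (t x)" "pbd D t (\<lambda>x. sz x + T x)"
    "pbd D (\<lambda>x. sz (f x)) (\<lambda>x. sz x + T x)"
  using assms unfolding tc_def by blast

lemma tc_weaken:
  assumes "tc f D T" "\<And>x. E x \<Longrightarrow> D x" "pbd E T (\<lambda>x. sz x + U x)"
  shows "tc f E U"
proof -
  from assms(1) obtain c t where c: "\<And>x. D x \<Longrightarrow> computes c f x (t x)" "pbd D t (\<lambda>x. sz x + T x)"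
    "pbd D (\<lambda>x. sz (f x)) (\<lambda>x. sz x + T x)" by (rule tcE) (rule that)
  have "pbd E (\<lambda>x. sz x + T x) (\<lambda>x. sz x + U x)"
    by (intro pbd_add assms(3) pbd_self) simp
  then show ?thesis using c(1) pbd_trans[OF pbd_dom[OF c(2) assms(2)]] pbd_trans[OF pbd_dom[OF c(3) assms(2)]]
    by (intro tcI[of E c f t]) (auto simp: assms(2))
qed

lemma tc_weaken_le: "tc f D T \<Longrightarrow> (\<And>x. E x \<Longrightarrow> D x) \<Longrightarrow> (\<And>x. E x \<Longrightarrow> T x \<le> U x) \<Longrightarrow> tc f E U"
  by (erule tc_weaken) (auto intro: pbd_self trans_le_add2)

text \<open>A program sees only codes, so functions that agree on codes share a program. In this way
  the tree primitives yield \<open>fst\<close>, \<open>hd\<close>, \<open>Suc\<close> and the like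
  at every type.\<close>

lemma tc_recode:
  assumes "tc F E U" "\<And>x. D x \<Longrightarrow> tov x = tov (e x)" "\<And>x. D x \<Longrightarrow> tov (f x) = tov (F (e x))"
    "\<And>x. D x \<Longrightarrow> E (e x)"
  shows "tc f D (\<lambda>x. U (e x))"
proof -
  from assms(1) obtain c t where c: "\<And>x. E x \<Longrightarrow> computes c F x (t x)" "pbd E t (\<lambda>x. sz x + U x)"
    "pbd E (\<lambda>x. sz (F x)) (\<lambda>x. sz x + U x)" by (rule tcE) (rule that)
  have *: "sz x = sz (e x)" "sz (f x) = sz (F (e x))" if "D x" for x
    using assms(2,3)[OF that] by (simp_all add: sz_def)
  show ?thesis
  proof (rule tcI)
    show "computes c f x (t (e x))" if "D x" for x
      using c(1)[OF assms(4)[OF that]] assms(2,3)[OF that] by (simp add: computes_def)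
    show "pbd D (\<lambda>x. t (e x)) (\<lambda>x. sz x + U (e x))"
      by (rule pbd_ge[OF pbd_subst[where f = e and D = D, OF c(2) assms(4)]]) (simp_all add: *)
    show "pbd D (\<lambda>x. sz (f x)) (\<lambda>x. sz x + U (e x))"
      by (rule pbd_le[OF pbd_ge[OF pbd_subst[where f = e and D = D, OF c(3) assms(4)]]]) (simp_all add: *)
  qed
qed

lemma tc_cong: "tc f D T \<Longrightarrow> (\<And>x. D x \<Longrightarrow> f x = g x) \<Longrightarrow> tc g D T"
  using tc_recode[of f D T D "\<lambda>x. x" g] by simp

lemma tc_comp:
  assumes "tc f D T" "tc g E U" "\<And>x. D x \<Longrightarrow> E (f x)"
  shows "tc (\<lambda>x. g (f x)) D (\<lambda>x. T x + U (f x))"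
proof -
  from assms(1) obtain c t where c: "\<And>x. D x \<Longrightarrow> computes c f x (t x)" "pbd D t (\<lambda>x. sz x + T x)"
    "pbd D (\<lambda>x. sz (f x)) (\<lambda>x. sz x + T x)" by (rule tcE) (rule that)
  from assms(2) obtain d u where d: "\<And>x. E x \<Longrightarrow> computes d g x (u x)" "pbd E u (\<lambda>x. sz x + U x)"
    "pbd E (\<lambda>x. sz (g x)) (\<lambda>x. sz x + U x)" by (rule tcE) (rule that)
  let ?h = "\<lambda>x. sz x + (T x + U (f x))"
  have f: "pbd D (\<lambda>x. sz (f x) + U (f x)) ?h"
    by (intro pbd_add pbd_ge[OF c(3)] pbd_self) auto
  show ?thesis
  proof (rule tcI)
    show "computes (Seq c d) (\<lambda>x. g (f x)) x (t x + u (f x))" if "D x" for x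
      using c(1)[OF that] d(1)[OF assms(3)[OF that]] unfolding computes_def by (blast intro: runs_Seq)
    show "pbd D (\<lambda>x. t x + u (f x)) ?h"
      by (intro pbd_add pbd_ge[OF c(2)] pbd_trans[OF pbd_subst[OF d(2) assms(3)] f]) auto
    show "pbd D (\<lambda>x. sz (g (f x))) ?h"
      by (intro pbd_trans[OF pbd_subst[OF d(3) assms(3)] f]) auto
  qed
qed

lemma tc_id: "tc (\<lambda>x. x) D T"
proof (rule tcI)
  have "runs (Seq (push 2 True) (pop 2)) (vst A w) (2 + 1) (vst A w)" for A w
    by (rule runs_Seq[OF runs_push2 runs_pop2])
  then show "computes (Seq (push 2 True) (pop 2)) (\<lambda>x. x) x 3" for x :: 'a
    by (simp add: computes_def)
qed (auto intro: pbd_const pbd_self)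

text \<open>The argument is duplicated; the first result is swapped below the remaining copy, and a
  second swap restores the order. The final \<open>True\<close> is the tree node above both
  results.\<close>

lemma tc_pair:
  assumes "tc f D T" "tc g D T"
  shows "tc (\<lambda>x. (f x, g x)) D T"
proof -
  from assms(1) obtain c t where c: "\<And>x. D x \<Longrightarrow> computes c f x (t x)" "pbd D t (\<lambda>x. sz x + T x)"
    "pbd D (\<lambda>x. sz (f x)) (\<lambda>x. sz x + T x)" by (rule tcE) (rule that)
  from assms(2) obtain d u where d: "\<And>x. D x \<Longrightarrow> computes d g x (u x)" "pbd D u (\<lambda>x. sz x + T x)"
    "pbd D (\<lambda>x. sz (g x)) (\<lambda>x. sz x + T x)" by (rule tcE) (rule that)
  let ?P = "Seq vdup (Seq c (Seq vswap (Seq d (Seq vswap (push 2 True)))))"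
  let ?t = "\<lambda>x. 42 * sz x + (t x + (30 * sz (f x) + 30 * sz x + (u x + (30 * sz (g x) + 30 * sz (f x) + 2))))"
  show ?thesis
  proof (rule tcI)
    fix x assume x: "D x"
    show "computes ?P (\<lambda>x. (f x, g x)) x (?t x)"
      unfolding computes_def
    proof (intro allI)
      fix A r
      have 1: "runs c (vst A (code x @ code x @ r)) (t x) (vst A (code (f x) @ code x @ r))"
        using c(1)[OF x] unfolding computes_def by blast
      have 2: "runs d (vst A (code x @ code (f x) @ r)) (u x) (vst A (code (g x) @ code (f x) @ r))"
        using d(1)[OF x] unfolding computes_def by blast
      show "runs ?P (vst A (code x @ r)) (?t x) (vst A (code (f x, g x) @ r))"
        unfolding sz_def
        using runs_Seq[OF runs_vdup[of A "tov x" r] runs_Seq[OF 1 runs_Seq[OF runs_vswap runs_Seq[OF 2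
          runs_Seq[OF runs_vswap runs_push2[of True]]]]]] by simp
    qed
  qed (unfold sz_simps, (intro pbd_intros c d pbd_sz)+)
qed

lemma runs_CondT2: "istrue (topsym (snd (vst A w) 2)) \<Longrightarrow> runs a (vst A w) t S \<Longrightarrow> runs (Cond 2 istrue a b) (vst A w) (t + 2) S"
  by (rule runs_CondT) auto

lemma runs_CondF2: "\<not> istrue (topsym (snd (vst A w) 2)) \<Longrightarrow> runs b (vst A w) t S \<Longrightarrow> runs (Cond 2 istrue a b) (vst A w) (t + 2) S"
  by (rule runs_CondF) auto

lemma tc_if:
  assumes "tc b D T" "tc f (\<lambda>x. D x \<and> b x) T" "tc g (\<lambda>x. D x \<and> \<not> b x) T"
  shows "tc (\<lambda>x. if b x then f x else g x) D T"
proof -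
  from assms(1) obtain e v where e: "\<And>x. D x \<Longrightarrow> computes e b x (v x)" "pbd D v (\<lambda>x. sz x + T x)"
    "pbd D (\<lambda>x. sz (b x)) (\<lambda>x. sz x + T x)"
    by (rule tcE) (rule that)
  from assms(2) obtain c t where c: "\<And>x. D x \<and> b x \<Longrightarrow> computes c f x (t x)" "pbd (\<lambda>x. D x \<and> b x) t (\<lambda>x. sz x + T x)"
    "pbd (\<lambda>x. D x \<and> b x) (\<lambda>x. sz (f x)) (\<lambda>x. sz x + T x)" by (rule tcE) (rule that)
  from assms(3) obtain d u where d: "\<And>x. D x \<and> \<not> b x \<Longrightarrow> computes d g x (u x)" "pbd (\<lambda>x. D x \<and> \<not> b x) u (\<lambda>x. sz x + T x)"
    "pbd (\<lambda>x. D x \<and> \<not> b x) (\<lambda>x. sz (g x)) (\<lambda>x. sz x + T x)" by (rule tcE) (rule that)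
  have pbd_if: "pbd D (\<lambda>x. if b x then p x else q x) h"
    if "pbd (\<lambda>x. D x \<and> b x) p h" "pbd (\<lambda>x. D x \<and> \<not> b x) q h" for p q h
  proof -
    obtain a a' where "\<forall>x. D x \<and> b x \<longrightarrow> p x \<le> (h x + 2) ^ a" "\<forall>x. D x \<and> \<not> b x \<longrightarrow> q x \<le> (h x + 2) ^ a'"
      using \<open>pbd _ p h\<close> \<open>pbd _ q h\<close> unfolding pbd_def by blast
    moreover have "(h x + 2) ^ a \<le> (h x + 2) ^ (a + a')" "(h x + 2) ^ a' \<le> (h x + 2) ^ (a + a')" for x
      by (auto intro!: power_increasing)
    ultimately show ?thesis by (intro pbdI[where a = "a + a'"]) (auto intro: order_trans)
  qed
  let ?P = "Seq vdup (Seq e (Cond 2 istrue (Seq vdrop c) (Seq vdrop d)))"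
  let ?t = "\<lambda>x. 42 * sz x + (v x + (60 + (if b x then t x else u x) + 2))"
  show ?thesis
  proof (rule tcI)
    fix x assume x: "D x"
    show "computes ?P (\<lambda>x. if b x then f x else g x) x (?t x)"
      unfolding computes_def
    proof (intro allI)
      fix A r
      have 1: "runs e (vst A (code x @ code x @ r)) (v x) (vst A (code (b x) @ code x @ r))"
        using e(1)[OF x] unfolding computes_def by blast
      have 2: "runs vdrop (vst A (code (b x) @ code x @ r)) 60 (vst A (code x @ r))"
        using runs_mono[OF runs_vdrop[of A "tov (b x)" "code x @ r"]] by (cases "b x") auto
      have 3: "runs (Cond 2 istrue (Seq vdrop c) (Seq vdrop d)) (vst A (code (b x) @ code x @ r))
         (60 + (if b x then t x else u x) + 2) (vst A (code (if b x then f x else g x) @ r))"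
      proof (cases "b x")
        case True
        then have "runs c (vst A (code x @ r)) (t x) (vst A (code (f x) @ r))"
          using c(1)[of x] x unfolding computes_def by blast
        from runs_CondT2[OF _ runs_Seq[OF 2 this]] show ?thesis using True by (simp add: topsym_venc del: venc.simps)
      next
        case False
        then have "runs d (vst A (code x @ r)) (u x) (vst A (code (g x) @ r))"
          using d(1)[of x] x unfolding computes_def by blast
        from runs_CondF2[OF _ runs_Seq[OF 2 this]] show ?thesis using False by (simp add: topsym_venc del: venc.simps)
      qed
      show "runs ?P (vst A (code x @ r)) (?t x) (vst A (code (if b x then f x else g x) @ r))"
        using runs_Seq[OF runs_vdup[of A "tov x" r] runs_Seq[OF 1 3]] unfolding sz_def .
    qed
  next
    show "pbd D ?t (\<lambda>x. sz x + T x)"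
      by (intro pbd_intros e pbd_if c d pbd_sz)
    show "pbd D (\<lambda>x. sz (if b x then f x else g x)) (\<lambda>x. sz x + T x)"
      using pbd_if[OF c(3) d(3)] by (rule pbd_le) auto
  qed
qed

fun pushes :: "bool list \<Rightarrow> com" where
  "pushes [] = Seq (push 2 True) (pop 2)"
| "pushes (b # bs) = Seq (pushes bs) (push 2 b)"

lemma runs_pushes: "runs (pushes bs) (vst A r) (2 * length bs + 3) (vst A (bs @ r))"
proof (induction bs)
  case Nil
  then show ?case using runs_Seq[OF runs_push2[of True] runs_pop2, of A r] by simp
next
  case (Cons b bs)
  from runs_Seq[OF this runs_push2[of b]] show ?case by (simp add: runs_mono)
qed

lemma tc_const: "tc (\<lambda>_. k) D T"
proof (rule tcI)
  show "computes (Seq vdrop (pushes (code k))) (\<lambda>_. k) x (20 * sz x + (2 * sz k + 3))" for x :: 'a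
    using runs_Seq[OF runs_vdrop runs_pushes[of "code k"]] by (simp add: computes_def sz_def)
qed (intro pbd_intros pbd_sz)+

fun vfst :: "val \<Rightarrow> val" where "vfst Nl = Nl" | "vfst (Cn a b) = a"
fun vsnd :: "val \<Rightarrow> val" where "vsnd Nl = Nl" | "vsnd (Cn a b) = b"

lemma runs_nop: "runs (Seq (push 2 True) (pop 2)) (vst A w) 3 (vst A w)"
  using runs_Seq[OF runs_push2[of True] runs_pop2, of A w] by simp

lemma tc_vfst: "tc vfst D T"
proof (rule tcI)
  show "computes (Cond 2 istrue (Seq (pop 2) (Seq vswap vdrop)) (Seq (push 2 True) (pop 2))) vfst x (60 * sz x + 6)" for x
  proof (cases x)
    case Nl
    have "runs (Cond 2 istrue (Seq (pop 2) (Seq vswap vdrop)) (Seq (push 2 True) (pop 2))) (vst A (venc Nl @ r))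
       (3 + 2) (vst A (venc Nl @ r))" for A r
      by (rule runs_CondF2[OF _ runs_nop]) (simp only: topsym_venc, simp)
    then show ?thesis by (intro computesI[where t = "3 + 2"]) (simp_all add: Nl tov_val_def sz_def)
  next
    case (Cn a b)
    have "runs (Cond 2 istrue (Seq (pop 2) (Seq vswap vdrop)) (Seq (push 2 True) (pop 2))) (vst A (venc x @ r))
       (1 + (30 * vlen a + 30 * vlen b + 20 * vlen b) + 2) (vst A (venc a @ r))" for A r
      using runs_CondT2[OF _ runs_Seq[OF runs_pop2 runs_Seq[OF runs_vswap runs_vdrop]]] Cn topsym_venc[of A x r]
      by simp
    then show ?thesis using Cn by (intro computesI) (auto simp: sz_def tov_val_def)
  qed
  show "pbd D (\<lambda>x. sz (vfst x)) (\<lambda>x. sz x + T x)"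
  proof (rule pbd_self)
    show "sz (vfst x) \<le> sz x + T x" for x by (cases x) (simp_all add: sz_def tov_val_def)
  qed
qed (intro pbd_intros pbd_sz)+

lemma tc_vsnd: "tc vsnd D T"
proof (rule tcI)
  show "computes (Cond 2 istrue (Seq (pop 2) vdrop) (Seq (push 2 True) (pop 2))) vsnd x (60 * sz x + 6)" for x
  proof (cases x)
    case Nl
    have "runs (Cond 2 istrue (Seq (pop 2) vdrop) (Seq (push 2 True) (pop 2))) (vst A (venc Nl @ r))
       (3 + 2) (vst A (venc Nl @ r))" for A r
      by (rule runs_CondF2[OF _ runs_nop]) (simp only: topsym_venc, simp)
    then show ?thesis by (intro computesI[where t = "3 + 2"]) (simp_all add: Nl tov_val_def sz_def)
  next
    case (Cn a b)
    have "runs (Cond 2 istrue (Seq (pop 2) vdrop) (Seq (push 2 True) (pop 2))) (vst A (venc x @ r))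
       (1 + 20 * vlen a + 2) (vst A (venc b @ r))" for A r
      using runs_CondT2[OF _ runs_Seq[OF runs_pop2 runs_vdrop]] Cn topsym_venc[of A x r]
      by simp
    then show ?thesis using Cn by (intro computesI) (auto simp: sz_def tov_val_def)
  qed
  show "pbd D (\<lambda>x. sz (vsnd x)) (\<lambda>x. sz x + T x)"
  proof (rule pbd_self)
    show "sz (vsnd x) \<le> sz x + T x" for x by (cases x) (simp_all add: sz_def tov_val_def)
  qed
qed (intro pbd_intros pbd_sz)+

definition visnil :: "val \<Rightarrow> bool" where "visnil v \<longleftrightarrow> v = Nl"

lemma tc_visnil: "tc visnil D T"
proof (rule tcI)
  let ?P = "Cond 2 istrue (Seq vdrop (pushes (code False))) (Seq vdrop (pushes (code True)))"
  show "computes ?P visnil x (20 * sz x + 20)" for x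
  proof -
    have "runs ?P (vst A (venc x @ r)) (20 * vlen x + 9 + 2) (vst A (code (visnil x) @ r))" for A r
    proof (cases "x = Nl")
      case True
      show ?thesis
        using runs_CondF2[OF _ runs_Seq[OF runs_vdrop[of A x] runs_pushes[of "code True"]]] topsym_venc[of A x r] True
        by (simp add: visnil_def)
    next
      case False
      show ?thesis
        using runs_mono[OF runs_CondT2[OF _ runs_Seq[OF runs_vdrop[of A x] runs_pushes[of "code False"]]], of r] topsym_venc[of A x r] False
        by (simp add: visnil_def)
    qed
    then show ?thesis by (intro computesI[where t = "20 * vlen x + 9 + 2"]) (simp_all add: sz_def tov_val_def)
  qed
  have "pbd D (\<lambda>x. 3) (\<lambda>x. sz x + T x)" by (rule pbd_const)
  then show "pbd D (\<lambda>x. sz (visnil x)) (\<lambda>x. sz x + T x)" by (rule pbd_le) (rule sz_bool)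
qed (intro pbd_intros pbd_sz)+

subsection \<open>Loops\<close>

text \<open>The allowance \<open>S\<close> bounds the number of rounds and, in each round, the size
  of the state plus the allowance of the body. The total is then \<open>S\<close> times a polynomial
  in \<open>S\<close> whose exponents come from \<open>b\<close> and \<open>F\<close> alone.\<close>

lemma tc_while:
  fixes F :: "'a :: codable \<Rightarrow> 'a"
  assumes b: "tc b D T" and F: "tc F D T"
    and W: "\<And>x. E x \<Longrightarrow> \<exists>n \<le> S x. (\<forall>i < n. b ((F ^^ i) x)) \<and> \<not> b ((F ^^ n) x) \<and> G x = (F ^^ n) x \<and>
      (\<forall>i \<le> n. D ((F ^^ i) x) \<and> sz ((F ^^ i) x) + T ((F ^^ i) x) \<le> S x)"
  shows "tc G E S"
proof -
  from F obtain c t where c: "\<And>x. D x \<Longrightarrow> computes c F x (t x)" "pbd D t (\<lambda>x. sz x + T x)"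
    "pbd D (\<lambda>x. sz (F x)) (\<lambda>x. sz x + T x)" by (rule tcE) (rule that)
  from b obtain d u where d: "\<And>x. D x \<Longrightarrow> computes d b x (u x)" "pbd D u (\<lambda>x. sz x + T x)"
    "pbd D (\<lambda>x. sz (b x)) (\<lambda>x. sz x + T x)" by (rule tcE) (rule that)
  from c(2) obtain a where a: "\<And>x. D x \<Longrightarrow> t x \<le> (sz x + T x + 2) ^ a" unfolding pbd_def by blast
  from d(2) obtain e where e: "\<And>x. D x \<Longrightarrow> u x \<le> (sz x + T x + 2) ^ e" unfolding pbd_def by blast
  let ?B = "Seq vdrop (Seq c (Seq vdup d))"
  \<comment> \<open>The cost of one round. The code of a Boolean has length at most 3, so dropping
    the old test result takes at most 60 steps; then come the body, a duplication and the next
    test.\<close>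
  define Q where "Q s = 60 + ((s + 2) ^ a + (42 * s + (s + 2) ^ e))" for s :: nat
  have runc: "runs c (vst A (code y @ r)) ((s + 2) ^ a) (vst A (code (F y) @ r))"
    if "D y" "sz y + T y \<le> s" for y s A r
  proof -
    have "t y \<le> (s + 2) ^ a" using that(2) by (intro order_trans[OF a[OF that(1)]] power_mono) auto
    then show ?thesis using c(1)[OF that(1)] unfolding computes_def by (blast intro: runs_mono)
  qed
  have rund: "runs (Seq vdup d) (vst A (code y @ r)) (42 * s + (s + 2) ^ e) (vst A (code (b y) @ code y @ r))"
    if "D y" "sz y + T y \<le> s" for y s A r
  proof -
    have "u y \<le> (s + 2) ^ e" using that(2) by (intro order_trans[OF e[OF that(1)]] power_mono) auto
    moreover have "42 * vlen (tov y) \<le> 42 * s" using that(2) by (simp add: sz_def)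
    moreover have "runs d (vst A (code y @ code y @ r)) (u y) (vst A (code (b y) @ code y @ r))"
      using d(1)[OF that(1)] unfolding computes_def by blast
    ultimately show ?thesis by (intro runs_Seq_le[OF runs_vdup]) auto
  qed
  have drop: "runs vdrop (vst A (code (z :: bool) @ r)) 60 (vst A r)" for z A r
    using runs_mono[OF runs_vdrop[of A "tov z" r]] by (cases z) auto
  have loop: "runs (While 2 istrue ?B) (vst A (code (b y) @ code y @ r)) (n * (Q s + 2) + 1)
      (vst A (code False @ code ((F ^^ n) y) @ r))"
    if "\<forall>i < n. b ((F ^^ i) y)" "\<not> b ((F ^^ n) y)"
      "\<forall>i \<le> n. D ((F ^^ i) y) \<and> sz ((F ^^ i) y) + T ((F ^^ i) y) \<le> s" for n y s A r
    using that
  proof (induction n arbitrary: y)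
    case 0
    then show ?case
      using runs_WhileF[of 2 istrue "vst A (code (b y) @ code y @ r)" ?B] topsym_venc[of A "tov (b y)" "code y @ r"] by simp
  next
    case (Suc n)
    have y: "D y" "sz y + T y \<le> s" "b y" using Suc.prems(1)[rule_format, of 0] Suc.prems(3)[rule_format, of 0] by auto
    have Fy: "D (F y)" "sz (F y) + T (F y) \<le> s" using Suc.prems(3)[rule_format, of 1] by auto
    have fs: "(F ^^ i) (F y) = (F ^^ Suc i) y" for i by (simp add: funpow_swap1)
    have IH: "runs (While 2 istrue ?B) (vst A (code (b (F y)) @ code (F y) @ r)) (n * (Q s + 2) + 1)
      (vst A (code False @ code ((F ^^ Suc n) y) @ r))"
      unfolding fs[symmetric]
    proof (rule Suc.IH)
      show "\<forall>i<n. b ((F ^^ i) (F y))" unfolding fs using Suc.prems(1) by blast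
      show "\<not> b ((F ^^ n) (F y))" unfolding fs by (rule Suc.prems(2))
      show "\<forall>i\<le>n. D ((F ^^ i) (F y)) \<and> sz ((F ^^ i) (F y)) + T ((F ^^ i) (F y)) \<le> s"
        unfolding fs using Suc.prems(3) by blast
    qed
    have "runs ?B (vst A (code (b y) @ code y @ r)) (Q s) (vst A (code (b (F y)) @ code (F y) @ r))"
      unfolding Q_def using runs_Seq[OF drop runs_Seq[OF runc[OF y(1,2)] rund[OF Fy]]] by simp
    from runs_WhileT[OF _ _ this IH] topsym_venc[of A "tov (b y)" "code y @ r"] y(3)
    have "runs (While 2 istrue ?B) (vst A (code (b y) @ code y @ r)) (Q s + (n * (Q s + 2) + 1) + 2)
      (vst A (code False @ code ((F ^^ Suc n) y) @ r))" by simp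
    then show ?case by (rule runs_mono) simp
  qed
  let ?P = "Seq (Seq vdup d) (Seq (While 2 istrue ?B) (pop 2))"
  let ?t = "\<lambda>x. (42 * S x + (S x + 2) ^ e) + ((S x * (Q (S x) + 2) + 1) + 1)"
  show ?thesis
  proof (rule tcI)
    fix x assume "E x"
    from W[OF this] obtain n where n: "n \<le> S x" "\<forall>i < n. b ((F ^^ i) x)" "\<not> b ((F ^^ n) x)" "G x = (F ^^ n) x"
      "\<forall>i \<le> n. D ((F ^^ i) x) \<and> sz ((F ^^ i) x) + T ((F ^^ i) x) \<le> S x" by blast
    have x: "D x" "sz x + T x \<le> S x" using n(5)[rule_format, of 0] by auto
    have "n * (Q (S x) + 2) + 1 \<le> S x * (Q (S x) + 2) + 1" using n(1) by (intro add_mono mult_mono) auto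
    note l = runs_mono[OF loop[OF n(2,3,5)] this]
    have "runs (pop 2) (vst A (code False @ r)) 1 (vst A r)" for A r
      using runs_pop2[of A False r] by simp
    from runs_Seq[OF rund[OF x] runs_Seq[OF l this]] show "computes ?P G x (?t x)"
      unfolding computes_def n(4) by (intro allI)
  next
    have "pbd E S (\<lambda>x. sz x + S x)" by (rule pbd_self) simp
    then show "pbd E ?t (\<lambda>x. sz x + S x)" unfolding Q_def by (intro pbd_intros)
    show "pbd E (\<lambda>x. sz (G x)) (\<lambda>x. sz x + S x)"
    proof (rule pbd_self)
      fix x assume "E x"
      from W[OF this] obtain n where "G x = (F ^^ n) x" "sz ((F ^^ n) x) + T ((F ^^ n) x) \<le> S x" by blast
      then show "sz (G x) \<le> sz x + S x" by simp
    qed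
  qed
qed


subsection \<open>From programs to Turing machines\<close>

lemma runs_Act0: "runs (Act 0 f) (vst A w) 1 (vst (act (f (read A)) A) w)"
proof (rule runsI)
  fix s assume "rep s (vst A w)"
  then show "\<exists>s' m. m \<le> 1 \<and> exec (Act 0 f) s m s' \<and> rep s' (vst (act (f (read A)) A) w)"
    by (intro exI[of _ "s(0 := act (f (read (s 0))) (s 0))"] exI[of _ 1] conjI exec_Act)
      (auto simp: rep_def vst_def st_def)
qed

lemma rep_read0: "rep s (vst A w) \<Longrightarrow> read (s 0) = read A"
  by (simp add: rep_def vst_def st_def)

lemma runs_While0F: "\<not> p (read A) \<Longrightarrow> runs (While 0 p a) (vst A w) 1 (vst A w)"
  by (rule runsI) (metis exec_WhileF order_refl rep_read0)

lemma runs_While0T: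
  assumes "p (read A)" "runs a (vst A w) t S'" "runs (While 0 p a) S' u S''"
  shows "runs (While 0 p a) (vst A w) (t + u + 2) S''"
proof (rule runsI)
  fix s assume r: "rep s (vst A w)"
  then obtain s' m where 1: "m \<le> t" "exec a s m s'" "rep s' S'" using assms(2) unfolding runs_def by blast
  then obtain s'' n where 2: "n \<le> u" "exec (While 0 p a) s' n s''" "rep s'' S''"
    using assms(3) unfolding runs_def by blast
  show "\<exists>s' m. m \<le> t + u + 2 \<and> exec (While 0 p a) s m s' \<and> rep s' S''"
    using assms(1) rep_read0[OF r] exec_WhileT[of p s 0 a m s' n s''] 1 2
    by (intro exI[of _ s''] exI[of _ "m + n + 2"]) auto
qed

lemma runs_Cond0:
  assumes "p (read A) \<Longrightarrow> runs a (vst A w) t S'" "\<not> p (read A) \<Longrightarrow> runs b (vst A w) t S'"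
  shows "runs (Cond 0 p a b) (vst A w) (t + 2) S'"
proof (rule runsI)
  fix s assume r: "rep s (vst A w)"
  show "\<exists>s' m. m \<le> t + 2 \<and> exec (Cond 0 p a b) s m s' \<and> rep s' S'"
  proof (cases "p (read A)")
    case True
    then obtain s' m where "m \<le> t" "exec a s m s'" "rep s' S'" using assms(1) r unfolding runs_def by blast
    then show ?thesis using True rep_read0[OF r] exec_CondT[of p s 0 a m s' b]
      by (intro exI[of _ s'] exI[of _ "m + 2"]) auto
  next
    case False
    then obtain s' m where "m \<le> t" "exec b s m s'" "rep s' S'" using assms(2) r unfolding runs_def by blast
    then show ?thesis using False rep_read0[OF r] exec_CondF[of p s 0 b m s' a]
      by (intro exI[of _ s'] exI[of _ "m + 1"]) auto
  qed
qed

section \<open>Reading the input and writing the output\<close>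

definition go_right :: com where "go_right = While 0 nonempty (Act 0 (\<lambda>s. (s, MoveRight)))"

lemma runs_go_right:
  "j \<le> length w \<Longrightarrow> runs go_right (vst (tape_content w, int j) r) (3 * (length w - j) + 1)
     (vst (tape_content w, int (length w)) r)"
proof (induction "length w - j" arbitrary: j)
  case 0
  then have "\<not> nonempty (read (tape_content w, int j))" by (simp add: read_def tape_content_def)
  from runs_While0F[where p = nonempty, OF this, of "Act 0 (\<lambda>s. (s, MoveRight))" r] 0 show ?case
    unfolding go_right_def by simp
next
  case (Suc n)
  then have j: "j < length w" by simp
  have "runs (Act 0 (\<lambda>s. (s, MoveRight))) (vst (tape_content w, int j) r) 1 (vst (tape_content w, int (Suc j)) r)"
    using runs_Act0[of "\<lambda>s. (s, MoveRight)" "(tape_content w, int j)" r] by (simp add: read_def add.commute)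
  moreover have "runs go_right (vst (tape_content w, int (Suc j)) r) (3 * (length w - Suc j) + 1) (vst (tape_content w, int (length w)) r)"
    using Suc j by (intro Suc.hyps) auto
  ultimately have "runs go_right (vst (tape_content w, int j) r) (1 + (3 * (length w - Suc j) + 1) + 2)
     (vst (tape_content w, int (length w)) r)"
    unfolding go_right_def using j by (intro runs_While0T) (auto simp: read_def tape_content_def)
  then show ?case by (rule runs_mono) (use j in auto)
qed

text \<open>Erasing the input from right to left leaves the first bit on top of the stack, and tape
  0 is blank when the output is written to it.\<close>

definition load :: com where
  "load = While 0 nonempty (Seq (Cond 0 istrue (pushes (True # code True)) (pushes (True # code False)))
     (Act 0 (\<lambda>s. (None, MoveLeft))))"

lemma tape_content_snoc: "tape_content (u @ [b]) = (tape_content u)(int (length u) := Some b)"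
  by (auto simp: tape_content_def fun_eq_iff nth_append split: if_splits)

lemma tape_content_upd_None: "(tape_content u)(int (length u) := None) = tape_content u"
  by (auto simp: tape_content_def fun_eq_iff)

lemma runs_load: "runs load (vst (tape_content u, int (length u) - 1) r) (20 * length u + 1)
   (vst (tape_content [], - 1) (concat (map (\<lambda>b. True # code b) u) @ r))"
proof (induction u arbitrary: r rule: rev_induct)
  case Nil
  have "\<not> nonempty (read (tape_content [], - 1))" by (simp add: read_def tape_content_def)
  then show ?case unfolding load_def using runs_While0F by simp
next
  case (snoc b u)
  let ?A = "(tape_content (u @ [b]), int (length u))"
  have rd: "read ?A = Some b" by (simp add: read_def tape_content_def)
  have p: "runs (pushes (True # code c)) (vst ?A r) 11 (vst ?A (True # code c @ r))" for c :: bool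
    by (rule runs_cong[OF runs_pushes[of "True # code c" ?A r]]) (cases c, simp_all)
  have 1: "runs (Cond 0 istrue (pushes (True # code True)) (pushes (True # code False))) (vst ?A r) (11 + 2) (vst ?A (True # code b @ r))"
    by (rule runs_Cond0) (use rd p in \<open>auto simp: istrue_def simp del: pushes.simps tov_bool_simps\<close>)
  have 2: "runs (Act 0 (\<lambda>s. (None, MoveLeft))) (vst ?A (True # code b @ r)) 1 (vst (tape_content u, int (length u) - 1) (True # code b @ r))"
    using runs_Act0[of "\<lambda>s. (None, MoveLeft)" ?A "True # code b @ r"]
    by (simp add: tape_content_snoc tape_content_upd_None)
  have "runs load (vst ?A r) (11 + 2 + 1 + (20 * length u + 1) + 2) (vst (tape_content [], - 1) (concat (map (\<lambda>b. True # code b) u) @ True # code b @ r))"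
    unfolding load_def by (rule runs_While0T[OF _ runs_Seq[OF 1 2] snoc[unfolded load_def]]) (simp add: rd)
  from runs_mono[OF this, of "20 * length (u @ [b]) + 1"] show ?case by simp
qed

definition input_com :: com where
  "input_com = Seq go_right (Seq (Act 0 (\<lambda>s. (s, MoveLeft))) (Seq (push 2 False) (Seq load (Act 0 (\<lambda>s. (s, MoveRight))))))"

lemma code_bools: "code (w :: bool list) = concat (map (\<lambda>b. True # code b) w) @ [False]"
  by (induction w) auto

lemma runs_input: "runs input_com (vst (tape_content w, 0) []) (23 * length w + 10) (vst (tape_content [], 0) (code w))"
proof -
  have 1: "runs go_right (vst (tape_content w, 0) []) (3 * length w + 1) (vst (tape_content w, int (length w)) [])"
    using runs_go_right[of 0 w "[]"] by simp
  have 2: "runs (Act 0 (\<lambda>s. (s, MoveLeft))) (vst (tape_content w, int (length w)) []) 1 (vst (tape_content w, int (length w) - 1) [])"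
    using runs_Act0[of "\<lambda>s. (s, MoveLeft)" "(tape_content w, int (length w))" "[]"] by (simp add: read_def)
  have 3: "runs (Act 0 (\<lambda>s. (s, MoveRight))) (vst (tape_content [], - 1) r) 1 (vst (tape_content [], 0) r)" for r
    using runs_Act0[of "\<lambda>s. (s, MoveRight)" "(tape_content [], - 1)" r] by (simp add: read_def)
  show ?thesis unfolding input_com_def
    by (rule runs_cong[OF runs_Seq[OF 1 runs_Seq[OF 2 runs_Seq[OF runs_push2[of False] runs_Seq[OF runs_load 3]]]]])
      (auto simp: code_bools)
qed

definition output_com :: com where
  "output_com = While 2 istrue (Seq (pop 2) (Cond 2 istrue (Seq vdrop (Act 0 (\<lambda>s. (Some True, MoveRight))))
     (Seq vdrop (Act 0 (\<lambda>s. (Some False, MoveRight))))))"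

lemma runs_drop_bool: "runs vdrop (vst A (code (b :: bool) @ r)) 60 (vst A r)"
proof -
  have "20 * vlen (tov b) \<le> 60" by (cases b) simp_all
  with runs_vdrop show ?thesis by (rule runs_mono)
qed

lemma topsym_bool: "istrue (topsym (snd (vst A (code b @ r)) 2)) \<longleftrightarrow> b"
  by (cases b) (simp_all add: vst_def)

lemma runs_output_bit:
  "runs (Cond 2 istrue (Seq vdrop (Act 0 (\<lambda>s. (Some True, MoveRight))))
     (Seq vdrop (Act 0 (\<lambda>s. (Some False, MoveRight))))) (vst A (code b @ r)) (60 + 1 + 2)
     (vst (act (Some b, MoveRight) A) r)"
proof (cases b)
  case True
  have "runs (Act 0 (\<lambda>s. (Some True, MoveRight))) (vst A r) 1 (vst (act (Some b, MoveRight) A) r)"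
    using runs_Act0[of "\<lambda>s. (Some True, MoveRight)" A r] True by simp
  with runs_drop_bool have "runs (Seq vdrop (Act 0 (\<lambda>s. (Some True, MoveRight)))) (vst A (code b @ r)) (60 + 1)
    (vst (act (Some b, MoveRight) A) r)" by (rule runs_Seq)
  then show ?thesis by (rule runs_CondT2[rotated]) (simp only: topsym_bool True)
next
  case False
  have "runs (Act 0 (\<lambda>s. (Some False, MoveRight))) (vst A r) 1 (vst (act (Some b, MoveRight) A) r)"
    using runs_Act0[of "\<lambda>s. (Some False, MoveRight)" A r] False by simp
  with runs_drop_bool have "runs (Seq vdrop (Act 0 (\<lambda>s. (Some False, MoveRight)))) (vst A (code b @ r)) (60 + 1)
    (vst (act (Some b, MoveRight) A) r)" by (rule runs_Seq)
  then show ?thesis by (rule runs_CondF2[rotated]) (simp only: topsym_bool False simp_thms)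
qed

lemma runs_output:
  "runs output_com (vst (tape_content u, int (length u)) (code v)) (70 * length v + 1)
     (vst (tape_content (u @ v), int (length (u @ v))) [False])"
proof (induction v arbitrary: u)
  case Nil
  then show ?case unfolding output_com_def
    using runs_WhileF[of 2 istrue "vst (tape_content u, int (length u)) [False]"] by (simp add: vst_def)
next
  case (Cons b v)
  let ?A = "(tape_content u, int (length u))"
  have A: "act (Some b, MoveRight) ?A = (tape_content (u @ [b]), int (length (u @ [b])))"
    by (simp add: tape_content_snoc add.commute)
  have "istrue (topsym (snd (vst ?A (True # code b @ code v)) 2))" by (simp add: vst_def)
  from runs_WhileT[OF _ this runs_Seq[OF runs_pop2 runs_output_bit[of ?A b "code v", unfolded A]]
      Cons.IH[unfolded output_com_def]]
  have "runs output_com (vst ?A (True # code b @ code v)) (1 + (60 + 1 + 2) + (70 * length v + 1) + 2)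
     (vst (tape_content ((u @ [b]) @ v), int (length ((u @ [b]) @ v))) [False])"
    unfolding output_com_def by simp
  from runs_mono[OF this, of "70 * length (b # v) + 1"] show ?case by simp
qed

lemma sz_bools: "sz (w :: bool list) \<le> 4 * length w + 1"
proof (induction w)
  case (Cons b w)
  then show ?case using sz_bool[of b] by simp
qed simp

lemma length_le_sz: "length xs \<le> sz xs"
  by (induction xs) auto

text \<open>The exponent \<open>a\<close> does not depend on the data \<open>p\<close> that is hardwired into the machine.\<close>

lemma tc_tm_param:
  fixes f :: "'p :: codable \<times> bool list \<Rightarrow> bool list"
  assumes "tc f D T"
  obtains a where "\<And>p. \<exists>M. wf_tm M \<and> (\<forall>w. D (p, w) \<longrightarrow> computes_within M w (f (p, w)) ((sz p + length w + T (p, w) + 2) ^ a))"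
proof -
  from assms obtain c t where c: "\<And>x. D x \<Longrightarrow> computes c f x (t x)" "pbd D t (\<lambda>x. sz x + T x)"
    "pbd D (\<lambda>x. sz (f x)) (\<lambda>x. sz x + T x)" by (rule tcE) (rule that)
  let ?P = "\<lambda>p. Seq input_com (Seq (pushes (True # code (p :: 'p))) (Seq c output_com))"
  let ?h = "\<lambda>x. sz (fst x) + length (snd x) + T x"
  let ?t = "\<lambda>x. 23 * length (snd x) + 10 + (2 * (1 + sz (fst x)) + 3 + (t x + (70 * length (f x) + 1)))"
  have b: "pbd D (\<lambda>x. sz (fst x)) ?h" "pbd D (\<lambda>x. length (snd x)) ?h" "pbd D T ?h" by (rule pbd_self; simp)+
  have "pbd D (\<lambda>x. 1 + sz (fst x) + (4 * length (snd x) + 1)) ?h"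
    by (intro pbd_add pbd_mult pbd_const b)
  then have "pbd D sz ?h" by (rule pbd_le) (use sz_bools in \<open>simp add: sz_prod\<close>)
  then have h: "pbd D (\<lambda>x. sz x + T x) ?h" using b(3) by (rule pbd_add)
  have "pbd D (\<lambda>x. length (f x)) (\<lambda>x. sz x + T x)" using c(3) by (rule pbd_le) (rule length_le_sz)
  note l = pbd_trans[OF this h]
  have "pbd D ?t ?h"
    by (intro pbd_add pbd_mult pbd_const pbd_trans[OF c(2) h] l b)
  then obtain a where a: "\<And>x. D x \<Longrightarrow> ?t x \<le> (?h x + 2) ^ a" unfolding pbd_def by (elim exE) (rule that, blast)
  have "wf_tm (com_tm (?P p)) \<and> (\<forall>w. D (p, w) \<longrightarrow> computes_within (com_tm (?P p)) w (f (p, w)) ((sz p + length w + T (p, w) + 2) ^ a))" for p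
  proof (intro conjI allI impI)
    show "wf_tm (com_tm (?P p))" by (rule wf_com_tm)
    fix w assume w: "D (p, w)"
    let ?u = "f (p, w)"
    have "runs c (vst (tape_content [], 0) (code (p, w))) (t (p, w)) (vst (tape_content [], 0) (code ?u))"
      using c(1)[OF w, unfolded computes_def, rule_format, of "(tape_content [], 0)" "[]"] by simp
    with runs_output[of "[]" ?u]
    have r: "runs (Seq c output_com) (vst (tape_content [], 0) (code (p, w))) (t (p, w) + (70 * length ?u + 1))
      (vst (tape_content ?u, int (length ?u)) [False])"
      by (intro runs_Seq) (simp_all del: venc.simps)
    have "(True # code p) @ code w = code (p, w)" by (simp add: tov_prod_def)
    then have "runs (pushes (True # code p)) (vst (tape_content [], 0) (code w)) (2 * (1 + sz p) + 3) (vst (tape_content [], 0) (code (p, w)))"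
      using runs_pushes[of "True # code p" "(tape_content [], 0)" "code w"] by (simp add: sz_def)
    from runs_Seq[OF runs_input runs_Seq[OF this r]]
    have 1: "runs (?P p) (vst (tape_content w, 0) []) (?t (p, w)) (vst (tape_content ?u, int (length ?u)) [False])" by simp
    have "rep (start_store w) (vst (tape_content w, 0) [])"
      by (simp add: rep_def vst_def st_def start_store_def stk_def)
    from 1[unfolded runs_def, rule_format, OF this] obtain s m where s: "m \<le> ?t (p, w)" "exec (?P p) (start_store w) m s"
      "rep s (vst (tape_content ?u, int (length ?u)) [False])" by (elim exE conjE) (rule that)
    have "fst (s 0) = tape_content ?u" using s(3) by (simp add: rep_def vst_def st_def)
    from com_tm_computes[OF s(2) this] show "computes_within (com_tm (?P p)) w ?u ((sz p + length w + T (p, w) + 2) ^ a)"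
    proof (rule computes_within_mono)
      show "m \<le> (sz p + length w + T (p, w) + 2) ^ a" using s(1) a[OF w] by simp
    qed
  qed
  then show thesis using that by blast
qed

corollary tc_tm:
  fixes f :: "bool list \<Rightarrow> bool list"
  assumes "tc f D T"
  obtains M a where "wf_tm M" "\<And>w. D w \<Longrightarrow> computes_within M w (f w) ((length w + T w + 2) ^ a)"
proof -
  have "tc (\<lambda>x :: val \<times> bool list. snd x) (\<lambda>x. D (snd x)) (\<lambda>_. 0)"
    using tc_vsnd by (rule tc_recode[where e = tov]) (simp_all add: tov_val_def tov_prod_def)
  from tc_comp[OF this assms] have "tc (\<lambda>x :: val \<times> bool list. f (snd x)) (\<lambda>x. D (snd x)) (\<lambda>x. T (snd x))" by simp
  then obtain a where a: "\<And>p :: val. \<exists>M. wf_tm M \<and> (\<forall>w. D (snd (p, w)) \<longrightarrow>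
      computes_within M w (f (snd (p, w))) ((sz p + length w + T (snd (p, w)) + 2) ^ a))"
    by (rule tc_tm_param) (rule that)
  from a[of Nl] obtain M where M: "wf_tm M" "\<And>w. D w \<Longrightarrow> computes_within M w (f w) ((sz Nl + length w + T w + 2) ^ a)"
    by auto
  have "computes_within M w (f w) ((length w + T w + 2) ^ (2 * a))" if "D w" for w
    using M(2)[OF that]
  proof (rule computes_within_mono)
    \<comment> \<open>The dummy parameter has size 1; squaring the base absorbs it at the price of a
      doubled exponent.\<close>
    have "sz Nl + length w + T w + 2 \<le> (length w + T w + 2) ^ 2"
      by (simp add: sz_def tov_val_def power2_eq_square)
    then show "(sz Nl + length w + T w + 2) ^ a \<le> (length w + T w + 2) ^ (2 * a)"
      unfolding power_mult by (rule power_mono) simp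
  qed
  then show thesis by (rule that[OF M(1)])
qed


section \<open>Polynomial-time functions\<close>

definition pt :: "('a :: codable \<Rightarrow> 'b :: codable) \<Rightarrow> bool" where
  "pt f \<longleftrightarrow> tc f (\<lambda>_. True) (\<lambda>_. 0)"

named_theorems pt_intros

lemma tc_pt: "pt f \<Longrightarrow> tc f D T"
  unfolding pt_def by (erule tc_weaken) (auto intro: pbd_const)

lemma tc_comp0:
  assumes "tc f D (\<lambda>_. 0)" "tc g E (\<lambda>_. 0)" "\<And>x. D x \<Longrightarrow> E (f x)"
  shows "tc (\<lambda>x. g (f x)) D (\<lambda>_. 0)"
  using tc_comp[OF assms] by simp

lemma pt_cong: "pt f \<Longrightarrow> (\<And>x. f x = g x) \<Longrightarrow> pt g"
  using ext[of f g] by simp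

lemma pt_comp: "pt g \<Longrightarrow> pt f \<Longrightarrow> pt (\<lambda>x. g (f x))"
  unfolding pt_def by (rule tc_comp0) auto

lemma pt_id [pt_intros]: "pt (\<lambda>x. x)"
  unfolding pt_def by (rule tc_id)

lemma pt_const [pt_intros]: "pt (\<lambda>_. c)"
  unfolding pt_def by (rule tc_const)

lemma pt_Pair [pt_intros]: "pt f \<Longrightarrow> pt g \<Longrightarrow> pt (\<lambda>x. (f x, g x))"
  unfolding pt_def by (rule tc_pair)

lemma pt_recode:
  assumes "pt F" "\<And>x. tov x = tov (e x)" "\<And>x. tov (f x) = tov (F (e x))"
  shows "pt f"
  using tc_recode[of F "\<lambda>_. True" "\<lambda>_. 0" "\<lambda>_. True" e f] assms by (simp add: pt_def)

lemma pt_fst [pt_intros]: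
  fixes f :: "'c :: codable \<Rightarrow> 'a :: codable \<times> 'b :: codable"
  assumes "pt f"
  shows "pt (\<lambda>x. fst (f x))"
proof (rule pt_comp[OF _ assms])
  show "pt (fst :: 'a \<times> 'b \<Rightarrow> 'a)"
    by (rule pt_recode[of vfst tov]) (auto simp: pt_def tc_vfst tov_val_def tov_prod_def)
qed

lemma pt_snd [pt_intros]:
  fixes f :: "'c :: codable \<Rightarrow> 'a :: codable \<times> 'b :: codable"
  assumes "pt f"
  shows "pt (\<lambda>x. snd (f x))"
proof (rule pt_comp[OF _ assms])
  show "pt (snd :: 'a \<times> 'b \<Rightarrow> 'b)"
    by (rule pt_recode[of vsnd tov]) (auto simp: pt_def tc_vsnd tov_val_def tov_prod_def)
qed

text \<open>The free and bound variables of a subterm are supplied as nested pairs. A function is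
  treated once on pairs or triples, and these rules apply it to arguments that depend on a common
  context.\<close>

lemma pt2: "pt (\<lambda>p. h (fst p) (snd p)) \<Longrightarrow> pt f \<Longrightarrow> pt g \<Longrightarrow> pt (\<lambda>x. h (f x) (g x))"
  using pt_comp[of "\<lambda>p. h (fst p) (snd p)" "\<lambda>x. (f x, g x)"] pt_Pair[of f g] by simp

lemma pt3: "pt (\<lambda>p. h (fst p) (fst (snd p)) (snd (snd p))) \<Longrightarrow> pt f \<Longrightarrow> pt g \<Longrightarrow> pt k \<Longrightarrow>
    pt (\<lambda>x. h (f x) (g x) (k x))"
  using pt_comp[of "\<lambda>p. h (fst p) (fst (snd p)) (snd (snd p))" "\<lambda>x. (f x, g x, k x)"]
    pt_Pair[of f "\<lambda>x. (g x, k x)"] pt_Pair[of g k] by simp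

lemma pt_case_prod [pt_intros]:
  "pt (\<lambda>x. g x (fst (f x)) (snd (f x))) \<Longrightarrow> pt (\<lambda>x. case f x of (a, b) \<Rightarrow> g x a b)"
  by (simp add: case_prod_unfold)

lemma pt_Let [pt_intros]: "pt f \<Longrightarrow> pt (\<lambda>p. g (fst p) (snd p)) \<Longrightarrow> pt (\<lambda>x. let y = f x in g x y)"
  using pt2[of g "\<lambda>x. x" f] by (simp add: pt_id)

lemma pt_Cons [pt_intros]: "pt f \<Longrightarrow> pt g \<Longrightarrow> pt (\<lambda>x. f x # g x)"
  by (rule pt2) (rule pt_recode[of "\<lambda>x. x" "\<lambda>x. x"], auto simp: tov_prod_def intro: pt_id)

lemma pt_Suc [pt_intros]: "pt f \<Longrightarrow> pt (\<lambda>x. Suc (f x))"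
  by (rule pt_comp[of Suc], rule pt_recode[of "\<lambda>x. (Nl, x)" "\<lambda>x. x"])
    (auto simp: tov_val_def intro: pt_intros)

lemma pt_Some [pt_intros]: "pt f \<Longrightarrow> pt (\<lambda>x. Some (f x))"
  by (rule pt_comp[of Some], rule pt_recode[of "\<lambda>x. (Nl, x)" "\<lambda>x. x"])
    (auto simp: tov_val_def intro: pt_intros)

lemma pt_If [pt_intros]: "pt b \<Longrightarrow> pt f \<Longrightarrow> pt g \<Longrightarrow> pt (\<lambda>x. if b x then f x else g x)"
  unfolding pt_def by (rule tc_if) (auto intro: tc_pt simp: pt_def)

lemma pt_vfst [pt_intros]: "pt f \<Longrightarrow> pt (\<lambda>x. vfst (f x))"
  by (rule pt_comp[of vfst]) (auto simp: pt_def tc_vfst)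

lemma pt_vsnd [pt_intros]: "pt f \<Longrightarrow> pt (\<lambda>x. vsnd (f x))"
  by (rule pt_comp[of vsnd]) (auto simp: pt_def tc_vsnd)

lemma pt_visnil [pt_intros]: "pt f \<Longrightarrow> pt (\<lambda>x. visnil (f x))"
  by (rule pt_comp[of visnil]) (auto simp: pt_def tc_visnil)

lemma pt_null [pt_intros]: "pt f \<Longrightarrow> pt (\<lambda>x. f x = [])"
proof (rule pt_comp[of "\<lambda>l. l = []"])
  show "pt (\<lambda>l :: 'b list. l = [])"
  proof (rule pt_recode[of visnil tov])
    show "tov (x = []) = tov (visnil (tov x))" for x :: "'b list" by (cases x) (auto simp: visnil_def)
  qed (auto simp: tov_val_def intro: pt_intros)
qed

lemma pt_Not [pt_intros]: "pt f \<Longrightarrow> pt (\<lambda>x. \<not> f x)"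
  by (rule pt_cong[OF pt_If[of f "\<lambda>_. False" "\<lambda>_. True"]]) (auto intro: pt_const)

lemma pt_conj [pt_intros]: "pt f \<Longrightarrow> pt g \<Longrightarrow> pt (\<lambda>x. f x \<and> g x)"
  by (rule pt_cong[OF pt_If[of f g "\<lambda>_. False"]]) (auto intro: pt_const)

lemma pt_disj [pt_intros]: "pt f \<Longrightarrow> pt g \<Longrightarrow> pt (\<lambda>x. f x \<or> g x)"
  by (rule pt_cong[OF pt_If[of f "\<lambda>_. True" g]]) (auto intro: pt_const)

lemma pt_imp [pt_intros]: "pt f \<Longrightarrow> pt g \<Longrightarrow> pt (\<lambda>x. f x \<longrightarrow> g x)"
  by (rule pt_cong[OF pt_If[of f g "\<lambda>_. True"]]) (auto intro: pt_const)

lemma pt_tl [pt_intros]: "pt f \<Longrightarrow> pt (\<lambda>x. tl (f x))"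
proof (rule pt_comp[of tl])
  show "pt (tl :: 'b list \<Rightarrow> _)"
  proof (rule pt_recode[of vsnd tov])
    show "tov (tl x) = tov (vsnd (tov x))" for x :: "'b list" by (cases x) (auto simp: tov_val_def)
  qed (auto simp: tov_val_def pt_def tc_vsnd)
qed

lemma tc_hd: "tc hd (\<lambda>l. l \<noteq> []) (\<lambda>_. 0)"
proof (rule tc_recode[of vfst "\<lambda>_. True" "\<lambda>_. 0" _ tov])
  show "tov (hd x) = tov (vfst (tov x))" if "x \<noteq> []" for x :: "'a list"
    using that by (cases x) (auto simp: tov_val_def)
qed (auto simp: tov_val_def tc_vfst)

lemma pt_case_list [pt_intros]:
  assumes "pt l" "pt f" "pt (\<lambda>p. g (fst p) (fst (snd p)) (snd (snd p)))"
  shows "pt (\<lambda>x. case l x of [] \<Rightarrow> f x | y # ys \<Rightarrow> g x y ys)"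
proof -
  let ?D = "\<lambda>x. True \<and> \<not> l x = []"
  have "tc (\<lambda>x. hd (l x)) ?D (\<lambda>_. 0)"
    by (rule tc_comp0[OF tc_pt[OF assms(1)] tc_hd]) auto
  then have "tc (\<lambda>x. (x, hd (l x), tl (l x))) ?D (\<lambda>_. 0)"
    by (intro tc_pair tc_id) (auto intro!: tc_pt pt_intros assms)
  from tc_comp0[OF this tc_pt[OF assms(3), of "\<lambda>_. True"]]
  have "tc (\<lambda>x. g x (hd (l x)) (tl (l x))) ?D (\<lambda>_. 0)" by simp
  moreover have "tc (\<lambda>x. l x = []) (\<lambda>_. True) (\<lambda>_. 0)" by (intro tc_pt pt_intros assms)
  ultimately have "tc (\<lambda>x. if l x = [] then f x else g x (hd (l x)) (tl (l x))) (\<lambda>_. True) (\<lambda>_. 0)"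
    by (intro tc_if tc_pt[OF assms(2)])
  then show ?thesis unfolding pt_def
    by (rule tc_cong) (auto split: list.splits)
qed

text \<open>Passing between a number and its list of units leaves the code unchanged, so list
  operations provide arithmetic and loops with a given number of rounds.\<close>

definition units :: "nat \<Rightarrow> unit list" where "units n = replicate n ()"

lemma length_units [simp]: "length (units n) = n" by (simp add: units_def)

lemma tov_units: "tov (units n) = tov n"
  by (induction n) (auto simp: units_def tov_unit_def)

lemma pt_units [pt_intros]: "pt f \<Longrightarrow> pt (\<lambda>x. units (f x))"
  by (rule pt_comp[of units], rule pt_recode[of "\<lambda>x. x" "\<lambda>x. x"]) (auto simp: tov_units intro: pt_intros)

lemma pt_case_nat [pt_intros]:
  assumes "pt l" "pt f" "pt (\<lambda>p. g (fst p) (snd p))"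
  shows "pt (\<lambda>x. case l x of 0 \<Rightarrow> f x | Suc n \<Rightarrow> g x n)"
proof -
  have "units_tov": "tov (u :: unit list) = tov (length u)" for u
    by (induction u) (auto simp: tov_unit_def)
  have len: "pt (length :: unit list \<Rightarrow> nat)"
    by (rule pt_recode[of "\<lambda>x. x" "\<lambda>x. x"]) (auto simp: units_tov intro: pt_intros)
  have "pt (\<lambda>x. case units (l x) of [] \<Rightarrow> f x | y # ys \<Rightarrow> g x (length ys))"
    by (rule pt_case_list, rule pt_units[OF assms(1)], rule assms(2),
        rule pt2[of g, OF assms(3)]) (intro pt_intros pt_comp[OF len])+
  moreover have "(case units (l x) of [] \<Rightarrow> f x | y # ys \<Rightarrow> g x (length ys)) =
      (case l x of 0 \<Rightarrow> f x | Suc n \<Rightarrow> g x n)" for x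
    by (cases "l x") (auto simp: units_def)
  ultimately show ?thesis by simp
qed

lemma pt_case_option [pt_intros]:
  fixes l :: "'a :: codable \<Rightarrow> 'c :: codable option"
  assumes "pt l" "pt f" "pt (\<lambda>p. g (fst p) (snd p))"
  shows "pt (\<lambda>x. case l x of None \<Rightarrow> f x | Some n \<Rightarrow> g x n)"
proof -
  have 1: "tc the (\<lambda>l :: 'c option. l \<noteq> None) (\<lambda>_. 0)"
  proof (rule tc_recode[of vsnd "\<lambda>_. True" "\<lambda>_. 0" _ tov])
    show "tov (the x) = tov (vsnd (tov x))" if "x \<noteq> None" for x :: "'c option"
      using that by (cases x) (auto simp: tov_val_def)
  qed (auto simp: tov_val_def tc_vsnd)
  have 2: "pt (\<lambda>x :: 'c option. x = None)"
  proof (rule pt_recode[of visnil tov])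
    show "tov (x = None) = tov (visnil (tov x))" for x :: "'c option" by (cases x) (auto simp: visnil_def)
  qed (auto simp: tov_val_def intro: pt_intros)
  let ?D = "\<lambda>x. True \<and> \<not> l x = None"
  have "tc (\<lambda>x. the (l x)) ?D (\<lambda>_. 0)"
    by (rule tc_comp0[OF tc_pt[OF assms(1)] 1]) auto
  then have "tc (\<lambda>x. (x, the (l x))) ?D (\<lambda>_. 0)" by (intro tc_pair tc_id)
  from tc_comp0[OF this tc_pt[OF assms(3), of "\<lambda>_. True"]]
  have "tc (\<lambda>x. g x (the (l x))) ?D (\<lambda>_. 0)" by simp
  moreover have "tc (\<lambda>x. l x = None) (\<lambda>_. True) (\<lambda>_. 0)" by (intro tc_pt pt_comp[OF 2] assms)
  ultimately have "tc (\<lambda>x. if l x = None then f x else g x (the (l x))) (\<lambda>_. True) (\<lambda>_. 0)"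
    by (intro tc_if tc_pt[OF assms(2)])
  then show ?thesis unfolding pt_def
    by (rule tc_cong) (auto split: option.splits)
qed


subsection \<open>Sizes\<close>

abbreviation pb :: "('a :: codable \<Rightarrow> nat) \<Rightarrow> bool" where
  "pb g \<equiv> pbd (\<lambda>_. True) g sz"

lemma pb_sz_pt: "pt f \<Longrightarrow> pb (\<lambda>x. sz (f x))"
  unfolding pt_def by (auto elim: tcE)

lemma pb_sz: "pb sz" by (rule pbd_self) simp

lemma sz_list: "sz xs = 1 + (\<Sum>x\<leftarrow>xs. 1 + sz x)"
  by (induction xs) auto

lemma sz_append: "sz (xs @ ys) + 1 = sz xs + sz ys"
  by (simp add: sz_list)

lemma sz_append_le: "sz (xs @ ys) \<le> sz xs + sz ys"
  using sz_append[of xs ys] by simp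

lemma sz_elem: "x \<in> set xs \<Longrightarrow> sz x < sz xs"
  by (induction xs) auto

lemma sz_take_drop: "sz (take n xs) \<le> sz xs" "sz (drop n xs) \<le> sz xs"
  using sz_append[of "take n xs" "drop n xs"] sz_pos[of "take n xs"] sz_pos[of "drop n xs"] by auto

lemma sz_list_le: "(\<And>x. x \<in> set xs \<Longrightarrow> sz x \<le> b) \<Longrightarrow> sz xs \<le> 1 + length xs * (1 + b)"
proof (induction xs)
  case (Cons a xs)
  then have "sz xs \<le> 1 + length xs * (1 + b)" "sz a \<le> b" by auto
  then show ?case by simp
qed simp

subsection \<open>Bounded iteration over lists\<close>

text \<open>Iterating a polynomial-time step may blow up the accumulator, for instance by doubling
  it each time. Hence the demand for a polynomial bound on every intermediate result.\<close>

lemma pt_foldl: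
  fixes f :: "'a :: codable \<Rightarrow> 's :: codable \<Rightarrow> 'b :: codable \<Rightarrow> 's"
  assumes f: "pt (\<lambda>p. f (fst p) (fst (snd p)) (snd (snd p)))" and i: "pt i" and l: "pt l"
    and B: "pb B" "\<And>x n. sz (foldl (f x) (i x) (take n (l x))) \<le> B x"
  shows "pt (\<lambda>x. foldl (f x) (i x) (l x))"
proof -
  define F where "F s = (case snd (snd s) of [] \<Rightarrow> s | y # ys \<Rightarrow> (fst s, f (fst s) (fst (snd s)) y, ys))"
    for s :: "'a \<times> 's \<times> 'b list"
  define S where "S s = sz s + B (fst s) + 2" for s :: "'a \<times> 's \<times> 'b list"
  define E where "E s \<longleftrightarrow> (\<exists>x. s = (x, i x, l x))" for s
  have "pt F" unfolding F_def
    by (intro pt_intros pt3[of f, OF f])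
  then have F: "tc F (\<lambda>_. True) (\<lambda>_. 0)" by (rule tc_pt)
  have b: "tc (\<lambda>s :: 'a \<times> 's \<times> 'b list. \<not> snd (snd s) = []) (\<lambda>_. True) (\<lambda>_. 0)"
    by (intro tc_pt pt_intros)
  have it: "(F ^^ n) (x, a, ys) = (x, foldl (f x) a (take n ys), drop n ys)" if "n \<le> length ys" for n x a ys
    using that
  proof (induction n arbitrary: a ys)
    case (Suc n)
    from Suc.prems obtain y zs where "ys = y # zs" by (cases ys) auto
    have "F (x, a, y # zs) = (x, f x a y, zs)" by (simp add: F_def)
    moreover have "(F ^^ Suc n) (x, a, ys) = (F ^^ n) (F (x, a, ys))" by (simp only: funpow_Suc_right o_apply)
    ultimately show ?case using Suc \<open>ys = y # zs\<close> by simp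
  qed simp
  define G where "G s = (F ^^ length (snd (snd s))) s" for s
  have G: "tc G E S"
  proof (rule tc_while[OF b F])
    fix s assume "E s"
    then obtain x where s: "s = (x, i x, l x)" by (auto simp: E_def)
    have "sz ((F ^^ n) s) \<le> S s" if "n \<le> length (l x)" for n
      using B(2)[of x n] sz_take_drop(2)[of n "l x"] that sz_pos[of "i x"] by (simp add: s it S_def)
    moreover have "length (l x) \<le> S s" using length_le_sz[of "l x"] by (simp add: s S_def)
    ultimately show "\<exists>n\<le>S s. (\<forall>j<n. snd (snd ((F ^^ j) s)) \<noteq> []) \<and> \<not> snd (snd ((F ^^ n) s)) \<noteq> [] \<and>
       G s = (F ^^ n) s \<and> (\<forall>j\<le>n. True \<and> sz ((F ^^ j) s) + 0 \<le> S s)"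
      by (intro exI[of _ "length (l x)"]) (auto simp: s it G_def)
  qed
  have "pbd E S (\<lambda>x. sz x + 0)"
  proof -
    have "pbd E (\<lambda>s. B (fst s)) (\<lambda>s. sz (fst s))" using B(1) by (rule pbd_subst) simp
    then have "pbd E (\<lambda>s. B (fst s)) (\<lambda>s. sz s)" by (rule pbd_ge) (simp add: sz_prod)
    then show ?thesis unfolding S_def by (intro pbd_intros) (auto intro: pbd_self)
  qed
  then have G0: "tc G E (\<lambda>_. 0)" by (intro tc_weaken[OF G])
  have "tc (\<lambda>x. (x, i x, l x)) (\<lambda>_. True) (\<lambda>_. 0)" by (intro tc_pair tc_id tc_pt[OF i] tc_pt[OF l])
  from tc_comp0[OF this G0] have "pt (\<lambda>x. G (x, i x, l x))" by (simp add: pt_def E_def)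
  from pt_fst[OF pt_snd[OF this]] show ?thesis by (simp add: G_def it)
qed

text \<open>The usual way to meet that bound: a round adds an amount that depends on the context but
  not on the accumulator.\<close>

lemma pt_foldl_add:
  assumes f: "pt (\<lambda>p. f (fst p) (fst (snd p)) (snd (snd p)))" and i: "pt i" and l: "pt l"
    and q: "pb q" "\<And>x a y. y \<in> set (l x) \<Longrightarrow> sz (f x a y) \<le> sz a + q x"
  shows "pt (\<lambda>x. foldl (f x) (i x) (l x))"
proof (rule pt_foldl[OF f i l])
  let ?B = "\<lambda>x. sz (i x) + sz (l x) * q x"
  show "pb ?B" by (intro pbd_intros pb_sz_pt i l q)
  have *: "sz (foldl (f x) a ys) \<le> sz a + length ys * q x" if "set ys \<subseteq> set (l x)" for x a ys
    using that
  proof (induction ys arbitrary: a)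
    case (Cons y ys)
    then have "sz (foldl (f x) (f x a y) ys) \<le> sz (f x a y) + length ys * q x" by simp
    moreover have "sz (f x a y) \<le> sz a + q x" using q(2) Cons.prems by simp
    ultimately show ?case by simp
  qed simp
  show "sz (foldl (f x) (i x) (take n (l x))) \<le> ?B x" for x n
  proof -
    have "length (take n (l x)) * q x \<le> sz (l x) * q x"
      using length_le_sz[of "l x"] by (intro mult_right_mono) auto
    then show ?thesis using *[of "take n (l x)" x "i x"] set_take_subset[of n "l x"] by linarith
  qed
qed

lemma pt_rev [pt_intros]: "pt f \<Longrightarrow> pt (\<lambda>x. rev (f x))"
proof -
  assume f: "pt f"
  have "pt (\<lambda>x. foldl (\<lambda>a y. y # a) [] (f x))"
  proof (rule pt_foldl_add[where q = "\<lambda>x. sz (f x) + 1"])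
    show "sz (y # a) \<le> sz a + (sz (f x) + 1)" if "y \<in> set (f x)" for x a y
      using sz_elem[OF that] by simp
  qed (intro pt_intros f pbd_intros pb_sz_pt)+
  moreover have "foldl (\<lambda>a y. y # a) [] l = rev l" for l :: "'b list"
    using foldl_conv_fold[of "\<lambda>a y. y # a" "[]" l] by (simp add: fold_Cons_rev)
  ultimately show ?thesis by simp
qed

lemma pt_append [pt_intros]: "pt f \<Longrightarrow> pt g \<Longrightarrow> pt (\<lambda>x. f x @ g x)"
proof -
  assume f: "pt f" "pt g"
  have "pt (\<lambda>x. foldl (\<lambda>a y. y # a) (g x) (rev (f x)))"
  proof (rule pt_foldl_add[where q = "\<lambda>x. sz (f x) + 1"])
    show "sz (y # a) \<le> sz a + (sz (f x) + 1)" if "y \<in> set (rev (f x))" for x a y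
      using sz_elem[of y "f x"] that by simp
  qed (intro pt_intros f pbd_intros pb_sz_pt)+
  moreover have "foldl (\<lambda>a y. y # a) m (rev l) = l @ m" for l m :: "'b list"
    by (induction l) auto
  ultimately show ?thesis by simp
qed

lemma pt_map [pt_intros]:
  assumes f: "pt (\<lambda>p. f (fst p) (snd p))" and l: "pt l"
  shows "pt (\<lambda>x. map (f x) (l x))"
proof -
  obtain a where a: "sz (f x y) \<le> (sz (x, y) + 2) ^ a" for x y
    using pb_sz_pt[OF f] unfolding pbd_def by (metis fst_conv snd_conv)
  have "pt (\<lambda>x. foldl (\<lambda>a y. f x y # a) [] (l x))"
  proof (rule pt_foldl_add[where q = "\<lambda>x. (sz x + sz (l x) + 3) ^ a + 1"])
    show "sz (f x y # as) \<le> sz as + ((sz x + sz (l x) + 3) ^ a + 1)" if "y \<in> set (l x)" for x as y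
    proof -
      have "(sz (x, y) + 2) ^ a \<le> (sz x + sz (l x) + 3) ^ a"
        using sz_elem[OF that] by (intro power_mono) auto
      then show ?thesis using a[of x y] by simp
    qed
  qed (intro pt_intros pt2[of f, OF f] l pbd_intros pb_sz_pt pb_sz)+
  then have "pt (\<lambda>x. rev (foldl (\<lambda>a y. f x y # a) [] (l x)))" by (intro pt_intros)
  moreover have "foldl (\<lambda>a y. f x y # a) m ys = rev (map (f x) ys) @ m" for x m ys
    by (induction ys arbitrary: m) auto
  ultimately show ?thesis by simp
qed

lemma pt_concat [pt_intros]:
  assumes l: "pt l"
  shows "pt (\<lambda>x. concat (l x))"
proof -
  have "pt (\<lambda>x. foldl (\<lambda>a y. a @ y) [] (l x))"
  proof (rule pt_foldl_add[where q = "\<lambda>x. sz (l x)"])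
    show "sz (as @ y) \<le> sz as + sz (l x)" if "y \<in> set (l x)" for x as y
      using sz_elem[OF that] sz_append_le[of as y] by simp
  qed (intro pt_intros l pb_sz_pt)+
  moreover have "foldl (\<lambda>a y. a @ y) m ys = m @ concat ys" for m :: "'b list" and ys
    by (induction ys arbitrary: m) auto
  ultimately show ?thesis by simp
qed

lemma pt_filter [pt_intros]:
  assumes "pt (\<lambda>p. f (fst p) (snd p))" and l: "pt l"
  shows "pt (\<lambda>x. filter (f x) (l x))"
proof -
  have "pt (\<lambda>x. concat (map (\<lambda>y. if f x y then [y] else []) (l x)))"
    by (intro pt_intros pt2[of f, OF assms(1)] l)
  moreover have "concat (map (\<lambda>y. if f x y then [y] else []) ys) = filter (f x) ys" for x ys
    by (induction ys) auto
  ultimately show ?thesis by simp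
qed

lemma pt_length [pt_intros]: "pt l \<Longrightarrow> pt (\<lambda>x. length (l x))"
proof -
  assume l: "pt l"
  have "pt (\<lambda>x. foldl (\<lambda>a y. Suc a) 0 (l x))"
    by (rule pt_foldl_add[where q = "\<lambda>x. 2"]) (intro pt_intros l pbd_intros | simp)+
  moreover have "foldl (\<lambda>a y. Suc a) n ys = n + length ys" for n and ys :: "'b list"
    by (induction ys arbitrary: n) auto
  ultimately show ?thesis by simp
qed

lemma pt_ex [pt_intros]:
  assumes "pt l" "pt (\<lambda>p. f (fst p) (snd p))"
  shows "pt (\<lambda>x. \<exists>y\<in>set (l x). f x y)"
proof -
  have "pt (\<lambda>x. \<not> filter (f x) (l x) = [])" by (intro pt_intros assms)
  then show ?thesis by (simp add: filter_empty_conv)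
qed

lemma pt_all [pt_intros]:
  assumes "pt l" "pt (\<lambda>p. f (fst p) (snd p))"
  shows "pt (\<lambda>x. \<forall>y\<in>set (l x). f x y)"
proof -
  have "pt (\<lambda>x. \<not> (\<exists>y\<in>set (l x). \<not> f x y))" by (intro pt_intros assms)
  then show ?thesis by simp
qed


subsection \<open>Arithmetic\<close>

lemma pt_plus [pt_intros]: "pt f \<Longrightarrow> pt g \<Longrightarrow> pt (\<lambda>x. f x + (g x :: nat))"
proof -
  assume "pt f" "pt g"
  then have "pt (\<lambda>x. length (units (f x) @ units (g x)))" by (intro pt_intros)
  then show ?thesis by simp
qed

lemma pt_mult [pt_intros]: "pt f \<Longrightarrow> pt g \<Longrightarrow> pt (\<lambda>x. f x * (g x :: nat))"
proof -
  assume "pt f" "pt g"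
  then have "pt (\<lambda>x. length (concat (map (\<lambda>_. units (g x)) (units (f x)))))"
    by (intro pt_intros pt_comp[of g fst])
  then show ?thesis by (simp add: length_concat comp_def sum_list_triv)
qed

lemma pt_pow: "pt f \<Longrightarrow> pt (\<lambda>x. f x ^ n :: nat)"
  by (induction n) (auto intro: pt_intros)

lemma pt_drop [pt_intros]:
  assumes "pt n" "pt l"
  shows "pt (\<lambda>x. drop (n x) (l x))"
proof -
  have "pt (\<lambda>x. foldl (\<lambda>a _. tl a) (l x) (units (n x)))"
  proof (rule pt_foldl_add[where q = "\<lambda>x. 0"])
    show "sz (tl a) \<le> sz a + 0" for a :: "'b list" by (cases a) auto
  qed (intro pt_intros assms pbd_intros)+
  moreover have "foldl (\<lambda>a _. tl a) ys (units m) = drop m ys" for m and ys :: "'b list"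
    by (induction m arbitrary: ys) (auto simp: units_def drop_Suc)
  ultimately show ?thesis by simp
qed

lemma pt_minus [pt_intros]:
  assumes "pt f" "pt g"
  shows "pt (\<lambda>x. f x - (g x :: nat))"
proof -
  have "pt (\<lambda>x. length (drop (g x) (units (f x))))" by (intro pt_intros assms)
  then show ?thesis by simp
qed

lemma pt_take [pt_intros]:
  assumes "pt n" "pt l"
  shows "pt (\<lambda>x. take (n x) (l x))"
proof -
  have "pt (\<lambda>x. rev (drop (length (l x) - n x) (rev (l x))))" by (intro pt_intros assms)
  then show ?thesis
  proof (rule pt_cong)
    show "rev (drop (length (l x) - n x) (rev (l x))) = take (n x) (l x)" for x
      by (cases "n x \<le> length (l x)") (auto simp: rev_drop)
  qed
qed

lemma pt_zero [pt_intros]: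
  assumes "pt f"
  shows "pt (\<lambda>x. f x = (0 :: nat))"
proof -
  have "pt (\<lambda>x. units (f x) = [])" by (intro pt_intros assms)
  then show ?thesis by (simp add: units_def)
qed

lemma pt_le [pt_intros]:
  assumes "pt f" "pt g"
  shows "pt (\<lambda>x. f x \<le> (g x :: nat))"
proof -
  have "pt (\<lambda>x. f x - g x = 0)" by (intro pt_intros assms)
  then show ?thesis by simp
qed

lemma pt_less [pt_intros]:
  assumes "pt f" "pt g"
  shows "pt (\<lambda>x. f x < (g x :: nat))"
proof -
  have "pt (\<lambda>x. Suc (f x) \<le> g x)" by (intro pt_intros assms)
  then show ?thesis by (simp add: Suc_le_eq)
qed

lemma pt_upt [pt_intros]:
  assumes "pt n"
  shows "pt (\<lambda>x. [0..<n x])"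
proof -
  have *: "foldl (\<lambda>a _. a @ [length a]) [] ys = [0..<length ys]" for ys :: "unit list"
    by (induction ys rule: rev_induct) auto
  have "pt (\<lambda>x. foldl (\<lambda>a _. a @ [length a]) [] (units (n x)))"
  proof (rule pt_foldl[where B = "\<lambda>x. 1 + sz (n x) * (1 + sz (n x))"])
    show "pb (\<lambda>x. 1 + sz (n x) * (1 + sz (n x)))" by (intro pbd_intros pb_sz_pt assms)
    show "sz (foldl (\<lambda>a _. a @ [length a]) [] (take m (units (n x)))) \<le> 1 + sz (n x) * (1 + sz (n x))" for x m
    proof -
      have "sz [0..<min (n x) m] \<le> 1 + length [0..<min (n x) m] * (1 + sz (n x))"
        by (rule sz_list_le) auto
      also have "\<dots> \<le> 1 + sz (n x) * (1 + sz (n x))" by (intro add_mono mult_right_mono) auto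
      finally show ?thesis unfolding * by simp
    qed
  qed (intro pt_intros assms)+
  then show ?thesis unfolding * by simp
qed

text \<open>A total substitute for \<open>!\<close>: an index out of range gives \<open>d\<close>
  instead of an unspecified value, so polynomial bounds hold for all arguments.\<close>

definition nth_default :: "'a \<Rightarrow> 'a list \<Rightarrow> nat \<Rightarrow> 'a" where
  "nth_default d xs n = (case drop n xs of [] \<Rightarrow> d | y # _ \<Rightarrow> y)"

lemma nth_default_nth [simp]: "n < length xs \<Longrightarrow> nth_default d xs n = xs ! n"
  by (simp add: nth_default_def Cons_nth_drop_Suc[symmetric])

lemma pt_nth_default [pt_intros]:
  assumes "pt d" "pt l" "pt n"
  shows "pt (\<lambda>x. nth_default (d x) (l x) (n x))"
  unfolding nth_default_def by (intro pt_intros assms)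

lemma pt_replicate [pt_intros]:
  assumes "pt n" "pt y"
  shows "pt (\<lambda>x. replicate (n x) (y x))"
proof -
  have "pt (\<lambda>x. map (\<lambda>_. y x) (units (n x)))" by (intro pt_intros pt_comp[OF assms(2)] assms(1))
  then show ?thesis by (simp add: map_replicate_const)
qed


subsection \<open>Equality\<close>

text \<open>Comparison of trees with an explicit work list in place of recursion; a mismatch empties
  the list and thereby ends the loop.\<close>

definition eq_step :: "bool \<times> (val \<times> val) list \<Rightarrow> bool \<times> (val \<times> val) list" where
  "eq_step s = (case snd s of [] \<Rightarrow> s | p # r \<Rightarrow>
     if visnil (fst p) then if visnil (snd p) then (True, r) else (False, [])
     else if visnil (snd p) then (False, [])
     else (True, (vfst (fst p), vfst (snd p)) # (vsnd (fst p), vsnd (snd p)) # r))"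

text \<open>Opening two inner nodes removes their own symbols, and comparing two leaves removes a
  pair. So the total length of the first components drops in every round that continues, and the
  size of the state never grows.\<close>

lemma eq_iter:
  "\<exists>n \<le> sum_list (map (vlen \<circ> fst) ws). (\<forall>i < n. snd ((eq_step ^^ i) (True, ws)) \<noteq> []) \<and>
     (eq_step ^^ n) (True, ws) = (\<forall>p \<in> set ws. fst p = snd p, []) \<and>
     (\<forall>i \<le> n. sz ((eq_step ^^ i) (True, ws)) \<le> sz (True, ws))"
proof (induction "sum_list (map (vlen \<circ> fst) ws)" arbitrary: ws rule: less_induct)
  case less
  show ?case
  proof (cases ws)
    case Nil
    then show ?thesis by (intro exI[of _ 0]) auto
  next
    case (Cons p r)
    have stop: ?thesis if "eq_step (True, ws) = (False, [])" "\<not> (\<forall>p \<in> set ws. fst p = snd p)"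
    proof (rule exI[of _ 1], intro conjI)
      show "1 \<le> sum_list (map (vlen \<circ> fst) ws)" using Cons vlen_pos[of "fst p"] by simp
      show "\<forall>i\<le>1. sz ((eq_step ^^ i) (True, ws)) \<le> sz (True, ws)"
      proof (intro allI impI)
        fix i :: nat assume "i \<le> 1"
        then consider "i = 0" | "i = 1" by linarith
        then show "sz ((eq_step ^^ i) (True, ws)) \<le> sz (True, ws)"
          using that sz_pos[of ws] by cases (auto simp: sz_def)
      qed
    qed (use that Cons in auto)
    have go: ?thesis if e: "eq_step (True, ws) = (True, us)" and
      lt: "sum_list (map (vlen \<circ> fst) us) < sum_list (map (vlen \<circ> fst) ws)" and
      eq: "(\<forall>p \<in> set us. fst p = snd p) \<longleftrightarrow> (\<forall>p \<in> set ws. fst p = snd p)" and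
      s: "sz us \<le> sz ws" for us
    proof -
      from less[OF lt] obtain n where n: "n \<le> sum_list (map (vlen \<circ> fst) us)"
        "\<forall>i < n. snd ((eq_step ^^ i) (True, us)) \<noteq> []"
        "(eq_step ^^ n) (True, us) = (\<forall>p \<in> set us. fst p = snd p, [])"
        "\<forall>i \<le> n. sz ((eq_step ^^ i) (True, us)) \<le> sz (True, us)" by blast
      have f: "(eq_step ^^ Suc i) (True, ws) = (eq_step ^^ i) (True, us)" for i
        using e by (simp add: funpow_swap1)
      show ?thesis
      proof (rule exI[of _ "Suc n"], intro conjI allI impI)
        show "Suc n \<le> sum_list (map (vlen \<circ> fst) ws)" using n(1) lt by simp
        show "snd ((eq_step ^^ i) (True, ws)) \<noteq> []" if "i < Suc n" for i
          using that n(2) f Cons by (cases i) (auto simp del: funpow.simps(2))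
        show "(eq_step ^^ Suc n) (True, ws) = (\<forall>p \<in> set ws. fst p = snd p, [])"
          unfolding f n(3) eq ..
        show "sz ((eq_step ^^ i) (True, ws)) \<le> sz (True, ws)" if "i \<le> Suc n" for i
        proof (cases i)
          case (Suc j)
          then have "sz ((eq_step ^^ i) (True, ws)) \<le> sz (True, us)" using that n(4) f[of j] by auto
          then show ?thesis using s by simp
        qed simp
      qed
    qed
    obtain a b where p: "p = (a, b)" by fastforce
    show ?thesis
    proof (cases a; cases b)
      assume "a = Nl" "b = Nl"
      then show ?thesis using Cons p by (intro go[of r]) (auto simp: eq_step_def visnil_def)
    next
      fix a1 a2 b1 b2 assume ab: "a = Cn a1 a2" "b = Cn b1 b2"
      then show ?thesis using Cons p
        by (intro go[of "(a1, b1) # (a2, b2) # r"]) (auto simp: eq_step_def visnil_def sz_def tov_val_def)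
    qed (use Cons p in \<open>(intro stop; auto simp: eq_step_def visnil_def)+\<close>)
  qed
qed

lemma pt_eq [pt_intros]:
  fixes f g :: "'a :: codable \<Rightarrow> 'b :: codable"
  assumes "pt f" "pt g"
  shows "pt (\<lambda>x. f x = g x)"
proof -
  have F: "tc eq_step (\<lambda>_. True) (\<lambda>_. 0)" unfolding eq_step_def by (intro tc_pt pt_intros)
  have b: "tc (\<lambda>s :: bool \<times> (val \<times> val) list. \<not> snd s = []) (\<lambda>_. True) (\<lambda>_. 0)" by (intro tc_pt pt_intros)
  let ?G = "\<lambda>s :: bool \<times> (val \<times> val) list. (\<forall>p \<in> set (snd s). fst p = snd p, [] :: (val \<times> val) list)"
  have G: "tc ?G (\<lambda>s. fst s) (\<lambda>s. sz s)"
  proof (rule tc_while[OF b F])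
    fix s :: "bool \<times> (val \<times> val) list" assume "fst s"
    then obtain ws where s: "s = (True, ws)" by (cases s) auto
    have "sum_list (map (vlen \<circ> fst) us) \<le> sz us" for us :: "(val \<times> val) list"
      by (induction us) (auto simp: sz_prod, simp add: sz_def tov_val_def)
    from this[of ws] have "sum_list (map (vlen \<circ> fst) ws) \<le> sz s" by (simp add: s)
    note le = this
    from eq_iter[of ws] obtain n where n: "n \<le> sum_list (map (vlen \<circ> fst) ws)"
      "\<forall>i<n. snd ((eq_step ^^ i) (True, ws)) \<noteq> []"
      "(eq_step ^^ n) (True, ws) = (\<forall>p \<in> set ws. fst p = snd p, [])"
      "\<forall>i\<le>n. sz ((eq_step ^^ i) (True, ws)) \<le> sz (True, ws)" by (elim exE conjE) (rule that)
    show "\<exists>n\<le>sz s. (\<forall>i<n. snd ((eq_step ^^ i) s) \<noteq> []) \<and> \<not> snd ((eq_step ^^ n) s) \<noteq> [] \<and>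
       ?G s = (eq_step ^^ n) s \<and> (\<forall>i\<le>n. True \<and> sz ((eq_step ^^ i) s) + 0 \<le> sz s)"
    proof (rule exI[of _ n], intro conjI)
      show "n \<le> sz s" using n(1) le by (rule order_trans)
      show "\<forall>i<n. snd ((eq_step ^^ i) s) \<noteq> []" unfolding s by (rule n(2))
      show "\<not> snd ((eq_step ^^ n) s) \<noteq> []" unfolding s n(3) by simp
      show "?G s = (eq_step ^^ n) s" unfolding s n(3) by simp
      show "\<forall>i\<le>n. True \<and> sz ((eq_step ^^ i) s) + 0 \<le> sz s" unfolding s using n(4) by simp
    qed
  qed
  have G0: "tc ?G (\<lambda>s. fst s) (\<lambda>s. 0)"
    by (rule tc_weaken[OF G]) (assumption, rule pbd_self, simp)
  have tov: "pt (tov :: 'b \<Rightarrow> val)"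
    by (rule pt_recode[of "\<lambda>x. x" "\<lambda>x. x"]) (simp_all add: tov_val_def pt_id)
  have "pt (\<lambda>x. (True, [(tov (f x), tov (g x))]))"
    by (intro pt_intros pt_comp[OF tov] assms)
  then have "tc (\<lambda>x. (True, [(tov (f x), tov (g x))])) (\<lambda>_. True) (\<lambda>_. 0)" unfolding pt_def .
  from tc_comp0[OF this G0] have "pt (\<lambda>x. ?G (True, [(tov (f x), tov (g x))]))"
    unfolding pt_def by (simp only: fst_conv simp_thms)
  from pt_fst[OF this] show ?thesis by simp
qed

section \<open>Simulation of Turing machines\<close>

lemma tc_poly: "tc f D T \<Longrightarrow> pbd D T (\<lambda>x. sz x + U x) \<Longrightarrow> tc f D U"
  by (rule tc_weaken)

instantiation move :: codable
begin
definition tov_move :: "move \<Rightarrow> val" where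
  "tov_move m = (case m of MoveLeft \<Rightarrow> Nl | MoveStay \<Rightarrow> Cn Nl Nl | MoveRight \<Rightarrow> Cn (Cn Nl Nl) Nl)"
instance by standard (auto simp: inj_def tov_move_def split: move.splits)
end

text \<open>A zipper: the cells to the left of the head from the nearest outwards, the scanned cell,
  and the cells to the right. Cells beyond the two lists are blank.\<close>

type_synonym simtape = "sym list \<times> sym \<times> sym list"

definition simtape_at :: "simtape \<Rightarrow> int \<Rightarrow> sym" where
  "simtape_at t j = (if j = 0 then fst (snd t)
     else if 0 < j then nth_default None (snd (snd t)) (nat (j - 1))
     else nth_default None (fst t) (nat (- j - 1)))"

definition sim_rel :: "tape \<Rightarrow> simtape \<Rightarrow> bool" where
  "sim_rel T t \<longleftrightarrow> (\<forall>j. fst T (snd T + j) = simtape_at t j)"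

definition simact :: "sym \<times> move \<Rightarrow> simtape \<Rightarrow> simtape" where
  "simact a t = (if snd a = MoveLeft then (tl (fst t), nth_default None (fst t) 0, fst a # snd (snd t))
     else if snd a = MoveRight then (fst a # fst t, nth_default None (snd (snd t)) 0, tl (snd (snd t)))
     else (fst t, fst a, snd (snd t)))"

lemma nth_default_simps [simp]:
  "nth_default d [] n = d" "nth_default d (x # xs) 0 = x" "nth_default d (x # xs) (Suc n) = nth_default d xs n"
  by (simp_all add: nth_default_def)

lemma nth_default_tl: "nth_default d (tl xs) n = nth_default d xs (Suc n)"
  by (cases xs) auto

lemma nth_default_eq: "nth_default d xs n = (if n < length xs then xs ! n else d)"
  by (simp add: nth_default_def Cons_nth_drop_Suc[symmetric])

lemma sim_rel_act:
  assumes "sim_rel T t"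
  shows "sim_rel (act a T) (simact a t)"
proof -
  obtain f h where T: "T = (f, h)" by fastforce
  obtain s m where a: "a = (s, m)" by fastforce
  have *: "f (h + j) = simtape_at t j" for j using assms by (simp add: sim_rel_def T)
  have f: "f k = simtape_at t (k - h)" for k using *[of "k - h"] by simp
  show ?thesis
  proof (cases m)
    case MoveLeft
    have "(f(h := s)) (h - 1 + j) = simtape_at (simact a t) j" for j
    proof -
      consider "j = 1" | "j = 0" | "1 < j" | "j < 0" by linarith
      then show ?thesis
      proof cases
        case 3
        then have "nat (j - 1) = Suc (nat (j - 2))" by simp
        then show ?thesis using 3 by (simp add: f a MoveLeft simact_def simtape_at_def)
      next
        case 4
        then have "nat (- (j - 1) - 1) = Suc (nat (- j - 1))" by simp
        then show ?thesis using 4 by (simp add: f a MoveLeft simact_def simtape_at_def nth_default_tl)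
      qed (auto simp: f a MoveLeft simact_def simtape_at_def)
    qed
    then show ?thesis by (simp add: sim_rel_def T a MoveLeft)
  next
    case MoveStay
    then show ?thesis by (auto simp: sim_rel_def T a simact_def simtape_at_def f)
  next
    case MoveRight
    have "(f(h := s)) (h + 1 + j) = simtape_at (simact a t) j" for j
    proof -
      consider "j = -1" | "j = 0" | "0 < j" | "j < -1" by linarith
      then show ?thesis
      proof cases
        case 3
        then have "nat (1 + j - 1) = Suc (nat (j - 1))" by simp
        then show ?thesis using 3 by (simp add: f a MoveRight simact_def simtape_at_def nth_default_tl)
      next
        case 4
        then have "nat (- j - 1) = Suc (nat (- (1 + j) - 1))" by simp
        then show ?thesis using 4 by (simp add: f a MoveRight simact_def simtape_at_def)
      qed (auto simp: f a MoveRight simact_def simtape_at_def)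
    qed
    then show ?thesis by (simp add: sim_rel_def T a MoveRight)
  qed
qed

lemma sz_sym: "sz (s :: sym) \<le> 5"
  using sz_bool by (cases s) auto

lemma sz_simact: "sz (simact a t) \<le> sz t + 11"
proof -
  have "sz (tl xs) \<le> sz xs" for xs :: "sym list" by (cases xs) auto
  then have 1: "sz (tl (fst t)) \<le> sz (fst t)" "sz (tl (snd (snd t))) \<le> sz (snd (snd t))" by auto
  show ?thesis
    using 1 sz_sym[of "fst a"] sz_sym[of "nth_default None (fst t) 0"] sz_sym[of "nth_default None (snd (snd t)) 0"]
      sz_pos[of "fst (snd t)"]
    by (auto simp: simact_def sz_prod[of t] sz_prod[of "snd t"])
qed

lemma pt_simact: "pt (\<lambda>p. simact (fst p) (snd p))"
  unfolding simact_def by (intro pt_intros)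

text \<open>A transition function is an arbitrary function, but only finitely many pairs of a state
  and a tuple of symbols matter; a nested case distinction serves as the table.\<close>

lemma pt_finite:
  fixes f :: "'a :: codable \<Rightarrow> 'b :: codable"
  assumes "finite A"
  shows "\<exists>F. pt F \<and> (\<forall>x\<in>A. F x = f x)"
  using assms
proof induction
  case empty
  show ?case by (intro exI[of _ "\<lambda>_. undefined"]) (auto intro: pt_intros)
next
  case (insert a A)
  then obtain F where F: "pt F" "\<forall>x\<in>A. F x = f x" by blast
  have "pt (\<lambda>x. if x = a then f a else F x)" by (intro pt_intros F)
  then show ?case using F(2) by (intro exI[of _ "\<lambda>x. if x = a then f a else F x"]) auto
qed

lemma simulation:
  assumes wf: "wf_tm M"
  obtains F :: "nat \<times> simtape list \<Rightarrow> nat \<times> simtape list" where "pt F"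
    "\<And>q ts rs. q \<le> num_states M \<Longrightarrow> length ts = num_tapes M \<Longrightarrow> list_all2 sim_rel ts rs \<Longrightarrow>
      fst (F (q, rs)) = fst (step M (q, ts)) \<and> fst (step M (q, ts)) \<le> num_states M \<and>
      length (snd (step M (q, ts))) = num_tapes M \<and>
      list_all2 sim_rel (snd (step M (q, ts))) (snd (F (q, rs)))"
    "\<And>q rs b. length rs = num_tapes M \<Longrightarrow> \<forall>t\<in>set rs. sz t \<le> b \<Longrightarrow> \<forall>t\<in>set (snd (F (q, rs))). sz t \<le> b + 11"
proof -
  let ?K = "num_tapes M"
  have "finite ({..<num_states M} \<times> {ss :: sym list. set ss \<subseteq> UNIV \<and> length ss = ?K})"
    by (intro finite_cartesian_product finite_lists_length_eq) auto
  from pt_finite[OF this, of "\<lambda>p. delta M (fst p) (snd p)"]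
  obtain \<Delta> where \<Delta>: "pt \<Delta>" "\<And>q ss. q < num_states M \<Longrightarrow> length ss = ?K \<Longrightarrow> \<Delta> (q, ss) = delta M q ss"
    by auto
  define d where "d c = \<Delta> (fst c, map (\<lambda>t. fst (snd t)) (snd c))" for c :: "nat \<times> simtape list"
  define F where "F c = (if fst c = num_states M then c
     else (fst (d c), map (\<lambda>i. simact (nth_default (None, MoveStay) (snd (d c)) i)
        (nth_default ([], None, []) (snd c) i)) [0..<?K]))" for c :: "nat \<times> simtape list"
  have d: "pt d" unfolding d_def by (intro pt_intros pt_comp[OF \<Delta>(1)])
  show ?thesis
  proof
    show "pt F" unfolding F_def
      by (intro pt_intros pt2[of simact, OF pt_simact] d pt_comp[of d fst])
  next
    fix q ts rs assume q: "q \<le> num_states M" and l: "length ts = ?K" and r: "list_all2 sim_rel ts rs"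
    show "fst (F (q, rs)) = fst (step M (q, ts)) \<and> fst (step M (q, ts)) \<le> num_states M \<and>
      length (snd (step M (q, ts))) = ?K \<and> list_all2 sim_rel (snd (step M (q, ts))) (snd (F (q, rs)))"
    proof (cases "q = num_states M")
      case True
      then show ?thesis using l r by (simp add: F_def step.simps)
    next
      case False
      let ?ss = "map (\<lambda>(c, h). c h) ts"
      have "list_all2 (\<lambda>T t. fst T (snd T) = fst (snd t)) ts rs"
        by (rule list_all2_mono[OF r]) (auto simp: sim_rel_def simtape_at_def dest: spec[of _ 0])
      then have ss: "map (\<lambda>t. fst (snd t)) rs = ?ss"
        by (auto simp: list_all2_conv_all_nth case_prod_unfold intro!: nth_equalityI)
      obtain q' as where \<delta>: "delta M q ?ss = (q', as)" by fastforce
      have w: "q' \<le> num_states M" "length as = ?K"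
        using wf q False l \<delta> unfolding wf_tm_def by (metis fst_conv le_neq_implies_less length_map, metis snd_conv le_neq_implies_less length_map)
      have dd: "d (q, rs) = (q', as)" using \<Delta>(2)[of q ?ss] q False l \<delta> by (simp add: d_def ss)
      have st: "step M (q, ts) = (q', map2 act as ts)" using False \<delta> by (simp add: step.simps)
      have "list_all2 sim_rel (map2 act as ts) (snd (F (q, rs)))"
        unfolding F_def dd using False l w r
        by (auto simp: list_all2_conv_all_nth dd intro!: sim_rel_act)
      then show ?thesis using st w l False by (simp add: F_def dd)
    qed
  next
    fix q :: nat and rs :: "simtape list" and b :: nat
    assume "length rs = ?K" "\<forall>t\<in>set rs. sz t \<le> b"
    then have "sz (simact a (nth_default ([], None, []) rs i)) \<le> b + 11" if "i < ?K" for a i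
      using sz_simact[of a "nth_default ([], None, []) rs i"] that by (force intro: order_trans)
    then show "\<forall>t\<in>set (snd (F (q, rs))). sz t \<le> b + 11"
      using \<open>\<forall>t\<in>set rs. sz t \<le> b\<close> by (auto simp: F_def)
  qed
qed

definition somes :: "sym list \<Rightarrow> bool list" where
  "somes xs = concat (map (\<lambda>x. case x of None \<Rightarrow> [] | Some b \<Rightarrow> [b]) xs)"

definition simtape_out :: "simtape \<Rightarrow> bool list" where
  "simtape_out t = somes (rev (fst t) @ fst (snd t) # snd (snd t))"

text \<open>Cells outside the window of the zipper are blank, and blanks inside it surround the word
  without interrupting it. Deleting blanks thus recovers the output wherever the window
  lies.\<close>

lemma simtape_out_eq:
  assumes "sim_rel T t" "fst T = tape_content w"
  shows "simtape_out t = w"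
proof -
  obtain L c R where t: "t = (L, c, R)" by (cases t) auto
  define a where "a = snd T - int (length L)"
  let ?xs = "rev L @ c # R"
  have tc: "tape_content w (snd T + j) = simtape_at t j" for j using assms by (simp add: sim_rel_def)
  have xs: "?xs ! i = tape_content w (a + int i)" if "i < length ?xs" for i
  proof -
    have "tape_content w (a + int i) = simtape_at t (int i - int (length L))"
      using tc[of "int i - int (length L)"] by (simp add: a_def algebra_simps)
    also have "\<dots> = ?xs ! i"
    proof -
      consider "i < length L" | "i = length L" | "length L < i" by linarith
      then show ?thesis
      proof cases
        case 1
        then have "nat (- (int i - int (length L)) - 1) = length L - Suc i" by linarith
        then show ?thesis using 1 by (simp add: simtape_at_def t nth_append rev_nth)
      next
        case 3
        then obtain k where k: "i = length L + Suc k" by (metis add_Suc_right less_imp_Suc_add)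
        then show ?thesis using that by (simp add: simtape_at_def t nth_append)
      qed (simp add: simtape_at_def t nth_append)
    qed
    finally show ?thesis by simp
  qed
  have out: "tape_content w p = None" if "p < a \<or> a + int (length ?xs) \<le> p" for p
  proof -
    have "tape_content w p = simtape_at t (p - snd T)" using tc[of "p - snd T"] by simp
    also have "\<dots> = None" using that by (auto simp: simtape_at_def t a_def nth_default_eq)
    finally show ?thesis .
  qed
  have app: "somes (us @ vs) = somes us @ somes vs" for us vs by (simp add: somes_def)
  have none: "somes (replicate n None) = []" for n by (induction n) (auto simp: somes_def)
  have some: "somes (map Some u) = u" for u by (induction u) (auto simp: somes_def)
  show ?thesis
  proof (cases "w = []")
    case True
    then have "?xs = replicate (length ?xs) None"
      by (intro nth_equalityI) (auto simp: xs tape_content_def simp del: length_append)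
    then show ?thesis using none[of "length ?xs"] True by (simp add: simtape_out_def t)
  next
    case False
    \<comment> \<open>The first and the last cell of a nonempty word are not blank, so the window
      contains both of them.\<close>
    have a: "a \<le> 0" using out[of 0] False by (force simp: tape_content_def)
    have b: "int (length w) \<le> a + int (length ?xs)"
      using out[of "int (length w) - 1"] False a by (force simp: tape_content_def)
    define m n where "m = nat (- a)" and "n = nat (a + int (length ?xs) - int (length w))"
    have len: "length ?xs = m + length w + n" using a b by (simp add: m_def n_def)
    have "?xs = replicate m None @ map Some w @ replicate n None"
    proof (rule nth_equalityI)
      fix i assume i: "i < length ?xs"
      have "a = - int m" using a by (simp add: m_def)
      then show "?xs ! i = (replicate m None @ map Some w @ replicate n None) ! i"
        using i len unfolding xs[OF i] by (auto simp: tape_content_def nth_append nat_diff_distrib' simp del: length_append)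
    qed (use len in simp)
    then show ?thesis by (simp add: simtape_out_def t app none some)
  qed
qed

text \<open>The converse of \<open>tc_tm\<close>. It brings machines that are merely given, a
  parameterized reduction or a solver of the swap problem, into the calculus, where they can be
  composed with programs.\<close>

theorem tc_of_tm:
  assumes wf: "wf_tm M" and comp: "\<And>w. D w \<Longrightarrow> computes_within M w (f w) (T w)"
  shows "tc f D T"
proof -
  let ?K = "num_tapes M"
  obtain F where F: "pt F"
    "\<And>q ts rs. q \<le> num_states M \<Longrightarrow> length ts = ?K \<Longrightarrow> list_all2 sim_rel ts rs \<Longrightarrow>
      fst (F (q, rs)) = fst (step M (q, ts)) \<and> fst (step M (q, ts)) \<le> num_states M \<and>
      length (snd (step M (q, ts))) = ?K \<and> list_all2 sim_rel (snd (step M (q, ts))) (snd (F (q, rs)))"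
    "\<And>q rs b. length rs = ?K \<Longrightarrow> \<forall>t\<in>set rs. sz t \<le> b \<Longrightarrow> \<forall>t\<in>set (snd (F (q, rs))). sz t \<le> b + 11"
    by (rule simulation[OF wf]) (rule that)
  define G where "G s = (fst s, F (snd s))" for s :: "bool list \<times> nat \<times> simtape list"
  define init where "init w = (w, 0 :: nat, ([] :: sym list, nth_default None (map Some w) 0, tl (map Some w)) #
     replicate (?K - 1) ([] :: sym list, None, [] :: sym list))" for w :: "bool list"
  \<comment> \<open>A simulated tape starts with size at most \<open>9 + 7 * length w\<close> and
    gains at most 11 per step.\<close>
  define S where "S s = (let t = T (fst s); w = fst s in
     t + (sz w + 2 * num_states M + 10 + ?K * (10 + 7 * length w + 11 * t)))" for s :: "bool list \<times> nat \<times> simtape list"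
  have G: "tc G (\<lambda>_. True) (\<lambda>_. 0)" unfolding G_def by (intro tc_pt pt_intros pt_comp[OF F(1)])
  have b: "tc (\<lambda>s :: bool list \<times> nat \<times> simtape list. \<not> fst (snd s) = num_states M) (\<lambda>_. True) (\<lambda>_. 0)"
    by (intro tc_pt pt_intros)
  define E where "E s \<longleftrightarrow> (\<exists>w. D w \<and> s = init w)" for s
  have K: "0 < ?K" using wf by (simp add: wf_tm_def)
  have rel0: "list_all2 sim_rel (snd (init_config M w)) (snd (snd (init w)))" for w
  proof -
    have "sim_rel (tape_content w, 0) ([], nth_default None (map Some w) 0, tl (map Some w))"
      by (auto simp: sim_rel_def simtape_at_def tape_content_def nth_default_eq nth_tl nat_diff_distrib')
    moreover have "sim_rel (tape_content [], 0) ([], None, [])"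
      by (auto simp: sim_rel_def simtape_at_def tape_content_def)
    ultimately show ?thesis by (simp add: init_config_def init_def list_all2_conv_all_nth nth_Cons')
  qed
  have sz0: "\<forall>t\<in>set (snd (snd (init w))). sz t \<le> 9 + 7 * length w" for w
  proof -
    have "sz (tl (map Some w)) \<le> 1 + length (tl (map Some w)) * (1 + 5)" by (rule sz_list_le) (rule sz_sym)
    also have "\<dots> \<le> 1 + 7 * length w" by simp
    finally show ?thesis using sz_sym[of "nth_default None (map Some w) 0"] by (auto simp: init_def)
  qed
  have inv: "fst ((G ^^ i) (init w)) = w \<and>
      fst (snd ((G ^^ i) (init w))) = fst ((step M ^^ i) (init_config M w)) \<and>
      fst ((step M ^^ i) (init_config M w)) \<le> num_states M \<and>
      length (snd ((step M ^^ i) (init_config M w))) = ?K \<and>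
      list_all2 sim_rel (snd ((step M ^^ i) (init_config M w))) (snd (snd ((G ^^ i) (init w)))) \<and>
      (\<forall>t\<in>set (snd (snd ((G ^^ i) (init w)))). sz t \<le> 9 + 7 * length w + 11 * i)" for i w
  proof (induction i)
    case 0
    show ?case using rel0[of w] sz0[of w] K by (simp add: init_def) (simp add: init_config_def)
  next
    case (Suc i)
    obtain q ts where 1: "(step M ^^ i) (init_config M w) = (q, ts)" by fastforce
    obtain rs where 2: "(G ^^ i) (init w) = (w, q, rs)" using Suc 1 by (cases "(G ^^ i) (init w)") auto
    have "length rs = ?K" using Suc 1 2 by (auto dest: list_all2_lengthD)
    then have "\<forall>t\<in>set (snd (F (q, rs))). sz t \<le> 9 + 7 * length w + 11 * i + 11"
      using Suc 1 2 by (intro F(3)) auto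
    moreover have "G (w, q, rs) = (w, F (q, rs))" by (simp add: G_def)
    then have "(G ^^ Suc i) (init w) = (w, F (q, rs))" by (simp add: 2)
    moreover have "(step M ^^ Suc i) (init_config M w) = step M (q, ts)" by (simp add: 1)
    moreover have "q \<le> num_states M" "length ts = ?K" "list_all2 sim_rel ts rs" using Suc 1 2 by auto
    note F(2)[OF this]
    ultimately show ?case by (simp del: funpow.simps)
  qed
  have szG: "sz ((G ^^ i) (init w)) \<le> S (init w)" if "i \<le> T w" for i w
  proof -
    obtain q rs where 1: "(G ^^ i) (init w) = (w, q, rs)" using inv[of i w] by (cases "(G ^^ i) (init w)") auto
    have l: "length rs = ?K" "q \<le> num_states M" using inv[of i w] 1 by (auto dest: list_all2_lengthD)
    have "sz rs \<le> 1 + length rs * (1 + (9 + 7 * length w + 11 * i))"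
      using inv[of i w] 1 by (intro sz_list_le) auto
    also have "\<dots> \<le> 1 + ?K * (10 + 7 * length w + 11 * T w)"
      using that l mult_le_mono2[of "1 + (9 + 7 * length w + 11 * i)" "10 + 7 * length w + 11 * T w" ?K] by simp
    finally show ?thesis using l 1 by (simp add: S_def Let_def init_def)
  qed
  define t where "t w = (LEAST n. fst ((step M ^^ n) (init_config M w)) = num_states M)" for w
  define H where "H s = (G ^^ t (fst s)) s" for s
  have t: "t w \<le> T w" "fst ((step M ^^ t w) (init_config M w)) = num_states M"
    "i < t w \<Longrightarrow> fst ((step M ^^ i) (init_config M w)) \<noteq> num_states M" if "D w" for w i
  proof -
    have *: "fst ((step M ^^ T w) (init_config M w)) = num_states M"
      using comp[OF that] by (auto simp: computes_within_def)
    show "t w \<le> T w" unfolding t_def by (rule Least_le) (rule *)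
    show "fst ((step M ^^ t w) (init_config M w)) = num_states M" unfolding t_def by (rule LeastI) (rule *)
    show "i < t w \<Longrightarrow> fst ((step M ^^ i) (init_config M w)) \<noteq> num_states M"
      unfolding t_def by (rule not_less_Least)
  qed
  have H: "tc H E S"
  proof (rule tc_while[OF b G])
    fix s assume "E s"
    then obtain w where w: "D w" "s = init w" by (auto simp: E_def)
    have "fst (init w) = w" by (simp add: init_def)
    moreover have "T w \<le> S s" by (simp add: w S_def init_def Let_def)
    then have "t w \<le> S s" using t(1)[OF w(1)] by simp
    ultimately show "\<exists>n\<le>S s. (\<forall>i<n. fst (snd ((G ^^ i) s)) \<noteq> num_states M) \<and>
        \<not> fst (snd ((G ^^ n) s)) \<noteq> num_states M \<and> H s = (G ^^ n) s \<and> (\<forall>i\<le>n. True \<and> sz ((G ^^ i) s) + 0 \<le> S s)"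
      using t[OF w(1)] inv[of _ w] szG[of _ w] by (intro exI[of _ "t w"]) (auto simp: w(2) H_def)
  qed
  have init: "tc init D (\<lambda>_. 0)"
    unfolding init_def by (intro tc_pt pt_intros)
  have "tc (\<lambda>w. H (init w)) D (\<lambda>w. 0 + S (init w))"
    by (rule tc_comp[OF init H]) (auto simp: E_def)
  then have "tc (\<lambda>w. simtape_out (nth_default ([], None, []) (snd (snd (H (init w)))) 0)) D (\<lambda>w. (0 + S (init w)) + 0)"
  proof (rule tc_comp[where E = "\<lambda>_. True"])
    show "tc (\<lambda>h :: bool list \<times> nat \<times> simtape list. simtape_out (nth_default ([], None, []) (snd (snd h)) 0)) (\<lambda>_. True) (\<lambda>_. 0)"
      unfolding simtape_out_def somes_def by (intro tc_pt pt_intros)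
  qed auto
  moreover have "pbd D (\<lambda>w. (0 + S (init w)) + 0) (\<lambda>w. sz w + T w)"
  proof -
    have "pbd D T (\<lambda>w. sz w + T w)" "pbd D sz (\<lambda>w. sz w + T w)" by (rule pbd_self, simp)+
    moreover have "pbd D length (\<lambda>w. sz w + T w)" by (rule pbd_self) (rule trans_le_add1[OF length_le_sz])
    ultimately show ?thesis by (simp add: S_def Let_def init_def) (intro pbd_intros)
  qed
  ultimately have "tc (\<lambda>w. simtape_out (nth_default ([], None, []) (snd (snd (H (init w)))) 0)) D T"
    by (rule tc_poly)
  then show ?thesis
  proof (rule tc_cong)
    fix w assume w: "D w"
    have f: "fst (init w) = w" by (simp add: init_def)
    obtain ts where ts: "(step M ^^ T w) (init_config M w) = (num_states M, ts)" "fst (hd ts) = tape_content (f w)"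
      using comp[OF w] by (auto simp: computes_within_def)
    have "T w = (T w - t w) + t w" using t(1)[OF w] by simp
    then have "(step M ^^ T w) (init_config M w) = (step M ^^ (T w - t w)) ((step M ^^ t w) (init_config M w))"
      by (metis funpow_add o_apply)
    also have "\<dots> = (step M ^^ t w) (init_config M w)"
      using t(2)[OF w] funpow_step_halted by (metis prod.collapse)
    finally have "(step M ^^ t w) (init_config M w) = (num_states M, ts)" using ts by simp
    then have "list_all2 sim_rel ts (snd (snd (H (init w))))" "length ts = ?K" using inv[of "t w" w] f by (auto simp: H_def)
    then have "sim_rel (hd ts) (nth_default ([], None, []) (snd (snd (H (init w)))) 0)"
      using K by (cases ts; cases "snd (snd (H (init w)))") auto
    then show "simtape_out (nth_default ([], None, []) (snd (snd (H (init w)))) 0) = f w"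
      using ts(2) by (rule simtape_out_eq)
  qed
qed

section \<open>From cliques to swaps\<close>

definition has_clique :: "nat \<Rightarrow> (nat \<Rightarrow> nat \<Rightarrow> bool) \<Rightarrow> nat \<Rightarrow> bool" where
  "has_clique n R m \<longleftrightarrow> (\<exists>W \<subseteq> {..<n}. card W = m \<and> (\<forall>a\<in>W. \<forall>b\<in>W. a \<noteq> b \<longrightarrow> R a b))"

text \<open>A vertex is a tag with an index. For every vertex \<open>a\<close> of the clique instance there are three
  vertices \<open>(0, a)\<close>, \<open>(1, a)\<close>, \<open>(2, a)\<close>; choosing \<open>a\<close> recolors them \<open>2 \<rightarrow> 3\<close>, \<open>1 \<rightarrow> 3\<close>, \<open>3 \<rightarrow> 2\<close>. The
  vertices \<open>(3, i)\<close> have to give away their color 3 in exchange for color 1. The vertices with tags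
  4, 5, 6 form a complete tripartite graph that is too large to be recolored; an edge to one of its
  parts forbids a color.\<close>

type_synonym vlabel = "nat \<times> nat"

text \<open>The parts have size \<open>4 * m + 1\<close> because \<open>2 * m\<close> swaps touch at
  most \<open>4 * m\<close> vertices, so each part keeps a vertex of its original color.\<close>

definition swap_labels :: "nat \<Rightarrow> nat \<Rightarrow> vlabel list" where
  "swap_labels n m = map (Pair 0) [0..<n] @ map (Pair 1) [0..<n] @ map (Pair 2) [0..<n] @
     map (Pair 3) [0..<m] @ map (Pair 4) [0..<4 * m + 1] @ map (Pair 5) [0..<4 * m + 1] @
     map (Pair 6) [0..<4 * m + 1]"

definition label_color :: "vlabel \<Rightarrow> nat" where
  "label_color l = (if fst l = 0 \<or> fst l = 5 then 2 else if fst l = 1 \<or> fst l = 4 then 1 else 3)"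

text \<open>The edges to tag 2 tie the copies together: if \<open>(1, a)\<close> has color 3, then
  \<open>(2, a)\<close> must give it up for color 2, and so \<open>(0, a)\<close> must go from 2 to
  3. For two chosen vertices both \<open>(0, a)\<close> and \<open>(1, b)\<close> have color 3; the
  edge between them is therefore present exactly when \<open>a\<close> and \<open>b\<close> are
  distinct and not adjacent.\<close>

definition label_arc :: "(nat \<Rightarrow> nat \<Rightarrow> bool) \<Rightarrow> vlabel \<Rightarrow> vlabel \<Rightarrow> bool" where
  "label_arc R x y \<longleftrightarrow>
     (fst x = 0 \<and> fst y = 2 \<and> snd x = snd y) \<or> (fst x = 1 \<and> fst y = 2 \<and> snd x = snd y) \<or>
     (fst x = 0 \<and> fst y = 1 \<and> snd x \<noteq> snd y \<and> \<not> R (snd x) (snd y)) \<or>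
     (fst x = 0 \<and> fst y = 4) \<or> (fst x = 2 \<and> fst y = 4) \<or> (fst x = 1 \<and> fst y = 5) \<or>
     (fst x = 3 \<and> fst y = 5) \<or> (fst x = 3 \<and> fst y = 6) \<or>
     (fst x = 4 \<and> fst y = 5) \<or> (fst x = 4 \<and> fst y = 6) \<or> (fst x = 5 \<and> fst y = 6)"

definition label_edge :: "(nat \<Rightarrow> nat \<Rightarrow> bool) \<Rightarrow> vlabel \<Rightarrow> vlabel \<Rightarrow> bool" where
  "label_edge R x y \<longleftrightarrow> label_arc R x y \<or> label_arc R y x"

definition swap_order :: "nat \<Rightarrow> nat \<Rightarrow> nat" where
  "swap_order n m = 3 * n + m + 3 * (4 * m + 1)"

definition swap_edges :: "nat \<Rightarrow> (nat \<Rightarrow> nat \<Rightarrow> bool) \<Rightarrow> nat \<Rightarrow> nat set set" where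
  "swap_edges n R m = {{i, j} | i j. i < swap_order n m \<and> j < swap_order n m \<and>
     label_edge R (swap_labels n m ! i) (swap_labels n m ! j)}"

definition swap_coloring :: "nat \<Rightarrow> nat \<Rightarrow> nat \<Rightarrow> nat" where
  "swap_coloring n m i = label_color (swap_labels n m ! i)"

lemma label_edge_irrefl: "\<not> label_edge R x x"
  by (auto simp: label_edge_def label_arc_def)

lemma label_edge_sym: "label_edge R x y \<longleftrightarrow> label_edge R y x"
  by (auto simp: label_edge_def)

lemma length_swap_labels: "length (swap_labels n m) = swap_order n m"
  by (simp add: swap_labels_def swap_order_def)

lemma swap_edges_iff:
  assumes "i < swap_order n m" "j < swap_order n m"
  shows "{i, j} \<in> swap_edges n R m \<longleftrightarrow> label_edge R (swap_labels n m ! i) (swap_labels n m ! j)"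
  using assms label_edge_sym by (fastforce simp: swap_edges_def doubleton_eq_iff)

lemma simple_swap_graph: "simple_graph (swap_order n m) (swap_edges n R m)"
proof -
  have "i \<noteq> j" if "label_edge R (swap_labels n m ! i) (swap_labels n m ! j)" for i j
    using that label_edge_irrefl[of R "swap_labels n m ! i"] by metis
  then show ?thesis unfolding simple_graph_def swap_edges_def by blast
qed

lemma coloring_swap: "3 \<le> r \<Longrightarrow> coloring r N (swap_coloring n m)"
  by (auto simp: coloring_def swap_coloring_def label_color_def)

text \<open>The code in terms of labels instead of indices, which is the form that
  \<open>pt_swap_inst\<close> computes.\<close>

lemma enc_swap_graph:
  "enc_colored_graph (swap_order n m) (swap_edges n R m) (swap_coloring n m) =
   enc_nats (length (swap_labels n m) #
     concat (map (\<lambda>x. map (\<lambda>y. (of_bool (label_edge R x y) :: nat)) (swap_labels n m)) (swap_labels n m)) @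
     map label_color (swap_labels n m))"
proof -
  let ?L = "swap_labels n m" and ?N = "swap_order n m"
  have L: "?L = map (\<lambda>i. ?L ! i) [0..<?N]" by (simp add: length_swap_labels[symmetric] map_nth)
  have "map (\<lambda>j. (of_bool ({i, j} \<in> swap_edges n R m) :: nat)) [0..<?N] = map (\<lambda>y. (of_bool (label_edge R (?L ! i) y) :: nat)) ?L"
    if "i < ?N" for i
  proof -
    have "map (\<lambda>j. (of_bool ({i, j} \<in> swap_edges n R m) :: nat)) [0..<?N] = map (\<lambda>j. (of_bool (label_edge R (?L ! i) (?L ! j)) :: nat)) [0..<?N]"
      using that swap_edges_iff by auto
    also have "\<dots> = map (\<lambda>y. (of_bool (label_edge R (?L ! i) y) :: nat)) (map (\<lambda>i. ?L ! i) [0..<?N])" by simp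
    finally show ?thesis using L by simp
  qed
  then have "map (\<lambda>i. map (\<lambda>j. (of_bool ({i, j} \<in> swap_edges n R m) :: nat)) [0..<?N]) [0..<?N] =
     map (\<lambda>x. map (\<lambda>y. (of_bool (label_edge R x y) :: nat)) ?L) (map (\<lambda>i. ?L ! i) [0..<?N])"
    unfolding map_map o_def by (intro map_cong) (simp_all only: set_upt atLeastLessThan_iff)
  then have 1: "map (\<lambda>i. map (\<lambda>j. (of_bool ({i, j} \<in> swap_edges n R m) :: nat)) [0..<?N]) [0..<?N] =
     map (\<lambda>x. map (\<lambda>y. (of_bool (label_edge R x y) :: nat)) ?L) ?L" using L by simp
  have "map (swap_coloring n m) [0..<?N] = map label_color (map (\<lambda>i. ?L ! i) [0..<?N])"
    by (simp add: swap_coloring_def)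
  then have 2: "map (swap_coloring n m) [0..<?N] = map label_color ?L" using L by simp
  show ?thesis unfolding enc_colored_graph_def 1 2 by (simp add: length_swap_labels)
qed

lemma swap_labels_nth:
  "a < n \<Longrightarrow> swap_labels n m ! a = (0, a)"
  "a < n \<Longrightarrow> swap_labels n m ! (n + a) = (1, a)"
  "a < n \<Longrightarrow> swap_labels n m ! (2 * n + a) = (2, a)"
  "i < m \<Longrightarrow> swap_labels n m ! (3 * n + i) = (3, i)"
  "l < 4 * m + 1 \<Longrightarrow> swap_labels n m ! (3 * n + m + l) = (4, l)"
  "l < 4 * m + 1 \<Longrightarrow> swap_labels n m ! (3 * n + m + (4 * m + 1) + l) = (5, l)"
  "l < 4 * m + 1 \<Longrightarrow> swap_labels n m ! (3 * n + m + 2 * (4 * m + 1) + l) = (6, l)"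
  by (auto simp: swap_labels_def nth_append simp del: upt_Suc)

lemma swap_order_cases:
  assumes "z < swap_order n m"
  obtains (u) a where "a < n" "z = a" | (w) a where "a < n" "z = n + a" | (x) a where "a < n" "z = 2 * n + a"
    | (t) i where "i < m" "z = 3 * n + i"
    | (p1) l where "l < 4 * m + 1" "z = 3 * n + m + l"
    | (p2) l where "l < 4 * m + 1" "z = 3 * n + m + (4 * m + 1) + l"
    | (p3) l where "l < 4 * m + 1" "z = 3 * n + m + 2 * (4 * m + 1) + l"
proof -
  let ?P = "4 * m + 1"
  consider "z < n" | "n \<le> z" "z < 2 * n" | "2 * n \<le> z" "z < 3 * n" | "3 * n \<le> z" "z < 3 * n + m"
    | "3 * n + m \<le> z" "z < 3 * n + m + ?P" | "3 * n + m + ?P \<le> z" "z < 3 * n + m + 2 * ?P"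
    | "3 * n + m + 2 * ?P \<le> z" "z < 3 * n + m + 3 * ?P"
    using assms by (fastforce simp: swap_order_def)
  then show thesis
  proof cases
    case 1 then show ?thesis by (intro u[of z]) auto
  next
    case 2 then show ?thesis by (intro w[of "z - n"]) auto
  next
    case 3 then show ?thesis by (intro x[of "z - 2 * n"]) auto
  next
    case 4 then show ?thesis by (intro t[of "z - 3 * n"]) auto
  next
    case 5 then show ?thesis by (intro p1[of "z - (3 * n + m)"]) auto
  next
    case 6 then show ?thesis by (intro p2[of "z - (3 * n + m + ?P)"]) auto
  next
    case 7 then show ?thesis by (intro p3[of "z - (3 * n + m + 2 * ?P)"]) auto
  qed
qed

lemma swap_order_bounds:
  "a < n \<Longrightarrow> a < swap_order n m" "a < n \<Longrightarrow> n + a < swap_order n m" "a < n \<Longrightarrow> 2 * n + a < swap_order n m"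
  "i < m \<Longrightarrow> 3 * n + i < swap_order n m" "l < 4 * m + 1 \<Longrightarrow> 3 * n + m + l < swap_order n m"
  "l < 4 * m + 1 \<Longrightarrow> 3 * n + m + (4 * m + 1) + l < swap_order n m"
  "l < 4 * m + 1 \<Longrightarrow> 3 * n + m + 2 * (4 * m + 1) + l < swap_order n m"
  by (auto simp: swap_order_def)

section \<open>Short swap sequences correspond to cliques\<close>

lemma fold_swap_disjoint:
  assumes "distinct (map fst ss)" "distinct (map snd ss)" "fst ` set ss \<inter> snd ` set ss = {}"
  shows "(\<forall>p\<in>set ss. fold swap_colors ss c (fst p) = c (snd p) \<and> fold swap_colors ss c (snd p) = c (fst p)) \<and>
    (\<forall>z. z \<notin> fst ` set ss \<and> z \<notin> snd ` set ss \<longrightarrow> fold swap_colors ss c z = c z)"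
  using assms
proof (induction ss arbitrary: c)
  case (Cons p ss)
  let ?c = "swap_colors p c"
  have c: "?c (fst p) = c (snd p)" "?c (snd p) = c (fst p)" "z \<noteq> fst p \<Longrightarrow> z \<noteq> snd p \<Longrightarrow> ?c z = c z" for z
    by (auto simp: swap_colors_def case_prod_unfold)
  have d: "fst p \<notin> fst ` set ss" "fst p \<notin> snd ` set ss" "snd p \<notin> fst ` set ss" "snd p \<notin> snd ` set ss"
    using Cons.prems by auto
  have pr: "distinct (map fst ss)" "distinct (map snd ss)" "fst ` set ss \<inter> snd ` set ss = {}"
    using Cons.prems by auto
  have IH: "fold swap_colors ss ?c (fst q) = ?c (snd q)" "fold swap_colors ss ?c (snd q) = ?c (fst q)" if "q \<in> set ss" for q
    using Cons.IH[OF pr, of ?c] that by blast+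
  have IH2: "fold swap_colors ss ?c z = ?c z" if "z \<notin> fst ` set ss" "z \<notin> snd ` set ss" for z
    using Cons.IH[OF pr, of ?c] that by blast
  have "fold swap_colors (p # ss) c (fst q) = c (snd q) \<and> fold swap_colors (p # ss) c (snd q) = c (fst q)"
    if q: "q \<in> set (p # ss)" for q
  proof (cases "q = p")
    case True
    then show ?thesis using IH2 d c by simp
  next
    case False
    then have qs: "q \<in> set ss" using q by simp
    then have "fst q \<in> fst ` set ss" "snd q \<in> snd ` set ss" by auto
    then have "snd q \<noteq> fst p" "snd q \<noteq> snd p" "fst q \<noteq> fst p" "fst q \<noteq> snd p" using d by metis+
    then show ?thesis using IH[OF qs] c by simp
  qed
  moreover have "fold swap_colors (p # ss) c z = c z"
    if "z \<notin> fst ` set (p # ss)" "z \<notin> snd ` set (p # ss)" for z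
    using that IH2[of z] c(3)[of z] by simp
  ultimately show ?case by blast
qed simp

lemma swappable_if_clique:
  assumes "has_clique n R m"
  shows "swappable (swap_order n m) (swap_edges n R m) (swap_coloring n m) (2 * m)"
proof -
  let ?N = "swap_order n m" and ?L = "swap_labels n m" and ?P = "4 * m + 1" and ?c = "swap_coloring n m"
  obtain W where W: "W \<subseteq> {..<n}" "card W = m" "\<forall>a\<in>W. \<forall>b\<in>W. a \<noteq> b \<longrightarrow> R a b"
    using assms by (auto simp: has_clique_def)
  then have "finite W" using finite_subset by blast
  then obtain ws where ws: "set ws = W" "distinct ws" using finite_distinct_list by blast
  then have len: "length ws = m" using W(2) distinct_card by fastforce
  \<comment> \<open>Per chosen vertex two swaps: a special vertex trades its color 3 for the color 1
    of the tag 1 copy, and the copies with tags 0 and 2 exchange 2 and 3. All pairs are disjoint, so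
    the order of the swaps does not matter.\<close>
  define ss where "ss = map (\<lambda>i. (3 * n + i, n + ws ! i)) [0..<m] @ map (\<lambda>a. (a, 2 * n + a)) ws"
  let ?f = "fold swap_colors ss ?c"
  have wsn: "a < n" if "a \<in> set ws" for a using that W(1) ws(1) by auto
  have wsi: "ws ! i < n" if "i < m" for i using that len wsn by auto
  have fs: "map fst ss = map (\<lambda>i. 3 * n + i) [0..<m] @ ws" by (simp add: ss_def comp_def)
  have sn: "map snd ss = map (\<lambda>a. n + a) ws @ map (\<lambda>a. 2 * n + a) ws"
    unfolding ss_def by (simp add: comp_def len[symmetric]) (simp add: map_nth[of ws] map_map[of _ "(!) ws", symmetric, unfolded comp_def])
  have "distinct (map fst ss)" using ws(2) by (auto simp: fs distinct_map inj_on_def dest: wsn)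
  moreover have "distinct (map snd ss)" using ws(2) by (auto simp: sn distinct_map inj_on_def dest: wsn)
  moreover have "set (map fst ss) \<inter> set (map snd ss) = {}"
    unfolding fs sn set_append set_map using wsn by fastforce
  then have "fst ` set ss \<inter> snd ` set ss = {}" by simp
  ultimately
  have F: "(\<forall>p\<in>set ss. ?f (fst p) = ?c (snd p) \<and> ?f (snd p) = ?c (fst p)) \<and>
    (\<forall>z. z \<notin> fst ` set ss \<and> z \<notin> snd ` set ss \<longrightarrow> ?f z = ?c z)"
    by (rule fold_swap_disjoint)
  have ssl: "length ss = 2 * m" by (simp add: ss_def len)
  have ssb: "\<forall>(u, v)\<in>set ss. u < ?N \<and> v < ?N \<and> u \<noteq> v"
    using wsi wsn by (fastforce simp: ss_def swap_order_def)
  have cc: "?c a = 2" "?c (n + a) = 1" "?c (2 * n + a) = 3" if "a < n" for a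
    using that by (auto simp: swap_coloring_def swap_labels_nth label_color_def)
  have ct: "?c (3 * n + i) = 3" if "i < m" for i
    using that by (auto simp: swap_coloring_def swap_labels_nth label_color_def)
  have fU: "?f a = (if a \<in> W then 3 else 2)" if "a < n" for a
  proof (cases "a \<in> W")
    case True
    then have "(a, 2 * n + a) \<in> set ss" using ws by (auto simp: ss_def)
    then show ?thesis using F cc that True by fastforce
  next
    case False
    then have "a \<notin> fst ` set ss \<and> a \<notin> snd ` set ss" using that ws by (auto simp: ss_def)
    then show ?thesis using F cc that False by simp
  qed
  have fX: "?f (2 * n + a) = (if a \<in> W then 2 else 3)" if "a < n" for a
  proof (cases "a \<in> W")
    case True
    then have "(a, 2 * n + a) \<in> set ss" using ws by (auto simp: ss_def)
    then show ?thesis using F cc that True by fastforce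
  next
    case False
    then have "2 * n + a \<notin> fst ` set ss \<and> 2 * n + a \<notin> snd ` set ss" using that ws wsi wsn by (fastforce simp: ss_def)
    then show ?thesis using F cc that False by simp
  qed
  have fW: "?f (n + a) = (if a \<in> W then 3 else 1)" if "a < n" for a
  proof (cases "a \<in> W")
    case True
    then obtain i where "i < m" "ws ! i = a" using ws len by (metis in_set_conv_nth)
    then have "(3 * n + i, n + a) \<in> set ss" by (auto simp: ss_def)
    then show ?thesis using F ct \<open>i < m\<close> that True by fastforce
  next
    case False
    then have "n + a \<notin> fst ` set ss \<and> n + a \<notin> snd ` set ss" using that ws wsi wsn len by (fastforce simp: ss_def)
    then show ?thesis using F cc that False by simp
  qed
  have fT: "?f (3 * n + i) = 1" if "i < m" for i
  proof -
    have "(3 * n + i, n + ws ! i) \<in> set ss" using that by (auto simp: ss_def)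
    from bspec[OF conjunct1[OF F] this] cc(2)[OF wsi[OF that]] show ?thesis by simp
  qed
  have fP: "?f z = ?c z" if "3 * n + m \<le> z" for z
  proof -
    have "z \<notin> set (map fst ss) \<and> z \<notin> set (map snd ss)"
      unfolding fs sn using that by (auto dest!: wsn)
    then have "z \<notin> fst ` set ss \<and> z \<notin> snd ` set ss" by simp
    then show ?thesis using F by blast
  qed
  define g where "g x = (if fst x = 0 then if snd x \<in> W then 3 else 2 else if fst x = 1 then if snd x \<in> W then 3 else 1
      else if fst x = 2 then if snd x \<in> W then 2 else 3 else if fst x = 3 then 1 else label_color x)" for x :: vlabel
  have fg: "?f z = g (?L ! z)" if "z < ?N" for z
    using that
  proof (cases rule: swap_order_cases)
    case (p1 l)
    then show ?thesis using fP[of z] by (simp add: g_def swap_labels_nth swap_coloring_def)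
  next
    case (p2 l)
    then have "?L ! z = (5, l)" "3 * n + m \<le> z" using swap_labels_nth(6) by auto
    then show ?thesis using fP[of z] by (simp add: g_def swap_coloring_def)
  next
    case (p3 l)
    then have "?L ! z = (6, l)" "3 * n + m \<le> z" using swap_labels_nth(7) by auto
    then show ?thesis using fP[of z] by (simp add: g_def swap_coloring_def)
  qed (simp_all add: g_def swap_labels_nth fU fW fX fT)
  have gp: "g x \<noteq> g y" if "label_arc R x y" for x y
    using that W(3) unfolding label_arc_def by (elim disjE conjE) (auto simp: g_def label_color_def)
  have "proper (swap_edges n R m) ?f"
    unfolding proper_def
  proof (intro allI impI)
    fix u v assume "{u, v} \<in> swap_edges n R m"
    then obtain i j where ij: "{u, v} = {i, j}" "i < ?N" "j < ?N" "label_edge R (?L ! i) (?L ! j)"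
      by (auto simp: swap_edges_def)
    have "g (?L ! i) \<noteq> g (?L ! j)" using ij(4) gp[of "?L ! i" "?L ! j"] gp[of "?L ! j" "?L ! i"] unfolding label_edge_def by metis
    then have "?f i \<noteq> ?f j" using fg ij(2,3) by simp
    then show "?f u \<noteq> ?f v" using ij(1) by (auto simp: doubleton_eq_iff)
  qed
  then show ?thesis unfolding swappable_def using ssl ssb by (intro exI[of _ ss]) auto
qed

text \<open>A swap composes the coloring with a transposition of the vertices. The sizes of the
  color classes are the invariant that later fixes the number of chosen vertices.\<close>

lemma fold_swap_count:
  assumes "\<forall>(u, v)\<in>set ss. u < N \<and> v < N \<and> u \<noteq> v"
  shows "card {z. z < N \<and> fold swap_colors ss c z = q} = card {z. z < N \<and> c z = q}"
  using assms
proof (induction ss arbitrary: c)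
  case (Cons p ss)
  obtain u v where p: "p = (u, v)" by fastforce
  have uv: "u < N" "v < N" using Cons.prems p by auto
  let ?\<tau> = "id(u := v, v := u)"
  have "{z. z < N \<and> swap_colors p c z = q} = ?\<tau> ` {z. z < N \<and> c z = q}"
  proof (intro equalityI subsetI)
    fix z assume "z \<in> {z. z < N \<and> swap_colors p c z = q}"
    then show "z \<in> ?\<tau> ` {z. z < N \<and> c z = q}" using uv
      by (intro image_eqI[of _ _ "?\<tau> z"]) (auto simp: p swap_colors_def split: if_splits)
  qed (use uv in \<open>auto simp: p swap_colors_def split: if_splits\<close>)
  moreover have "inj_on ?\<tau> {z. z < N \<and> c z = q}" by (auto simp: inj_on_def split: if_splits)
  ultimately have "card {z. z < N \<and> swap_colors p c z = q} = card {z. z < N \<and> c z = q}"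
    by (simp only: card_image)
  then show ?case using Cons by simp
qed simp

lemma fold_swap_changed: "finite {z. fold swap_colors ss c z \<noteq> c z} \<and> card {z. fold swap_colors ss c z \<noteq> c z} \<le> 2 * length ss"
proof (induction ss arbitrary: c)
  case (Cons p ss)
  let ?c = "swap_colors p c" and ?A = "{z. fold swap_colors ss (swap_colors p c) z \<noteq> swap_colors p c z}"
  have 1: "{z. fold swap_colors (p # ss) c z \<noteq> c z} \<subseteq> ?A \<union> {fst p, snd p}"
    by (auto simp: swap_colors_def case_prod_unfold split: if_splits)
  have 2: "finite (?A \<union> {fst p, snd p})" using Cons[of ?c] by simp
  have "card {fst p, snd p} \<le> 2" by (simp add: card_insert_if)
  then have "card (?A \<union> {fst p, snd p}) \<le> 2 * length (p # ss)"
    using Cons[of ?c] card_Un_le[of ?A "{fst p, snd p}"] by simp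
  then show ?case using order_trans[OF card_mono[OF 2 1]] finite_subset[OF 1 2] by simp
qed simp

text \<open>Too few vertices change for any part of the tripartite graph to lose its color entirely.
  The surviving vertices fix the color of each part and restrict all others to two colors, the
  special ones to color 1. The class of color 1 had \<open>n\<close> vertices outside the tripartite
  graph and now contains \<open>m\<close> special ones, so exactly \<open>m\<close> vertices
  \<open>(1, a)\<close> have left it; these are the clique.\<close>

lemma clique_if_swappable:
  assumes "swappable (swap_order n m) (swap_edges n R m) (swap_coloring n m) (2 * m)"
  shows "has_clique n R m"
proof -
  let ?N = "swap_order n m" and ?L = "swap_labels n m" and ?P = "4 * m + 1" and ?c = "swap_coloring n m"
  obtain ss where ss: "length ss \<le> 2 * m" "\<forall>(u, v)\<in>set ss. u < ?N \<and> v < ?N \<and> u \<noteq> v"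
    "proper (swap_edges n R m) (fold swap_colors ss ?c)" using assms unfolding swappable_def by blast
  define f where "f = fold swap_colors ss ?c"
  have edge: "f i \<noteq> f j" if "i < ?N" "j < ?N" "label_edge R (?L ! i) (?L ! j)" for i j
  proof -
    have "{i, j} \<in> swap_edges n R m" using swap_edges_iff[OF that(1,2), of R] that(3) by simp
    then show ?thesis using ss(3) unfolding proper_def f_def by blast
  qed
  \<comment> \<open>Swaps create no new colors, so only the three initial ones occur even if
    \<open>r > 3\<close>.\<close>
  have col: "f z \<in> {1, 2, 3}" if "z < ?N" for z
  proof -
    have "{y. y < ?N \<and> ?c y = f z} \<noteq> {}"
    proof
      assume "{y. y < ?N \<and> ?c y = f z} = {}"
      then have "card {y. y < ?N \<and> f y = f z} = 0" using fold_swap_count[OF ss(2), of ?c "f z"] by (simp add: f_def)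
      then have "{y. y < ?N \<and> f y = f z} = {}" by (simp add: card_eq_0_iff)
      then show False using that by blast
    qed
    then obtain y where "?c y = f z" by blast
    moreover have "?c y \<in> {1, 2, 3}" for y by (simp add: swap_coloring_def label_color_def)
    ultimately show ?thesis by metis
  qed
  note nth = swap_labels_nth[where n = n and m = m] and bd = swap_order_bounds[where n = n and m = m]
  have stable: "\<exists>l < ?P. f (b + l) = ?c (b + l)" for b
  proof (rule ccontr)
    assume "\<not> (\<exists>l < ?P. f (b + l) = ?c (b + l))"
    then have sub: "(\<lambda>l. b + l) ` {..<?P} \<subseteq> {z. f z \<noteq> ?c z}" by blast
    have "finite {z. f z \<noteq> ?c z}" "card {z. f z \<noteq> ?c z} \<le> 2 * length ss"
      unfolding f_def using fold_swap_changed[of ss ?c] by blast+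
    with card_mono[OF _ sub] have "card ((\<lambda>l. b + l) ` {..<?P}) \<le> 2 * length ss" by linarith
    moreover have "card ((\<lambda>l. b + l) ` {..<?P}) = ?P" by (subst card_image) (simp_all add: inj_on_def)
    ultimately show False using ss(1) by linarith
  qed
  from stable[of "3 * n + m"] obtain l1 where l: "l1 < ?P" "f (3 * n + m + l1) = ?c (3 * n + m + l1)" by blast
  have l1: "l1 < ?P" "f (3 * n + m + l1) = 1"
    using l nth(5)[OF l(1)] by (simp_all add: swap_coloring_def label_color_def)
  from stable[of "3 * n + m + ?P"] obtain l2 where l: "l2 < ?P" "f (3 * n + m + ?P + l2) = ?c (3 * n + m + ?P + l2)" by blast
  have l2: "l2 < ?P" "f (3 * n + m + ?P + l2) = 2"
    using l nth(6)[OF l(1)] by (simp_all add: swap_coloring_def label_color_def)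
  from stable[of "3 * n + m + 2 * ?P"] obtain l3 where l: "l3 < ?P" "f (3 * n + m + 2 * ?P + l3) = ?c (3 * n + m + 2 * ?P + l3)" by blast
  have l3: "l3 < ?P" "f (3 * n + m + 2 * ?P + l3) = 3"
    using l nth(7)[OF l(1)] by (simp_all add: swap_coloring_def label_color_def)
  have no1: "f z \<noteq> 1" if "z < ?N" "label_edge R (?L ! z) (4, l1)" for z
    using edge[OF that(1) bd(5)[OF l1(1)], unfolded nth(5)[OF l1(1)], OF that(2)] unfolding l1(2) .
  have no2: "f z \<noteq> 2" if "z < ?N" "label_edge R (?L ! z) (5, l2)" for z
    using edge[OF that(1) bd(6)[OF l2(1)], unfolded nth(6)[OF l2(1)], OF that(2)] unfolding l2(2) .
  have no3: "f z \<noteq> 3" if "z < ?N" "label_edge R (?L ! z) (6, l3)" for z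
    using edge[OF that(1) bd(7)[OF l3(1)], unfolded nth(7)[OF l3(1)], OF that(2)] unfolding l3(2) .
  note le = label_edge_def label_arc_def
  have U: "f a = 2 \<or> f a = 3" if "a < n" for a
    using col[OF bd(1)[OF that]] no1[OF bd(1)[OF that]] nth(1)[OF that] by (simp add: le)
  have W: "f (n + a) = 1 \<or> f (n + a) = 3" if "a < n" for a
    using col[OF bd(2)[OF that]] no2[OF bd(2)[OF that]] nth(2)[OF that] by (simp add: le)
  have X: "f (2 * n + a) = 2 \<or> f (2 * n + a) = 3" if "a < n" for a
    using col[OF bd(3)[OF that]] no1[OF bd(3)[OF that]] nth(3)[OF that] by (simp add: le)
  have T: "f (3 * n + i) = 1" if "i < m" for i
    using col[OF bd(4)[OF that]] no2[OF bd(4)[OF that]] no3[OF bd(4)[OF that]] nth(4)[OF that] by (simp add: le)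
  have P1: "f (3 * n + m + l) = 1" if "l < ?P" for l
    using col[OF bd(5)[OF that]] no2[OF bd(5)[OF that]] no3[OF bd(5)[OF that]] nth(5)[OF that] by (simp add: le)
  have P2: "f (3 * n + m + ?P + l) = 2" if "l < ?P" for l
    using col[OF bd(6)[OF that]] no1[OF bd(6)[OF that]] no3[OF bd(6)[OF that]] nth(6)[OF that] by (simp add: le)
  have P3: "f (3 * n + m + 2 * ?P + l) = 3" if "l < ?P" for l
    using col[OF bd(7)[OF that]] no1[OF bd(7)[OF that]] no2[OF bd(7)[OF that]] nth(7)[OF that] by (simp add: le)
  define A where "A = {a. a < n \<and> f (n + a) = 3}"
  have count: "card {z. z < ?N \<and> f z = 1} = (n - card B) + m + ?P"
    if "\<And>a. a < n \<Longrightarrow> f a \<noteq> 1" "\<And>a. a < n \<Longrightarrow> f (n + a) = 1 \<longleftrightarrow> a \<notin> B" "B \<subseteq> {..<n}"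
      "\<And>a. a < n \<Longrightarrow> f (2 * n + a) \<noteq> 1" "\<And>i. i < m \<Longrightarrow> f (3 * n + i) = 1"
      "\<And>l. l < ?P \<Longrightarrow> f (3 * n + m + l) = 1" "\<And>l. l < ?P \<Longrightarrow> f (3 * n + m + ?P + l) \<noteq> 1"
      "\<And>l. l < ?P \<Longrightarrow> f (3 * n + m + 2 * ?P + l) \<noteq> 1" for f B
  proof -
    have "{z. z < ?N \<and> f z = 1} = (\<lambda>a. n + a) ` ({..<n} - B) \<union> {3 * n..<3 * n + m + ?P}"
    proof (intro equalityI subsetI)
      fix z assume "z \<in> {z. z < ?N \<and> f z = 1}"
      then have "z < ?N" "f z = 1" by auto
      then show "z \<in> (\<lambda>a. n + a) ` ({..<n} - B) \<union> {3 * n..<3 * n + m + ?P}"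
        using that by (cases rule: swap_order_cases) auto
    next
      fix z assume z: "z \<in> (\<lambda>a. n + a) ` ({..<n} - B) \<union> {3 * n..<3 * n + m + ?P}"
      then consider a where "a < n" "a \<notin> B" "z = n + a" | "3 * n \<le> z" "z < 3 * n + m" | "3 * n + m \<le> z" "z < 3 * n + m + ?P"
        by fastforce
      then show "z \<in> {z. z < ?N \<and> f z = 1}"
        using that(2) that(5)[of "z - 3 * n"] that(6)[of "z - (3 * n + m)"] by cases (auto simp: swap_order_def)
    qed
    moreover have "card ((\<lambda>a. n + a) ` ({..<n} - B) \<union> {3 * n..<3 * n + m + ?P}) =
       card ((\<lambda>a. n + a) ` ({..<n} - B)) + card {3 * n..<3 * n + m + ?P}"
      by (rule card_Un_disjoint) auto
    moreover have "card ((\<lambda>a. n + a) ` ({..<n} - B)) = n - card B"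
      using that(3) by (simp add: card_image card_Diff_subset finite_subset)
    ultimately show ?thesis by simp
  qed
  have "card {z. z < ?N \<and> f z = 1} = (n - card A) + m + ?P"
  proof (rule count)
    show "f a \<noteq> 1" "f (2 * n + a) \<noteq> 1" if "a < n" for a using U[OF that] X[OF that] by auto
    show "f (n + a) = 1 \<longleftrightarrow> a \<notin> A" if "a < n" for a using W[OF that] that by (auto simp: A_def)
    show "f (3 * n + m + ?P + l) \<noteq> 1" "f (3 * n + m + 2 * ?P + l) \<noteq> 1" if "l < ?P" for l
      using P2[OF that] P3[OF that] by simp_all
  qed (use T P1 in \<open>simp_all add: A_def subset_eq\<close>)
  moreover have "card {z. z < ?N \<and> ?c z = 1} = card {z. z < ?N \<and> f z = 1}"
    using fold_swap_count[OF ss(2), of ?c 1] by (simp add: f_def)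
  moreover have "card {z. z < ?N \<and> ?c z = 1} = n + ?P"
  proof -
    have 1: "?c (3 * n + m + l) = 1" if "l < ?P" for l using nth(5)[OF that] by (simp add: swap_coloring_def label_color_def)
    have "{z. z < ?N \<and> ?c z = 1} = {n..<2 * n} \<union> {3 * n + m..<3 * n + m + ?P}"
    proof (intro equalityI subsetI)
      fix z assume "z \<in> {z. z < ?N \<and> ?c z = 1}"
      then have "z < ?N" "?c z = 1" by auto
      then show "z \<in> {n..<2 * n} \<union> {3 * n + m..<3 * n + m + ?P}"
      proof (cases rule: swap_order_cases)
        case (p2 l)
        then show ?thesis using nth(6)[of l] \<open>?c z = 1\<close> by (simp add: swap_coloring_def label_color_def)
      next
        case (p3 l)
        then show ?thesis using nth(7)[of l] \<open>?c z = 1\<close> by (simp add: swap_coloring_def label_color_def)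
      qed (auto simp: swap_coloring_def label_color_def nth)
    next
      fix z assume "z \<in> {n..<2 * n} \<union> {3 * n + m..<3 * n + m + ?P}"
      then consider "n \<le> z" "z < 2 * n" | "3 * n + m \<le> z" "z < 3 * n + m + ?P" by fastforce
      then show "z \<in> {z. z < ?N \<and> ?c z = 1}"
        using nth(2)[of "z - n"] 1[of "z - (3 * n + m)"]
        by cases (auto simp: swap_order_def swap_coloring_def label_color_def)
    qed
    moreover have "card ({n..<2 * n} \<union> {3 * n + m..<3 * n + m + ?P}) = card {n..<2 * n} + card {3 * n + m..<3 * n + m + ?P}"
      by (rule card_Un_disjoint) auto
    ultimately show ?thesis by simp
  qed
  moreover have "card A \<le> n" using card_mono[of "{..<n}" A] by (auto simp: A_def)
  ultimately have "card A = m" by linarith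
  moreover have "R a b" if "a \<in> A" "b \<in> A" "a \<noteq> b" for a b
  proof -
    have ab: "a < n" "b < n" "f (n + a) = 3" "f (n + b) = 3" using that by (auto simp: A_def)
    have "f (2 * n + a) = 2" using X[OF ab(1)] edge[OF bd(2)[OF ab(1)] bd(3)[OF ab(1)]] nth(2)[OF ab(1)] nth(3)[OF ab(1)] ab(3)
      by (simp add: le)
    then have "f a = 3" using U[OF ab(1)] edge[OF bd(1)[OF ab(1)] bd(3)[OF ab(1)]] nth(1)[OF ab(1)] nth(3)[OF ab(1)]
      by (simp add: le)
    then show ?thesis using edge[OF bd(1)[OF ab(1)] bd(2)[OF ab(2)]] nth(1)[OF ab(1)] nth(2)[OF ab(2)] ab(4) that(3)
      by (auto simp: le)
  qed
  ultimately show ?thesis unfolding has_clique_def by (intro exI[of _ A]) (auto simp: A_def)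
qed

section \<open>Codes of instances\<close>

lemma pt_mem [pt_intros]:
  assumes "pt f" "pt l"
  shows "pt (\<lambda>x. f x \<in> set (l x))"
proof -
  have "pt (\<lambda>x. \<exists>y\<in>set (l x). y = f x)" by (intro pt_intros pt_comp[OF assms(1)] assms)
  then show ?thesis by (rule pt_cong) blast
qed

lemma pt_max [pt_intros]: "pt f \<Longrightarrow> pt g \<Longrightarrow> pt (\<lambda>x. max (f x) (g x :: nat))"
  unfolding max_def by (intro pt_intros)

lemma pt_of_bool [pt_intros]: "pt f \<Longrightarrow> pt (\<lambda>x. of_bool (f x) :: nat)"
  unfolding of_bool_def by (intro pt_intros)

text \<open>The length \<open>n\<close> is fixed, since the number of words is exponential in it;
  \<open>tc_ternary\<close> treats a variable length.\<close>

lemma pt_n_lists: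
  assumes "pt l"
  shows "pt (\<lambda>x. List.n_lists n (l x))"
proof (induction n)
  case (Suc n)
  have "pt (\<lambda>x. concat (map (\<lambda>ys. map (\<lambda>y. y # ys) (l x)) (List.n_lists n (l x))))"
    by (intro pt_intros Suc pt_comp[OF assms])
  then show ?case by simp
qed (simp add: pt_const)

lemma pt_product:
  assumes "pt l" "pt k"
  shows "pt (\<lambda>x. List.product (l x) (k x))"
proof -
  have "pt (\<lambda>x. concat (map (\<lambda>a. map (\<lambda>b. (a, b)) (k x)) (l x)))"
    by (intro pt_intros assms pt_comp[OF assms(2)])
  then show ?thesis by (simp add: product_concat_map)
qed

lemma pt_enc_nats [pt_intros]: "pt f \<Longrightarrow> pt (\<lambda>x. enc_nats (f x))"
  unfolding enc_nats_def by (intro pt_intros)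

lemma pt_enc_inst [pt_intros]: "pt f \<Longrightarrow> pt g \<Longrightarrow> pt (\<lambda>x. enc_inst (f x) (g x))"
  unfolding enc_inst_def by (intro pt_intros)

section \<open>Decoding of instances\<close>

definition dec_step :: "nat list \<times> nat \<Rightarrow> bool \<Rightarrow> nat list \<times> nat" where
  "dec_step s b = (if b then (fst s, Suc (snd s)) else (fst s @ [snd s], 0))"

definition dec_nats :: "bool list \<Rightarrow> nat list" where
  "dec_nats w = fst (foldl dec_step ([], 0) w)"

lemma dec_step_simps: "dec_step (ns, n) True = (ns, Suc n)" "dec_step (ns, n) False = (ns @ [n], 0)"
  by (simp_all add: dec_step_def)

lemma foldl_dec_step_True: "foldl dec_step (ns, n) (replicate m True) = (ns, n + m)"
  by (induction m arbitrary: n) (auto simp: dec_step_simps)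

lemma foldl_dec_step_enc: "foldl dec_step (ns, 0) (enc_nats ms) = (ns @ ms, 0)"
proof (induction ms arbitrary: ns)
  case (Cons m ms)
  have "enc_nats (m # ms) = replicate m True @ [False] @ enc_nats ms" by (simp add: enc_nats_def)
  then show ?case using Cons by (simp add: foldl_dec_step_True dec_step_simps)
qed (simp add: enc_nats_def)

lemma dec_enc_nats [simp]: "dec_nats (enc_nats ms) = ms"
  by (simp add: dec_nats_def foldl_dec_step_enc)

lemma enc_nats_inj [simp]: "enc_nats ms = enc_nats ns \<longleftrightarrow> ms = ns"
  by (metis dec_enc_nats)

lemma pt_dec_nats [pt_intros]:
  assumes "pt f"
  shows "pt (\<lambda>x. dec_nats (f x))"
proof -
  have "pt (\<lambda>x. foldl dec_step ([], 0) (f x))"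
  proof (rule pt_foldl_add[where q = "\<lambda>_. 10"])
    show "pt (\<lambda>p. dec_step (fst (snd p)) (snd (snd p)))" unfolding dec_step_def by (intro pt_intros)
    show "sz (dec_step a y) \<le> sz a + 10" for a y
      using sz_append_le[of "fst a" "[snd a]"] by (simp add: dec_step_def sz_prod[of a])
  qed (intro pt_intros assms pbd_intros)+
  then show ?thesis unfolding dec_nats_def by (intro pt_intros)
qed

text \<open>The parameter stands at the front in unary and is ended by \<open>False\<close>, so
  decoding the entire word as numbers returns it first, whatever follows.\<close>

definition inst_param :: "bool list \<Rightarrow> nat" where
  "inst_param w = nth_default 0 (dec_nats w) 0"

definition inst_word :: "bool list \<Rightarrow> bool list" where
  "inst_word w = drop (Suc (inst_param w)) w"

lemma foldl_dec_step_prefix: "\<exists>ms' k. foldl dec_step (ns, n) w = (ns @ ms', k)"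
proof (induction w arbitrary: ns n)
  case (Cons b w)
  obtain ns' n' where 1: "dec_step (ns, n) b = (ns @ ns', n')"
    by (cases b) (auto simp: dec_step_simps)
  obtain ms' k where "foldl dec_step (ns @ ns', n') w = ((ns @ ns') @ ms', k)" using Cons by blast
  then show ?case using 1 by simp
qed simp

lemma inst_param_enc [simp]: "inst_param (enc_inst x k) = k"
proof -
  obtain ms n where "foldl dec_step ([k], 0) x = ([k] @ ms, n)" using foldl_dec_step_prefix by blast
  then have "dec_nats (enc_inst x k) = k # ms"
    unfolding dec_nats_def enc_inst_def foldl_append foldl_dec_step_True
    by (simp add: dec_step_simps)
  then show ?thesis by (simp add: inst_param_def)
qed

lemma inst_word_enc [simp]: "inst_word (enc_inst x k) = x"
  by (simp add: inst_word_def) (simp add: enc_inst_def)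

lemma pt_inst [pt_intros]:
  "pt f \<Longrightarrow> pt (\<lambda>x. inst_param (f x))" "pt f \<Longrightarrow> pt (\<lambda>x. inst_word (f x))"
  unfolding inst_word_def inst_param_def by (intro pt_intros; assumption)+

lemma length_enc_inst: "length (enc_inst x k) = k + 1 + length x"
  by (simp add: enc_inst_def)

lemma length_enc_nats: "length (enc_nats ns) = length ns + sum_list ns"
  by (induction ns) (auto simp: enc_nats_def)

text \<open>A code determines the coloring only below \<open>n\<close>; by this lemma, membership in
  \<open>r_swap\<close> does not depend on the remaining values.\<close>

lemma swappable_cong:
  assumes "\<And>v. v < n \<Longrightarrow> c v = c' v" "simple_graph n E" "swappable n E c k"
  shows "swappable n E c' k"
proof -
  obtain ss where ss: "length ss \<le> k" "\<forall>(u, v) \<in> set ss. u < n \<and> v < n \<and> u \<noteq> v" "proper E (fold swap_colors ss c)"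
    using assms(3) unfolding swappable_def by blast
  have "fold swap_colors ss c v = fold swap_colors ss c' v" if "v < n" for v
    using ss(2) assms(1) that
  proof (induction ss arbitrary: c c')
    case (Cons p ss)
    have "swap_colors p c v = swap_colors p c' v" if "v < n" for v
      using Cons.prems(1,2) that by (auto simp: swap_colors_def case_prod_unfold)
    then show ?case using Cons.IH[of "swap_colors p c" "swap_colors p c'"] Cons.prems by simp
  qed simp
  moreover have "u < n \<and> v < n" if "{u, v} \<in> E" for u v
  proof -
    have "{u, v} \<in> {{u, v} | u v. u < n \<and> v < n \<and> u \<noteq> v}" using assms(2) that unfolding simple_graph_def by blast
    then show ?thesis by (auto simp: doubleton_eq_iff)
  qed
  ultimately have "proper E (fold swap_colors ss c')" using ss(3) unfolding proper_def by metis
  then show ?thesis unfolding swappable_def using ss(1,2) by blast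
qed

lemma concat_map_eqD:
  assumes "\<And>u. length (f u) = length (g u)" "concat (map f us) = concat (map g us)"
  shows "\<forall>u\<in>set us. f u = g u"
  using assms(2) by (induction us) (auto simp: assms(1))

lemma length_concat_map_eq: "(\<And>u. length (f u) = length (g u)) \<Longrightarrow> length (concat (map f us)) = length (concat (map g us))"
  by (induction us) auto

lemma enc_colored_graph_eqD:
  assumes "enc_colored_graph n E c = enc_colored_graph n' E' c'" "simple_graph n E" "simple_graph n' E'"
  shows "n = n' \<and> E = E' \<and> (\<forall>v < n. c v = c' v)"
proof -
  define f where "f E m u = map (\<lambda>v. of_bool ({u, v} \<in> E) :: nat) [0..<m]" for E and m u :: nat
  have eq: "n # concat (map (f E n) [0..<n]) @ map c [0..<n] = n' # concat (map (f E' n') [0..<n']) @ map c' [0..<n']"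
    using assms(1) unfolding enc_colored_graph_def enc_nats_inj f_def .
  then have n: "n = n'" by simp
  have lf: "length (f E n u) = length (f E' n u)" for u by (simp add: f_def)
  have "concat (map (f E n) [0..<n]) @ map c [0..<n] = concat (map (f E' n) [0..<n]) @ map c' [0..<n]"
    using eq unfolding n by simp
  then have 1: "concat (map (f E n) [0..<n]) = concat (map (f E' n) [0..<n])" and 2: "map c [0..<n] = map c' [0..<n]"
    unfolding append_eq_append_conv[OF disjI1[OF length_concat_map_eq[OF lf]]] by auto
  have e: "{u, v} \<in> E \<longleftrightarrow> {u, v} \<in> E'" if "u < n" "v < n" for u v
  proof -
    have "f E n u = f E' n u" using concat_map_eqD[OF lf 1] that by simp
    then have "f E n u ! v = f E' n u ! v" by simp
    then show ?thesis using that by (simp add: f_def of_bool_def split: if_splits)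
  qed
  have "A \<in> E \<longleftrightarrow> A \<in> E'" for A
  proof -
    have "\<exists>u v. A = {u, v} \<and> u < n \<and> v < n" if "A \<in> E \<or> A \<in> E'"
      using that assms(2,3) n unfolding simple_graph_def by blast
    then show ?thesis using e by blast
  qed
  then have "E = E'" by blast
  moreover have "\<forall>v < n. c v = c' v" using 2 by simp
  ultimately show ?thesis using n by blast
qed

lemma r_swap_iff:
  assumes "simple_graph n E" "coloring r n c"
  shows "(enc_colored_graph n E c, k) \<in> r_swap r \<longleftrightarrow> 0 < k \<and> swappable n E c k"
proof
  assume "(enc_colored_graph n E c, k) \<in> r_swap r"
  then obtain n' E' c' where *: "enc_colored_graph n E c = enc_colored_graph n' E' c'"
    "simple_graph n' E'" "0 < k" "swappable n' E' c' k" unfolding r_swap_def by blast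
  have "n = n'" "E = E'" "\<And>v. v < n \<Longrightarrow> c v = c' v" using enc_colored_graph_eqD[OF *(1) assms(1) *(2)] by auto
  then show "0 < k \<and> swappable n E c k" using swappable_cong[of n c' c E k] *(3,4) assms(1) by simp
next
  assume "0 < k \<and> swappable n E c k"
  then show "(enc_colored_graph n E c, k) \<in> r_swap r" unfolding r_swap_def using assms by blast
qed


section \<open>Clique instances with a polynomial-time adjacency test\<close>

text \<open>Adjacency of positions, written with total operations so that it lies in the
  polynomial-time calculus; positions out of range are isolated.\<close>

definition vadj :: "('v \<Rightarrow> 'v \<Rightarrow> bool) \<Rightarrow> 'v list \<Rightarrow> nat \<Rightarrow> nat \<Rightarrow> bool" where
  "vadj A vs i j = (case drop i vs of [] \<Rightarrow> False | a # _ \<Rightarrow> (case drop j vs of [] \<Rightarrow> False | b # _ \<Rightarrow> A a b))"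

lemma vadj_nth: "i < length vs \<Longrightarrow> j < length vs \<Longrightarrow> vadj A vs i j = A (vs ! i) (vs ! j)"
  by (simp add: vadj_def Cons_nth_drop_Suc[symmetric])

text \<open>Cliques consist of positions: equal entries at different positions count as different
  vertices.\<close>

definition list_clique :: "('v \<Rightarrow> 'v \<Rightarrow> bool) \<Rightarrow> 'v list \<Rightarrow> nat \<Rightarrow> bool" where
  "list_clique A vs m \<longleftrightarrow> (\<exists>W \<subseteq> {..<length vs}. card W = m \<and>
     (\<forall>i\<in>W. \<forall>j\<in>W. i \<noteq> j \<longrightarrow> A (vs ! i) (vs ! j)))"

lemma has_clique_vadj: "has_clique (length vs) (vadj A vs) m \<longleftrightarrow> list_clique A vs m"
proof -
  have eq: "(\<forall>i\<in>W. \<forall>j\<in>W. i \<noteq> j \<longrightarrow> vadj A vs i j) = (\<forall>i\<in>W. \<forall>j\<in>W. i \<noteq> j \<longrightarrow> A (vs ! i) (vs ! j))"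
    if W: "W \<subseteq> {..<length vs}" for W
  proof (intro ball_cong refl)
    fix i j assume "i \<in> W" "j \<in> W"
    then have "i < length vs" "j < length vs" using W by auto
    from vadj_nth[OF this] show "(i \<noteq> j \<longrightarrow> vadj A vs i j) = (i \<noteq> j \<longrightarrow> A (vs ! i) (vs ! j))" by simp
  qed
  show ?thesis unfolding has_clique_def list_clique_def
  proof (rule arg_cong[where f = Ex], rule ext)
    fix W show "(W \<subseteq> {..<length vs} \<and> card W = m \<and> (\<forall>i\<in>W. \<forall>j\<in>W. i \<noteq> j \<longrightarrow> vadj A vs i j)) =
      (W \<subseteq> {..<length vs} \<and> card W = m \<and> (\<forall>i\<in>W. \<forall>j\<in>W. i \<noteq> j \<longrightarrow> A (vs ! i) (vs ! j)))"
      using eq[of W] by (cases "W \<subseteq> {..<length vs}") simp_all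
  qed
qed

definition swap_inst :: "('v \<Rightarrow> 'v \<Rightarrow> bool) \<Rightarrow> 'v list \<Rightarrow> nat \<Rightarrow> bool list" where
  "swap_inst A vs m = enc_colored_graph (swap_order (length vs) m)
     (swap_edges (length vs) (vadj A vs) m) (swap_coloring (length vs) m)"

lemma pt_swap_inst:
  assumes A: "pt (\<lambda>p. A (fst p) (fst (snd p)) (snd (snd p)))" and V: "pt V" and m: "pt m"
  shows "pt (\<lambda>x. swap_inst (A x) (V x) (m x))"
proof -
  have va: "pt (\<lambda>p. vadj (A (fst p)) (V (fst p)) (fst (snd p)) (snd (snd p)))"
    unfolding vadj_def by (intro pt_intros pt3[of A, OF A] pt_comp[OF V])
  have lab: "pt (\<lambda>x. swap_labels (length (V x)) (m x))"
    unfolding swap_labels_def by (intro pt_intros V m pt_const)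
  have col: "pt label_color" unfolding label_color_def by (intro pt_intros)
  have arc: "pt (\<lambda>p. label_arc (vadj (A (fst p)) (V (fst p))) (fst (snd p)) (snd (snd p)))"
    unfolding label_arc_def
    by (intro pt_intros pt3[of "\<lambda>x. vadj (A x) (V x)", OF va])
  have edge: "pt (\<lambda>p. label_edge (vadj (A (fst p)) (V (fst p))) (fst (snd p)) (snd (snd p)))"
    unfolding label_edge_def
    by (intro pt_intros pt3[of "\<lambda>x. label_arc (vadj (A x) (V x))", OF arc])
  show ?thesis unfolding swap_inst_def enc_swap_graph
    by (intro pt_intros pt3[of "\<lambda>x. label_edge (vadj (A x) (V x))", OF edge] lab pt_comp[OF lab] pt_comp[OF col])
qed

lemma swap_inst_iff:
  assumes "3 \<le> r" "0 < m"
  shows "(swap_inst A vs m, 2 * m) \<in> r_swap r \<longleftrightarrow> list_clique A vs m"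
proof -
  have "swappable (swap_order (length vs) m) (swap_edges (length vs) (vadj A vs) m) (swap_coloring (length vs) m) (2 * m)
    \<longleftrightarrow> list_clique A vs m"
    unfolding has_clique_vadj[symmetric] by (rule iffI[OF clique_if_swappable swappable_if_clique])
  then show ?thesis
    unfolding swap_inst_def r_swap_iff[OF simple_swap_graph coloring_swap[OF assms(1)]] using assms(2) by simp
qed

section \<open>Circuits of weft one\<close>

text \<open>A gate is handled through its code, a list of numbers whose head is the kind of the gate.\<close>

definition kind :: "nat list \<Rightarrow> nat" where "kind g = nth_default 0 g 0"

definition wires :: "nat list \<Rightarrow> nat list" where
  "wires g = (if kind g = 0 then [] else if kind g = 1 then drop 1 g else drop 2 g)"

lemma kind_enc [simp]: "kind (enc_gate InputG) = 0" "kind (enc_gate (NotG i)) = 1"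
  "kind (enc_gate (AndG is)) = 2" "kind (enc_gate (OrG is)) = 3"
  by (simp_all add: kind_def)

lemma wires_enc [simp]: "wires (enc_gate g) = in_wires g"
  by (cases g) (simp_all add: wires_def kind_def)

declare enc_gate.simps [simp del]

lemma pt_kind [pt_intros]: "pt f \<Longrightarrow> pt (\<lambda>x. kind (f x))"
  unfolding kind_def by (intro pt_intros)

lemma pt_wires [pt_intros]: "pt f \<Longrightarrow> pt (\<lambda>x. wires (f x))"
  unfolding wires_def by (intro pt_intros)

subsection \<open>Scanning a circuit\<close>

text \<open>Recursion along the topological order as a left fold: the value of a node is computed
  from the list of all earlier values.\<close>

definition scan :: "('r list \<Rightarrow> 'g \<Rightarrow> 'r) \<Rightarrow> 'g list \<Rightarrow> 'r list" where
  "scan f G = foldl (\<lambda>acc g. acc @ [f acc g]) [] G"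

lemma scan_snoc: "scan f (G @ [g]) = scan f G @ [f (scan f G) g]"
  by (simp add: scan_def)

lemma length_scan [simp]: "length (scan f G) = length G"
  by (induction G rule: rev_induct) (simp_all add: scan_snoc, simp add: scan_def)

lemma take_scan: "take n (scan f G) = scan f (take n G)"
proof (induction G rule: rev_induct)
  case Nil
  show ?case by (simp add: scan_def)
next
  case (snoc g G)
  show ?case
  proof (cases "n \<le> length G")
    case True
    then show ?thesis using snoc by (simp add: scan_snoc)
  next
    case False
    then have "n \<ge> Suc (length G)" by simp
    then show ?thesis by (simp add: scan_snoc)
  qed
qed

lemma scan_nth:
  assumes "j < length G"
  shows "scan f G ! j = f (take j (scan f G)) (G ! j)"
proof -
  have "scan f G ! j = take (Suc j) (scan f G) ! j" by simp
  also have "\<dots> = scan f (take j G @ [G ! j]) ! j" using assms by (simp add: take_scan take_Suc_conv_app_nth)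
  also have "\<dots> = f (scan f (take j G)) (G ! j)" using assms by (simp add: scan_snoc nth_append)
  finally show ?thesis by (simp add: take_scan)
qed

lemma pt_scan:
  assumes f: "pt (\<lambda>p. f (fst p) (fst (snd p)) (snd (snd p)))" and l: "pt l"
    and B: "pb B" "\<And>x j. j < length (l x) \<Longrightarrow> sz (scan (f x) (l x) ! j) \<le> B x"
  shows "pt (\<lambda>x. scan (f x) (l x))"
  unfolding scan_def
proof (rule pt_foldl[where B = "\<lambda>x. 1 + sz (l x) * (1 + B x)"])
  show "pb (\<lambda>x. 1 + sz (l x) * (1 + B x))" by (intro pbd_intros B pb_sz_pt l)
  show "sz (foldl (\<lambda>acc g. acc @ [f x acc g]) [] (take n (l x))) \<le> 1 + sz (l x) * (1 + B x)" for x n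
  proof -
    have "sz (take n (scan (f x) (l x))) \<le> 1 + length (take n (scan (f x) (l x))) * (1 + B x)"
    proof (rule sz_list_le)
      fix y assume "y \<in> set (take n (scan (f x) (l x)))"
      then have "y \<in> set (scan (f x) (l x))" by (rule in_set_takeD)
      then show "sz y \<le> B x" using B(2) by (metis in_set_conv_nth length_scan)
    qed
    also have "\<dots> \<le> 1 + sz (l x) * (1 + B x)"
      using length_le_sz[of "l x"] by (intro add_mono mult_right_mono) simp_all
    finally show ?thesis unfolding take_scan by (simp add: scan_def)
  qed
qed (intro pt_intros pt3[of f, OF f] l)+

subsection \<open>Depth and weft\<close>

definition maxl :: "nat list \<Rightarrow> nat" where "maxl xs = foldl max 0 xs"

lemma foldl_max_ge: "a \<le> foldl max a xs \<and> (\<forall>x\<in>set xs. x \<le> foldl max a (xs :: nat list))"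
proof (induction xs arbitrary: a)
  case (Cons y xs)
  have "max a y \<le> foldl max (max a y) xs" "\<forall>x\<in>set xs. x \<le> foldl max (max a y) xs" using Cons by blast+
  then show ?case by simp
qed simp

lemma foldl_max_in: "foldl max a xs = a \<or> foldl max a xs \<in> set (xs :: nat list)"
proof (induction xs arbitrary: a)
  case (Cons y xs)
  have "max a y = a \<or> max a y = y" by linarith
  then show ?case using Cons[of "max a y"] by fastforce
qed simp

lemma maxl_ge: "x \<in> set xs \<Longrightarrow> x \<le> maxl xs"
  unfolding maxl_def using foldl_max_ge[of 0 xs] by blast

lemma maxl_in:
  assumes "xs \<noteq> []"
  shows "maxl xs \<in> set xs"
proof (cases "maxl xs = 0")
  case True
  have "hd xs \<in> set xs" using assms by simp
  moreover have "hd xs = 0" using maxl_ge[OF \<open>hd xs \<in> set xs\<close>] True by simp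
  ultimately show ?thesis using True by simp
next
  case False
  then show ?thesis using foldl_max_in[of 0 xs] by (simp add: maxl_def)
qed

lemma pt_maxl [pt_intros]: "pt f \<Longrightarrow> pt (\<lambda>x. maxl (f x))"
proof -
  assume f: "pt f"
  have "pt (\<lambda>x. foldl (\<lambda>a b. max a b) 0 (f x))"
  proof (rule pt_foldl_add[where q = "\<lambda>x. sz (f x)"])
    show "sz (max a y) \<le> sz a + sz (f x)" if "y \<in> set (f x)" for x a y
      using sz_elem[OF that] by (simp add: max_def)
  qed (intro pt_intros f pb_sz_pt)+
  then show ?thesis unfolding maxl_def .
qed

text \<open>The largest total weight of a path that ends in the node, by dynamic programming. Depth
  and weft of a circuit are instances, which makes both of them testable in polynomial time.\<close>

definition heights :: "(nat list \<Rightarrow> nat) \<Rightarrow> nat list list \<Rightarrow> nat list" where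
  "heights c G = scan (\<lambda>acc g. c g + maxl (map (\<lambda>i. nth_default 0 acc i) (wires g))) G"

definition wired :: "nat list list \<Rightarrow> bool" where
  "wired G \<longleftrightarrow> (\<forall>j < length G. \<forall>i \<in> set (wires (G ! j)). i < j)"

lemma length_heights [simp]: "length (heights c G) = length G" by (simp add: heights_def)

lemma heights_nth:
  assumes "wired G" "j < length G"
  shows "heights c G ! j = c (G ! j) + maxl (map (\<lambda>i. heights c G ! i) (wires (G ! j)))"
proof -
  have "nth_default 0 (take j (heights c G)) i = heights c G ! i" if "i \<in> set (wires (G ! j))" for i
    using assms that by (simp add: wired_def)
  then show ?thesis unfolding heights_def scan_nth[OF assms(2)] by (simp add: heights_def[symmetric] cong: map_cong)
qed

lemma heights_wire:
  assumes "wired G" "j < length G" "i \<in> set (wires (G ! j))"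
  shows "c (G ! j) + heights c G ! i \<le> heights c G ! j"
  unfolding heights_nth[OF assms(1,2)] using assms(3) by (simp add: maxl_ge)

lemma heights_le:
  assumes "\<And>g. c g \<le> 1" "j < length G"
  shows "heights c G ! j \<le> Suc j"
  using assms(2)
proof (induction j rule: less_induct)
  case (less j)
  let ?f = "\<lambda>i. nth_default 0 (take j (heights c G)) i"
  have b: "?f i \<le> j" for i
  proof (cases "i < j")
    case True
    then have "?f i = heights c G ! i" using less.prems by simp
    then show ?thesis using less.IH[OF True] True less.prems by simp
  next
    case False
    then show ?thesis by (simp add: nth_default_eq)
  qed
  have "maxl (map ?f (wires (G ! j))) \<le> j"
  proof (cases "wires (G ! j) = []")
    case True
    then show ?thesis by (simp add: maxl_def)
  next
    case False
    then have "maxl (map ?f (wires (G ! j))) \<in> set (map ?f (wires (G ! j)))" by (intro maxl_in) simp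
    then show ?thesis using b by auto
  qed
  moreover have "heights c G ! j = c (G ! j) + maxl (map ?f (wires (G ! j)))"
    unfolding heights_def by (subst scan_nth[OF less.prems]) (rule refl)
  ultimately show ?case using assms(1)[of "G ! j"] by simp
qed

definition linked :: "nat list list \<Rightarrow> nat list \<Rightarrow> bool" where
  "linked G p \<longleftrightarrow> p \<noteq> [] \<and> (\<forall>j\<in>set p. j < length G) \<and>
     (\<forall>l. Suc l < length p \<longrightarrow> p ! l \<in> set (wires (G ! (p ! Suc l))))"

lemma linked_snoc: "p \<noteq> [] \<Longrightarrow> linked G (p @ [j]) \<longleftrightarrow> linked G p \<and> j < length G \<and> last p \<in> set (wires (G ! j))"
proof -
  assume p: "p \<noteq> []"
  have "(\<forall>l. Suc l < length (p @ [j]) \<longrightarrow> (p @ [j]) ! l \<in> set (wires (G ! ((p @ [j]) ! Suc l)))) \<longleftrightarrow>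
    (\<forall>l. Suc l < length p \<longrightarrow> p ! l \<in> set (wires (G ! (p ! Suc l)))) \<and> last p \<in> set (wires (G ! j))" (is "?L \<longleftrightarrow> ?R")
  proof
    assume L: ?L
    have "p ! l \<in> set (wires (G ! (p ! Suc l)))" if "Suc l < length p" for l
      using L[rule_format, of l] that by (simp add: nth_append)
    moreover have "last p \<in> set (wires (G ! j))"
      using L[rule_format, of "length p - 1"] p by (simp add: nth_append last_conv_nth)
    ultimately show ?R by blast
  next
    assume R: ?R
    show ?L
    proof (intro allI impI)
      fix l assume l: "Suc l < length (p @ [j])"
      show "(p @ [j]) ! l \<in> set (wires (G ! ((p @ [j]) ! Suc l)))"
      proof (cases "Suc l < length p")
        case True
        then show ?thesis using R by (simp add: nth_append)
      next
        case False
        then have "l = length p - 1" using l p by (simp add: Suc_lessI)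
        then show ?thesis using R p by (simp add: nth_append last_conv_nth)
      qed
    qed
  qed
  then show ?thesis using p unfolding linked_def by auto
qed

lemma linked_cost_le:
  assumes "wired G"
  shows "linked G p \<Longrightarrow> (\<Sum>j\<leftarrow>p. c (G ! j)) \<le> heights c G ! last p"
proof (induction p rule: rev_induct)
  case (snoc j p)
  show ?case
  proof (cases "p = []")
    case True
    then show ?thesis using snoc.prems heights_nth[OF assms, of j c] by (simp add: linked_def)
  next
    case False
    then have l: "linked G p" "j < length G" "last p \<in> set (wires (G ! j))" using snoc.prems linked_snoc by blast+
    then show ?thesis using snoc.IH[OF l(1)] heights_wire[OF assms l(2,3), of c] by simp
  qed
qed (simp add: linked_def)

text \<open>Tracing a wire of maximal height backwards stops only at a node without wires, and such
  a node is an input. The maximum is therefore attained by a path of the kind that defines depth and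
  weft.\<close>

lemma linked_cost_ex:
  assumes "wired G" "\<And>j. j < length G \<Longrightarrow> kind (G ! j) \<noteq> 0 \<Longrightarrow> wires (G ! j) \<noteq> []"
  shows "j < length G \<Longrightarrow> \<exists>p. linked G p \<and> last p = j \<and> kind (G ! hd p) = 0 \<and> (\<Sum>j\<leftarrow>p. c (G ! j)) = heights c G ! j"
proof (induction j rule: less_induct)
  case (less j)
  show ?case
  proof (cases "wires (G ! j) = []")
    case True
    then have "kind (G ! j) = 0" using assms(2) less.prems by blast
    then show ?thesis using True less.prems heights_nth[OF assms(1) less.prems, of c]
      by (intro exI[of _ "[j]"]) (simp add: linked_def maxl_def)
  next
    case False
    then obtain i where i: "i \<in> set (wires (G ! j))" "maxl (map (\<lambda>i. heights c G ! i) (wires (G ! j))) = heights c G ! i"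
      using maxl_in[of "map (\<lambda>i. heights c G ! i) (wires (G ! j))"] by auto
    then have "i < j" using assms(1) less.prems by (simp add: wired_def)
    then obtain p where p: "linked G p" "last p = i" "kind (G ! hd p) = 0" "(\<Sum>j\<leftarrow>p. c (G ! j)) = heights c G ! i"
      using less.IH[of i] less.prems by auto
    then have "p \<noteq> []" by (simp add: linked_def)
    then show ?thesis using p i less.prems heights_nth[OF assms(1) less.prems, of c]
      by (intro exI[of _ "p @ [j]"]) (simp add: linked_snoc)
  qed
qed

definition depth_cost :: "nat list \<Rightarrow> nat" where "depth_cost g = of_bool (wires g \<noteq> [])"
definition weft_cost :: "nat list \<Rightarrow> nat" where "weft_cost g = of_bool (2 < length (wires g))"

definition codes :: "circuit \<Rightarrow> nat list list" where "codes C = map enc_gate C"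

lemma wf_circuit_codes:
  assumes "wf_circuit C"
  shows "wired (codes C)" "\<And>j. j < length C \<Longrightarrow> kind (codes C ! j) \<noteq> 0 \<Longrightarrow> wires (codes C ! j) \<noteq> []"
proof -
  show "wired (codes C)" using assms by (auto simp: wired_def wf_circuit_def codes_def)
  fix j assume "j < length C" "kind (codes C ! j) \<noteq> 0"
  moreover have "wf_gate (C ! j)" using assms \<open>j < length C\<close> by (simp add: wf_circuit_def)
  ultimately show "wires (codes C ! j) \<noteq> []" by (cases "C ! j") (auto simp: codes_def)
qed

lemma io_path_codes:
  "io_path C p \<longleftrightarrow> linked (codes C) p \<and> kind (codes C ! hd p) = 0 \<and> last p = length C - 1"
proof (cases "p \<noteq> [] \<and> (\<forall>j\<in>set p. j < length C)")
  case True
  then have b: "p ! l < length C" if "l < length p" for l using that by simp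
  have "hd p < length C" using True by simp
  then have "C ! hd p = InputG \<longleftrightarrow> kind (codes C ! hd p) = 0" by (cases "C ! hd p") (simp_all add: codes_def)
  moreover have "(\<forall>l. Suc l < length p \<longrightarrow> p ! l \<in> set (in_wires (C ! (p ! Suc l)))) \<longleftrightarrow>
    (\<forall>l. Suc l < length p \<longrightarrow> p ! l \<in> set (wires (codes C ! (p ! Suc l))))" using b by (simp add: codes_def)
  ultimately show ?thesis using True unfolding io_path_def linked_def by (auto simp: codes_def)
next
  case False
  then show ?thesis unfolding io_path_def linked_def by (auto simp: codes_def)
qed

lemma depth_weft_codes:
  assumes "wf_circuit C"
  shows "depth_le C d \<longleftrightarrow> heights depth_cost (codes C) ! (length C - 1) \<le> d"
    "weft_le C t \<longleftrightarrow> heights weft_cost (codes C) ! (length C - 1) \<le> t"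
proof -
  note wf = wf_circuit_codes[OF assms]
  have out: "length C - 1 < length (codes C)" using assms by (simp add: wf_circuit_def codes_def)
  have ex: "\<exists>p. io_path C p \<and> (\<Sum>j\<leftarrow>p. c (codes C ! j)) = heights c (codes C) ! (length C - 1)" for c
    using linked_cost_ex[OF wf(1) _ out, of c] wf(2) unfolding io_path_codes by (auto simp: codes_def)
  have le: "(\<Sum>j\<leftarrow>p. c (codes C ! j)) \<le> heights c (codes C) ! (length C - 1)" if "io_path C p" for c p
    using linked_cost_le[OF wf(1), of p c] that unfolding io_path_codes by simp
  have dc: "(\<Sum>j\<leftarrow>p. depth_cost (codes C ! j)) = length p - 1" if p: "io_path C p" for p
  proof -
    have l: "linked (codes C) p" "kind (codes C ! hd p) = 0" using p unfolding io_path_codes by auto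
    then obtain a q where q: "p = a # q" by (cases p) (auto simp: linked_def)
    have "depth_cost (codes C ! j) = 1" if jq: "j \<in> set q" for j
    proof -
      obtain l' where "l' < length q" "j = q ! l'" using jq unfolding in_set_conv_nth by blast
      then have "p ! l' \<in> set (wires (codes C ! j))" using l(1) q by (auto simp: linked_def)
      then show ?thesis by (auto simp: depth_cost_def)
    qed
    then have "(\<Sum>j\<leftarrow>q. depth_cost (codes C ! j)) = (\<Sum>j\<leftarrow>q. 1)" by (intro arg_cong[where f = sum_list] map_cong) auto
    moreover have "depth_cost (codes C ! a) = 0" using l(2) q by (simp add: depth_cost_def wires_def)
    ultimately show ?thesis using q by (simp add: sum_list_triv)
  qed
  have wc: "(\<Sum>j\<leftarrow>p. weft_cost (codes C ! j)) = length (filter (\<lambda>j. large (C ! j)) p)" if "\<forall>j\<in>set p. j < length C" for p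
    using that by (induction p) (auto simp: weft_cost_def large_def codes_def)
  have wc': "(\<Sum>j\<leftarrow>p. weft_cost (codes C ! j)) = length (filter (\<lambda>j. large (C ! j)) p)" if "io_path C p" for p
    using that wc by (simp add: io_path_def)
  show "depth_le C d \<longleftrightarrow> heights depth_cost (codes C) ! (length C - 1) \<le> d"
  proof
    assume *: "depth_le C d"
    obtain p where p: "io_path C p" "(\<Sum>j\<leftarrow>p. depth_cost (codes C ! j)) = heights depth_cost (codes C) ! (length C - 1)"
      using ex by blast
    have "length p - 1 \<le> d" using * p(1) unfolding depth_le_def by blast
    then show "heights depth_cost (codes C) ! (length C - 1) \<le> d"
      using p(2) dc[OF p(1)] by linarith
  next
    assume *: "heights depth_cost (codes C) ! (length C - 1) \<le> d"
    show "depth_le C d" unfolding depth_le_def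
    proof (intro allI impI)
      fix p assume p: "io_path C p"
      from order_trans[OF le[OF p] *] show "length p - 1 \<le> d" unfolding dc[OF p] .
    qed
  qed
  show "weft_le C t \<longleftrightarrow> heights weft_cost (codes C) ! (length C - 1) \<le> t"
  proof
    assume *: "weft_le C t"
    obtain p where p: "io_path C p" "(\<Sum>j\<leftarrow>p. weft_cost (codes C ! j)) = heights weft_cost (codes C) ! (length C - 1)"
      using ex by blast
    have "length (filter (\<lambda>j. large (C ! j)) p) \<le> t" using * p(1) unfolding weft_le_def by blast
    then show "heights weft_cost (codes C) ! (length C - 1) \<le> t"
      using p(2) wc'[OF p(1)] by linarith
  next
    assume *: "heights weft_cost (codes C) ! (length C - 1) \<le> t"
    show "weft_le C t" unfolding weft_le_def
    proof (intro allI impI)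
      fix p assume p: "io_path C p"
      from order_trans[OF le[OF p] *] show "length (filter (\<lambda>j. large (C ! j)) p) \<le> t" unfolding wc'[OF p] .
    qed
  qed
qed

subsection \<open>Three-valued evaluation\<close>

text \<open>Strong Kleene logic, with \<open>None\<close> for unknown: one input with the absorbing
  value \<open>kind g \<noteq> 2\<close> decides a gate although other inputs may be
  unknown.\<close>

definition kstep :: "(nat \<Rightarrow> bool option) \<Rightarrow> bool option list \<Rightarrow> nat list \<Rightarrow> bool option" where
  "kstep know acc g = (let vs = map (\<lambda>i. nth_default None acc i) (wires g) in
     if kind g = 0 then know (length acc)
     else if kind g = 1 then (case nth_default None vs 0 of None \<Rightarrow> None | Some b \<Rightarrow> Some (\<not> b))
     else if Some (kind g \<noteq> 2) \<in> set vs then Some (kind g \<noteq> 2)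
     else if \<forall>v\<in>set vs. v = Some (kind g = 2) then Some (kind g = 2) else None)"

definition keval :: "(nat \<Rightarrow> bool option) \<Rightarrow> nat list list \<Rightarrow> bool option list" where
  "keval know G = scan (kstep know) G"

text \<open>\<open>kind g = 2\<close> is the value that a conjunction or disjunction takes when all its inputs have that
  value; the other value only needs one input.\<close>

definition sem :: "(nat \<Rightarrow> bool) \<Rightarrow> nat \<Rightarrow> nat list \<Rightarrow> bool" where
  "sem v j g \<longleftrightarrow> (if kind g = 0 then True else if kind g = 1 then (v j \<longleftrightarrow> \<not> v (nth_default 0 (wires g) 0))
     else (v j = (kind g = 2) \<longleftrightarrow> (\<forall>i\<in>set (wires g). v i = (kind g = 2))))"

lemma sem_codes: "j < length C \<Longrightarrow> sem v j (codes C ! j) \<longleftrightarrow> gate_holds v j (C ! j)"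
  by (cases "C ! j") (auto simp: sem_def codes_def)

definition gshape :: "nat list list \<Rightarrow> bool" where
  "gshape G \<longleftrightarrow> (\<forall>j < length G. (kind (G ! j) = 1 \<longrightarrow> length (wires (G ! j)) = 1) \<and>
     (kind (G ! j) \<noteq> 0 \<longrightarrow> wires (G ! j) \<noteq> []))"

lemma gshape_codes: "wf_circuit C \<Longrightarrow> gshape (codes C)"
proof -
  assume wf: "wf_circuit C"
  have "(kind (codes C ! j) = 1 \<longrightarrow> length (wires (codes C ! j)) = 1)" if "j < length C" for j
    using that by (cases "C ! j") (simp_all add: codes_def)
  then show ?thesis using wf_circuit_codes(2)[OF wf] by (simp add: gshape_def codes_def)
qed

lemma length_keval [simp]: "length (keval know G) = length G" by (simp add: keval_def)

lemma keval_nth: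
  assumes "wired G" "j < length G"
  shows "keval know G ! j = (let vs = map (\<lambda>i. keval know G ! i) (wires (G ! j)) in
     if kind (G ! j) = 0 then know j
     else if kind (G ! j) = 1 then (case nth_default None vs 0 of None \<Rightarrow> None | Some b \<Rightarrow> Some (\<not> b))
     else if Some (kind (G ! j) \<noteq> 2) \<in> set vs then Some (kind (G ! j) \<noteq> 2)
     else if \<forall>v\<in>set vs. v = Some (kind (G ! j) = 2) then Some (kind (G ! j) = 2) else None)"
proof -
  have m: "map (\<lambda>i. nth_default None (take j (keval know G)) i) (wires (G ! j)) = map (\<lambda>i. keval know G ! i) (wires (G ! j))"
    using assms by (simp add: wired_def)
  have l: "length (take j (keval know G)) = j" using assms(2) by simp
  have "keval know G ! j = kstep know (take j (keval know G)) (G ! j)"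
    unfolding keval_def by (rule scan_nth[OF assms(2)])
  then show ?thesis unfolding kstep_def m l .
qed

lemma keval_sound:
  assumes "wired G" "gshape G" "\<And>j. j < length G \<Longrightarrow> sem v j (G ! j)"
    "\<And>j b. j < length G \<Longrightarrow> kind (G ! j) = 0 \<Longrightarrow> know j = Some b \<Longrightarrow> v j = b"
  shows "j < length G \<Longrightarrow> keval know G ! j = Some b \<Longrightarrow> v j = b"
proof (induction j arbitrary: b rule: less_induct)
  case (less j)
  let ?g = "G ! j"
  have w: "i < j" "i < length G" if "i \<in> set (wires ?g)" for i
    using assms(1) less.prems(1) that unfolding wired_def by (blast, meson less_trans)
  have IH: "v i = b" if "i \<in> set (wires ?g)" "keval know G ! i = Some b" for i b
    using less.IH[OF w(1) w(2)] that by blast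
  note e = less.prems(2)[unfolded keval_nth[OF assms(1) less.prems(1)] Let_def]
  have s: "sem v j ?g" using assms(3) less.prems(1) by blast
  consider "kind ?g = 0" | "kind ?g = 1" | "kind ?g \<noteq> 0" "kind ?g \<noteq> 1" by blast
  then show ?case
  proof cases
    case 1
    then show ?thesis using e assms(4) less.prems(1) by simp
  next
    case 2
    then have "length (wires ?g) = 1" using assms(2) less.prems(1) by (simp add: gshape_def)
    then obtain i where i: "wires ?g = [i]" by (cases "wires ?g") auto
    then show ?thesis using e 2 s IH[of i] by (auto simp: sem_def split: option.splits)
  next
    case 3
    show ?thesis
    proof (cases "Some (kind ?g \<noteq> 2) \<in> set (map (\<lambda>i. keval know G ! i) (wires ?g))")
      case True
      then obtain i where i: "i \<in> set (wires ?g)" "keval know G ! i = Some (kind ?g \<noteq> 2)" by auto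
      then have "v i = (kind ?g \<noteq> 2)" using IH by blast
      then have "\<not> (\<forall>i\<in>set (wires ?g). v i = (kind ?g = 2))" using i(1) by blast
      then have "v j = (kind ?g \<noteq> 2)" using s 3 by (simp add: sem_def) blast
      moreover have "b = (kind ?g \<noteq> 2)" using e 3 True by simp
      ultimately show ?thesis by simp
    next
      case False
      then have a: "\<forall>u\<in>set (map (\<lambda>i. keval know G ! i) (wires ?g)). u = Some (kind ?g = 2)" and b: "b = (kind ?g = 2)"
        using e 3 by (simp_all split: if_splits)
      have "\<forall>i\<in>set (wires ?g). v i = (kind ?g = 2)" using a IH by simp
      then show ?thesis using s 3 b by (simp add: sem_def)
    qed
  qed
qed

lemma keval_step_complete:
  assumes "wired G" "gshape G" "j < length G" "sem v j (G ! j)" "kind (G ! j) \<noteq> 0"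
    "\<And>i. i \<in> set (wires (G ! j)) \<Longrightarrow> keval know G ! i = Some (v i)"
  shows "keval know G ! j = Some (v j)"
proof -
  let ?g = "G ! j"
  have m: "map (\<lambda>i. keval know G ! i) (wires ?g) = map (\<lambda>i. Some (v i)) (wires ?g)" using assms(6) by simp
  show ?thesis
  proof (cases "kind ?g = 1")
    case True
    then have "length (wires ?g) = 1" using assms(2,3) by (simp add: gshape_def)
    then obtain i where i: "wires ?g = [i]" by (cases "wires ?g") auto
    then show ?thesis unfolding keval_nth[OF assms(1,3)] Let_def m using assms(4) True by (simp add: sem_def)
  next
    case False
    have s: "v j = (kind ?g = 2) \<longleftrightarrow> (\<forall>i\<in>set (wires ?g). v i = (kind ?g = 2))" using assms(4,5) False by (simp add: sem_def)
    show ?thesis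
    proof (cases "\<forall>i\<in>set (wires ?g). v i = (kind ?g = 2)")
      case True
      then have "Some (kind ?g \<noteq> 2) \<notin> set (map (\<lambda>i. Some (v i)) (wires ?g))" by auto
      then show ?thesis unfolding keval_nth[OF assms(1,3)] Let_def m using assms(5) False s True by simp
    next
      case F: False
      then obtain i where i: "i \<in> set (wires ?g)" "v i = (kind ?g \<noteq> 2)" by blast
      then have "Some (kind ?g \<noteq> 2) \<in> set (map (\<lambda>i. Some (v i)) (wires ?g))" by force
      moreover have "v j = (kind ?g \<noteq> 2)" using s F by blast
      ultimately show ?thesis unfolding keval_nth[OF assms(1,3)] Let_def m using assms(5) False by simp
    qed
  qed
qed

subsection \<open>Weighted satisfiability as a clique problem\<close>

text \<open>The true inputs are guessed as an increasing sequence, shifted by one and framed by the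
  sentinels \<open>0\<close> and \<open>Suc (length G)\<close>. Slot \<open>i\<close> holds the \<open>i\<close>-th element. Two consecutive slots certify
  that everything strictly between them is false.\<close>

definition know :: "(nat \<times> nat) list \<Rightarrow> nat \<Rightarrow> bool option" where
  "know s j = (if \<exists>p\<in>set s. snd p = Suc j then Some True
     else if \<exists>p\<in>set s. \<exists>p'\<in>set s. fst p' = Suc (fst p) \<and> snd p < Suc j \<and> Suc j < snd p' then Some False
     else None)"

text \<open>A list \<open>\<gamma>\<close> of claims (node, value) is closed under local justification. For a large gate the
  claims about its inputs are replaced by the test \<open>P\<close>, since there are too many of them.\<close>

definition justified :: "(nat \<Rightarrow> bool \<Rightarrow> bool) \<Rightarrow> nat list list \<Rightarrow> (nat \<times> bool) list \<Rightarrow> nat \<Rightarrow> bool \<Rightarrow> bool" where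
  "justified P G \<gamma> j b \<longleftrightarrow> (let g = nth_default [] G j; ws = wires g in
     if kind g = 0 then True
     else if kind g = 1 then \<forall>i\<in>set ws. (i, \<not> b) \<in> set \<gamma>
     else if b \<noteq> (kind g = 2) then \<exists>i\<in>set ws. (i, b) \<in> set \<gamma>
     else (\<forall>i\<in>set ws. (i, b) \<in> set \<gamma>) \<or> (2 < length ws \<and> (\<forall>i\<in>set ws. P i b)))"

lemma justified_mono:
  assumes "justified P G \<gamma> j b" "set \<gamma> \<subseteq> set \<gamma>'" "\<And>i. i \<in> set (wires (nth_default [] G j)) \<Longrightarrow> P i b \<Longrightarrow> P' i b"
  shows "justified P' G \<gamma>' j b"
  using assms unfolding justified_def Let_def by (auto split: if_splits)

definition slots_ok :: "nat list list \<Rightarrow> nat \<Rightarrow> (nat \<times> nat) list \<Rightarrow> bool" where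
  "slots_ok G k s \<longleftrightarrow>
     (\<forall>p\<in>set s. \<forall>p'\<in>set s. (fst p = fst p' \<longrightarrow> snd p = snd p') \<and> (fst p < fst p' \<longrightarrow> snd p < snd p')) \<and>
     (\<forall>p\<in>set s. (fst p = 0 \<longrightarrow> snd p = 0) \<and> (fst p = Suc k \<longrightarrow> snd p = Suc (length G)) \<and>
        (fst p \<noteq> 0 \<and> fst p \<noteq> Suc k \<longrightarrow> 0 < snd p \<and> snd p \<le> length G \<and> kind (nth_default [] G (snd p - 1)) = 0))"

text \<open>Claims about inputs, and the inputs of a large gate that all matter, are only tested
  against the slots of this one vertex: three-valued evaluation must not refute them. The decisive
  test is made by some other vertex of the clique, which carries the same claims.\<close>

definition claims_ok :: "nat list list \<Rightarrow> bool option list \<Rightarrow> (nat \<times> bool) list \<Rightarrow> bool" where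
  "claims_ok G kv \<gamma> \<longleftrightarrow> (length G - 1, True) \<in> set \<gamma> \<and>
     (\<forall>c\<in>set \<gamma>. fst c < length G \<and> nth_default None kv (fst c) \<noteq> Some (\<not> snd c) \<and>
        justified (\<lambda>i b. nth_default None kv i \<noteq> Some (\<not> b)) G \<gamma> (fst c) (snd c))"

type_synonym cvertex = "(nat \<times> nat) list \<times> (nat \<times> bool) list"

definition vertex_ok :: "nat list list \<Rightarrow> nat \<Rightarrow> cvertex \<Rightarrow> bool" where
  "vertex_ok G k x \<longleftrightarrow> slots_ok G k (fst x) \<and> claims_ok G (keval (know (fst x)) G) (snd x)"

text \<open>Different index tuples force a clique of size \<open>(k + 2) ^ (2 * 2 ^ d)\<close> to
  use every tuple; equal claims give it one common list; agreement on shared indices gives it one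
  common guess.\<close>

definition vertex_adj :: "cvertex \<Rightarrow> cvertex \<Rightarrow> bool" where
  "vertex_adj x y \<longleftrightarrow> map fst (fst x) \<noteq> map fst (fst y) \<and> snd x = snd y \<and>
     (\<forall>p\<in>set (fst x). \<forall>p'\<in>set (fst y). fst p = fst p' \<longrightarrow> snd p = snd p')"

text \<open>A node over small gates of depth at most \<open>d\<close> depends on at most
  \<open>2 ^ d\<close> inputs, and a false input needs two slots to certify it: hence
  \<open>2 * 2 ^ d\<close> slots. The number of claims comes from
  \<open>claims_exist\<close>.\<close>

definition vertices :: "nat \<Rightarrow> nat list list \<Rightarrow> nat \<Rightarrow> cvertex list" where
  "vertices d G k = filter (vertex_ok G k)
     (List.product (List.n_lists (2 * 2 ^ d) (List.product [0..<k + 2] [0..<length G + 2]))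
        (List.n_lists (2 ^ Suc d) (List.product [0..<length G] [False, True])))"

lemma in_vertices:
  "(s, \<gamma>) \<in> set (vertices d G k) \<longleftrightarrow> vertex_ok G k (s, \<gamma>) \<and>
     length s = 2 * 2 ^ d \<and> (\<forall>p\<in>set s. fst p < k + 2 \<and> snd p < length G + 2) \<and>
     length \<gamma> = 2 ^ Suc d \<and> (\<forall>c\<in>set \<gamma>. fst c < length G)"
proof -
  have 1: "set s \<subseteq> set (List.product [0..<k + 2] [0..<length G + 2]) \<longleftrightarrow> (\<forall>p\<in>set s. fst p < k + 2 \<and> snd p < length G + 2)"
    by (simp only: set_product set_upt subset_iff mem_Times_iff atLeastLessThan_iff) auto
  have 2: "set \<gamma> \<subseteq> set (List.product [0..<length G] [False, True]) \<longleftrightarrow> (\<forall>c\<in>set \<gamma>. fst c < length G)"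
    by (simp only: set_product set_upt subset_iff mem_Times_iff atLeastLessThan_iff) auto
  show ?thesis unfolding vertices_def set_filter mem_Collect_eq set_product mem_Times_iff fst_conv snd_conv set_n_lists
    using 1 2 unfolding set_product by blast
qed

text \<open>A claim calls for at most two others: one input suffices for the absorbing value, a
  small gate has at most two inputs, and a large gate whose inputs all matter ends the recursion.
  The claims thus form a binary tree of height \<open>e\<close>, with fewer than
  \<open>2 ^ Suc e\<close> nodes.\<close>

lemma claims_exist:
  assumes "wired G" "gshape G" "\<And>j. j < length G \<Longrightarrow> sem v j (G ! j)"
  shows "j < length G \<Longrightarrow> heights depth_cost G ! j \<le> e \<Longrightarrow> \<exists>\<gamma>. length \<gamma> < 2 ^ Suc e \<and> (j, v j) \<in> set \<gamma> \<and>
    (\<forall>c\<in>set \<gamma>. fst c < length G \<and> v (fst c) = snd c \<and> justified (\<lambda>i b. v i = b) G \<gamma> (fst c) (snd c))"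
proof (induction j arbitrary: e rule: less_induct)
  case (less j)
  let ?g = "G ! j" and ?J = "justified (\<lambda>i b. v i = b) G"
  let ?ok = "\<lambda>\<gamma>. \<forall>c\<in>set \<gamma>. fst c < length G \<and> v (fst c) = snd c \<and> ?J \<gamma> (fst c) (snd c)"
  have nd: "nth_default [] G j = ?g" using less.prems by simp
  have s: "sem v j ?g" using assms(3) less.prems by blast
  have wi: "i < j" "i < length G" if "i \<in> set (wires ?g)" for i
    using assms(1) less.prems(1) that unfolding wired_def by (blast, meson less_trans)
  have single: ?case if "?J [(j, v j)] j (v j)"
    using that less.prems(1) by (intro exI[of _ "[(j, v j)]"]) (simp add: Suc_lessI less_Suc_eq_le)
  have IH: "\<exists>e' \<gamma>. e = Suc e' \<and> length \<gamma> < 2 ^ Suc e' \<and> (i, v i) \<in> set \<gamma> \<and> ?ok \<gamma>" if i: "i \<in> set (wires ?g)" for i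
  proof -
    have "depth_cost ?g = 1" using i by (auto simp: depth_cost_def)
    then have "1 + heights depth_cost G ! i \<le> e"
      using heights_wire[OF assms(1) less.prems(1) i, of depth_cost] less.prems(2) by linarith
    then obtain e' where e: "e = Suc e'" "heights depth_cost G ! i \<le> e'" by (cases e) auto
    from less.IH[OF wi(1)[OF i] wi(2)[OF i] e(2)] show ?thesis using e(1) by blast
  qed
  have ext: ?case if "length \<delta> < 2 ^ Suc e - 1" "?ok \<delta>" "?J ((j, v j) # \<delta>) j (v j)" for \<delta>
  proof (rule exI[of _ "(j, v j) # \<delta>"], intro conjI)
    show "length ((j, v j) # \<delta>) < 2 ^ Suc e" using that(1) by simp
    show "?ok ((j, v j) # \<delta>)"
    proof
      fix c assume c: "c \<in> set ((j, v j) # \<delta>)"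
      show "fst c < length G \<and> v (fst c) = snd c \<and> ?J ((j, v j) # \<delta>) (fst c) (snd c)"
      proof (cases "c = (j, v j)")
        case True
        then show ?thesis using that(3) less.prems(1) by simp
      next
        case False
        then have "c \<in> set \<delta>" using c by simp
        then have "fst c < length G" "v (fst c) = snd c" "?J \<delta> (fst c) (snd c)" using that(2) by blast+
        moreover have "?J ((j, v j) # \<delta>) (fst c) (snd c)"
          by (rule justified_mono[OF \<open>?J \<delta> (fst c) (snd c)\<close>]) auto
        ultimately show ?thesis by blast
      qed
    qed
  qed simp
  consider "kind ?g = 0" | "kind ?g = 1" | "kind ?g \<noteq> 0" "kind ?g \<noteq> 1" by blast
  then show ?case
  proof cases
    case 1
    then show ?thesis by (intro single) (simp add: justified_def nd)
  next
    case 2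
    then have "length (wires ?g) = 1" using assms(2) less.prems(1) by (simp add: gshape_def)
    then obtain i where i: "wires ?g = [i]" by (cases "wires ?g") auto
    obtain e' \<delta> where \<delta>: "e = Suc e'" "length \<delta> < 2 ^ Suc e'" "(i, v i) \<in> set \<delta>" "?ok \<delta>" using IH[of i] i by auto
    have "v j = (\<not> v i)" using s 2 i by (simp add: sem_def)
    then have "?J ((j, v j) # \<delta>) j (v j)" using 2 i \<delta>(3) by (simp add: justified_def nd)
    moreover have "length \<delta> < 2 ^ Suc e - 1" using \<delta>(1,2) by simp
    ultimately show ?thesis using ext \<delta>(4) by blast
  next
    case 3
    have sj: "v j = (kind ?g = 2) \<longleftrightarrow> (\<forall>i\<in>set (wires ?g). v i = (kind ?g = 2))" using s 3 by (simp add: sem_def)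
    show ?thesis
    proof (cases "v j = (kind ?g = 2)")
      case False
      then obtain i where i: "i \<in> set (wires ?g)" "v i \<noteq> (kind ?g = 2)" using sj by blast
      then have vi: "v i = v j" using False by blast
      obtain e' \<delta> where \<delta>: "e = Suc e'" "length \<delta> < 2 ^ Suc e'" "(i, v i) \<in> set \<delta>" "?ok \<delta>" using IH[OF i(1)] by blast
      have "?J ((j, v j) # \<delta>) j (v j)" unfolding justified_def Let_def nd using 3 False i(1) \<delta>(3) vi by auto
      moreover have "length \<delta> < 2 ^ Suc e - 1" using \<delta>(1,2) by simp
      ultimately show ?thesis using ext \<delta>(4) by blast
    next
      case True
      have all: "\<forall>i\<in>set (wires ?g). v i = v j" using True sj by blast
      show ?thesis
      proof (cases "2 < length (wires ?g)")
        case l: True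
        \<comment> \<open>All inputs of this large gate have the value \<open>v j\<close>, which
          satisfies the test in place of claims about them.\<close>
        have "?J [(j, v j)] j (v j)" unfolding justified_def Let_def nd using 3 True l all by simp
        then show ?thesis by (rule single)
      next
        case False
        then consider a where "wires ?g = [a]" | a b where "wires ?g = [a, b]"
          using assms(2) less.prems(1) 3(1) by (cases "wires ?g"; cases "tl (wires ?g)") (auto simp: gshape_def)
        then show ?thesis
        proof cases
          case (1 a)
          obtain e' \<delta> where \<delta>: "e = Suc e'" "length \<delta> < 2 ^ Suc e'" "(a, v a) \<in> set \<delta>" "?ok \<delta>" using IH[of a] 1 by auto
          have "?J ((j, v j) # \<delta>) j (v j)" unfolding justified_def Let_def nd using 3 True 1 all \<delta>(3) by simp
          moreover have "length \<delta> < 2 ^ Suc e - 1" using \<delta>(1,2) by simp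
          ultimately show ?thesis using ext \<delta>(4) by blast
        next
          case (2 a b)
          obtain e' \<delta> where \<delta>: "e = Suc e'" "length \<delta> < 2 ^ Suc e'" "(a, v a) \<in> set \<delta>" "?ok \<delta>" using IH[of a] 2 by auto
          obtain \<delta>' where \<delta>': "length \<delta>' < 2 ^ Suc e'" "(b, v b) \<in> set \<delta>'" "?ok \<delta>'" using IH[of b] 2 \<delta>(1) by auto
          have "?ok (\<delta> @ \<delta>')"
          proof
            fix c assume "c \<in> set (\<delta> @ \<delta>')"
            then consider "c \<in> set \<delta>" | "c \<in> set \<delta>'" by auto
            then show "fst c < length G \<and> v (fst c) = snd c \<and> ?J (\<delta> @ \<delta>') (fst c) (snd c)"
            proof cases
              case 1
              then have j1: "fst c < length G \<and> v (fst c) = snd c" "?J \<delta> (fst c) (snd c)" using \<delta>(4) by blast+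
              have "?J (\<delta> @ \<delta>') (fst c) (snd c)" by (rule justified_mono[OF j1(2)]) auto
              then show ?thesis using j1(1) by blast
            next
              case 2
              then have j1: "fst c < length G \<and> v (fst c) = snd c" "?J \<delta>' (fst c) (snd c)" using \<delta>'(3) by blast+
              have "?J (\<delta> @ \<delta>') (fst c) (snd c)" by (rule justified_mono[OF j1(2)]) auto
              then show ?thesis using j1(1) by blast
            qed
          qed
          moreover have "?J ((j, v j) # \<delta> @ \<delta>') j (v j)" unfolding justified_def Let_def nd using 3 True 2 all \<delta>(3) \<delta>'(2) by simp
          moreover have "length (\<delta> @ \<delta>') < 2 ^ Suc e - 1" using \<delta>(1,2) \<delta>'(1) by simp
          ultimately show ?thesis using ext by blast
        qed
      qed
    qed
  qed
qed

text \<open>Every index tuple is filled in from the sorted list of true inputs and carries the same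
  list of true claims. Three-valued evaluation from correct slots is sound, so no vertex refutes a
  true claim.\<close>

lemma list_clique_if_sat:
  assumes G: "wired G" "gshape G" "0 < length G" and d: "heights depth_cost G ! (length G - 1) \<le> d"
    and v: "\<And>j. j < length G \<Longrightarrow> sem v j (G ! j)" "v (length G - 1)"
      "card {j. j < length G \<and> kind (G ! j) = 0 \<and> v j} = k"
  shows "list_clique vertex_adj (vertices d G k) ((k + 2) ^ (2 * 2 ^ d))"
proof -
  let ?N = "length G" and ?Q = "2 * 2 ^ d :: nat" and ?vs = "vertices d G k"
  define T where "T = {j. j < ?N \<and> kind (G ! j) = 0 \<and> v j}"
  define xs where "xs = sorted_list_of_set T"
  have xs: "set xs = T" "sorted_wrt (<) xs" "length xs = k"
    using v(3) by (simp_all add: xs_def T_def)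
  define X where "X i = (if i = 0 then 0 else if i \<le> k then Suc (xs ! (i - 1)) else Suc ?N)" for i
  have xT: "xs ! i \<in> T" if "i < k" for i using that xs(1,3) by auto
  have Tb: "j < ?N" "kind (G ! j) = 0" "v j" if "j \<in> T" for j using that by (auto simp: T_def)
  have X_less: "X i < X i'" if lt: "i < i'" "i' \<le> Suc k" for i i'
  proof -
    consider "i = 0" | "i \<noteq> 0" "i' \<le> k" | "i \<noteq> 0" "i' = Suc k" using lt by linarith
    then show ?thesis
    proof cases
      case 1
      then show ?thesis using that by (simp add: X_def)
    next
      case 2
      then have "i - 1 < i' - 1" "i' - 1 < length xs" using lt xs(3) by linarith+
      from sorted_wrt_nth_less[OF xs(2) this] have "xs ! (i - 1) < xs ! (i' - 1)" .
      then show ?thesis using 2 that by (simp add: X_def)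
    next
      case 3
      then have "xs ! (i - 1) < ?N" using Tb(1)[OF xT[of "i - 1"]] that by simp
      then show ?thesis using 3 that by (simp add: X_def)
    qed
  qed
  have X_lt: "i < i'" if "X i < X i'" "i \<le> Suc k" for i i'
  proof (rule ccontr)
    assume "\<not> i < i'"
    then have "i' = i \<or> X i' < X i" using X_less[of i' i] that(2) by linarith
    then show False using that(1) by auto
  qed
  define S where "S = map (\<lambda>i. (i, X i))"
  have sl: "slots_ok G k (S \<phi>)" if "set \<phi> \<subseteq> {..<k + 2}" for \<phi>
    unfolding slots_ok_def
  proof (intro conjI ballI)
    fix p p' assume p: "p \<in> set (S \<phi>)" and p': "p' \<in> set (S \<phi>)"
    then have "snd p = X (fst p)" "snd p' = X (fst p')" "fst p' < k + 2" using that by (auto simp: S_def)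
    then show "fst p = fst p' \<longrightarrow> snd p = snd p'" "fst p < fst p' \<longrightarrow> snd p < snd p'" using X_less by auto
  next
    fix p assume p: "p \<in> set (S \<phi>)"
    then have e: "snd p = X (fst p)" "fst p < k + 2" using that by (auto simp: S_def)
    show "fst p = 0 \<longrightarrow> snd p = 0" "fst p = Suc k \<longrightarrow> snd p = Suc ?N" using e by (auto simp: X_def)
    show "fst p \<noteq> 0 \<and> fst p \<noteq> Suc k \<longrightarrow> 0 < snd p \<and> snd p \<le> ?N \<and> kind (nth_default [] G (snd p - 1)) = 0"
    proof
      assume a: "fst p \<noteq> 0 \<and> fst p \<noteq> Suc k"
      then have "snd p = Suc (xs ! (fst p - 1))" "fst p - 1 < k" using e by (auto simp: X_def)
      then show "0 < snd p \<and> snd p \<le> ?N \<and> kind (nth_default [] G (snd p - 1)) = 0"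
        using Tb[OF xT[of "fst p - 1"]] by simp
    qed
  qed
  have kn: "v j = b" if "set \<phi> \<subseteq> {..<k + 2}" "j < ?N" "kind (G ! j) = 0" "know (S \<phi>) j = Some b" for \<phi> j b
  proof (cases b)
    case True
    then have "\<exists>p\<in>set (S \<phi>). snd p = Suc j" using that(4) by (simp add: know_def split: if_splits)
    then obtain i where i: "i \<in> set \<phi>" "X i = Suc j" by (auto simp: S_def)
    then have "i \<noteq> 0" "i \<le> k" using that(2) by (auto simp: X_def split: if_splits)
    then have "xs ! (i - 1) = j" "i - 1 < k" using i(2) by (auto simp: X_def)
    then show ?thesis using Tb(3) xT[of "i - 1"] True by simp
  next
    case False
    then have "\<exists>p\<in>set (S \<phi>). \<exists>p'\<in>set (S \<phi>). fst p' = Suc (fst p) \<and> snd p < Suc j \<and> Suc j < snd p'"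
      using that(4) by (simp add: know_def split: if_splits)
    then obtain i where i: "i \<in> set \<phi>" "Suc i \<in> set \<phi>" "X i < Suc j" "Suc j < X (Suc i)" by (auto simp: S_def)
    have "\<not> v j"
    proof
      assume "v j"
      then have "j \<in> set xs" using that(2,3) xs(1) by (simp add: T_def)
      then obtain m where m: "m < k" "j = xs ! m" unfolding in_set_conv_nth using xs(3) by blast
      then have "X (Suc m) = Suc j" by (simp add: X_def)
      moreover have "i \<le> Suc k" using i(1) that(1) by auto
      ultimately have "i < Suc m" "Suc m < Suc i"
        using X_lt[of i "Suc m"] X_lt[of "Suc m" "Suc i"] i(3,4) m(1) by simp_all
      then show False by simp
    qed
    then show ?thesis using False by simp
  qed
  have "?N - 1 < ?N" using G(3) by simp
  from claims_exist[OF G(1,2) v(1) this d] v(2) obtain \<delta> where \<delta>: "length \<delta> < 2 ^ Suc d" "(?N - 1, True) \<in> set \<delta>"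
    "\<forall>c\<in>set \<delta>. fst c < ?N \<and> v (fst c) = snd c \<and> justified (\<lambda>i b. v i = b) G \<delta> (fst c) (snd c)" by auto
  \<comment> \<open>Vertices have lists of claims of one fixed length; repeating the output claim
    pads the list without changing its set.\<close>
  define \<gamma> where "\<gamma> = \<delta> @ replicate (2 ^ Suc d - length \<delta>) (?N - 1, True)"
  have \<gamma>: "length \<gamma> = 2 ^ Suc d" "set \<gamma> = set \<delta>" using \<delta>(1,2) by (auto simp: \<gamma>_def)
  have cl: "claims_ok G (keval (know (S \<phi>)) G) \<gamma>" if \<phi>: "set \<phi> \<subseteq> {..<k + 2}" for \<phi>
    unfolding claims_ok_def
  proof (intro conjI ballI)
    show "(?N - 1, True) \<in> set \<gamma>" using \<gamma>(2) \<delta>(2) by simp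
    let ?kv = "keval (know (S \<phi>)) G"
    have snd: "nth_default None ?kv i \<noteq> Some (\<not> v i)" if "i < ?N" for i
    proof
      assume "nth_default None ?kv i = Some (\<not> v i)"
      then have "?kv ! i = Some (\<not> v i)" using that by simp
      from keval_sound[OF G(1,2) v(1) kn[OF \<phi>] that this] show False by blast
    qed
    fix c assume "c \<in> set \<gamma>"
    then have c: "fst c < ?N" "v (fst c) = snd c" "justified (\<lambda>i b. v i = b) G \<delta> (fst c) (snd c)" using \<gamma>(2) \<delta>(3) by auto
    show "fst c < ?N" "nth_default None ?kv (fst c) \<noteq> Some (\<not> snd c)" using c snd[OF c(1)] by simp_all
    show "justified (\<lambda>i b. nth_default None ?kv i \<noteq> Some (\<not> b)) G \<gamma> (fst c) (snd c)"
    proof (rule justified_mono[OF c(3)])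
      fix i assume "i \<in> set (wires (nth_default [] G (fst c)))" "v i = snd c"
      then have "i < fst c" using G(1) c(1) by (simp add: wired_def)
      then show "nth_default None ?kv i \<noteq> Some (\<not> snd c)" using snd[of i] c(1) \<open>v i = snd c\<close> by simp
    qed (simp add: \<gamma>(2))
  qed
  define L where "L = {\<phi>. set \<phi> \<subseteq> {..<k + 2} \<and> length \<phi> = ?Q}"
  have "(S \<phi>, \<gamma>) \<in> set ?vs" if "\<phi> \<in> L" for \<phi>
  proof -
    have "X i < ?N + 2" if "i < k + 2" for i
    proof (cases "0 < i \<and> i \<le> k")
      case True
      then have "xs ! (i - 1) < ?N" by (intro Tb(1) xT) linarith
      then show ?thesis using True by (simp add: X_def)
    qed (use that in \<open>auto simp: X_def\<close>)
    then have "\<forall>p\<in>set (S \<phi>). fst p < k + 2 \<and> snd p < ?N + 2" using \<open>\<phi> \<in> L\<close> by (auto simp: S_def L_def)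
    then show ?thesis unfolding in_vertices vertex_ok_def
      using sl[of \<phi>] cl[of \<phi>] that \<gamma> \<delta>(3) by (simp add: L_def S_def)
  qed
  then have "\<forall>\<phi>\<in>L. \<exists>i. i < length ?vs \<and> ?vs ! i = (S \<phi>, \<gamma>)" by (simp add: in_set_conv_nth)
  from bchoice[OF this] obtain f where f: "\<forall>\<phi>\<in>L. f \<phi> < length ?vs \<and> ?vs ! f \<phi> = (S \<phi>, \<gamma>)" ..
  have fS: "map fst (S \<phi>) = \<phi>" for \<phi> by (simp add: S_def comp_def)
  have "inj_on f L"
  proof (rule inj_onI)
    fix \<phi> \<psi> assume "\<phi> \<in> L" "\<psi> \<in> L" "f \<phi> = f \<psi>"
    then have "(S \<phi>, \<gamma>) = (S \<psi>, \<gamma>)" using f by metis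
    then have "S \<phi> = S \<psi>" by simp
    then show "\<phi> = \<psi>" using fS by metis
  qed
  then have "card (f ` L) = card L" by (rule card_image)
  also have "card L = (k + 2) ^ ?Q" unfolding L_def using card_lists_length_eq[of "{..<k + 2}" ?Q] by simp
  finally have card: "card (f ` L) = (k + 2) ^ ?Q" .
  show ?thesis unfolding list_clique_def
  proof (intro exI[of _ "f ` L"] conjI ballI impI)
    show "f ` L \<subseteq> {..<length ?vs}" using f by auto
    show "card (f ` L) = (k + 2) ^ ?Q" by (rule card)
    fix i j assume "i \<in> f ` L" "j \<in> f ` L" "i \<noteq> j"
    then obtain \<phi> \<psi> where \<phi>: "\<phi> \<in> L" "\<psi> \<in> L" "i = f \<phi>" "j = f \<psi>" "\<phi> \<noteq> \<psi>" by auto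
    have "vertex_adj (S \<phi>, \<gamma>) (S \<psi>, \<gamma>)" unfolding vertex_adj_def using \<phi>(5) fS by (auto simp: S_def)
    then show "vertex_adj (?vs ! i) (?vs ! j)" using f \<phi> by simp
  qed
qed

section \<open>A clique yields a satisfying assignment\<close>

lemma eval_exists:
  assumes "wired G" "gshape G"
  shows "\<exists>v. (\<forall>j < length G. sem v j (G ! j)) \<and> (\<forall>j < length G. kind (G ! j) = 0 \<longrightarrow> v j = (j \<in> T))"
proof -
  define f where "f acc g = (if kind g = 0 then length acc \<in> T
     else if kind g = 1 then \<not> nth_default False acc (nth_default 0 (wires g) 0)
     else if \<forall>i\<in>set (wires g). nth_default False acc i = (kind g = 2) then kind g = 2 else kind g \<noteq> 2)"
    for acc and g :: "nat list"
  define v where "v j = (if j < length G then scan f G ! j else False)" for j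
  have acc: "nth_default False (take j (scan f G)) i = v i" if "j < length G" "i < j" for i j
    using that by (simp add: v_def)
  have vj: "v j = f (take j (scan f G)) (G ! j)" if "j < length G" for j
    using that scan_nth[OF that, of f] by (simp add: v_def)
  have "sem v j (G ! j)" if j: "j < length G" for j
  proof -
    have w: "nth_default False (take j (scan f G)) i = v i" if "i \<in> set (wires (G ! j))" for i
      using acc[OF j] assms(1) j that unfolding wired_def by blast
    consider "kind (G ! j) = 0" | "kind (G ! j) = 1" | "kind (G ! j) \<noteq> 0" "kind (G ! j) \<noteq> 1" by blast
    then show ?thesis
    proof cases
      case 2
      then have "wires (G ! j) \<noteq> []" using assms(2) j by (simp add: gshape_def)
      then obtain i "is" where "wires (G ! j) = i # is" by (cases "wires (G ! j)") auto
      then show ?thesis using 2 vj[OF j] w[of i] by (simp add: sem_def f_def)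
    next
      case 3
      have "(\<forall>i\<in>set (wires (G ! j)). nth_default False (take j (scan f G)) i = (kind (G ! j) = 2)) \<longleftrightarrow>
         (\<forall>i\<in>set (wires (G ! j)). v i = (kind (G ! j) = 2))" using w by simp
      then show ?thesis using 3 vj[OF j] by (simp add: sem_def f_def)
    qed (simp add: sem_def)
  qed
  moreover have "v j = (j \<in> T)" if "j < length G" "kind (G ! j) = 0" for j
    using that vj[OF that(1)] by (simp add: f_def)
  ultimately show ?thesis by blast
qed

lemma ex_last_step:
  assumes "P 0" "\<not> P (n :: nat)"
  shows "\<exists>i < n. P i \<and> \<not> P (Suc i)"
  using assms(2)
proof (induction n)
  case 0
  then show ?case using assms(1) by blast
next
  case (Suc n)
  show ?case
  proof (cases "P n")
    case True
    then show ?thesis using Suc.prems by blast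
  next
    case False
    then obtain i where "i < n" "P i" "\<not> P (Suc i)" using Suc.IH by blast
    then show ?thesis by (intro exI[of _ i]) simp
  qed
qed

text \<open>Height 0 for \<open>weft_cost\<close> means that only small gates lie below the node, so
  it depends on at most \<open>2 ^ e\<close> inputs. A true input is certified by its own slot, a
  false one by the two consecutive slots around it; every tuple that contains these indices
  determines the value.\<close>

lemma low_determined:
  assumes G: "wired G" "gshape G" and v: "\<And>j. j < length G \<Longrightarrow> sem v j (G ! j)"
    "\<And>j. j < length G \<Longrightarrow> kind (G ! j) = 0 \<Longrightarrow> v j \<longleftrightarrow> (\<exists>i. 0 < i \<and> i \<le> k \<and> X i = Suc j)"
    and X: "X 0 = 0" "X (Suc k) = Suc (length G)"
  shows "j < length G \<Longrightarrow> heights weft_cost G ! j = 0 \<Longrightarrow> heights depth_cost G ! j \<le> e \<Longrightarrow>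
    \<exists>\<phi>. length \<phi> \<le> 2 * 2 ^ e \<and> set \<phi> \<subseteq> {..<k + 2} \<and>
      (\<forall>s. (\<forall>p\<in>set s. snd p = X (fst p) \<and> fst p < k + 2) \<longrightarrow> set \<phi> \<subseteq> fst ` set s \<longrightarrow>
        keval (know s) G ! j = Some (v j))"
proof (induction j arbitrary: e rule: less_induct)
  case (less j)
  let ?g = "G ! j"
  let ?D = "\<lambda>j \<phi>. \<forall>s. (\<forall>p\<in>set s. snd p = X (fst p) \<and> fst p < k + 2) \<longrightarrow> set \<phi> \<subseteq> fst ` set s \<longrightarrow>
        keval (know s) G ! j = Some (v j)"
  show ?case
  proof (cases "kind ?g = 0")
    case True
    have kv: "keval (know s) G ! j = know s j" for s
      using keval_nth[OF G(1) less.prems(1), of "know s"] True by (simp add: Let_def)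
    have p1: "(1::nat) \<le> 2 ^ e" by simp
    show ?thesis
    proof (cases "v j")
      case vT: True
      then obtain i where i: "0 < i" "i \<le> k" "X i = Suc j" using v(2)[OF less.prems(1) True] by blast
      have "?D j [i]"
      proof (intro allI impI)
        fix s assume s: "\<forall>p\<in>set s. snd p = X (fst p) \<and> fst p < k + 2" "set [i] \<subseteq> fst ` set s"
        then obtain p where "p \<in> set s" "fst p = i" by auto
        then have "p \<in> set s \<and> snd p = Suc j" using s(1) i(3) by simp
        then have "\<exists>p\<in>set s. snd p = Suc j" by blast
        then show "keval (know s) G ! j = Some (v j)" unfolding kv know_def using vT by simp
      qed
      moreover have "length [i] \<le> 2 * 2 ^ e" using p1 unfolding list.size by linarith
      moreover have "set [i] \<subseteq> {..<k + 2}" using i by auto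
      ultimately show ?thesis by (intro exI[of _ "[i]"] conjI)
    next
      case vF: False
      \<comment> \<open>The sentinels enclose all nodes, so the sequence \<open>X\<close> passes
        \<open>Suc j\<close> at some step, and it skips that value because \<open>j\<close> is
        false.\<close>
      have "X 0 < Suc j" "\<not> X (Suc k) < Suc j" using X less.prems(1) by simp_all
      then obtain i where i: "i < Suc k" "X i < Suc j" "\<not> X (Suc i) < Suc j" using ex_last_step[of "\<lambda>i. X i < Suc j" "Suc k"] by blast
      have ne: "X i' \<noteq> Suc j" if "i' < k + 2" for i'
      proof
        assume e: "X i' = Suc j"
        have "i' \<noteq> 0" using e X(1) by (intro notI) simp
        moreover have "i' \<noteq> Suc k" using e X(2) less.prems(1) by (intro notI) simp
        ultimately have "0 < i' \<and> i' \<le> k" using that by simp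
        then show False using v(2)[OF less.prems(1) True] vF e by blast
      qed
      have "X (Suc i) \<noteq> Suc j" using i(1) by (intro ne) simp
      then have "Suc j < X (Suc i)" using i(3) by linarith
      have "?D j [i, Suc i]"
      proof (intro allI impI)
        fix s assume s: "\<forall>p\<in>set s. snd p = X (fst p) \<and> fst p < k + 2" "set [i, Suc i] \<subseteq> fst ` set s"
        then obtain p p' where p: "p \<in> set s" "fst p = i" "p' \<in> set s" "fst p' = Suc i" by auto
        have "\<not> (\<exists>p\<in>set s. snd p = Suc j)" using s(1) ne by auto
        moreover have "fst p' = Suc (fst p) \<and> snd p < Suc j \<and> Suc j < snd p'" using s(1) p i(2) \<open>Suc j < X (Suc i)\<close> by simp
        then have "\<exists>p\<in>set s. \<exists>p'\<in>set s. fst p' = Suc (fst p) \<and> snd p < Suc j \<and> Suc j < snd p'" using p by blast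
        ultimately show "keval (know s) G ! j = Some (v j)" unfolding kv know_def using vF by simp
      qed
      moreover have "length [i, Suc i] \<le> 2 * 2 ^ e" using p1 unfolding list.size by linarith
      moreover have "set [i, Suc i] \<subseteq> {..<k + 2}" using i by auto
      ultimately show ?thesis by (intro exI[of _ "[i, Suc i]"] conjI)
    qed
  next
    case False
    have wne: "wires ?g \<noteq> []" using G(2) less.prems(1) False by (simp add: gshape_def)
    have wi: "i < j" "i < length G" if "i \<in> set (wires ?g)" for i
      using G(1) less.prems(1) that unfolding wired_def by (blast, meson less_trans)
    have "weft_cost ?g = 0" using heights_nth[OF G(1) less.prems(1), of weft_cost] less.prems(2) by simp
    then have len: "length (wires ?g) \<le> 2" by (simp add: weft_cost_def)
    have dc: "depth_cost ?g = 1" using wne by (simp add: depth_cost_def)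
    obtain i0 where i0: "i0 \<in> set (wires ?g)" using wne by (cases "wires ?g") auto
    obtain e' where e': "e = Suc e'"
      using heights_wire[OF G(1) less.prems(1) i0, of depth_cost] dc less.prems(3) by (cases e) auto
    have "\<forall>i\<in>set (wires ?g). \<exists>\<phi>. length \<phi> \<le> 2 * 2 ^ e' \<and> set \<phi> \<subseteq> {..<k + 2} \<and> ?D i \<phi>"
    proof
      fix i assume i: "i \<in> set (wires ?g)"
      have "heights weft_cost G ! i = 0" using heights_wire[OF G(1) less.prems(1) i, of weft_cost] less.prems(2) by simp
      moreover have "heights depth_cost G ! i \<le> e'"
        using heights_wire[OF G(1) less.prems(1) i, of depth_cost] less.prems(3) dc e' by simp
      ultimately show "\<exists>\<phi>. length \<phi> \<le> 2 * 2 ^ e' \<and> set \<phi> \<subseteq> {..<k + 2} \<and> ?D i \<phi>"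
        using less.IH[OF wi(1)[OF i] wi(2)[OF i]] by blast
    qed
    from bchoice[OF this] obtain F where F: "\<forall>i\<in>set (wires ?g). length (F i) \<le> 2 * 2 ^ e' \<and> set (F i) \<subseteq> {..<k + 2} \<and> ?D i (F i)" ..
    let ?\<phi> = "concat (map F (wires ?g))"
    have "length (concat (map F is)) \<le> length is * (2 * 2 ^ e')" if "set is \<subseteq> set (wires ?g)" for "is"
      using that
    proof (induction "is")
      case (Cons i "is")
      then have "length (F i) \<le> 2 * 2 ^ e'" "length (concat (map F is)) \<le> length is * (2 * 2 ^ e')" using F by auto
      then show ?case by simp
    qed simp
    then have "length ?\<phi> \<le> length (wires ?g) * (2 * 2 ^ e')" by blast
    also have "\<dots> \<le> 2 * (2 * 2 ^ e')" using len by (rule mult_le_mono1)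
    finally have l: "length ?\<phi> \<le> 2 * 2 ^ e" by (simp add: e')
    have sub: "set ?\<phi> \<subseteq> {..<k + 2}" using F by auto
    have "?D j ?\<phi>"
    proof (intro allI impI)
      fix s assume s: "\<forall>p\<in>set s. snd p = X (fst p) \<and> fst p < k + 2" "set ?\<phi> \<subseteq> fst ` set s"
      show "keval (know s) G ! j = Some (v j)"
      proof (rule keval_step_complete[OF G less.prems(1) v(1)[OF less.prems(1)] False])
        fix i assume i: "i \<in> set (wires ?g)"
        then have "set (F i) \<subseteq> fst ` set s" using s(2) by auto
        then show "keval (know s) G ! i = Some (v i)" using F i s(1) by blast
      qed
    qed
    then show ?thesis using l sub by blast
  qed
qed

text \<open>The vertices of the clique have distinct index tuples and are as many as there are
  tuples, so every tuple occurs. Constant tuples define the guess, tuples with two indices show that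
  it is increasing, and the tuples of \<open>low_determined\<close> verify what a large gate
  requires of its inputs.\<close>

lemma sat_if_list_clique:
  assumes G: "wired G" "gshape G" "0 < length G" and d: "heights depth_cost G ! (length G - 1) \<le> d"
    and w: "heights weft_cost G ! (length G - 1) \<le> 1"
    and cl: "list_clique vertex_adj (vertices d G k) ((k + 2) ^ (2 * 2 ^ d))"
  shows "\<exists>v. (\<forall>j < length G. sem v j (G ! j)) \<and> v (length G - 1) \<and> card {j. j < length G \<and> kind (G ! j) = 0 \<and> v j} = k"
proof -
  let ?N = "length G" and ?Q = "2 * 2 ^ d :: nat" and ?vs = "vertices d G k"
  have Q2: "2 \<le> ?Q" by simp
  obtain W where W: "W \<subseteq> {..<length ?vs}" "card W = (k + 2) ^ ?Q"
    "\<forall>i\<in>W. \<forall>j\<in>W. i \<noteq> j \<longrightarrow> vertex_adj (?vs ! i) (?vs ! j)" using cl unfolding list_clique_def by blast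
  define L where "L = {\<phi>. set \<phi> \<subseteq> {..<k + 2} \<and> length \<phi> = ?Q}"
  define sl where "sl i = map fst (fst (?vs ! i))" for i
  have inV: "?vs ! i \<in> set ?vs" if "i \<in> W" for i using that W(1) by auto
  have vok: "vertex_ok G k (?vs ! i)" "sl i \<in> L" if "i \<in> W" for i
  proof -
    obtain s \<gamma> where e: "?vs ! i = (s, \<gamma>)" by fastforce
    have "(s, \<gamma>) \<in> set ?vs" using inV[OF that] e by simp
    then have 1: "vertex_ok G k (s, \<gamma>)" "length s = ?Q" "\<forall>p\<in>set s. fst p < k + 2 \<and> snd p < ?N + 2" unfolding in_vertices by blast+
    show "vertex_ok G k (?vs ! i)" using 1(1) e by simp
    show "sl i \<in> L" using 1(2,3) by (auto simp: L_def sl_def e)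
  qed
  have inj: "inj_on sl W"
  proof (rule inj_onI)
    fix i j assume ij: "i \<in> W" "j \<in> W" "sl i = sl j"
    show "i = j"
    proof (rule ccontr)
      assume "i \<noteq> j"
      then have "vertex_adj (?vs ! i) (?vs ! j)" using W(3) ij by blast
      then show False using ij(3) by (simp add: vertex_adj_def sl_def)
    qed
  qed
  have finL: "finite L" unfolding L_def by (rule finite_lists_length_eq) simp
  have cardL: "card L = (k + 2) ^ ?Q" unfolding L_def using card_lists_length_eq[of "{..<k + 2}" ?Q] by simp
  have "sl ` W \<subseteq> L" using vok(2) by blast
  moreover have "card (sl ` W) = card L" using card_image[OF inj] W(2) cardL by simp
  ultimately have im: "sl ` W = L" using card_subset_eq[OF finL] by blast
  have "W \<noteq> {}" using W(2) by auto
  then obtain i0 where i0: "i0 \<in> W" by blast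
  define \<gamma> where "\<gamma> = snd (?vs ! i0)"
  have g: "snd (?vs ! i) = \<gamma>" if "i \<in> W" for i
  proof (cases "i = i0")
    case False
    then have "vertex_adj (?vs ! i) (?vs ! i0)" using W(3) that i0 by blast
    then show ?thesis by (simp add: vertex_adj_def \<gamma>_def)
  qed (simp add: \<gamma>_def)
  have "\<forall>\<phi>\<in>L. \<exists>i\<in>W. sl i = \<phi>" using im by blast
  then have "\<forall>\<phi>\<in>L. \<exists>i. i \<in> W \<and> sl i = \<phi>" by blast
  from bchoice[OF this] obtain f where f: "\<forall>\<phi>\<in>L. f \<phi> \<in> W \<and> sl (f \<phi>) = \<phi>" ..
  define S where "S \<phi> = fst (?vs ! f \<phi>)" for \<phi>
  have S: "map fst (S \<phi>) = \<phi>" "slots_ok G k (S \<phi>)" "claims_ok G (keval (know (S \<phi>)) G) \<gamma>" if "\<phi> \<in> L" for \<phi>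
    using f that vok(1)[of "f \<phi>"] g[of "f \<phi>"] by (auto simp: S_def sl_def vertex_ok_def)
  have cons: "snd p = snd p'" if "\<phi> \<in> L" "\<psi> \<in> L" "p \<in> set (S \<phi>)" "p' \<in> set (S \<psi>)" "fst p = fst p'" for \<phi> \<psi> p p'
  proof (cases "f \<phi> = f \<psi>")
    case True
    then show ?thesis using S(2)[OF that(1)] that(3-5) unfolding slots_ok_def S_def by metis
  next
    case False
    then have "vertex_adj (?vs ! f \<phi>) (?vs ! f \<psi>)" using W(3) f that(1,2) by blast
    then show ?thesis using that(3-5) unfolding vertex_adj_def S_def by blast
  qed
  define X where "X i = snd (hd (S (replicate ?Q i)))" for i
  have rep: "replicate ?Q i \<in> L" if "i < k + 2" for i using that by (auto simp: L_def)
  have memS: "\<exists>p\<in>set (S \<phi>). fst p = i" if "\<phi> \<in> L" "i \<in> set \<phi>" for \<phi> i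
  proof -
    have "i \<in> set (map fst (S \<phi>))" using S(1)[OF that(1)] that(2) by simp
    then show ?thesis by auto
  qed
  have fstS: "fst p \<in> set \<phi>" if "\<phi> \<in> L" "p \<in> set (S \<phi>)" for \<phi> p
  proof -
    have "fst p \<in> set (map fst (S \<phi>))" using that(2) by simp
    then show ?thesis using S(1)[OF that(1)] by simp
  qed
  have SX: "snd p = X (fst p) \<and> fst p < k + 2" if "\<phi> \<in> L" "p \<in> set (S \<phi>)" for \<phi> p
  proof -
    have lt: "fst p < k + 2" using fstS[OF that] that(1) by (auto simp: L_def)
    have m: "map fst (S (replicate ?Q (fst p))) = replicate ?Q (fst p)" using S(1)[OF rep[OF lt]] .
    then have "S (replicate ?Q (fst p)) \<noteq> []" using Q2 by (metis length_map length_replicate list.size(3) not_numeral_le_zero)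
    then have h: "hd (S (replicate ?Q (fst p))) \<in> set (S (replicate ?Q (fst p)))" by simp
    have "fst (hd (S (replicate ?Q (fst p)))) = fst p" using fstS[OF rep[OF lt] h] by simp
    then show ?thesis using cons[OF that(1) rep[OF lt] that(2) h] lt by (simp add: X_def)
  qed
  have slX: "(i = 0 \<longrightarrow> X i = 0) \<and> (i = Suc k \<longrightarrow> X i = Suc ?N) \<and>
     (i \<noteq> 0 \<and> i \<noteq> Suc k \<longrightarrow> 0 < X i \<and> X i \<le> ?N \<and> kind (nth_default [] G (X i - 1)) = 0)" if i: "i < k + 2" for i
  proof -
    have "i \<in> set (replicate ?Q i)" by simp
    then obtain p where p: "p \<in> set (S (replicate ?Q i))" "fst p = i" using memS[OF rep[OF i]] by blast
    then show ?thesis using S(2)[OF rep[OF i]] SX[OF rep[OF i] p(1)] unfolding slots_ok_def by metis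
  qed
  have X0: "X 0 = 0" and Xk: "X (Suc k) = Suc ?N" using slX[of 0] slX[of "Suc k"] by auto
  have X_less: "X i < X i'" if "i < i'" "i' < k + 2" for i i'
  proof -
    \<comment> \<open>A single vertex that carries both indices; its own slots are ordered by
      \<open>slots_ok\<close>.\<close>
    have q: "i # replicate (?Q - 1) i' \<in> L" using that Q2 by (auto simp: L_def)
    have "?Q - 1 \<noteq> 0" using Q2 by linarith
    then have "i' \<in> set (i # replicate (?Q - 1) i')" by (simp only: list.set(2) insert_iff in_set_replicate) simp
    then obtain p p' where p: "p \<in> set (S (i # replicate (?Q - 1) i'))" "fst p = i"
      "p' \<in> set (S (i # replicate (?Q - 1) i'))" "fst p' = i'" using memS[OF q] by (metis list.set_intros(1))
    then have "snd p < snd p'" using S(2)[OF q] that(1) unfolding slots_ok_def by blast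
    then show ?thesis using SX[OF q p(1)] SX[OF q p(3)] p by simp
  qed
  define T where "T = (\<lambda>i. X i - 1) ` {1..k}"
  have Tin: "X i - 1 < ?N" "kind (G ! (X i - 1)) = 0" "0 < X i" if "i \<in> {1..k}" for i
    using slX[of i] that by (auto simp del: nth_default_simps)
  have "inj_on (\<lambda>i. X i - 1) {1..k}"
  proof (rule linorder_inj_onI')
    fix i j assume ij: "i \<in> {1..k}" "j \<in> {1..k}" "i < j"
    then have "X i < X j" using X_less by simp
    then show "X i - 1 \<noteq> X j - 1" using Tin(3)[OF ij(1)] by simp
  qed
  then have cardT: "card T = k" unfolding T_def by (simp add: card_image)
  obtain v where v: "\<forall>j < ?N. sem v j (G ! j)" "\<forall>j < ?N. kind (G ! j) = 0 \<longrightarrow> v j = (j \<in> T)"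
    using eval_exists[OF G(1,2), of T] by blast
  have "{j. j < ?N \<and> kind (G ! j) = 0 \<and> v j} = T" using v(2) Tin by (auto simp: T_def)
  then have card: "card {j. j < ?N \<and> kind (G ! j) = 0 \<and> v j} = k" using cardT by simp
  have vX: "v j \<longleftrightarrow> (\<exists>i. 0 < i \<and> i \<le> k \<and> X i = Suc j)" if "j < ?N" "kind (G ! j) = 0" for j
  proof -
    have "v j \<longleftrightarrow> (\<exists>i\<in>{1..k}. j = X i - 1)" using v(2) that by (auto simp: T_def)
    also have "\<dots> \<longleftrightarrow> (\<exists>i\<in>{1..k}. X i = Suc j)" using Tin(3) by (intro bex_cong) auto
    also have "\<dots> \<longleftrightarrow> (\<exists>i. 0 < i \<and> i \<le> k \<and> X i = Suc j)" by (auto simp: Suc_le_eq)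
    finally show ?thesis .
  qed
  have det: "\<exists>\<phi>\<in>L. keval (know (S \<phi>)) G ! j = Some (v j)"
    if jj: "j < ?N" "heights weft_cost G ! j = 0" "heights depth_cost G ! j \<le> d" for j
  proof -
    obtain \<phi>0 where \<phi>0: "length \<phi>0 \<le> ?Q" "set \<phi>0 \<subseteq> {..<k + 2}"
      "\<forall>s. (\<forall>p\<in>set s. snd p = X (fst p) \<and> fst p < k + 2) \<longrightarrow> set \<phi>0 \<subseteq> fst ` set s \<longrightarrow> keval (know s) G ! j = Some (v j)"
      using low_determined[OF G(1,2) v(1)[rule_format] vX X0 Xk jj] by blast
    let ?\<phi> = "\<phi>0 @ replicate (?Q - length \<phi>0) 0"
    have q: "?\<phi> \<in> L" using \<phi>0(1,2) by (auto simp: L_def)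
    have "set \<phi>0 \<subseteq> set (map fst (S ?\<phi>))" using S(1)[OF q] by simp
    then have "set \<phi>0 \<subseteq> fst ` set (S ?\<phi>)" by simp
    then have "keval (know (S ?\<phi>)) G ! j = Some (v j)" using \<phi>0(3) SX[OF q] by blast
    then show ?thesis using q by blast
  qed
  \<comment> \<open>Induction along the topological order. Wires only lower the two heights, so the
    bounds at the output pass down to every claim that is used.\<close>
  have true: "(j, b) \<in> set \<gamma> \<Longrightarrow> j < ?N \<Longrightarrow> heights weft_cost G ! j \<le> 1 \<Longrightarrow> heights depth_cost G ! j \<le> d \<Longrightarrow> v j = b" for j b
  proof (induction j arbitrary: b rule: less_induct)
    case (less j)
    let ?g = "G ! j"
    have nd: "nth_default [] G j = ?g" using less.prems by simp
    have wi: "i < j" "i < ?N" if "i \<in> set (wires ?g)" for i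
      using G(1) less.prems(2) that unfolding wired_def by (blast, meson less_trans)
    have hw: "heights weft_cost G ! i + weft_cost ?g \<le> 1" "heights depth_cost G ! i \<le> d" if "i \<in> set (wires ?g)" for i
      using heights_wire[OF G(1) less.prems(2) that, of weft_cost] heights_wire[OF G(1) less.prems(2) that, of depth_cost]
        less.prems(3,4) by linarith+
    have IH: "v i = b" if "i \<in> set (wires ?g)" "(i, b) \<in> set \<gamma>" for i b
      using less.IH[OF wi(1)[OF that(1)] that(2) wi(2)[OF that(1)]] hw[OF that(1)] by simp
    have chk: "nth_default None (keval (know (S \<phi>)) G) j \<noteq> Some (\<not> b)"
      "justified (\<lambda>i b. nth_default None (keval (know (S \<phi>)) G) i \<noteq> Some (\<not> b)) G \<gamma> j b" if "\<phi> \<in> L" for \<phi>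
      using S(3)[OF that] less.prems(1) unfolding claims_ok_def by auto
    have s: "sem v j ?g" using v(1) less.prems(2) by blast
    obtain \<phi>1 where \<phi>1: "\<phi>1 \<in> L" using rep[of 0] by auto
    consider "kind ?g = 0" | "kind ?g = 1" | "kind ?g \<noteq> 0" "kind ?g \<noteq> 1" by blast
    then show ?case
    proof cases
      case 1
      then have "heights weft_cost G ! j = 0"
        using heights_nth[OF G(1) less.prems(2), of weft_cost] by (simp add: weft_cost_def wires_def maxl_def)
      then obtain \<phi> where "\<phi> \<in> L" "keval (know (S \<phi>)) G ! j = Some (v j)" using det less.prems by blast
      then show ?thesis using chk(1)[of \<phi>] less.prems(2) by auto
    next
      case 2
      then have "length (wires ?g) = 1" using G(2) less.prems(2) by (simp add: gshape_def)
      then obtain i where i: "wires ?g = [i]" by (cases "wires ?g") auto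
      then have "(i, \<not> b) \<in> set \<gamma>" using chk(2)[OF \<phi>1] 2 unfolding justified_def Let_def nd by simp
      then have "v i = (\<not> b)" using IH i by simp
      then show ?thesis using s 2 i by (simp add: sem_def)
    next
      case 3
      have sj: "v j = (kind ?g = 2) \<longleftrightarrow> (\<forall>i\<in>set (wires ?g). v i = (kind ?g = 2))" using s 3 by (simp add: sem_def)
      show ?thesis
      proof (cases "b = (kind ?g = 2)")
        case False
        then obtain i where "i \<in> set (wires ?g)" "(i, b) \<in> set \<gamma>"
          using chk(2)[OF \<phi>1] 3 unfolding justified_def Let_def nd by auto
        then have "i \<in> set (wires ?g)" "v i = b" using IH by blast+
        then show ?thesis using sj False by blast
      next
        case True
        have "v i = b" if i: "i \<in> set (wires ?g)" for i
        proof (cases "\<forall>i\<in>set (wires ?g). (i, b) \<in> set \<gamma>")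
          case all: True
          then show ?thesis using IH i by blast
        next
          case nall: False
          \<comment> \<open>Here the gate contributes 1 to the weft, so nothing large lies below it.
            Some tuple determines the input \<open>i\<close>, and the vertex of that tuple has found
            the value \<open>b\<close> unrefuted.\<close>
          have lg: "2 < length (wires ?g)" "\<phi> \<in> L \<Longrightarrow> nth_default None (keval (know (S \<phi>)) G) i \<noteq> Some (\<not> b)" for \<phi>
            using chk(2)[OF \<phi>1] chk(2)[of \<phi>] 3 True nall i unfolding justified_def Let_def nd by auto
          have "weft_cost ?g = 1" using lg(1) by (simp add: weft_cost_def)
          then have "heights weft_cost G ! i = 0" using hw[OF i] by simp
          then obtain \<phi> where "\<phi> \<in> L" "keval (know (S \<phi>)) G ! i = Some (v i)" using det[OF wi(2)[OF i]] hw(2)[OF i] by blast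
          then show ?thesis using lg(2)[of \<phi>] wi(2)[OF i] by auto
        qed
        then show ?thesis using sj True by blast
      qed
    qed
  qed
  obtain \<phi>1 where \<phi>1: "\<phi>1 \<in> L" using rep[of 0] by auto
  have "(?N - 1, True) \<in> set \<gamma>" using S(3)[OF \<phi>1] unfolding claims_ok_def by blast
  then have "v (?N - 1) = True" using true[of "?N - 1" True] G(3) d w by simp
  then show ?thesis using v(1) card by blast
qed

subsection \<open>Parsing circuits\<close>

text \<open>The state holds the finished gates, the code being read and the number of wires still to
  come. A nonempty code with no wires to come waits for its length entry.\<close>

definition parse_gate :: "nat list list \<times> nat list \<times> nat \<Rightarrow> nat \<Rightarrow> nat list list \<times> nat list \<times> nat" where
  "parse_gate z a = (let gs = fst z; cur = fst (snd z); m = snd (snd z) in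
     if cur = [] then (if a = 0 then (gs @ [[0]], [], 0) else if a = 1 then (gs, [1], 1) else (gs, [a], 0))
     else if m = 0 then (if a = 0 then (gs @ [cur @ [0]], [], 0) else (gs, cur @ [a], a))
     else if m = 1 then (gs @ [cur @ [a]], [], 0) else (gs, cur @ [a], m - 1))"

definition parse_gates :: "nat list \<Rightarrow> nat list list" where
  "parse_gates ns = fst (foldl parse_gate ([], [], 0) ns)"

lemma parse_gate_args:
  "cur \<noteq> [] \<Longrightarrow> js \<noteq> [] \<Longrightarrow> foldl parse_gate (gs, cur, length js) js = (gs @ [cur @ js], [], 0)"
proof (induction js arbitrary: cur)
  case (Cons a js)
  show ?case
  proof (cases js)
    case Nil
    then show ?thesis using Cons.prems by (simp add: parse_gate_def)
  next
    case (Cons b js')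
    then have "parse_gate (gs, cur, length (a # js)) a = (gs, cur @ [a], length js)"
      using \<open>cur \<noteq> []\<close> by (simp add: parse_gate_def)
    then show ?thesis using Cons.IH[of "cur @ [a]"] Cons by simp
  qed
qed simp

lemma parse_gate_enc: "foldl parse_gate (gs, [], 0) (enc_gate g) = (gs @ [enc_gate g], [], 0)"
proof -
  have c: "foldl parse_gate (gs, [], 0) (a # length is # is) = (gs @ [a # length is # is], [], 0)" if "2 \<le> a" for a "is"
  proof -
    have 1: "parse_gate (gs, [], 0) a = (gs, [a], 0)" using that by (simp add: parse_gate_def)
    show ?thesis
    proof (cases "is = []")
      case True
      then show ?thesis using 1 by (simp add: parse_gate_def)
    next
      case False
      then have "parse_gate (gs, [a], 0) (length is) = (gs, [a, length is], length is)" by (simp add: parse_gate_def)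
      then show ?thesis using 1 parse_gate_args[of "[a, length is]" "is" gs] False by simp
    qed
  qed
  show ?thesis
  proof (cases g)
    case InputG
    then show ?thesis by (simp add: enc_gate.simps parse_gate_def)
  next
    case (NotG i)
    have "parse_gate (gs, [], 0) 1 = (gs, [1], length [i])" by (simp add: parse_gate_def)
    then show ?thesis using parse_gate_args[of "[1]" "[i]" gs] NotG by (simp add: enc_gate.simps)
  next
    case (AndG "is")
    then show ?thesis using c[of 2 "is"] by (simp add: enc_gate.simps)
  next
    case (OrG "is")
    then show ?thesis using c[of 3 "is"] by (simp add: enc_gate.simps)
  qed
qed

lemma parse_gates_codes: "parse_gates (concat (codes C)) = codes C"
proof -
  have "foldl parse_gate (gs, [], 0) (concat (codes C)) = (gs @ codes C, [], 0)" for gs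
    by (induction C arbitrary: gs) (simp_all add: codes_def parse_gate_enc)
  then show ?thesis by (simp add: parse_gates_def)
qed

lemma pt_parse_gates [pt_intros]:
  assumes "pt f"
  shows "pt (\<lambda>x. parse_gates (f x))"
proof -
  have "pt (\<lambda>x. foldl parse_gate ([], [], 0) (f x))"
  proof (rule pt_foldl_add[where q = "\<lambda>x. 3 * sz (f x) + 20"])
    show "pt (\<lambda>p. parse_gate (fst (snd p)) (snd (snd p)))" unfolding parse_gate_def by (intro pt_intros)
    show "sz (parse_gate a y) \<le> sz a + (3 * sz (f x) + 20)" if "y \<in> set (f x)" for x a y
    proof -
      have y: "1 + 2 * y < sz (f x)" using sz_elem[OF that] by simp
      obtain gs cur m where a: "a = (gs, cur, m)" by (cases a) auto
      have 1: "sz (gs @ [c]) = sz gs + sz c + 1" for c using sz_append[of gs "[c]"] by simp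
      have 2: "sz (cur @ [y]) = sz cur + 2 * y + 2" for y using sz_append[of cur "[y]"] by simp
      show ?thesis using y sz_pos[of cur] by (auto simp: parse_gate_def a 1 2)
    qed
  qed (intro pt_intros assms pbd_intros pb_sz_pt)+
  then show ?thesis unfolding parse_gates_def by (intro pt_intros)
qed

definition valid_gate :: "nat list \<Rightarrow> bool" where
  "valid_gate g \<longleftrightarrow> g = [0] \<or> (length g = 2 \<and> kind g = 1) \<or>
     ((kind g = 2 \<or> kind g = 3) \<and> 2 \<le> length g \<and> nth_default 0 g 1 = length g - 2)"

lemma valid_gate_iff: "valid_gate g \<longleftrightarrow> (\<exists>h. g = enc_gate h)"
proof
  assume "valid_gate g"
  then consider "g = [0]" | "length g = 2" "kind g = 1"
    | "kind g = 2 \<or> kind g = 3" "2 \<le> length g" "nth_default 0 g 1 = length g - 2" by (auto simp: valid_gate_def)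
  then show "\<exists>h. g = enc_gate h"
  proof cases
    case 1
    then show ?thesis by (intro exI[of _ InputG]) (simp add: enc_gate.simps)
  next
    case 2
    then obtain a i where "g = [a, i]" by (cases g; cases "tl g") auto
    then show ?thesis using 2 by (intro exI[of _ "NotG i"]) (simp add: enc_gate.simps kind_def)
  next
    case 3
    then obtain a l "is" where g: "g = a # l # is" by (cases g; cases "tl g") auto
    then have "l = length is" using 3(3) by (simp add: nth_default_def)
    then show ?thesis using 3(1) g by (auto simp: kind_def enc_gate.simps intro: exI[of _ "AndG is"] exI[of _ "OrG is"])
  qed
next
  assume "\<exists>h. g = enc_gate h"
  then obtain h where "g = enc_gate h" by blast
  then show "valid_gate g" by (cases h) (simp_all add: valid_gate_def enc_gate.simps kind_def nth_default_def)
qed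

lemma distinct_iff_filter: "distinct xs \<longleftrightarrow> (\<forall>a\<in>set xs. length (filter (\<lambda>b. b = a) xs) \<le> 1)"
proof (induction xs)
  case (Cons x xs)
  have e: "filter (\<lambda>b. b = x) xs = [] \<longleftrightarrow> x \<notin> set xs" by (auto simp: filter_empty_conv)
  show ?case
  proof (cases "x \<in> set xs")
    case True
    then have "filter (\<lambda>b. b = x) xs \<noteq> []" using e by blast
    then show ?thesis using True by auto
  next
    case False
    then have "length (filter (\<lambda>b. b = a) (x # xs)) = length (filter (\<lambda>b. b = a) xs)" if "a \<in> set xs" for a using that by auto
    then show ?thesis using Cons False e by simp
  qed
qed simp

definition wf_codes :: "nat list list \<Rightarrow> bool" where
  "wf_codes G \<longleftrightarrow> \<not> G = [] \<and> (\<forall>j\<in>set [0..<length G].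
     (2 \<le> kind (nth_default [] G j) \<longrightarrow> 2 \<le> length (wires (nth_default [] G j)) \<and>
        (\<forall>a\<in>set (wires (nth_default [] G j)). length (filter (\<lambda>b. b = a) (wires (nth_default [] G j))) \<le> 1)) \<and>
     (\<forall>i\<in>set (wires (nth_default [] G j)). i < j))"

lemma wf_codes_iff: "wf_codes (codes C) \<longleftrightarrow> wf_circuit C"
proof -
  have g: "wf_gate h \<longleftrightarrow> (2 \<le> kind (enc_gate h) \<longrightarrow> 2 \<le> length (in_wires h) \<and> distinct (in_wires h))" for h
    by (cases h) auto
  have "wf_codes (codes C) \<longleftrightarrow> C \<noteq> [] \<and> (\<forall>j < length C. wf_gate (C ! j) \<and> (\<forall>i\<in>set (in_wires (C ! j)). i < j))"
    unfolding wf_codes_def g distinct_iff_filter by (simp add: codes_def Ball_def)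
  then show ?thesis by (simp add: wf_circuit_def)
qed

text \<open>The parser accepts every list of numbers, so its result is encoded again and compared
  with \<open>x\<close>. Together with the test of the gates this singles out the words that are
  codes of circuits.\<close>

definition good_circuit :: "nat \<Rightarrow> bool list \<Rightarrow> nat list list \<Rightarrow> bool" where
  "good_circuit d x G \<longleftrightarrow> x = enc_nats (concat G) \<and> (\<forall>g\<in>set G. valid_gate g) \<and> wf_codes G \<and>
     nth_default 0 (heights weft_cost G) (length G - 1) \<le> 1 \<and> nth_default 0 (heights depth_cost G) (length G - 1) \<le> d"

lemma good_circuit_codes:
  "good_circuit d (enc_circuit C) (codes C) \<longleftrightarrow> wf_circuit C \<and> weft_le C 1 \<and> depth_le C d"
proof (cases "wf_circuit C")
  case True
  then have "length C - 1 < length (codes C)" by (simp add: wf_circuit_def codes_def)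
  moreover have "\<forall>g\<in>set (codes C). valid_gate g" by (auto simp: codes_def valid_gate_iff)
  moreover have "length (codes C) = length C" by (simp add: codes_def)
  ultimately show ?thesis using True unfolding good_circuit_def wf_codes_iff depth_weft_codes[OF True]
    by (simp add: enc_circuit_def codes_def[symmetric])
next
  case False
  then show ?thesis unfolding good_circuit_def wf_codes_iff by simp
qed

lemma wcs_iff:
  "(x, k) \<in> wcs 1 d \<longleftrightarrow> good_circuit d x (parse_gates (dec_nats x)) \<and>
     list_clique vertex_adj (vertices d (parse_gates (dec_nats x)) k) ((k + 2) ^ (2 * 2 ^ d))"
proof -
  have main: "weighted_sat C k \<longleftrightarrow> list_clique vertex_adj (vertices d (codes C) k) ((k + 2) ^ (2 * 2 ^ d))"
    if C: "wf_circuit C" "weft_le C 1" "depth_le C d" for C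
  proof -
    have G: "wired (codes C)" "gshape (codes C)" "0 < length (codes C)"
      using wf_circuit_codes(1) gshape_codes C(1) by (auto simp: wf_circuit_def codes_def)
    have l: "length (codes C) = length C" by (simp add: codes_def)
    have h: "heights depth_cost (codes C) ! (length (codes C) - 1) \<le> d" "heights weft_cost (codes C) ! (length (codes C) - 1) \<le> 1"
      using depth_weft_codes[OF C(1)] C(2,3) by (simp_all add: l)
    have set: "{j. j < length C \<and> C ! j = InputG \<and> v j} = {j. j < length C \<and> kind (codes C ! j) = 0 \<and> v j}" for v
    proof -
      have "C ! j = InputG \<longleftrightarrow> kind (codes C ! j) = 0" if "j < length C" for j
        using that by (cases "C ! j") (simp_all add: codes_def)
      then show ?thesis by blast
    qed
    have sem: "(\<forall>j < length C. gate_holds v j (C ! j)) \<longleftrightarrow> (\<forall>j < length C. sem v j (codes C ! j))" for v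
      using sem_codes by blast
    show ?thesis
    proof
      assume "weighted_sat C k"
      then obtain v where v: "\<forall>j < length C. sem v j (codes C ! j)" "v (length C - 1)"
        "card {j. j < length C \<and> kind (codes C ! j) = 0 \<and> v j} = k"
        unfolding weighted_sat_def sem set by (elim exE conjE) (rule that)
      show "list_clique vertex_adj (vertices d (codes C) k) ((k + 2) ^ (2 * 2 ^ d))"
        by (rule list_clique_if_sat[OF G h(1), of v]) (use v in \<open>simp_all add: l\<close>)
    next
      assume "list_clique vertex_adj (vertices d (codes C) k) ((k + 2) ^ (2 * 2 ^ d))"
      from sat_if_list_clique[OF G h this] show "weighted_sat C k" unfolding weighted_sat_def sem set l .
    qed
  qed
  have pc: "parse_gates (dec_nats (enc_circuit C)) = codes C" for C
    unfolding enc_circuit_def dec_enc_nats codes_def[symmetric] by (rule parse_gates_codes)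
  show ?thesis
  proof
    assume "(x, k) \<in> wcs 1 d"
    then obtain C where C: "x = enc_circuit C" "wf_circuit C" "weft_le C 1" "depth_le C d" "weighted_sat C k"
      unfolding wcs_def by blast
    then show "good_circuit d x (parse_gates (dec_nats x)) \<and>
     list_clique vertex_adj (vertices d (parse_gates (dec_nats x)) k) ((k + 2) ^ (2 * 2 ^ d))"
      unfolding C(1) pc using main[OF C(2-4)] good_circuit_codes[of d C] C(2-5) by simp
  next
    assume a: "good_circuit d x (parse_gates (dec_nats x)) \<and>
     list_clique vertex_adj (vertices d (parse_gates (dec_nats x)) k) ((k + 2) ^ (2 * 2 ^ d))"
    let ?G = "parse_gates (dec_nats x)"
    have "\<forall>g\<in>set ?G. \<exists>h. g = enc_gate h" using a unfolding good_circuit_def valid_gate_iff by blast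
    from bchoice[OF this] obtain h where h: "\<forall>g\<in>set ?G. g = enc_gate (h g)" ..
    then have G: "?G = codes (map h ?G)" unfolding codes_def map_map by (intro map_idI[symmetric]) simp
    then obtain C where C: "?G = codes C" by blast
    have g: "good_circuit d x (codes C)" and l: "list_clique vertex_adj (vertices d (codes C) k) ((k + 2) ^ (2 * 2 ^ d))"
      using a unfolding C by (rule conjunct1, rule conjunct2)
    have x: "x = enc_circuit C" using g by (simp add: good_circuit_def enc_circuit_def codes_def)
    have w: "wf_circuit C \<and> weft_le C 1 \<and> depth_le C d"
      using g unfolding x by (rule iffD1[OF good_circuit_codes])
    then have "weighted_sat C k" using l main[of C] by simp
    then show "(x, k) \<in> wcs 1 d" using w unfolding wcs_def x by blast
  qed
qed


subsection \<open>The reduction in polynomial time\<close>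

lemma pt_heights:
  assumes "pt c" "\<And>g. c g \<le> 1" "pt f"
  shows "pt (\<lambda>x. heights c (f x))"
  unfolding heights_def
proof (rule pt_scan[where B = "\<lambda>x. 1 + 2 * (sz (f x) + 1)"])
  show "sz (scan (\<lambda>acc g. c g + maxl (map (nth_default 0 acc) (wires g))) (f x) ! j) \<le> 1 + 2 * (sz (f x) + 1)"
    if "j < length (f x)" for x j
    using heights_le[of c j "f x", OF assms(2) that] length_le_sz[of "f x"] that by (simp add: heights_def)
qed (intro pt_intros pt_comp[OF assms(1)] assms(3) pbd_intros pb_sz_pt)+

lemma pt_know: "pt (\<lambda>p. know (fst p) (snd p))"
  unfolding know_def by (intro pt_intros)

lemma pt_keval:
  assumes "pt s" "pt f"
  shows "pt (\<lambda>x. keval (know (s x)) (f x))"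
  unfolding keval_def
proof (rule pt_scan[where B = "\<lambda>x. 5"])
  show "pt (\<lambda>p. kstep (know (s (fst p))) (fst (snd p)) (snd (snd p)))"
    unfolding kstep_def by (intro pt_intros pt2[of know, OF pt_know] pt_comp[OF assms(1)])
qed (intro pt_intros assms pbd_intros sz_sym)+

lemma pt_vertex_ok: "pt (\<lambda>p. vertex_ok (fst p) (fst (snd p)) (snd (snd p)))"
  unfolding vertex_ok_def slots_ok_def claims_ok_def justified_def
  by (intro pt_intros pt_keval)

lemma pt_vertices:
  assumes "pt f" "pt k"
  shows "pt (\<lambda>x. vertices d (f x) (k x))"
  unfolding vertices_def
  by (intro pt_filter pt_product pt_n_lists pt3[of vertex_ok, OF pt_vertex_ok] pt_intros assms pt_comp[OF assms(1)] pt_comp[OF assms(2)])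

lemma pt_good_circuit:
  assumes "pt x" "pt f"
  shows "pt (\<lambda>y. good_circuit d (x y) (f y))"
proof -
  have w: "pt weft_cost" "pt depth_cost" unfolding weft_cost_def depth_cost_def by (intro pt_intros)+
  show ?thesis unfolding good_circuit_def valid_gate_def wf_codes_def
    by (intro pt_intros assms pt_heights[OF w(1)] pt_heights[OF w(2)] pt_comp[OF assms(2)])
      (simp_all add: weft_cost_def depth_cost_def)
qed

text \<open>A malformed instance is sent to the empty list of vertices, which has no clique because
  \<open>m\<close> is positive.\<close>

definition wcs_reduction :: "nat \<Rightarrow> bool list \<Rightarrow> bool list" where
  "wcs_reduction d w = (let x = inst_word w; k = inst_param w; G = parse_gates (dec_nats x); m = (k + 2) ^ (2 * 2 ^ d) in
     enc_inst (swap_inst vertex_adj (if good_circuit d x G then vertices d G k else []) m) (2 * m))"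

lemma pt_wcs_reduction: "pt (wcs_reduction d)"
proof -
  have a: "pt (\<lambda>p. vertex_adj (fst (snd p)) (snd (snd p)))" for p :: "unit itself" unfolding vertex_adj_def by (intro pt_intros)
  show ?thesis unfolding wcs_reduction_def Let_def
    by (intro pt_intros pt_swap_inst pt_pow pt_vertices pt_good_circuit) (auto simp: vertex_adj_def intro!: pt_intros)
qed

lemma wcs_reduction_correct:
  assumes "3 \<le> r"
  obtains x' where "wcs_reduction d (enc_inst x k) = enc_inst x' (2 * (k + 2) ^ (2 * 2 ^ d))"
    "(x, k) \<in> wcs 1 d \<longleftrightarrow> (x', 2 * (k + 2) ^ (2 * 2 ^ d)) \<in> r_swap r"
proof -
  let ?m = "(k + 2) ^ (2 * 2 ^ d)" and ?G = "parse_gates (dec_nats x)"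
  let ?vs = "if good_circuit d x ?G then vertices d ?G k else []"
  have m: "0 < ?m" by simp
  have "\<not> list_clique vertex_adj [] ?m" using m by (auto simp: list_clique_def)
  then have "(x, k) \<in> wcs 1 d \<longleftrightarrow> list_clique vertex_adj ?vs ?m" unfolding wcs_iff by simp
  also have "\<dots> \<longleftrightarrow> (swap_inst vertex_adj ?vs ?m, 2 * ?m) \<in> r_swap r" using swap_inst_iff[OF assms m] by blast
  finally show ?thesis by (intro that[of "swap_inst vertex_adj ?vs ?m"]) (simp_all add: wcs_reduction_def Let_def)
qed

text \<open>A parameterized reduction asks for computable bounds, and composition changes the given
  ones by polynomials. The unknown running time of the machine for \<open>f\<close> merely serves as
  an allowance.\<close>

lemma computable_pt:
  assumes "computable f" "pt h"
  shows "computable (\<lambda>n. h (f n))"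
proof -
  obtain M where M: "wf_tm M" "\<forall>n. \<exists>t. computes_within M (replicate n True) (replicate (f n) True) t"
    using assms(1) unfolding computable_def by blast
  from choice[OF M(2)] obtain t where t: "\<forall>n. computes_within M (replicate n True) (replicate (f n) True) (t n)" ..
  define D where "D w \<longleftrightarrow> w = replicate (length w) True" for w
  have tm: "computes_within M w (replicate (f (length w)) True) (t (length w))" if "D w" for w
    using t[rule_format, of "length w"] that unfolding D_def by simp
  have "tc (\<lambda>w. replicate (f (length w)) True) D (\<lambda>w. t (length w))"
    by (rule tc_of_tm[OF M(1)]) (rule tm)
  moreover have "pt (\<lambda>w :: bool list. replicate (h (length w)) True)" by (intro pt_intros pt_comp[OF assms(2)])
  ultimately have "tc (\<lambda>w. replicate (h (length (replicate (f (length w)) True))) True) D (\<lambda>w. t (length w) + 0)"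
    by (rule tc_comp[where g = "\<lambda>w. replicate (h (length w)) True" and E = "\<lambda>_. True", OF _ tc_pt]) simp
  then obtain M' a where M': "wf_tm M'" "\<And>w. D w \<Longrightarrow> computes_within M' w (replicate (h (length (replicate (f (length w)) True))) True)
     ((length w + (t (length w) + 0) + 2) ^ a)" by (rule tc_tm) (rule that)
  have "\<exists>t. computes_within M' (replicate n True) (replicate (h (f n)) True) t" for n
    using M'(2)[of "replicate n True"] by (auto simp: D_def)
  then show ?thesis unfolding computable_def using M'(1) by blast
qed

text \<open>The given reduction to \<open>wcs 1 d\<close> is simulated inside the calculus and
  followed by \<open>wcs_reduction d\<close>. As \<open>d\<close> is fixed for the problem
  \<open>A\<close>, the exponent \<open>2 * 2 ^ d\<close> is a constant and the new parameter is
  bounded through \<open>g\<close>.\<close>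

theorem W1_hard_r_swap:
  assumes "3 \<le> r"
  shows "W_hard 1 (r_swap r)"
  unfolding W_hard_def
proof
  fix A assume "A \<in> W_class 1"
  then obtain d where "fpt_reducible A (wcs 1 d)" unfolding W_class_def by blast
  then obtain M f g c where M: "wf_tm M" "computable f" "computable g"
    "\<forall>x k. \<exists>x' k'. computes_within M (enc_inst x k) (enc_inst x' k') (f k * length (enc_inst x k) ^ c) \<and>
        ((x, k) \<in> A \<longleftrightarrow> (x', k') \<in> wcs 1 d) \<and> k' \<le> g k" unfolding fpt_reducible_def by blast
  define Q where "Q = (2 * 2 ^ d :: nat)"
  have "\<forall>p. \<exists>q. computes_within M (enc_inst (fst p) (snd p)) (enc_inst (fst q) (snd q)) (f (snd p) * length (enc_inst (fst p) (snd p)) ^ c) \<and>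
     (p \<in> A \<longleftrightarrow> q \<in> wcs 1 d) \<and> snd q \<le> g (snd p)" using M(4) by (metis fst_conv snd_conv surj_pair)
  from choice[OF this] obtain h where h: "\<And>p. computes_within M (enc_inst (fst p) (snd p)) (enc_inst (fst (h p)) (snd (h p)))
      (f (snd p) * length (enc_inst (fst p) (snd p)) ^ c)" "\<And>p. p \<in> A \<longleftrightarrow> h p \<in> wcs 1 d" "\<And>p. snd (h p) \<le> g (snd p)" by blast
  define D where "D w \<longleftrightarrow> w = enc_inst (inst_word w) (inst_param w)" for w
  define H where "H w = h (inst_word w, inst_param w)" for w
  define T where "T w = f (inst_param w) * length w ^ c" for w
  have tm: "computes_within M w (enc_inst (fst (H w)) (snd (H w))) (T w)" if "D w" for w
    using h(1)[of "(inst_word w, inst_param w)"] that unfolding D_def H_def T_def by simp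
  have "tc (\<lambda>w. enc_inst (fst (H w)) (snd (H w))) D T"
    by (rule tc_of_tm[OF M(1)]) (rule tm)
  then have "tc (\<lambda>w. wcs_reduction d (enc_inst (fst (H w)) (snd (H w)))) D (\<lambda>w. T w + 0)"
    by (rule tc_comp[where E = "\<lambda>_. True", OF _ tc_pt[OF pt_wcs_reduction]]) simp
  then obtain M' a where M': "wf_tm M'" "\<And>w. D w \<Longrightarrow> computes_within M' w (wcs_reduction d (enc_inst (fst (H w)) (snd (H w))))
     ((length w + (T w + 0) + 2) ^ a)" by (rule tc_tm) (rule that)
  have c1: "computable (\<lambda>k. (f k + 3) ^ a)" by (rule computable_pt[OF M(2)]) (intro pt_pow pt_intros)
  have c2: "computable (\<lambda>k. 2 * (g k + 2) ^ Q)" by (rule computable_pt[OF M(3)]) (intro pt_pow pt_intros)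
  show "fpt_reducible A (r_swap r)" unfolding fpt_reducible_def
  proof (rule exI[of _ M'], rule exI[of _ "\<lambda>k. (f k + 3) ^ a"], rule exI[of _ "\<lambda>k. 2 * (g k + 2) ^ Q"],
      rule exI[of _ "(c + 1) * a"], intro conjI allI)
    fix x k
    let ?w = "enc_inst x k"
    have D: "D ?w" by (simp add: D_def)
    have H: "H ?w = h (x, k)" by (simp add: H_def)
    obtain x' where x': "wcs_reduction d (enc_inst (fst (H ?w)) (snd (H ?w))) = enc_inst x' (2 * (snd (H ?w) + 2) ^ Q)"
      "(fst (H ?w), snd (H ?w)) \<in> wcs 1 d \<longleftrightarrow> (x', 2 * (snd (H ?w) + 2) ^ Q) \<in> r_swap r"
      unfolding Q_def by (rule wcs_reduction_correct[OF assms])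
    let ?l = "length ?w"
    have l: "1 \<le> ?l" by (simp add: length_enc_inst)
    have lc: "?l \<le> ?l ^ (c + 1)" "?l ^ c \<le> ?l ^ (c + 1)" "2 \<le> 2 * ?l ^ (c + 1)" using l by (simp_all add: self_le_power power_increasing)
    \<comment> \<open>Each summand is compared with \<open>?l ^ (c + 1)\<close>: the length
      contributes 1, the given machine \<open>f k\<close> and the constant 2, which makes the factor
      \<open>f k + 3\<close>.\<close>
    have "?l + T ?w + 2 \<le> ?l ^ (c + 1) + f k * ?l ^ (c + 1) + 2 * ?l ^ (c + 1)"
      unfolding T_def using lc by (intro add_mono mult_le_mono) simp_all
    also have "\<dots> = (f k + 3) * ?l ^ (c + 1)" by (simp add: algebra_simps)
    finally have "(?l + (T ?w + 0) + 2) ^ a \<le> ((f k + 3) * ?l ^ (c + 1)) ^ a" by (intro power_mono) simp_all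
    also have "\<dots> = (f k + 3) ^ a * ?l ^ ((c + 1) * a)" by (simp only: power_mult_distrib power_mult)
    finally have "computes_within M' ?w (enc_inst x' (2 * (snd (H ?w) + 2) ^ Q)) ((f k + 3) ^ a * ?l ^ ((c + 1) * a))"
      using computes_within_mono[OF M'(2)[OF D]] x'(1) by simp
    moreover have "(x, k) \<in> A \<longleftrightarrow> (x', 2 * (snd (H ?w) + 2) ^ Q) \<in> r_swap r"
      using h(2)[of "(x, k)"] x'(2) by (simp add: H)
    moreover have "2 * (snd (H ?w) + 2) ^ Q \<le> 2 * (g k + 2) ^ Q"
      using h(3)[of "(x, k)"] by (simp add: H power_mono)
    ultimately show "\<exists>x' k'. computes_within M' ?w (enc_inst x' k') ((f k + 3) ^ a * ?l ^ ((c + 1) * a)) \<and>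
        ((x, k) \<in> A \<longleftrightarrow> (x', k') \<in> r_swap r) \<and> k' \<le> 2 * (g k + 2) ^ Q" by blast
  qed (use M'(1) c1 c2 in simp_all)
qed

section \<open>Sparsification\<close>

definition subsume :: "nat set set \<Rightarrow> nat set set" where
  "subsume F = {C \<in> F. \<not> (\<exists>C'\<in>F. C' \<subset> C)}"

text \<open>A sunflower in the weak sense: its clauses share the heart \<open>H\<close>, but the
  petals \<open>C - H\<close> may overlap. One branch asserts the heart, the other asserts all
  petals.\<close>

definition petals :: "nat set set \<Rightarrow> nat \<Rightarrow> nat set \<Rightarrow> nat set set" where
  "petals F c H = {C \<in> F. card C = c \<and> H \<subseteq> C}"

definition branch_heart :: "nat set set \<Rightarrow> nat set \<Rightarrow> nat set set" where
  "branch_heart F H = subsume (insert H F)"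

definition branch_petals :: "nat set set \<Rightarrow> nat \<Rightarrow> nat set \<Rightarrow> nat set set" where
  "branch_petals F c H = subsume (F \<union> (\<lambda>C. C - H) ` petals F c H)"

definition degree_added :: "nat set set \<Rightarrow> nat set set \<Rightarrow> nat \<Rightarrow> nat" where
  "degree_added G F p = card {C \<in> F. card C = 2 \<and> p \<in> C \<and> C \<notin> G}"

definition added :: "nat set set \<Rightarrow> nat set set \<Rightarrow> nat set set" where
  "added G F = {C \<in> F. card C = 2 \<and> C \<notin> G}"

definition unit_lits :: "nat set set \<Rightarrow> nat set" where "unit_lits F = {l. {l} \<in> F}"

text \<open>\<open>G\<close> is the initial formula; only the 2-clauses that were added since then are charged.\<close>

definition sparse_inv :: "nat \<Rightarrow> nat \<Rightarrow> nat set set \<Rightarrow> nat set set \<Rightarrow> bool" where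
  "sparse_inv N D G F \<longleftrightarrow> (\<forall>C\<in>F. C \<subseteq> {..<N} \<and> card C \<le> 3) \<and> (\<forall>C\<in>F. \<forall>C'\<in>F. \<not> C' \<subset> C) \<and>
     (\<forall>C\<in>G. \<exists>C'\<in>F. C' \<subseteq> C) \<and> (\<forall>p. degree_added G F p \<le> D)"

text \<open>A literal without a unit clause is worth \<open>x\<close> for the unit clause it may
  still get, and \<open>y\<close> for each of the up to \<open>D\<close> added 2-clauses that such a
  unit clause may destroy. Each new unit clause thus lowers the potential by at least
  \<open>x\<close>, and each new pair lowers it by \<open>y\<close>.\<close>

definition potential :: "nat \<Rightarrow> nat \<Rightarrow> real \<Rightarrow> real \<Rightarrow> nat set set \<Rightarrow> nat set set \<Rightarrow> real" where
  "potential N D x y G F = (x + y * real D) * (real N - real (card (unit_lits F))) - y * real (card (added G F))"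

section \<open>Effect of the branches on the potential\<close>

lemma sparse_inv_finite: "sparse_inv N D G F \<Longrightarrow> finite F"
proof (rule finite_subset)
  assume "sparse_inv N D G F"
  then show "F \<subseteq> Pow {..<N}" unfolding sparse_inv_def by blast
qed simp

lemma unit_lits_subset:
  assumes "sparse_inv N D G F"
  shows "unit_lits F \<subseteq> {..<N}"
proof
  fix l assume "l \<in> unit_lits F"
  then have "{l} \<subseteq> {..<N}" using assms unfolding sparse_inv_def unit_lits_def by blast
  then show "l \<in> {..<N}" by simp
qed

lemma subsume_covers:
  assumes "finite F" "C \<in> F"
  shows "\<exists>C'\<in>subsume F. C' \<subseteq> C"
proof -
  have "\<exists>m\<in>{C' \<in> F. C' \<subseteq> C}. m \<le> C \<and> (\<forall>a\<in>{C' \<in> F. C' \<subseteq> C}. a \<le> m \<longrightarrow> m = a)"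
    using assms by (intro finite_has_minimal2) auto
  then obtain m where m: "m \<in> F" "m \<subseteq> C" "\<forall>a\<in>{C' \<in> F. C' \<subseteq> C}. a \<le> m \<longrightarrow> m = a" by auto
  have "\<not> (\<exists>C'\<in>F. C' \<subset> m)"
  proof
    assume "\<exists>C'\<in>F. C' \<subset> m"
    then obtain C' where "C' \<in> F" "C' \<subset> m" by blast
    then have "m = C'" using m(2,3) by blast
    then show False using \<open>C' \<subset> m\<close> by blast
  qed
  then show ?thesis using m(1,2) unfolding subsume_def by blast
qed

text \<open>Since \<open>F\<close> is an antichain, an added pair contains no literal that has a
  unit clause. So there are at most \<open>D\<close> such pairs per remaining literal.\<close>

lemma potential_nonneg:
  assumes inv: "sparse_inv N D G F" and xy: "0 \<le> x" "0 \<le> y"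
  shows "0 \<le> potential N D x y G F"
proof -
  let ?U = "unit_lits F" and ?L = "{..<N} - unit_lits F"
  note fin = sparse_inv_finite[OF inv]
  have sub: "?U \<subseteq> {..<N}" by (rule unit_lits_subset[OF inv])
  have "added G F \<subseteq> (\<Union>p\<in>?L. {C \<in> F. card C = 2 \<and> p \<in> C \<and> C \<notin> G})"
  proof
    fix C assume C: "C \<in> added G F"
    then have "card C = 2" "C \<in> F" by (auto simp: added_def)
    then obtain p q where pq: "C = {p, q}" "p \<noteq> q" by (auto simp: card_2_iff)
    have "{p} \<subset> C" using pq by blast
    then have "{p} \<notin> F" using inv \<open>C \<in> F\<close> unfolding sparse_inv_def by blast
    moreover have "C \<subseteq> {..<N}" using inv \<open>C \<in> F\<close> unfolding sparse_inv_def by blast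
    then have "p < N" using pq by simp
    ultimately show "C \<in> (\<Union>p\<in>?L. {C \<in> F. card C = 2 \<and> p \<in> C \<and> C \<notin> G})"
      using C pq unfolding added_def unit_lits_def by blast
  qed
  then have "card (added G F) \<le> card (\<Union>p\<in>?L. {C \<in> F. card C = 2 \<and> p \<in> C \<and> C \<notin> G})"
    using fin by (intro card_mono finite_UN_I) simp_all
  also have "\<dots> \<le> (\<Sum>p\<in>?L. card {C \<in> F. card C = 2 \<and> p \<in> C \<and> C \<notin> G})" by (rule card_UN_le) simp
  also have "\<dots> \<le> (\<Sum>p\<in>?L. D)"
    using inv unfolding sparse_inv_def degree_added_def by (intro sum_mono) blast
  also have "\<dots> = (N - card ?U) * D" using sub by (simp add: card_Diff_subset finite_subset)
  finally have "real (card (added G F)) \<le> real ((N - card ?U) * D)" by linarith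
  moreover have cU: "card ?U \<le> N" using card_mono[OF _ sub] by simp
  ultimately have a: "real (card (added G F)) \<le> (real N - real (card ?U)) * real D" by (simp add: of_nat_diff)
  have "y * real (card (added G F)) \<le> y * ((real N - real (card ?U)) * real D)" using a xy(2) by (rule mult_left_mono)
  moreover have "0 \<le> x * (real N - real (card ?U))" using cU xy(1) by simp
  ultimately show ?thesis by (simp add: potential_def algebra_simps)
qed

text \<open>New unit clauses subsume only clauses through their literals, among them at most
  \<open>D\<close> added pairs each. The term \<open>y * D\<close> of the potential pays for these,
  and \<open>x\<close> per literal remains.\<close>

lemma add_units:
  assumes inv: "sparse_inv N D G F" and xy: "0 \<le> y" and P: "P \<subseteq> {..<N}" "P \<inter> unit_lits F = {}" "{} \<notin> F"
  defines "F' \<equiv> subsume (F \<union> (\<lambda>p. {p}) ` P)"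
  shows "sparse_inv N D G F'" "potential N D x y G F' \<le> potential N D x y G F - x * real (card P)"
proof -
  note fin = sparse_inv_finite[OF inv]
  have finP: "finite P" using P(1) finite_subset by blast
  let ?E = "F \<union> (\<lambda>p. {p}) ` P"
  have finE: "finite ?E" using fin finP by simp
  have ne: "{} \<notin> ?E" using P(3) by blast
  have ac: "\<not> C' \<subset> C" if "C \<in> F" "C' \<in> F" for C C' using inv that unfolding sparse_inv_def by blast
  have unit: "{l} \<in> F'" if "{l} \<in> ?E" for l
  proof -
    have "C' = {}" if "C' \<subset> {l}" for C' using that by auto
    then have "\<not> (\<exists>C'\<in>?E. C' \<subset> {l})" using ne by metis
    then show ?thesis using that unfolding F'_def subsume_def by blast
  qed
  have U: "unit_lits F' = unit_lits F \<union> P"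
  proof (intro equalityI subsetI)
    fix l assume "l \<in> unit_lits F'"
    then have "{l} \<in> ?E" unfolding unit_lits_def F'_def subsume_def by blast
    then show "l \<in> unit_lits F \<union> P" unfolding unit_lits_def by blast
  next
    fix l assume "l \<in> unit_lits F \<union> P"
    then show "l \<in> unit_lits F'" using unit unfolding unit_lits_def by blast
  qed
  have finU: "finite (unit_lits F)" using unit_lits_subset[OF inv] finite_subset by blast
  have cU: "card (unit_lits F') = card (unit_lits F) + card P"
    unfolding U using finU finP P(2) by (subst card_Un_disjoint) auto
  have two: "C \<in> F" if "C \<in> F'" "card C = 2" for C
    using that unfolding F'_def subsume_def by auto
  have keep: "C \<in> F'" if C: "C \<in> F" "card C = 2" "C \<inter> P = {}" for C
  proof -
    have "\<not> (\<exists>C'\<in>?E. C' \<subset> C)" using ac[OF C(1)] C(3) by blast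
    then show ?thesis using C(1) unfolding F'_def subsume_def by blast
  qed
  have F'E: "F' \<subseteq> ?E" unfolding F'_def subsume_def by blast
  show "sparse_inv N D G F'"
    unfolding sparse_inv_def
  proof (intro conjI ballI allI)
    fix C assume "C \<in> F'"
    then consider "C \<in> F" | p where "p \<in> P" "C = {p}" using F'E by blast
    then show "C \<subseteq> {..<N}" "card C \<le> 3"
      using inv P(1) unfolding sparse_inv_def by (cases; auto)+
  next
    fix C C' assume "C \<in> F'" "C' \<in> F'"
    then show "\<not> C' \<subset> C" unfolding F'_def subsume_def by blast
  next
    fix C assume "C \<in> G"
    then obtain C1 where C1: "C1 \<in> F" "C1 \<subseteq> C" using inv unfolding sparse_inv_def by blast
    then obtain C2 where "C2 \<in> F'" "C2 \<subseteq> C1" using subsume_covers[OF finE, of C1] unfolding F'_def by blast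
    then show "\<exists>C'\<in>F'. C' \<subseteq> C" using C1 by blast
  next
    fix p
    have "degree_added G F' p \<le> degree_added G F p"
      unfolding degree_added_def using fin two by (intro card_mono) auto
    also have "\<dots> \<le> D" using inv unfolding sparse_inv_def by blast
    finally show "degree_added G F' p \<le> D" .
  qed
  have "added G F \<subseteq> added G F' \<union> (\<Union>p\<in>P. {C \<in> F. card C = 2 \<and> p \<in> C \<and> C \<notin> G})"
    unfolding added_def using keep by blast
  then have "card (added G F) \<le> card (added G F' \<union> (\<Union>p\<in>P. {C \<in> F. card C = 2 \<and> p \<in> C \<and> C \<notin> G}))"
    using fin finP finite_subset[OF F'E finE] by (intro card_mono) (auto simp: added_def)
  also have "\<dots> \<le> card (added G F') + card (\<Union>p\<in>P. {C \<in> F. card C = 2 \<and> p \<in> C \<and> C \<notin> G})" by (rule card_Un_le)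
  also have "card (\<Union>p\<in>P. {C \<in> F. card C = 2 \<and> p \<in> C \<and> C \<notin> G}) \<le> (\<Sum>p\<in>P. card {C \<in> F. card C = 2 \<and> p \<in> C \<and> C \<notin> G})"
    by (rule card_UN_le[OF finP])
  also have "(\<Sum>p\<in>P. card {C \<in> F. card C = 2 \<and> p \<in> C \<and> C \<notin> G}) \<le> (\<Sum>p\<in>P. D)"
    using inv unfolding sparse_inv_def degree_added_def by (intro sum_mono) blast
  finally have "card (added G F) \<le> card (added G F') + card P * D" by simp
  then have "real (card (added G F)) \<le> real (card (added G F') + card P * D)" by linarith
  then have "y * real (card (added G F)) \<le> y * (real (card (added G F')) + real (card P) * real D)"
    using xy by (intro mult_left_mono) simp_all
  then show "potential N D x y G F' \<le> potential N D x y G F - x * real (card P)"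
    unfolding potential_def cU by (simp add: algebra_simps)
qed

text \<open>A pair of \<open>A\<close> lies properly inside a clause of the antichain
  \<open>F\<close>, so it contains no clause of \<open>F\<close> and survives. It subsumes only
  larger clauses, so unit clauses and old pairs survive too.\<close>

lemma add_pairs:
  assumes inv: "sparse_inv N D G F"
    and A: "finite A" "\<And>a. a \<in> A \<Longrightarrow> card a = 2 \<and> (\<exists>X\<in>F. a \<subset> X)"
    and deg: "\<And>p. degree_added G F p + card {a \<in> A. p \<in> a} \<le> D"
  defines "F' \<equiv> subsume (F \<union> A)"
  shows "sparse_inv N D G F'" "potential N D x y G F' = potential N D x y G F - y * real (card A)"
proof -
  note fin = sparse_inv_finite[OF inv]
  have ac: "\<not> C' \<subset> C" if "C \<in> F" "C' \<in> F" for C C' using inv that unfolding sparse_inv_def by blast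
  have finE: "finite (F \<union> A)" using fin A(1) by simp
  have F'E: "F' \<subseteq> F \<union> A" unfolding F'_def subsume_def by blast
  have card_lt: "card b < 2" if "a \<in> A" "b \<subset> a" for a b
    using psubset_card_mono[of a b] A(2)[OF that(1)] that(2) by (metis card.infinite zero_neq_numeral)
  have A_F: "\<not> C \<subseteq> a" if "a \<in> A" "C \<in> F" for a C
    using A(2)[OF that(1)] ac[OF _ that(2)] by blast
  have AF': "A \<subseteq> F'"
  proof
    fix a assume a: "a \<in> A"
    have "\<not> (\<exists>C'\<in>F \<union> A. C' \<subset> a)"
    proof
      assume "\<exists>C'\<in>F \<union> A. C' \<subset> a"
      then obtain C' where C': "C' \<in> F \<union> A" "C' \<subset> a" by blast
      then have "C' \<in> A" using A_F[OF a] by blast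
      then show False using card_lt[OF a C'(2)] A(2) by force
    qed
    then show "a \<in> F'" using a unfolding F'_def subsume_def by blast
  qed
  have keep: "C \<in> F'" if C: "C \<in> F" "card C \<le> 2" for C
  proof -
    have "\<not> (\<exists>C'\<in>F \<union> A. C' \<subset> C)"
    proof
      assume "\<exists>C'\<in>F \<union> A. C' \<subset> C"
      then obtain C' where C': "C' \<in> F \<union> A" "C' \<subset> C" by blast
      then have "C' \<in> A" using ac[OF C(1)] by blast
      then have "card C' = 2" using A(2) by blast
      moreover have "finite C" using inv C(1) unfolding sparse_inv_def by (metis finite_lessThan finite_subset)
      ultimately show False using psubset_card_mono[OF _ C'(2)] C(2) by simp
    qed
    then show ?thesis using C(1) unfolding F'_def subsume_def by blast
  qed
  have U: "unit_lits F' = unit_lits F"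
  proof (intro equalityI subsetI)
    fix l assume "l \<in> unit_lits F'"
    then have "{l} \<in> F \<union> A" using F'E unfolding unit_lits_def by blast
    moreover have "{l} \<notin> A" using A(2)[of "{l}"] by auto
    ultimately show "l \<in> unit_lits F" unfolding unit_lits_def by blast
  next
    fix l assume "l \<in> unit_lits F"
    then show "l \<in> unit_lits F'" using keep[of "{l}"] unfolding unit_lits_def by simp
  qed
  \<comment> \<open>Every clause of \<open>G\<close> contains a clause of \<open>F\<close> whereas a
    pair of \<open>A\<close> contains none; hence all new pairs count as added.\<close>
  have AG: "A \<inter> G = {}"
  proof (rule ccontr)
    assume "A \<inter> G \<noteq> {}"
    then obtain a where a: "a \<in> A" "a \<in> G" by blast
    then obtain C' where "C' \<in> F" "C' \<subseteq> a" using inv unfolding sparse_inv_def by blast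
    then show False using A_F[OF a(1)] by blast
  qed
  have AF: "A \<inter> F = {}" using A_F by blast
  have ad: "added G F' = added G F \<union> A"
  proof (intro equalityI subsetI)
    fix C assume "C \<in> added G F'"
    then show "C \<in> added G F \<union> A" using F'E unfolding added_def by blast
  next
    fix C assume "C \<in> added G F \<union> A"
    then show "C \<in> added G F'" using keep[of C] AF' A(2)[of C] AG unfolding added_def by auto
  qed
  have "card (added G F') = card (added G F) + card A"
    unfolding ad using fin A(1) AF by (intro card_Un_disjoint) (auto simp: added_def)
  then show "potential N D x y G F' = potential N D x y G F - y * real (card A)"
    unfolding potential_def U by (simp add: algebra_simps)
  show "sparse_inv N D G F'"
    unfolding sparse_inv_def
  proof (intro conjI ballI allI)
    fix C assume "C \<in> F'"
    then consider "C \<in> F" | "C \<in> A" using F'E by blast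
    then show "C \<subseteq> {..<N}" "card C \<le> 3"
    proof (atomize (full), cases)
      case 1
      then show "C \<subseteq> {..<N} \<and> card C \<le> 3" using inv unfolding sparse_inv_def by blast
    next
      case 2
      then obtain X where "X \<in> F" "C \<subset> X" "card C = 2" using A(2) by blast
      then show "C \<subseteq> {..<N} \<and> card C \<le> 3" using inv unfolding sparse_inv_def by force
    qed
  next
    fix C C' assume "C \<in> F'" "C' \<in> F'"
    then show "\<not> C' \<subset> C" unfolding F'_def subsume_def by blast
  next
    fix C assume "C \<in> G"
    then obtain C1 where C1: "C1 \<in> F" "C1 \<subseteq> C" using inv unfolding sparse_inv_def by blast
    then obtain C2 where "C2 \<in> F'" "C2 \<subseteq> C1" using subsume_covers[OF finE, of C1] unfolding F'_def by blast
    then show "\<exists>C'\<in>F'. C' \<subseteq> C" using C1 by blast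
  next
    fix p
    have "{C \<in> F'. card C = 2 \<and> p \<in> C \<and> C \<notin> G} \<subseteq> {C \<in> F. card C = 2 \<and> p \<in> C \<and> C \<notin> G} \<union> {a \<in> A. p \<in> a}"
      using F'E by blast
    then have "degree_added G F' p \<le> card ({C \<in> F. card C = 2 \<and> p \<in> C \<and> C \<notin> G} \<union> {a \<in> A. p \<in> a})"
      unfolding degree_added_def using fin A(1) by (intro card_mono) simp_all
    also have "\<dots> \<le> degree_added G F p + card {a \<in> A. p \<in> a}" unfolding degree_added_def by (rule card_Un_le)
    finally show "degree_added G F' p \<le> D" using deg[of p] by linarith
  qed
qed

lemma inj_on_minus_heart: "inj_on (\<lambda>C. C - H) (petals F c H)"
  by (rule inj_onI) (auto simp: petals_def)

text \<open>The three cases are tried in this order, which is why the last two may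
  assume that the earlier ones do not apply.\<close>

lemma branch_potential:
  assumes inv: "sparse_inv N D G F" and xy: "0 < x" "0 < y"
    and D: "D = t1 + t2" "1 \<le> t1" "1 \<le> t2"
    and H: "H \<subseteq> {..<N}" and s: "t \<le> card (petals F c H)" "1 \<le> t"
    and cases: "(c = 2 \<and> card H = 1 \<and> t = t1) \<or>
      (c = 3 \<and> card H = 2 \<and> t = t2 \<and> (\<forall>l. card (petals F 2 {l}) < t1)) \<or>
      (c = 3 \<and> card H = 1 \<and> t = t3 \<and> (\<forall>l. card (petals F 2 {l}) < t1) \<and> (\<forall>K. card K = 2 \<longrightarrow> card (petals F 3 K) < t2))"
    and w: "2 powr - x + 2 powr - (real t1 * x) \<le> 1" "2 powr - y + 2 powr - (real t2 * x) \<le> 1"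
      "2 powr - x + 2 powr - (real t3 * y) \<le> 1"
  shows "sparse_inv N D G (branch_heart F H)" "sparse_inv N D G (branch_petals F c H)"
    "2 powr potential N D x y G (branch_heart F H) + 2 powr potential N D x y G (branch_petals F c H)
       \<le> 2 powr potential N D x y G F"
proof -
  let ?S = "petals F c H" and ?\<Phi> = "potential N D x y G"
  note fin = sparse_inv_finite[OF inv]
  have finS: "finite ?S" using fin by (simp add: petals_def)
  have "?S \<noteq> {}" using s by auto
  then obtain X where X: "X \<in> F" "card X = c" "H \<subseteq> X" by (auto simp: petals_def)
  have c: "c = 2 \<or> c = 3" and h: "card H = 1 \<or> card H = 2" and hc: "card H < c" using cases by auto
  have finX: "finite C" if "C \<in> F" for C using inv that unfolding sparse_inv_def by (metis finite_lessThan finite_subset)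
  have finH: "finite H" using H finite_subset by blast
  have ac: "\<not> C' \<subset> C" if "C \<in> F" "C' \<in> F" for C C' using inv that unfolding sparse_inv_def by blast
  have HX: "H \<subset> C" if "C \<in> ?S" for C using that hc unfolding petals_def by (metis (mono_tags, lifting) less_irrefl mem_Collect_eq psubsetI)
  have ne: "{} \<notin> F"
  proof
    assume "{} \<in> F"
    then have "\<not> {} \<subset> X" using ac X(1) by blast
    then have "X = {}" by blast
    then show False using X(2) c by auto
  qed
  have card_diff: "card (C - H) = c - card H" if "C \<in> ?S" for C
    using that finH by (auto simp: petals_def card_Diff_subset)
  have drop: "2 powr ?\<Phi> F1 + 2 powr ?\<Phi> F2 \<le> 2 powr ?\<Phi> F"
    if "?\<Phi> F1 \<le> ?\<Phi> F - a" "?\<Phi> F2 \<le> ?\<Phi> F - b" "2 powr - a + 2 powr - b \<le> 1" for F1 F2 a b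
  proof -
    have "2 powr ?\<Phi> F1 + 2 powr ?\<Phi> F2 \<le> 2 powr (?\<Phi> F - a) + 2 powr (?\<Phi> F - b)"
      using that(1,2) by (intro add_mono powr_mono) simp_all
    also have "\<dots> = 2 powr ?\<Phi> F * (2 powr - a + 2 powr - b)" by (simp add: powr_diff powr_minus_divide algebra_simps)
    also have "\<dots> \<le> 2 powr ?\<Phi> F * 1" using that(3) by (intro mult_left_mono) simp_all
    finally show ?thesis by simp
  qed
  have heart1: "sparse_inv N D G (branch_heart F H) \<and> ?\<Phi> (branch_heart F H) \<le> ?\<Phi> F - x" if h1: "card H = 1"
  proof -
    obtain l where l: "H = {l}" using h1 by (auto simp: card_1_singleton_iff)
    have "l \<notin> unit_lits F" using HX X ac[OF X(1)] l unfolding unit_lits_def petals_def by blast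
    then have lu: "{l} \<inter> unit_lits F = {}" by simp
    have lN: "{l} \<subseteq> {..<N}" using H l by simp
    note u = add_units(1)[OF inv less_imp_le[OF xy(2)] lN lu ne] add_units(2)[OF inv less_imp_le[OF xy(2)] lN lu ne, of x]
    then show ?thesis unfolding branch_heart_def l by simp
  qed
  have petals1: "sparse_inv N D G (branch_petals F c H) \<and> ?\<Phi> (branch_petals F c H) \<le> ?\<Phi> F - real t * x" if "c = card H + 1"
  proof -
    define P where "P = \<Union> ((\<lambda>C. C - H) ` ?S)"
    have sing: "\<exists>p. C - H = {p}" if "C \<in> ?S" for C using card_diff[OF that] \<open>c = card H + 1\<close> by (simp add: card_1_singleton_iff)
    have PS: "(\<lambda>p. {p}) ` P = (\<lambda>C. C - H) ` ?S"
    proof (intro equalityI subsetI)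
      fix z assume "z \<in> (\<lambda>p. {p}) ` P"
      then obtain p C where "z = {p}" "C \<in> ?S" "p \<in> C - H" unfolding P_def by blast
      moreover obtain q where "C - H = {q}" using sing[OF \<open>C \<in> ?S\<close>] by blast
      ultimately show "z \<in> (\<lambda>C. C - H) ` ?S" by (metis image_eqI singletonD)
    next
      fix z assume "z \<in> (\<lambda>C. C - H) ` ?S"
      then obtain C where C: "z = C - H" "C \<in> ?S" by blast
      moreover obtain q where "C - H = {q}" using sing[OF C(2)] by blast
      ultimately show "z \<in> (\<lambda>p. {p}) ` P" unfolding P_def by blast
    qed
    have "card P = card ((\<lambda>p. {p}) ` P)" by (simp add: card_image)
    also have "\<dots> = card ?S" unfolding PS by (rule card_image[OF inj_on_minus_heart])
    finally have cP: "t \<le> card P" using s(1) by simp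
    have PN: "P \<subseteq> {..<N}" using inv unfolding P_def petals_def sparse_inv_def by blast
    have "p \<notin> unit_lits F" if p: "p \<in> P" for p
    proof
      assume "p \<in> unit_lits F"
      obtain C where C: "C \<in> F" "p \<in> C" "card C = c" using p unfolding P_def petals_def by blast
      then have "{p} \<subset> C" using c by auto
      then show False using ac[OF C(1)] \<open>p \<in> unit_lits F\<close> unfolding unit_lits_def by blast
    qed
    then have PU: "P \<inter> unit_lits F = {}" by blast
    from add_units(1)[OF inv less_imp_le[OF xy(2)] PN PU ne] add_units(2)[OF inv less_imp_le[OF xy(2)] PN PU ne, of x]
    have "sparse_inv N D G (branch_petals F c H)" "?\<Phi> (branch_petals F c H) \<le> ?\<Phi> F - x * real (card P)"
      unfolding branch_petals_def PS[symmetric] by simp_all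
    moreover have "real t * x \<le> x * real (card P)" using cP xy(1) by (simp add: mult.commute)
    ultimately show ?thesis by linarith
  qed
  have degs: "degree_added G F p \<le> card (petals F 2 {p})" for p
    unfolding degree_added_def petals_def using fin by (intro card_mono) auto
  \<comment> \<open>Drops in the heart and the petals branch: in A one unit clause against
    \<open>t1\<close> unit clauses, in B one pair against \<open>t2\<close> unit clauses, in C one
    unit clause against \<open>t3\<close> pairs. Pairs arise only in B and C, where each literal is
    in fewer than \<open>t1\<close> pairs beforehand and gains at most \<open>t2\<close>; this is
    the origin of \<open>D = t1 + t2\<close>.\<close>
  consider (A) "c = 2" "card H = 1" "t = t1" | (B) "c = 3" "card H = 2" "t = t2" "\<forall>l. card (petals F 2 {l}) < t1"
    | (C) "c = 3" "card H = 1" "t = t3" "\<forall>l. card (petals F 2 {l}) < t1" "\<forall>K. card K = 2 \<longrightarrow> card (petals F 3 K) < t2"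
    using cases by blast
  then have "sparse_inv N D G (branch_heart F H) \<and> sparse_inv N D G (branch_petals F c H) \<and>
    2 powr ?\<Phi> (branch_heart F H) + 2 powr ?\<Phi> (branch_petals F c H) \<le> 2 powr ?\<Phi> F"
  proof cases
    case A
    then show ?thesis using heart1 petals1 drop[of _ x _ "real t1 * x"] w(1) by simp
  next
    case B
    have dg: "degree_added G F p + card {a \<in> {H}. p \<in> a} \<le> D" for p
    proof -
      have "card {a \<in> {H}. p \<in> a} \<le> card {H}" by (rule card_mono) auto
      then show ?thesis using degs[of p] B(4)[rule_format, of p] D by simp
    qed
    have pr: "card a = 2 \<and> (\<exists>X\<in>F. a \<subset> X)" if "a \<in> {H}" for a
    proof -
      have "H \<subset> X" using HX X by (simp add: petals_def)
      then show ?thesis using that B(2) X(1) by blast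
    qed
    have finH1: "finite {H}" by simp
    have "sparse_inv N D G (branch_heart F H)" "?\<Phi> (branch_heart F H) = ?\<Phi> F - y * real (card {H})"
      using add_pairs(1)[OF inv finH1 pr dg] add_pairs(2)[OF inv finH1 pr dg, of x y] unfolding branch_heart_def by simp_all
    then show ?thesis using petals1 B drop[of "branch_heart F H" y "branch_petals F c H" "real t2 * x"] w(2) by simp
  next
    case C
    let ?A = "(\<lambda>C. C - H) ` ?S"
    obtain l where l: "H = {l}" using C(2) by (auto simp: card_1_singleton_iff)
    have cA: "card ?A = card ?S" by (rule card_image[OF inj_on_minus_heart])
    have pr: "card a = 2 \<and> (\<exists>X\<in>F. a \<subset> X)" if "a \<in> ?A" for a
    proof -
      obtain C' where C': "a = C' - H" "C' \<in> ?S" using \<open>a \<in> ?A\<close> by blast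
      then have "card a = 2" using card_diff C(1,2) by simp
      moreover have "a \<subset> C'" using C' l unfolding petals_def by blast
      ultimately show ?thesis using C'(2) unfolding petals_def by blast
    qed
    have dg: "degree_added G F p + card {a \<in> ?A. p \<in> a} \<le> D" for p
    proof -
      \<comment> \<open>A new pair through \<open>p\<close> stems from a 3-clause through
        \<open>l\<close> and \<open>p\<close>; there are fewer than \<open>t2\<close> of those, as
        the second case does not apply.\<close>
      have "card {a \<in> ?A. p \<in> a} \<le> t2"
      proof (cases "p = l")
        case True
        then have "{a \<in> ?A. p \<in> a} = {}" using l by auto
        then show ?thesis by (simp only: card.empty)
      next
        case False
        have "{a \<in> ?A. p \<in> a} \<subseteq> (\<lambda>C. C - H) ` petals F 3 {l, p}" using l C(1) unfolding petals_def by auto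
        then have "card {a \<in> ?A. p \<in> a} \<le> card ((\<lambda>C. C - H) ` petals F 3 {l, p})"
          using fin by (intro card_mono finite_imageI) (simp_all add: petals_def)
        also have "\<dots> \<le> card (petals F 3 {l, p})" using fin by (intro card_image_le) (simp add: petals_def)
        also have "\<dots> \<le> t2" using C(5)[rule_format, of "{l, p}"] False by simp
        finally show ?thesis .
      qed
      then show ?thesis using degs[of p] C(4)[rule_format, of p] D(1) by simp
    qed
    have finA: "finite ?A" using finS by simp
    have "sparse_inv N D G (branch_petals F c H)" "?\<Phi> (branch_petals F c H) = ?\<Phi> F - y * real (card ?A)"
      using add_pairs(1)[OF inv finA pr dg] add_pairs(2)[OF inv finA pr dg, of x y] unfolding branch_petals_def by simp_all
    moreover have "real t3 * y \<le> y * real (card ?A)" using cA s(1) C(3) xy(2) by (simp add: mult.commute)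
    ultimately show ?thesis using heart1 C(2) drop[of "branch_heart F H" x "branch_petals F c H" "real t3 * y"] w(3) by simp
  qed
  then show "sparse_inv N D G (branch_heart F H)" "sparse_inv N D G (branch_petals F c H)"
    "2 powr ?\<Phi> (branch_heart F H) + 2 powr ?\<Phi> (branch_petals F c H) \<le> 2 powr ?\<Phi> F" by blast+
qed

subsection \<open>Formulas as lists\<close>

text \<open>A sorted list without repetitions as the unique representative of a set of literals:
  equality of clauses becomes equality of lists, and \<open>length\<close> is cardinality.\<close>

definition canon :: "nat \<Rightarrow> nat list \<Rightarrow> nat list" where
  "canon N C = filter (\<lambda>l. l \<in> set C) [0..<N]"

definition cform :: "nat \<Rightarrow> nat list list \<Rightarrow> bool" where
  "cform N F \<longleftrightarrow> distinct F \<and> (\<forall>C\<in>set F. C = canon N C)"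

definition clause_sets :: "nat list list \<Rightarrow> nat set set" where "clause_sets F = set ` set F"

lemma set_canon: "set (canon N C) = set C \<inter> {..<N}"
  by (auto simp: canon_def)

lemma distinct_canon: "distinct (canon N C)" by (simp add: canon_def)

lemma canon_canon: "canon N (canon N C) = canon N C"
  unfolding canon_def by (rule filter_cong) auto

lemma canon_unique:
  assumes "C = canon N C" "C' = canon N C'" "set C = set C'"
  shows "C = C'"
proof -
  have "canon N C = canon N C'" by (simp add: canon_def assms(3))
  then show ?thesis using assms(1,2) by metis
qed

lemma canon_length: "C = canon N C \<Longrightarrow> length C = card (set C)"
proof -
  assume c: "C = canon N C"
  have "distinct C" by (subst c) (rule distinct_canon)
  then show "length C = card (set C)" by (rule distinct_card[symmetric])
qed

lemma cformD:
  assumes "cform N F" "C \<in> set F"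
  shows "C = canon N C" "set C \<subseteq> {..<N}" "length C = card (set C)"
proof -
  show c: "C = canon N C" using assms by (simp add: cform_def)
  show "set C \<subseteq> {..<N}" by (subst c) (simp add: set_canon)
  show "length C = card (set C)" by (rule canon_length[OF c])
qed

lemma cform_inj: "cform N F \<Longrightarrow> inj_on set (set F)"
proof (rule inj_onI)
  fix C C' assume a: "cform N F" "C \<in> set F" "C' \<in> set F" "set C = set C'"
  show "C = C'" by (rule canon_unique[OF cformD(1)[OF a(1,2)] cformD(1)[OF a(1,3)] a(4)])
qed

lemma card_clause_sets:
  assumes "cform N F"
  shows "card {C \<in> clause_sets F. P C} = length (filter (\<lambda>C. P (set C)) F)"
proof -
  have "{C \<in> clause_sets F. P C} = set ` set (filter (\<lambda>C. P (set C)) F)" by (auto simp: clause_sets_def)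
  moreover have "inj_on set (set (filter (\<lambda>C. P (set C)) F))"
    by (rule inj_on_subset[OF cform_inj[OF assms]]) auto
  moreover have "distinct (filter (\<lambda>C. P (set C)) F)" using assms by (simp add: cform_def)
  ultimately show ?thesis by (simp only: card_image distinct_card)
qed

definition subs_list :: "nat list list \<Rightarrow> nat list list" where
  "subs_list F = filter (\<lambda>C. \<not> (\<exists>C'\<in>set F. \<not> C' = C \<and> (\<forall>l\<in>set C'. l \<in> set C))) F"

definition petal_list :: "nat list list \<Rightarrow> nat \<Rightarrow> nat list \<Rightarrow> nat list list" where
  "petal_list F c H = filter (\<lambda>C. length C = c \<and> (\<forall>l\<in>set H. l \<in> set C)) F"

definition dedup :: "'a list \<Rightarrow> 'a list" where
  "dedup xs = foldl (\<lambda>acc y. if y \<in> set acc then acc else acc @ [y]) [] xs"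

definition heart_list :: "nat list list \<Rightarrow> nat list \<Rightarrow> nat list list" where
  "heart_list F H = subs_list (dedup (H # F))"

definition petals_list :: "nat list list \<Rightarrow> nat \<Rightarrow> nat list \<Rightarrow> nat list list" where
  "petals_list F c H = subs_list (dedup (map (\<lambda>C. filter (\<lambda>l. \<not> l \<in> set H) C) (petal_list F c H) @ F))"

lemma foldl_dedup: "distinct acc \<Longrightarrow>
  distinct (foldl (\<lambda>acc y. if y \<in> set acc then acc else acc @ [y]) acc xs) \<and>
  set (foldl (\<lambda>acc y. if y \<in> set acc then acc else acc @ [y]) acc xs) = set acc \<union> set xs"
  by (induction xs arbitrary: acc) auto

lemma dedup: "distinct (dedup xs)" "set (dedup xs) = set xs"
  using foldl_dedup[of "[]" xs] by (simp_all add: dedup_def)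

lemma cform_dedup: "(\<And>C. C \<in> set F \<Longrightarrow> C = canon N C) \<Longrightarrow> cform N (dedup F)"
  unfolding cform_def dedup(2) by (intro conjI ballI dedup(1))

lemma clause_sets_subs:
  assumes "cform N F"
  shows "clause_sets (subs_list F) = subsume (clause_sets F)" "cform N (subs_list F)"
proof -
  have "(\<exists>C'\<in>set F. \<not> C' = C \<and> (\<forall>l\<in>set C'. l \<in> set C)) \<longleftrightarrow> (\<exists>C'\<in>clause_sets F. C' \<subset> set C)" if "C \<in> set F" for C
  proof -
    have "(\<not> C' = C \<and> (\<forall>l\<in>set C'. l \<in> set C)) = (set C' \<subset> set C)" if "C' \<in> set F" for C'
      using canon_unique[OF cformD(1)[OF assms that] cformD(1)[OF assms \<open>C \<in> set F\<close>]] by (auto simp: psubset_eq)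
    then show ?thesis unfolding clause_sets_def by simp
  qed
  then show "clause_sets (subs_list F) = subsume (clause_sets F)"
  proof -
    assume h: "\<And>C. C \<in> set F \<Longrightarrow> (\<exists>C'\<in>set F. \<not> C' = C \<and> (\<forall>l\<in>set C'. l \<in> set C)) \<longleftrightarrow> (\<exists>C'\<in>clause_sets F. C' \<subset> set C)"
    have "subsume (clause_sets F) = set ` {C \<in> set F. \<not> (\<exists>C'\<in>clause_sets F. C' \<subset> set C)}"
      unfolding subsume_def clause_sets_def by auto
    also have "{C \<in> set F. \<not> (\<exists>C'\<in>clause_sets F. C' \<subset> set C)} = set (subs_list F)"
      unfolding subs_list_def set_filter using h by (intro Collect_cong) (simp only: cong: conj_cong)
    finally show ?thesis by (simp add: clause_sets_def)
  qed
  show "cform N (subs_list F)" using assms unfolding cform_def subs_list_def by simp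
qed

lemma heart_list:
  assumes "cform N F" "H = canon N H"
  shows "clause_sets (heart_list F H) = branch_heart (clause_sets F) (set H)" "cform N (heart_list F H)"
proof -
  have c: "cform N (dedup (H # F))"
  proof (rule cform_dedup)
    fix C assume "C \<in> set (H # F)"
    then consider "C = H" | "C \<in> set F" by auto
    then show "C = canon N C"
    proof cases
      case 1
      show ?thesis unfolding 1 by (rule assms(2))
    qed (rule cformD(1)[OF assms(1)])
  qed
  have "clause_sets (dedup (H # F)) = insert (set H) (clause_sets F)" by (simp add: clause_sets_def dedup)
  then show "clause_sets (heart_list F H) = branch_heart (clause_sets F) (set H)" "cform N (heart_list F H)"
    using clause_sets_subs[OF c] by (simp_all add: heart_list_def branch_heart_def)
qed

lemma petal_list_card:
  assumes "cform N F"
  shows "card (petals (clause_sets F) c (set H)) = length (petal_list F c H)"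
proof -
  have "filter (\<lambda>C. card (set C) = c \<and> set H \<subseteq> set C) F = petal_list F c H"
    unfolding petal_list_def using cformD(3)[OF assms] by (intro filter_cong) auto
  then show ?thesis unfolding petals_def card_clause_sets[OF assms] by simp
qed

lemma petals_list:
  assumes "cform N F"
  shows "clause_sets (petals_list F c H) = branch_petals (clause_sets F) c (set H)" "cform N (petals_list F c H)"
proof -
  let ?A = "map (\<lambda>C. filter (\<lambda>l. \<not> l \<in> set H) C) (petal_list F c H)"
  have can: "filter P C = canon N (filter P C)" if "C = canon N C" for P C
  proof -
    have "filter P (canon N C) = canon N (filter P (canon N C))" unfolding canon_def filter_filter by (rule filter_cong) auto
    then show ?thesis unfolding that[symmetric] .
  qed
  have c: "cform N (dedup (?A @ F))"
  proof (rule cform_dedup)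
    fix C assume "C \<in> set (?A @ F)"
    then consider "C \<in> set F" | C' where "C' \<in> set F" "C = filter (\<lambda>l. \<not> l \<in> set H) C'" by (auto simp: petal_list_def)
    then show "C = canon N C"
    proof cases
      case 2
      show ?thesis unfolding 2(2) by (rule can[OF cformD(1)[OF assms 2(1)]])
    qed (rule cformD(1)[OF assms])
  qed
  have "set ` set (petal_list F c H) = petals (clause_sets F) c (set H)"
    unfolding petal_list_def petals_def clause_sets_def using cformD(3)[OF assms] by (auto simp: subset_iff)
  then have "clause_sets (dedup (?A @ F)) = clause_sets F \<union> (\<lambda>C. C - set H) ` petals (clause_sets F) c (set H)"
  proof -
    have "set ` set ?A = (\<lambda>C. C - set H) ` set ` set (petal_list F c H)"
      by (simp add: image_image set_diff_eq)
    then show ?thesis unfolding clause_sets_def dedup(2) set_append image_Un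
      using \<open>set ` set (petal_list F c H) = petals (clause_sets F) c (set H)\<close> by (simp add: clause_sets_def Un_commute)
  qed
  then show "clause_sets (petals_list F c H) = branch_petals (clause_sets F) c (set H)" "cform N (petals_list F c H)"
    using clause_sets_subs[OF c] by (simp_all add: petals_list_def branch_petals_def)
qed

text \<open>The searches follow the order that \<open>branch_potential\<close> presupposes, with
  \<open>t1\<close>, \<open>t2\<close>, \<open>t3\<close> as the components of \<open>t\<close>. The
  result is the clause size together with the heart.\<close>

definition find_branch :: "nat \<times> nat \<times> nat \<Rightarrow> nat \<Rightarrow> nat list list \<Rightarrow> (nat \<times> nat list) option" where
  "find_branch t N F =
     (case filter (\<lambda>l. fst t \<le> length (petal_list F 2 [l])) [0..<N] of l # _ \<Rightarrow> Some (2, canon N [l]) | [] \<Rightarrow>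
     (case filter (\<lambda>p. \<not> fst p = snd p \<and> fst (snd t) \<le> length (petal_list F 3 [fst p, snd p])) (List.product [0..<N] [0..<N]) of
        p # _ \<Rightarrow> Some (3, canon N [fst p, snd p]) | [] \<Rightarrow>
     (case filter (\<lambda>l. snd (snd t) \<le> length (petal_list F 3 [l])) [0..<N] of l # _ \<Rightarrow> Some (3, canon N [l]) | [] \<Rightarrow> None)))"

lemma petals_outside:
  assumes "cform N F" "\<not> K \<subseteq> {..<N}"
  shows "petals (clause_sets F) c K = {}"
  using assms cformD(2)[OF assms(1)] unfolding petals_def clause_sets_def by blast

lemma find_branch_cases:
  assumes F: "cform N F" and t: "1 \<le> t1" "1 \<le> t2"
  shows "(case find_branch (t1, t2, t3) N F of
      None \<Rightarrow> (\<forall>l. card (petals (clause_sets F) 2 {l}) < t1) \<and> (\<forall>l < N. card (petals (clause_sets F) 3 {l}) < t3)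
    | Some (c, H) \<Rightarrow> H = canon N H \<and> (\<exists>t. t \<le> card (petals (clause_sets F) c (set H)) \<and>
       ((c = 2 \<and> card (set H) = 1 \<and> t = t1) \<or>
        (c = 3 \<and> card (set H) = 2 \<and> t = t2 \<and> (\<forall>l. card (petals (clause_sets F) 2 {l}) < t1)) \<or>
        (c = 3 \<and> card (set H) = 1 \<and> t = t3 \<and> (\<forall>l. card (petals (clause_sets F) 2 {l}) < t1) \<and>
          (\<forall>K. card K = 2 \<longrightarrow> card (petals (clause_sets F) 3 K) < t2)))))"
proof -
  let ?P = "petals (clause_sets F)"
  let ?f1 = "filter (\<lambda>l. t1 \<le> length (petal_list F 2 [l])) [0..<N]"
  let ?f2 = "filter (\<lambda>p. \<not> fst p = snd p \<and> t2 \<le> length (petal_list F 3 [fst p, snd p])) (List.product [0..<N] [0..<N])"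
  let ?f3 = "filter (\<lambda>l. t3 \<le> length (petal_list F 3 [l])) [0..<N]"
  have pl: "length (petal_list F c H) = card (?P c (set H))" for c H using petal_list_card[OF F] by simp
  have can1: "set (canon N [l]) = {l}" if "l < N" for l using that by (auto simp: set_canon)
  have can2: "set (canon N [l, k]) = {l, k}" if "l < N" "k < N" for l k using that by (auto simp: set_canon)
  have n1: "\<forall>l. card (?P 2 {l}) < t1" if "?f1 = []"
  proof
    fix l show "card (?P 2 {l}) < t1"
    proof (cases "l < N")
      case True
      then have "\<not> t1 \<le> length (petal_list F 2 [l])" using that by (simp add: filter_empty_conv)
      then show ?thesis by (simp add: pl)
    next
      case False
      then have "?P 2 {l} = {}" by (intro petals_outside[OF F]) simp
      then show ?thesis using t(1) by simp
    qed
  qed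
  have n2: "\<forall>K. card K = 2 \<longrightarrow> card (?P 3 K) < t2" if f2: "?f2 = []"
  proof (intro allI impI)
    fix K :: "nat set" assume "card K = 2"
    then obtain a b where K: "K = {a, b}" "a \<noteq> b" by (auto simp: card_2_iff)
    show "card (?P 3 K) < t2"
    proof (cases "a < N \<and> b < N")
      case True
      then have "(a, b) \<in> set (List.product [0..<N] [0..<N])" by simp
      then have "\<not> (\<not> fst (a, b) = snd (a, b) \<and> t2 \<le> length (petal_list F 3 [fst (a, b), snd (a, b)]))"
        using f2 unfolding filter_empty_conv by blast
      then show ?thesis using K by (simp add: pl)
    next
      case False
      then have "?P 3 K = {}" using K by (intro petals_outside[OF F]) auto
      then show ?thesis using t(2) by simp
    qed
  qed
  show ?thesis
  proof (cases ?f1)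
    case (Cons l ls)
    then have "l \<in> set ?f1" by (metis list.set_intros(1))
    then have l: "l < N" "t1 \<le> card (?P 2 {l})" by (simp_all add: pl)
    have "find_branch (t1, t2, t3) N F = Some (2, canon N [l])" using Cons by (simp add: find_branch_def)
    then show ?thesis using l by (simp add: canon_canon can1)
  next
    case Nil
    note n1 = n1[OF Nil]
    show ?thesis
    proof (cases ?f2)
      case (Cons p ps)
      then have "p \<in> set ?f2" by (metis list.set_intros(1))
      then have p: "fst p < N" "snd p < N" "fst p \<noteq> snd p" "t2 \<le> card (?P 3 {fst p, snd p})" by (auto simp: pl)
      have "find_branch (t1, t2, t3) N F = Some (3, canon N [fst p, snd p])" using Nil Cons by (simp add: find_branch_def)
      then show ?thesis using p n1 by (simp add: canon_canon can2)
    next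
      case Nil2: Nil
      note n2 = n2[OF Nil2]
      show ?thesis
      proof (cases ?f3)
        case (Cons l ls)
        then have "l \<in> set ?f3" by (metis list.set_intros(1))
        then have l: "l < N" "t3 \<le> card (?P 3 {l})" by (simp_all add: pl)
        have "find_branch (t1, t2, t3) N F = Some (3, canon N [l])" using Nil Nil2 Cons by (simp add: find_branch_def)
        then show ?thesis using l n1 n2 by (simp add: canon_canon can1)
      next
        case Nil3: Nil
        have "find_branch (t1, t2, t3) N F = None" using Nil Nil2 Nil3 by (simp add: find_branch_def)
        moreover have "card (?P 3 {l}) < t3" if "l < N" for l
          using Nil3 that by (auto simp: filter_empty_conv pl not_le dest!: bspec[of _ _ l])
        ultimately show ?thesis using n1 by simp
      qed
    qed
  qed
qed

text \<open>Each nonempty clause is charged to one of its literals, which has its unit clause, fewer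
  than \<open>t1\<close> clauses of size 2 and fewer than \<open>t3\<close> of size 3. The number of
  clauses is therefore linear in \<open>N\<close>.\<close>

lemma sparse_length:
  assumes F: "cform N F" "\<forall>C\<in>set F. length C \<le> 3"
    and d: "\<forall>l. card (petals (clause_sets F) 2 {l}) < t1" "\<forall>l < N. card (petals (clause_sets F) 3 {l}) < t3"
  shows "length F \<le> 1 + N * (1 + t1 + t3)"
proof -
  let ?S = "clause_sets F" and ?P = "petals (clause_sets F)"
  have fin: "finite ?S" by (simp add: clause_sets_def)
  have "?S \<subseteq> {{}} \<union> (\<Union>l\<in>{..<N}. {{l}} \<union> ?P 2 {l} \<union> ?P 3 {l})"
  proof
    fix X assume X: "X \<in> ?S"
    then obtain C where C: "C \<in> set F" "X = set C" by (auto simp: clause_sets_def)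
    show "X \<in> {{}} \<union> (\<Union>l\<in>{..<N}. {{l}} \<union> ?P 2 {l} \<union> ?P 3 {l})"
    proof (cases "X = {}")
      case False
      then obtain l where l: "l \<in> X" by blast
      then have lN: "l < N" using cformD(2)[OF F(1) C(1)] C(2) by blast
      have "card X \<le> 3" using F(2) C unfolding C(2) cformD(3)[OF F(1) C(1), symmetric] by blast
      moreover have "card X \<noteq> 0" using False C(2) by simp
      ultimately have "card X = 1 \<or> card X = 2 \<or> card X = 3" by linarith
      then have "X = {l} \<or> X \<in> ?P 2 {l} \<or> X \<in> ?P 3 {l}"
        using l X unfolding petals_def by (auto simp: card_1_singleton_iff)
      then show ?thesis using lN by blast
    qed simp
  qed
  then have "card ?S \<le> card ({{}} \<union> (\<Union>l\<in>{..<N}. {{l}} \<union> ?P 2 {l} \<union> ?P 3 {l}))"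
    using fin by (intro card_mono) (auto simp: petals_def)
  also have "\<dots> \<le> card {{} :: nat set} + card (\<Union>l\<in>{..<N}. {{l}} \<union> ?P 2 {l} \<union> ?P 3 {l})" by (rule card_Un_le)
  also have "card (\<Union>l\<in>{..<N}. {{l}} \<union> ?P 2 {l} \<union> ?P 3 {l}) \<le> (\<Sum>l\<in>{..<N}. card ({{l}} \<union> ?P 2 {l} \<union> ?P 3 {l}))"
    by (rule card_UN_le) simp
  also have "\<dots> \<le> (\<Sum>l\<in>{..<N}. 1 + t1 + t3)"
  proof (rule sum_mono)
    fix l assume l: "l \<in> {..<N}"
    have "card ({{l}} \<union> ?P 2 {l} \<union> ?P 3 {l}) \<le> card ({{l}} \<union> ?P 2 {l}) + card (?P 3 {l})" by (rule card_Un_le)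
    also have "card ({{l}} \<union> ?P 2 {l}) \<le> card {{l}} + card (?P 2 {l})" by (rule card_Un_le)
    finally have *: "card ({{l}} \<union> ?P 2 {l} \<union> ?P 3 {l}) \<le> card {{l}} + card (?P 2 {l}) + card (?P 3 {l})" by simp
    have "card (?P 2 {l}) < t1" "card (?P 3 {l}) < t3" using d l by simp_all
    then show "card ({{l}} \<union> ?P 2 {l} \<union> ?P 3 {l}) \<le> 1 + t1 + t3" using * by simp
  qed
  also have "\<dots> = N * (1 + t1 + t3)" by simp
  finally have "card ?S \<le> 1 + N * (1 + t1 + t3)" by simp
  moreover have "card ?S = length F"
    using F(1) card_image[OF cform_inj[OF F(1)]] by (simp add: clause_sets_def cform_def distinct_card)
  ultimately show ?thesis by simp
qed


subsection \<open>Satisfiability\<close>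

text \<open>The coding of literals by \<open>lit_code\<close>: the variable is
  \<open>l div 2\<close>, and odd codes are positive. Complementary literals are
  \<open>2 * x\<close> and \<open>2 * x + 1\<close>, which are the pairs of
  \<open>conflict\<close>.\<close>

definition lit_holds :: "(nat \<Rightarrow> bool) \<Rightarrow> nat \<Rightarrow> bool" where
  "lit_holds a l \<longleftrightarrow> a (l div 2) = odd l"

definition sat_sets :: "nat set set \<Rightarrow> bool" where
  "sat_sets F \<longleftrightarrow> (\<exists>a. \<forall>C\<in>F. \<exists>l\<in>C. lit_holds a l)"

lemma sat_subsume: "finite F \<Longrightarrow> (\<forall>C\<in>subsume F. \<exists>l\<in>C. P l) \<longleftrightarrow> (\<forall>C\<in>F. \<exists>l\<in>C. P l)"
proof
  assume fin: "finite F" and a: "\<forall>C\<in>subsume F. \<exists>l\<in>C. P l"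
  show "\<forall>C\<in>F. \<exists>l\<in>C. P l"
  proof
    fix C assume "C \<in> F"
    then obtain C' where "C' \<in> subsume F" "C' \<subseteq> C" using subsume_covers[OF fin] by blast
    then show "\<exists>l\<in>C. P l" using a by blast
  qed
next
  assume "\<forall>C\<in>F. \<exists>l\<in>C. P l"
  then show "\<forall>C\<in>subsume F. \<exists>l\<in>C. P l" unfolding subsume_def by blast
qed

text \<open>An assignment that makes no literal of the heart true must satisfy each clause of the
  sunflower within its petal. Conversely, both branches only add clauses up to subsumption.\<close>

lemma sat_branch:
  assumes "finite F"
  shows "sat_sets F \<longleftrightarrow> sat_sets (branch_heart F H) \<or> sat_sets (branch_petals F c H)"
proof -
  have f1: "finite (insert H F)" using assms by simp
  have f2: "finite (F \<union> (\<lambda>C. C - H) ` petals F c H)" using assms by (simp add: petals_def)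
  have e: "(\<forall>C\<in>F. \<exists>l\<in>C. P l) \<longleftrightarrow> (\<forall>C\<in>insert H F. \<exists>l\<in>C. P l) \<or> (\<forall>C\<in>F \<union> (\<lambda>C. C - H) ` petals F c H. \<exists>l\<in>C. P l)" for P
  proof
    assume a: "\<forall>C\<in>F. \<exists>l\<in>C. P l"
    show "(\<forall>C\<in>insert H F. \<exists>l\<in>C. P l) \<or> (\<forall>C\<in>F \<union> (\<lambda>C. C - H) ` petals F c H. \<exists>l\<in>C. P l)"
    proof (cases "\<exists>l\<in>H. P l")
      case True
      then show ?thesis using a by blast
    next
      case False
      have "\<exists>l\<in>C - H. P l" if "C \<in> petals F c H" for C
      proof -
        have "C \<in> F" using that by (simp add: petals_def)
        then obtain l where "l \<in> C" "P l" using a by blast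
        then show ?thesis using False by blast
      qed
      then show ?thesis using a by blast
    qed
  qed blast
  show ?thesis unfolding sat_sets_def branch_heart_def branch_petals_def sat_subsume[OF f1] sat_subsume[OF f2] ex_disj_distrib[symmetric]
    by (rule arg_cong[where f = Ex], rule ext) (rule e)
qed

section \<open>Consistent choices of literals as cliques\<close>

definition conflict :: "nat \<Rightarrow> nat \<Rightarrow> bool" where
  "conflict l k \<longleftrightarrow> (even l \<and> k = Suc l) \<or> (even k \<and> l = Suc k)"

definition lits_compat :: "nat list \<Rightarrow> nat list \<Rightarrow> bool" where
  "lits_compat ls ks \<longleftrightarrow> (\<forall>l\<in>set ls. \<forall>k\<in>set ks. \<not> conflict l k)"

lemma holds_no_conflict: "lit_holds a l \<Longrightarrow> lit_holds a k \<Longrightarrow> \<not> conflict l k"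
  unfolding lit_holds_def conflict_def by (metis even_Suc even_Suc_div_two)

text \<open>The size is rounded up past the quotient so that \<open>m\<close> chunks cover
  \<open>F\<close>; the last ones may be short or empty.\<close>

definition chunk :: "nat \<Rightarrow> 'a list \<Rightarrow> nat \<Rightarrow> 'a list" where
  "chunk m F i = take (length F div m + 1) (drop (i * (length F div m + 1)) F)"

text \<open>A word over 0, 1, 2 names a literal in each clause of the chunk. Letters beyond the
  chunk are not read, so a choice may be listed repeatedly; this is harmless, since vertices of the
  same chunk are never adjacent.\<close>

definition pick :: "nat list list \<Rightarrow> nat list \<Rightarrow> nat list" where
  "pick ch w = map (\<lambda>t. nth_default 0 (nth_default [] ch t) (nth_default 0 w t)) [0..<length ch]"

definition word_ok :: "nat list list \<Rightarrow> nat list \<Rightarrow> bool" where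
  "word_ok ch w \<longleftrightarrow> (\<forall>t\<in>set [0..<length ch]. nth_default 0 w t < length (nth_default [] ch t))"

definition choice_vertices :: "nat \<Rightarrow> nat list list \<Rightarrow> nat list list \<Rightarrow> (nat \<times> nat list) list" where
  "choice_vertices m F ws = concat (map (\<lambda>i. map (\<lambda>ls. (i, ls)) (filter (\<lambda>ls. lits_compat ls ls)
     (map (\<lambda>w. pick (chunk m F i) w) (filter (\<lambda>w. word_ok (chunk m F i) w) ws)))) [0..<m])"

definition choice_adj :: "nat \<times> nat list \<Rightarrow> nat \<times> nat list \<Rightarrow> bool" where
  "choice_adj x y \<longleftrightarrow> \<not> fst x = fst y \<and> lits_compat (snd x) (snd y)"

lemma in_choice_vertices:
  "(i, ls) \<in> set (choice_vertices m F ws) \<longleftrightarrow> i < m \<and> lits_compat ls ls \<and>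
     (\<exists>w\<in>set ws. word_ok (chunk m F i) w \<and> ls = pick (chunk m F i) w)"
proof -
  have "set (choice_vertices m F ws) = (\<Union>i<m. Pair i ` {ls \<in> pick (chunk m F i) ` {w \<in> set ws. word_ok (chunk m F i) w}. lits_compat ls ls})"
    unfolding choice_vertices_def set_concat set_map set_filter image_image set_upt atLeast0LessThan ..
  then show ?thesis by (simp add: image_iff) blast
qed

text \<open>A clique of size \<open>m\<close> has exactly one choice for each chunk. Consistency of
  literals is a pairwise condition, so adjacency together with consistency within each choice makes
  the union of all choices consistent.\<close>

lemma choice_clique_iff:
  assumes m: "1 \<le> m" and F3: "\<forall>C\<in>set F. length C \<le> 3"
  shows "list_clique choice_adj (choice_vertices m F (List.n_lists (length F div m + 1) [0, 1, 2])) m \<longleftrightarrow> sat_sets (clause_sets F)"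
proof -
  define q where "q = length F div m + 1"
  define ws where "ws = List.n_lists q [0::nat, 1, 2]"
  let ?V = "choice_vertices m F ws" and ?ch = "chunk m F"
  have ch: "?ch i = take q (drop (i * q) F)" for i by (simp add: chunk_def q_def)
  have lch: "length (?ch i) \<le> q" for i by (simp add: ch)
  have chF: "C \<in> set F" if "C \<in> set (?ch i)" for C i using that unfolding ch by (meson in_set_dropD in_set_takeD)
  have mq: "length F < m * q"
    unfolding q_def using m dividend_less_times_div[of m "length F"] by (simp add: algebra_simps)
  show ?thesis unfolding q_def[symmetric] ws_def[symmetric]
  proof
    assume "sat_sets (clause_sets F)"
    then obtain a where a: "\<forall>C\<in>set F. \<exists>l\<in>set C. lit_holds a l" unfolding sat_sets_def clause_sets_def by blast
    have "\<forall>C\<in>set F. \<exists>j. j < length C \<and> lit_holds a (C ! j)"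
    proof
      fix C assume "C \<in> set F"
      then obtain l where "l \<in> set C" "lit_holds a l" using a by blast
      then show "\<exists>j. j < length C \<and> lit_holds a (C ! j)" unfolding in_set_conv_nth by blast
    qed
    from bchoice[OF this] obtain f where f: "\<forall>C\<in>set F. f C < length C \<and> lit_holds a (C ! f C)" ..
    define w where "w i = map (\<lambda>t. if t < length (?ch i) then f (?ch i ! t) else 0) [0..<q]" for i
    have wn: "nth_default 0 (w i) t = f (?ch i ! t)" if "t < length (?ch i)" for i t
      using that lch[of i] by (simp add: w_def)
    have fm: "f (?ch i ! t) < length (?ch i ! t)" "lit_holds a (?ch i ! t ! f (?ch i ! t))" "f (?ch i ! t) < 3"
      if "t < length (?ch i)" for i t
    proof -
      have "?ch i ! t \<in> set F" by (rule chF[of _ i]) (rule nth_mem[OF that])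
      then show "f (?ch i ! t) < length (?ch i ! t)" "lit_holds a (?ch i ! t ! f (?ch i ! t))" "f (?ch i ! t) < 3"
        using f F3 by (auto intro: less_le_trans)
    qed
    have win: "w i \<in> set ws" for i
    proof -
      have "set (w i) \<subseteq> {0, 1, 2}" using fm(3)[of _ i] by (fastforce simp: w_def)
      then show ?thesis unfolding ws_def set_n_lists by (simp add: w_def)
    qed
    have wok: "word_ok (?ch i) (w i)" for i
      unfolding word_ok_def using wn fm(1) by simp
    have tr: "lit_holds a l" if "l \<in> set (pick (?ch i) (w i))" for l i
    proof -
      obtain t where "t < length (?ch i)" "l = nth_default 0 (nth_default [] (?ch i) t) (nth_default 0 (w i) t)"
        using \<open>l \<in> _\<close> unfolding pick_def by auto
      then show ?thesis using wn[of t i] fm[of t i] by simp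
    qed
    have cp: "lits_compat (pick (?ch i) (w i)) (pick (?ch j) (w j))" for i j
      unfolding lits_compat_def using holds_no_conflict tr by blast
    have "\<forall>i\<in>{..<m}. \<exists>k. k < length ?V \<and> ?V ! k = (i, pick (?ch i) (w i))"
    proof
      fix i assume "i \<in> {..<m}"
      then have "(i, pick (?ch i) (w i)) \<in> set ?V" unfolding in_choice_vertices using cp win wok by blast
      then show "\<exists>k. k < length ?V \<and> ?V ! k = (i, pick (?ch i) (w i))" unfolding in_set_conv_nth .
    qed
    from bchoice[OF this] obtain g where g: "\<forall>i\<in>{..<m}. g i < length ?V \<and> ?V ! g i = (i, pick (?ch i) (w i))" ..
    have "inj_on g {..<m}"
    proof (rule inj_onI)
      fix i j assume "i \<in> {..<m}" "j \<in> {..<m}" "g i = g j"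
      then have "(i, pick (?ch i) (w i)) = (j, pick (?ch j) (w j))" using g by metis
      then show "i = j" by simp
    qed
    then have card: "card (g ` {..<m}) = m" by (simp add: card_image)
    show "list_clique choice_adj ?V m" unfolding list_clique_def
    proof (intro exI[of _ "g ` {..<m}"] conjI ballI impI)
      show "g ` {..<m} \<subseteq> {..<length ?V}" using g by auto
      show "card (g ` {..<m}) = m" by (rule card)
      fix x y assume "x \<in> g ` {..<m}" "y \<in> g ` {..<m}" "x \<noteq> y"
      then obtain i j where ij: "i < m" "j < m" "x = g i" "y = g j" "i \<noteq> j" by auto
      then show "choice_adj (?V ! x) (?V ! y)" using g cp by (simp add: choice_adj_def)
    qed
  next
    assume "list_clique choice_adj ?V m"
    then obtain W where W: "W \<subseteq> {..<length ?V}" "card W = m" "\<forall>i\<in>W. \<forall>j\<in>W. i \<noteq> j \<longrightarrow> choice_adj (?V ! i) (?V ! j)"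
      unfolding list_clique_def by blast
    have inV: "?V ! k \<in> set ?V" if "k \<in> W" for k using that W(1) by auto
    have "inj_on (\<lambda>k. fst (?V ! k)) W"
    proof (rule inj_onI)
      fix i j assume "i \<in> W" "j \<in> W" "fst (?V ! i) = fst (?V ! j)"
      then show "i = j" using W(3) unfolding choice_adj_def by blast
    qed
    then have "card ((\<lambda>k. fst (?V ! k)) ` W) = m" using W(2) by (simp add: card_image)
    moreover have "(\<lambda>k. fst (?V ! k)) ` W \<subseteq> {..<m}"
    proof
      fix i assume "i \<in> (\<lambda>k. fst (?V ! k)) ` W"
      then obtain k where "k \<in> W" "i = fst (?V ! k)" by blast
      then have "(i, snd (?V ! k)) \<in> set ?V" using inV by simp
      then show "i \<in> {..<m}" unfolding in_choice_vertices by blast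
    qed
    ultimately have im: "(\<lambda>k. fst (?V ! k)) ` W = {..<m}" using card_subset_eq[of "{..<m}"] by simp
    define L where "L = (\<Union>k\<in>W. set (snd (?V ! k)))"
    have nc: "\<not> conflict l l'" if l: "l \<in> L" "l' \<in> L" for l l'
    proof -
      obtain k k' where k: "k \<in> W" "k' \<in> W" "l \<in> set (snd (?V ! k))" "l' \<in> set (snd (?V ! k'))" using l unfolding L_def by blast
      have "lits_compat (snd (?V ! k)) (snd (?V ! k'))"
      proof (cases "k = k'")
        case True
        have "(fst (?V ! k), snd (?V ! k)) \<in> set ?V" using inV[OF k(1)] by simp
        then show ?thesis unfolding in_choice_vertices True by blast
      next
        case False
        then show ?thesis using W(3) k(1,2) unfolding choice_adj_def by blast
      qed
      then show ?thesis using k(3,4) unfolding lits_compat_def by blast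
    qed
    \<comment> \<open>A variable is set to true iff its positive literal, of code
      \<open>2 * x + 1\<close>, was chosen; absence of conflicts handles the negative
      literals.\<close>
    have holds: "lit_holds (\<lambda>x. 2 * x + 1 \<in> L) l" if l: "l \<in> L" for l
    proof (cases "odd l")
      case True
      then have "2 * (l div 2) + 1 = l" by simp
      then show ?thesis using l True by (simp add: lit_holds_def)
    next
      case False
      then have "Suc l \<notin> L" using nc[OF l, of "Suc l"] by (auto simp: conflict_def)
      moreover have "2 * (l div 2) + 1 = Suc l" using False by simp
      ultimately show ?thesis using False unfolding lit_holds_def by simp
    qed
    have "\<exists>l\<in>set C. lit_holds (\<lambda>x. 2 * x + 1 \<in> L) l" if C: "C \<in> set F" for C
    proof -
      obtain p where p: "p < length F" "F ! p = C" using C unfolding in_set_conv_nth by blast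
      have q0: "0 < q" by (simp add: q_def)
      define i t where "i = p div q" and "t = p mod q"
      have pe: "p = i * q + t" and tq: "t < q" using q0 by (simp_all add: i_def t_def)
      have "i < m" using mq p(1) q0 unfolding i_def by (simp add: less_mult_imp_div_less)
      have tl: "t < length (?ch i)" using p(1) pe tq by (simp add: ch)
      have ct: "?ch i ! t = C" using p(2) pe tq tl by (simp add: ch)
      have "i \<in> (\<lambda>k. fst (?V ! k)) ` W" unfolding im using \<open>i < m\<close> by simp
      then obtain k where k: "k \<in> W" "fst (?V ! k) = i" by (rule imageE) blast
      have "(i, snd (?V ! k)) \<in> set ?V" unfolding k(2)[symmetric] using inV[OF k(1)] by simp
      then obtain u where u: "word_ok (?ch i) u" "snd (?V ! k) = pick (?ch i) u" unfolding in_choice_vertices by blast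
      have ul: "nth_default 0 u t < length C" using u(1) tl ct unfolding word_ok_def by (auto dest!: bspec[of _ _ t])
      have "pick (?ch i) u ! t = C ! nth_default 0 u t" using tl ct ul by (simp add: pick_def)
      moreover have "pick (?ch i) u ! t \<in> set (pick (?ch i) u)" using tl by (intro nth_mem) (simp add: pick_def)
      ultimately have "C ! nth_default 0 u t \<in> L" using k(1) unfolding L_def u(2)[symmetric] by (intro UN_I[of k]) simp_all
      moreover have "C ! nth_default 0 u t \<in> set C" using ul by simp
      ultimately show ?thesis using holds by blast
    qed
    then show "sat_sets (clause_sets F)" unfolding sat_sets_def clause_sets_def by blast
  qed
qed


subsection \<open>Reading a 3-CNF\<close>

text \<open>The state holds the finished clauses, the clause being read and the number of its
  literals still to come; with none to come, the next number is a length.\<close>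

definition parse_clause :: "nat list list \<times> nat list \<times> nat \<Rightarrow> nat \<Rightarrow> nat list list \<times> nat list \<times> nat" where
  "parse_clause z a = (let cs = fst z; cur = fst (snd z); m = snd (snd z) in
     if m = 0 then (if a = 0 then (cs @ [[]], [], 0) else (cs, [], a))
     else if m = 1 then (cs @ [cur @ [a]], [], 0) else (cs, cur @ [a], m - 1))"

definition parse_clauses :: "nat list \<Rightarrow> nat list list" where
  "parse_clauses ns = fst (foldl parse_clause ([], [], 0) ns)"

definition lit_code :: "literal \<Rightarrow> nat" where "lit_code p = 2 * fst p + of_bool (snd p)"

lemma parse_clause_args: "js \<noteq> [] \<Longrightarrow> foldl parse_clause (cs, cur, length js) js = (cs @ [cur @ js], [], 0)"
proof (induction js arbitrary: cur)
  case (Cons a js)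
  show ?case
  proof (cases js)
    case Nil
    then show ?thesis by (simp add: parse_clause_def)
  next
    case (Cons b js')
    then have "parse_clause (cs, cur, length (a # js)) a = (cs, cur @ [a], length js)" by (simp add: parse_clause_def)
    then show ?thesis using Cons.IH[of "cur @ [a]"] Cons by simp
  qed
qed simp

lemma parse_clause_enc: "foldl parse_clause (cs, [], 0) (length C # C) = (cs @ [C], [], 0)"
proof (cases "C = []")
  case True
  then show ?thesis by (simp add: parse_clause_def)
next
  case False
  then have "parse_clause (cs, [], 0) (length C) = (cs, [], length C)" by (simp add: parse_clause_def)
  then show ?thesis using parse_clause_args[OF False, of cs "[]"] by simp
qed

lemma parse_cnf:
  "dec_nats (enc_cnf n F) = n # concat (map (\<lambda>C. length C # C) (map (map lit_code) F))"
  "parse_clauses (concat (map (\<lambda>C. length C # C) G)) = G"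
proof -
  have "map (\<lambda>C. length C # map (\<lambda>(x, b). 2 * x + of_bool b) C) F = map (\<lambda>C. length C # C) (map (map lit_code) F)"
    by (simp add: comp_def lit_code_def case_prod_unfold)
  then show "dec_nats (enc_cnf n F) = n # concat (map (\<lambda>C. length C # C) (map (map lit_code) F))"
    unfolding enc_cnf_def by (simp only: dec_enc_nats)
  have "foldl parse_clause (cs, [], 0) (concat (map (\<lambda>C. length C # C) G)) = (cs @ G, [], 0)" for cs
  proof (induction G arbitrary: cs)
    case (Cons C G)
    have "foldl parse_clause (cs, [], 0) (concat (map (\<lambda>C. length C # C) (C # G))) =
      foldl parse_clause (foldl parse_clause (cs, [], 0) (length C # C)) (concat (map (\<lambda>C. length C # C) G))" by simp
    then show ?case unfolding parse_clause_enc using Cons by simp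
  qed simp
  then show "parse_clauses (concat (map (\<lambda>C. length C # C) G)) = G" by (simp add: parse_clauses_def)
qed

definition initial_form :: "nat \<Rightarrow> nat list list \<Rightarrow> nat list list" where
  "initial_form N F = subs_list (dedup (map (canon N) F))"

lemma initial_form:
  assumes "is_3cnf n F"
  defines "F0 \<equiv> initial_form (2 * n) (map (map lit_code) F)"
  shows "cform (2 * n) F0" "sparse_inv (2 * n) D (clause_sets F0) (clause_sets F0)"
    "satisfiable F \<longleftrightarrow> sat_sets (clause_sets F0)"
proof -
  let ?N = "2 * n" and ?G = "map (canon (2 * n)) (map (map lit_code) F)"
  have c: "cform ?N (dedup ?G)" by (rule cform_dedup) (auto simp: canon_canon)
  show cf: "cform ?N F0" unfolding F0_def initial_form_def by (rule clause_sets_subs(2)[OF c])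
  have e: "clause_sets F0 = subsume (clause_sets ?G)"
    unfolding F0_def initial_form_def clause_sets_subs(1)[OF c] by (simp add: clause_sets_def dedup)
  have lt: "set (map lit_code C) \<subseteq> {..<?N}" "length C \<le> 3" if "C \<in> set F" for C
  proof -
    have "length C \<le> 3 \<and> (\<forall>(x, b)\<in>set C. x < n)" using assms(1) that unfolding is_3cnf_def by blast
    then show "set (map lit_code C) \<subseteq> {..<?N}" "length C \<le> 3" by (auto simp: lit_code_def of_bool_def)
  qed
  have cs: "clause_sets ?G = (\<lambda>C. lit_code ` set C) ` set F"
  proof -
    have "set (canon ?N (map lit_code C)) = lit_code ` set C" if "C \<in> set F" for C
      using lt(1)[OF that] unfolding set_canon by auto
    then show ?thesis unfolding clause_sets_def by (simp add: image_image)
  qed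
  have hl: "lit_holds a (lit_code p) \<longleftrightarrow> a (fst p) = snd p" for a p
    by (cases p) (auto simp: lit_holds_def lit_code_def)
  have "satisfiable F \<longleftrightarrow> (\<exists>a. \<forall>C\<in>clause_sets ?G. \<exists>l\<in>C. lit_holds a l)"
    unfolding satisfiable_def cs by (simp add: hl case_prod_unfold)
  then show "satisfiable F \<longleftrightarrow> sat_sets (clause_sets F0)"
    unfolding e sat_sets_def using sat_subsume[of "clause_sets ?G"] by (simp add: clause_sets_def)
  have "C \<subseteq> {..<?N} \<and> card C \<le> 3" if "C \<in> clause_sets F0" for C
  proof -
    have "C \<in> (\<lambda>C. lit_code ` set C) ` set F" using that unfolding e cs subsume_def by blast
    then obtain C' where C': "C' \<in> set F" "C = lit_code ` set C'" by blast
    have "card C \<le> length C'" unfolding C'(2) using card_image_le[of "set C'" lit_code] card_length[of C'] by simp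
    then show ?thesis using lt[OF C'(1)] C'(2) by simp
  qed
  moreover have "\<not> C' \<subset> C" if "C \<in> clause_sets F0" "C' \<in> clause_sets F0" for C C'
    using that unfolding e subsume_def by blast
  moreover have "degree_added (clause_sets F0) (clause_sets F0) p = 0" for p
  proof -
    have "{C \<in> clause_sets F0. card C = 2 \<and> p \<in> C \<and> C \<notin> clause_sets F0} = {}" by blast
    then show ?thesis unfolding degree_added_def by (simp only: card.empty)
  qed
  ultimately show "sparse_inv ?N D (clause_sets F0) (clause_sets F0)" unfolding sparse_inv_def by fastforce
qed

subsection \<open>The sparsification algorithm as a program\<close>

lemma pt_even [pt_intros]:
  assumes "pt f"
  shows "pt (\<lambda>x. even (f x :: nat))"
proof -
  have "pt (\<lambda>x. foldl (\<lambda>b _. \<not> b) True (units (f x)))"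
    by (rule pt_foldl[where B = "\<lambda>_. 3"]) (intro pt_intros assms pbd_const sz_bool)+
  moreover have "foldl (\<lambda>b _. \<not> b) c us = (c = even (length us))" for c and us :: "unit list"
    by (induction us arbitrary: c) auto
  ultimately show ?thesis by (simp add: units_def)
qed

lemma pt_div [pt_intros]:
  assumes "pt f" "pt g"
  shows "pt (\<lambda>x. f x div (g x :: nat))"
proof -
  have "pt (\<lambda>p. if snd p = 0 then 0 else length (filter (\<lambda>k. Suc k * snd p \<le> fst p) [0..<fst p]))"
    by (intro pt_intros)
  moreover have "(if y = 0 then 0 else length (filter (\<lambda>k. Suc k * y \<le> x) [0..<x])) = x div y" for x y :: nat
  proof (cases "y = 0")
    case False
    have "Suc k * y \<le> x \<longleftrightarrow> k < x div y" for k
      using False by (simp add: less_eq_div_iff_mult_less_eq Suc_le_eq[symmetric] del: mult_Suc)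
    then have "filter (\<lambda>k. Suc k * y \<le> x) [0..<x] = filter (\<lambda>k. k < x div y) [0..<x]" by simp
    moreover have "{k. k < x \<and> k < x div y} = {..<x div y}" by (auto intro: less_le_trans[OF _ div_le_dividend])
    then have "length (filter (\<lambda>k. k < x div y) [0..<x]) = x div y"
      by (simp add: length_filter_conv_card cong: conj_cong)
    ultimately show ?thesis using False by simp
  qed simp
  ultimately have "pt (\<lambda>p. fst p div snd p :: nat)" by (simp only:)
  then show ?thesis by (rule pt2[OF _ assms])
qed

lemma pt_canon [pt_intros]: "pt f \<Longrightarrow> pt g \<Longrightarrow> pt (\<lambda>x. canon (f x) (g x))"
  by (rule pt2) (unfold canon_def, intro pt_intros)

lemma pt_subs_list [pt_intros]: "pt f \<Longrightarrow> pt (\<lambda>x. subs_list (f x))"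
  by (rule pt_comp[of subs_list]) (unfold subs_list_def, intro pt_intros)

lemma pt_petal_list [pt_intros]: "pt f \<Longrightarrow> pt g \<Longrightarrow> pt h \<Longrightarrow> pt (\<lambda>x. petal_list (f x) (g x) (h x))"
  by (rule pt3) (unfold petal_list_def, intro pt_intros)

lemma pt_dedup [pt_intros]:
  assumes "pt f"
  shows "pt (\<lambda>x. dedup (f x))"
proof (rule pt_comp[OF _ assms])
  show "pt (dedup :: 'b list \<Rightarrow> _)" unfolding dedup_def
  proof (rule pt_foldl_add[where q = "\<lambda>x. sz x + 1"])
    show "sz (if y \<in> set a then a else a @ [y]) \<le> sz a + (sz x + 1)" if "y \<in> set x" for x a and y :: 'b
      using sz_append[of a "[y]"] sz_elem[OF that] by simp
  qed (intro pt_intros pbd_add pbd_const pb_sz)+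
qed

lemma pt_heart_list [pt_intros]: "pt f \<Longrightarrow> pt g \<Longrightarrow> pt (\<lambda>x. heart_list (f x) (g x))"
  by (rule pt2) (unfold heart_list_def, intro pt_intros)

lemma pt_petals_list [pt_intros]: "pt f \<Longrightarrow> pt g \<Longrightarrow> pt h \<Longrightarrow> pt (\<lambda>x. petals_list (f x) (g x) (h x))"
  by (rule pt3) (unfold petals_list_def, intro pt_intros)

lemma pt_find_branch [pt_intros]: "pt f \<Longrightarrow> pt g \<Longrightarrow> pt h \<Longrightarrow> pt (\<lambda>x. find_branch (f x) (g x) (h x))"
  by (rule pt3) (unfold find_branch_def, intro pt_intros pt_product)

lemma pt_lits_compat [pt_intros]: "pt f \<Longrightarrow> pt g \<Longrightarrow> pt (\<lambda>x. lits_compat (f x) (g x))"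
  by (rule pt2) (unfold lits_compat_def conflict_def, intro pt_intros)

lemma pt_chunk [pt_intros]: "pt f \<Longrightarrow> pt g \<Longrightarrow> pt h \<Longrightarrow> pt (\<lambda>x. chunk (f x) (g x) (h x))"
  by (rule pt3) (unfold chunk_def, intro pt_intros)

lemma pt_pick [pt_intros]: "pt f \<Longrightarrow> pt g \<Longrightarrow> pt (\<lambda>x. pick (f x) (g x))"
  by (rule pt2) (unfold pick_def, intro pt_intros)

lemma pt_word_ok [pt_intros]: "pt f \<Longrightarrow> pt g \<Longrightarrow> pt (\<lambda>x. word_ok (f x) (g x))"
  by (rule pt2) (unfold word_ok_def, intro pt_intros)

lemma pt_choice_vertices [pt_intros]: "pt f \<Longrightarrow> pt g \<Longrightarrow> pt h \<Longrightarrow> pt (\<lambda>x. choice_vertices (f x) (g x) (h x))"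
  by (rule pt3) (unfold choice_vertices_def, intro pt_intros)

lemma pt_choice_adj [pt_intros]: "pt f \<Longrightarrow> pt g \<Longrightarrow> pt (\<lambda>x. choice_adj (f x) (g x))"
  by (rule pt2) (unfold choice_adj_def, intro pt_intros)

lemma pt_parse_clauses [pt_intros]:
  assumes "pt f"
  shows "pt (\<lambda>x. parse_clauses (f x))"
proof (rule pt_comp[OF _ assms])
  have "pt (\<lambda>ns. foldl parse_clause ([], [], 0) ns)"
  proof (rule pt_foldl_add[where q = "\<lambda>x. sz x + 10"])
    show "pt (\<lambda>p. parse_clause (fst (snd p)) (snd (snd p)))" unfolding parse_clause_def by (intro pt_intros)
    show "sz (parse_clause z y) \<le> sz z + (sz x + 10)" if "y \<in> set x" for x z y
    proof -
      obtain cs cur m where z: "z = (cs, cur, m)" by (rule prod_cases3)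
      have "sz y < sz x" by (rule sz_elem[OF that])
      then show ?thesis
        using sz_append[of cs "[[]]"] sz_append[of cs "[cur @ [y]]"] sz_append[of cur "[y]"] sz_pos[of cur]
        by (simp add: z parse_clause_def) (use sz_pos[of x] in linarith)
    qed
  qed (intro pt_intros pbd_add pbd_const pb_sz)+
  then show "pt parse_clauses" unfolding parse_clauses_def by (intro pt_intros)
qed

lemma pt_initial_form [pt_intros]: "pt f \<Longrightarrow> pt g \<Longrightarrow> pt (\<lambda>x. initial_form (f x) (g x))"
  by (rule pt2) (unfold initial_form_def, intro pt_intros)

definition ternary_step :: "nat \<times> nat list list \<Rightarrow> nat \<times> nat list list" where
  "ternary_step s = (fst s - 1, concat (map (\<lambda>ys. map (\<lambda>y. y # ys) [0, 1, 2]) (snd s)))"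

lemma ternary_funpow: "i \<le> q \<Longrightarrow> (ternary_step ^^ i) (q, [[]]) = (q - i, List.n_lists i [0, 1, 2])"
  by (induction i) (auto simp: ternary_step_def)

lemma sz_ternary: "sz (List.n_lists q [0 :: nat, 1, 2]) \<le> 1 + 3 ^ q * (2 + 6 * q)"
proof -
  have "sz w \<le> 1 + 6 * q" if "w \<in> set (List.n_lists q [0 :: nat, 1, 2])" for w
  proof -
    have w: "length w = q" "set w \<subseteq> {0, 1, 2}" using that by (auto simp: set_n_lists)
    have "sz w \<le> 1 + length w * (1 + 5)" by (rule sz_list_le) (use w(2) in auto)
    then show ?thesis using w(1) by simp
  qed
  then have "sz (List.n_lists q [0 :: nat, 1, 2]) \<le> 1 + length (List.n_lists q [0 :: nat, 1, 2]) * (1 + (1 + 6 * q))"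
    by (rule sz_list_le)
  then show ?thesis by (simp add: length_n_lists numeral_3_eq_3)
qed

text \<open>The number of words outgrows every polynomial in \<open>q\<close>, so it becomes the
  allowance. Besides the solver, this is the only cost at a leaf that is not polynomial.\<close>

lemma tc_ternary: "tc (\<lambda>q. List.n_lists q [0 :: nat, 1, 2]) (\<lambda>_. True) (\<lambda>q. 3 ^ q)"
proof -
  define S where "S s = 10 + 2 * fst s + 1 + 3 ^ fst s * (2 + 6 * fst s)" for s :: "nat \<times> nat list list"
  have step: "tc ternary_step (\<lambda>_. True) (\<lambda>_. 0)" by (rule tc_pt) (unfold ternary_step_def, intro pt_intros)
  have test: "tc (\<lambda>s :: nat \<times> nat list list. \<not> fst s = 0) (\<lambda>_. True) (\<lambda>_. 0)" by (intro tc_pt pt_intros)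
  have loop: "tc (\<lambda>s. (0 :: nat, List.n_lists (fst s) [0 :: nat, 1, 2])) (\<lambda>s. snd s = [[]]) S"
  proof (rule tc_while[OF test step])
    fix s :: "nat \<times> nat list list" assume "snd s = [[]]"
    then obtain q where s: "s = (q, [[]])" by (cases s) simp
    have f: "(ternary_step ^^ i) s = (q - i, List.n_lists i [0, 1, 2])" if "i \<le> q" for i
      unfolding s by (rule ternary_funpow[OF that])
    have z: "sz ((ternary_step ^^ i) s) + 0 \<le> S s" if i: "i \<le> q" for i
    proof -
      have "(3 :: nat) ^ i * (2 + 6 * i) \<le> 3 ^ q * (2 + 6 * q)" using i by (intro mult_le_mono power_increasing) auto
      then show ?thesis using sz_ternary[of i] f[OF i] by (simp add: S_def s)
    qed
    show "\<exists>n\<le>S s. (\<forall>i<n. \<not> fst ((ternary_step ^^ i) s) = 0) \<and> \<not> \<not> fst ((ternary_step ^^ n) s) = 0 \<and>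
      (0, List.n_lists (fst s) [0, 1, 2]) = (ternary_step ^^ n) s \<and>
      (\<forall>i\<le>n. True \<and> sz ((ternary_step ^^ i) s) + 0 \<le> S s)"
      by (rule exI[of _ q]) (use f z in \<open>simp add: s S_def\<close>)
  qed
  have "tc (\<lambda>q. (q :: nat, [[]] :: nat list list)) (\<lambda>_. True) (\<lambda>_. 0)" by (intro tc_pt pt_intros)
  from tc_comp[OF this loop]
  have "tc (\<lambda>q. (0 :: nat, List.n_lists q [0 :: nat, 1, 2])) (\<lambda>_. True) (\<lambda>q. S (q, [[]]))" by simp
  moreover have "tc (snd :: nat \<times> nat list list \<Rightarrow> _) (\<lambda>_. True) (\<lambda>_. 0)" by (intro tc_pt pt_intros)
  ultimately have "tc (\<lambda>q. snd (0 :: nat, List.n_lists q [0 :: nat, 1, 2])) (\<lambda>_. True) (\<lambda>q. S (q, [[]]) + 0)"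
    by (rule tc_comp) simp
  then have "tc (\<lambda>q. List.n_lists q [0 :: nat, 1, 2]) (\<lambda>_. True) (\<lambda>q. S (q, [[]]))" by simp
  then show ?thesis
  proof (rule tc_weaken)
    have "pbd (\<lambda>_. True) (\<lambda>q :: nat. q) (\<lambda>q. sz q + 3 ^ q)" "pbd (\<lambda>_. True) (\<lambda>q :: nat. 3 ^ q :: nat) (\<lambda>q. sz q + 3 ^ q)"
      by (rule pbd_self; simp)+
    then show "pbd (\<lambda>_. True) (\<lambda>q. S (q, [[]])) (\<lambda>q. sz q + 3 ^ q)"
      unfolding S_def fst_conv by (intro pbd_add pbd_mult pbd_const)
  qed simp
qed

section \<open>Deciding a sparse formula with the solver\<close>

definition leaf_vertices :: "nat \<times> nat list list \<Rightarrow> (nat \<times> nat list) list" where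
  "leaf_vertices x = choice_vertices (fst x) (snd x) (List.n_lists (length (snd x) div fst x + 1) [0, 1, 2])"

definition leaf_inst :: "nat \<times> nat list list \<Rightarrow> bool list" where
  "leaf_inst x = enc_inst (swap_inst choice_adj (leaf_vertices x) (fst x)) (2 * fst x)"

text \<open>The answer as a function of the whole input word, so that the solver can enter the
  calculus as a function; \<open>solves\<close> is its domain.\<close>

definition solution :: "nat \<Rightarrow> bool list \<Rightarrow> bool list" where
  "solution r w = [(inst_word w, inst_param w) \<in> r_swap r]"

definition solves :: "tm \<Rightarrow> nat \<Rightarrow> bool list \<Rightarrow> bool" where
  "solves M r w \<longleftrightarrow> (\<exists>t. computes_within M w (solution r w) t)"

text \<open>The actual halting time is the allowance, which postpones every estimate in terms of
  \<open>f\<close> and \<open>g\<close>.\<close>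

definition solver_time :: "tm \<Rightarrow> nat \<Rightarrow> bool list \<Rightarrow> nat" where
  "solver_time M r w = (LEAST t. computes_within M w (solution r w) t)"

definition leaf :: "nat \<Rightarrow> nat \<times> nat list list \<Rightarrow> bool" where
  "leaf r x \<longleftrightarrow> solution r (leaf_inst x) = [True]"

definition leaf_cost :: "tm \<Rightarrow> nat \<Rightarrow> nat \<times> nat list list \<Rightarrow> nat" where
  "leaf_cost M r x = 3 ^ (length (snd x) div fst x + 1) + solver_time M r (leaf_inst x)"

lemma tc_leaf:
  assumes "wf_tm M"
  shows "tc (leaf r) (\<lambda>x. solves M r (leaf_inst x)) (leaf_cost M r)"
proof -
  let ?T = "\<lambda>x :: nat \<times> nat list list. 3 ^ (length (snd x) div fst x + 1) :: nat"
  have "tc (\<lambda>x :: nat \<times> nat list list. length (snd x) div fst x + 1) (\<lambda>_. True) (\<lambda>_. 0)" by (intro tc_pt pt_intros)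
  from tc_comp[OF this tc_ternary]
  have "tc (\<lambda>x :: nat \<times> nat list list. List.n_lists (length (snd x) div fst x + 1) [0 :: nat, 1, 2]) (\<lambda>_. True) ?T" by simp
  then have "tc (\<lambda>x. (x, List.n_lists (length (snd x) div fst x + 1) [0 :: nat, 1, 2])) (\<lambda>_. True) ?T"
    by (rule tc_pair[OF tc_pt[OF pt_id]])
  moreover have "pt (\<lambda>p. enc_inst (swap_inst choice_adj (choice_vertices (fst (fst p)) (snd (fst p)) (snd p)) (fst (fst p))) (2 * fst (fst p)))"
    by (intro pt_intros pt_swap_inst)
  then have "tc (\<lambda>p. enc_inst (swap_inst choice_adj (choice_vertices (fst (fst p)) (snd (fst p)) (snd p)) (fst (fst p))) (2 * fst (fst p)))
    (\<lambda>_. True) (\<lambda>_. 0)" by (rule tc_pt)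
  ultimately have "tc (\<lambda>x. enc_inst (swap_inst choice_adj (choice_vertices (fst (fst (x, List.n_lists (length (snd x) div fst x + 1) [0 :: nat, 1, 2])))
     (snd (fst (x, List.n_lists (length (snd x) div fst x + 1) [0 :: nat, 1, 2]))) (snd (x, List.n_lists (length (snd x) div fst x + 1) [0 :: nat, 1, 2])))
     (fst (fst (x, List.n_lists (length (snd x) div fst x + 1) [0 :: nat, 1, 2])))) (2 * fst (fst (x, List.n_lists (length (snd x) div fst x + 1) [0 :: nat, 1, 2]))))
     (\<lambda>_. True) (\<lambda>x. ?T x + 0)" by (rule tc_comp) simp
  then have "tc leaf_inst (\<lambda>_. True) ?T"
    by (rule tc_weaken_le[OF tc_cong]) (simp_all add: leaf_inst_def leaf_vertices_def)
  then have 1: "tc leaf_inst (\<lambda>x. solves M r (leaf_inst x)) ?T" by (rule tc_weaken_le) simp_all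
  have 2: "tc (solution r) (solves M r) (solver_time M r)"
  proof (rule tc_of_tm[OF assms])
    fix w assume "solves M r w"
    then show "computes_within M w (solution r w) (solver_time M r w)"
      unfolding solves_def solver_time_def by (rule LeastI_ex)
  qed
  have 3: "tc (\<lambda>w. w = [True]) (\<lambda>_. True) (\<lambda>_. 0)" by (intro tc_pt pt_intros)
  have "tc (\<lambda>x. solution r (leaf_inst x)) (\<lambda>x. solves M r (leaf_inst x)) (leaf_cost M r)"
    using tc_comp[OF 1 2] unfolding leaf_cost_def by simp
  from tc_comp[OF this 3] show ?thesis by (simp add: leaf_def[abs_def])
qed

text \<open>Thresholds, number of chunks and number of literals; then whether a satisfiable leaf has
  been seen; then the formulas still to be treated. The list is a stack that replaces recursion over
  the branching tree.\<close>

type_synonym sparse_state = "((nat \<times> nat \<times> nat) \<times> nat \<times> nat) \<times> bool \<times> nat list list list"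

definition branch_at :: "sparse_state \<Rightarrow> (nat \<times> nat list) option" where
  "branch_at z = find_branch (fst (fst z)) (snd (snd (fst z))) (nth_default [] (snd (snd z)) 0)"

definition at_leaf :: "sparse_state \<Rightarrow> bool" where
  "at_leaf z \<longleftrightarrow> \<not> snd (snd z) = [] \<and> branch_at z = None"

definition leaf_arg :: "sparse_state \<Rightarrow> nat \<times> nat list list" where
  "leaf_arg z = (fst (snd (fst z)), nth_default [] (snd (snd z)) 0)"

definition branch_step :: "sparse_state \<Rightarrow> sparse_state" where
  "branch_step z = (case branch_at z of None \<Rightarrow> z | Some d \<Rightarrow>
     (fst z, fst (snd z), heart_list (nth_default [] (snd (snd z)) 0) (snd d) #
        petals_list (nth_default [] (snd (snd z)) 0) (fst d) (snd d) # tl (snd (snd z))))"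

definition sparse_step :: "nat \<Rightarrow> sparse_state \<Rightarrow> sparse_state" where
  "sparse_step r z = (if at_leaf z then (fst z, fst (snd z) \<or> leaf r (leaf_arg z), tl (snd (snd z))) else branch_step z)"

definition step_dom :: "tm \<Rightarrow> nat \<Rightarrow> sparse_state \<Rightarrow> bool" where
  "step_dom M r z \<longleftrightarrow> (at_leaf z \<longrightarrow> solves M r (leaf_inst (leaf_arg z)))"

definition step_cost :: "tm \<Rightarrow> nat \<Rightarrow> sparse_state \<Rightarrow> nat" where
  "step_cost M r z = (if at_leaf z then leaf_cost M r (leaf_arg z) else 0)"

lemma pt_branch_at [pt_intros]: "pt f \<Longrightarrow> pt (\<lambda>x. branch_at (f x))"
  by (rule pt_comp[of branch_at]) (unfold branch_at_def, intro pt_intros)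

lemma tc_sparse_step:
  assumes M: "wf_tm M"
  shows "tc (sparse_step r) (step_dom M r) (step_cost M r)"
  unfolding sparse_step_def
proof (rule tc_if)
  have "pt at_leaf" unfolding at_leaf_def by (intro pt_intros)
  then show "tc at_leaf (step_dom M r) (step_cost M r)" by (rule tc_pt)
  have "pt branch_step" unfolding branch_step_def by (intro pt_intros)
  then show "tc branch_step (\<lambda>x. step_dom M r x \<and> \<not> at_leaf x) (step_cost M r)" by (rule tc_pt)
  let ?D = "\<lambda>z. step_dom M r z \<and> at_leaf z"
  have "pt leaf_arg" unfolding leaf_arg_def by (intro pt_intros)
  then have "tc leaf_arg ?D (\<lambda>_. 0)" by (rule tc_pt)
  from tc_comp[OF this tc_leaf[OF M]]
  have "tc (\<lambda>z. leaf r (leaf_arg z)) ?D (\<lambda>z. 0 + leaf_cost M r (leaf_arg z))"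
    unfolding step_dom_def by blast
  then have "tc (\<lambda>z. leaf r (leaf_arg z)) ?D (step_cost M r)"
    by (rule tc_weaken_le) (simp_all add: step_cost_def)
  from tc_pair[OF tc_pt[OF pt_id] this]
  have 1: "tc (\<lambda>z. (z, leaf r (leaf_arg z))) ?D (step_cost M r)" .
  have "pt (\<lambda>p :: sparse_state \<times> bool. (fst (fst p), fst (snd (fst p)) \<or> snd p, tl (snd (snd (fst p)))))"
    by (intro pt_intros)
  then have 2: "tc (\<lambda>p :: sparse_state \<times> bool. (fst (fst p), fst (snd (fst p)) \<or> snd p, tl (snd (snd (fst p))))) (\<lambda>_. True) (\<lambda>_. 0)"
    by (rule tc_pt)
  from tc_comp[OF 1 2]
  show "tc (\<lambda>z. (fst z, fst (snd z) \<or> leaf r (leaf_arg z), tl (snd (snd z)))) ?D (step_cost M r)" by simp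
qed

definition loop_cost :: "('a :: codable \<Rightarrow> bool) \<Rightarrow> ('a \<Rightarrow> 'a) \<Rightarrow> ('a \<Rightarrow> bool) \<Rightarrow> ('a \<Rightarrow> nat) \<Rightarrow> 'a \<Rightarrow> nat \<Rightarrow> bool" where
  "loop_cost b F D T x s \<longleftrightarrow> (\<exists>n \<le> s. (\<forall>i < n. b ((F ^^ i) x)) \<and> \<not> b ((F ^^ n) x) \<and>
     (\<forall>i \<le> n. D ((F ^^ i) x) \<and> sz ((F ^^ i) x) + T ((F ^^ i) x) \<le> s))"

definition loop_result :: "('a \<Rightarrow> bool) \<Rightarrow> ('a \<Rightarrow> 'a) \<Rightarrow> 'a \<Rightarrow> 'a" where
  "loop_result b F x = (F ^^ (LEAST n. \<not> b ((F ^^ n) x))) x"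

lemma loop_result_eq: "(\<And>i. i < n \<Longrightarrow> b ((F ^^ i) x)) \<Longrightarrow> \<not> b ((F ^^ n) x) \<Longrightarrow> loop_result b F x = (F ^^ n) x"
proof -
  assume "\<And>i. i < n \<Longrightarrow> b ((F ^^ i) x)" "\<not> b ((F ^^ n) x)"
  then have "(LEAST n. \<not> b ((F ^^ n) x)) = n" by (intro Least_equality) (auto simp: not_less[symmetric])
  then show ?thesis by (simp add: loop_result_def)
qed

text \<open>The least bound that fits the actual run is taken as allowance. So the program and its
  exponent exist before the parameters are chosen on which an estimate of the run depends.\<close>

lemma tc_loop:
  assumes "tc b D T" "tc F D T"
  shows "tc (loop_result b F) (\<lambda>x. \<exists>s. loop_cost b F D T x s) (\<lambda>x. LEAST s. loop_cost b F D T x s)"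
proof (rule tc_while[OF assms])
  fix x assume "\<exists>s. loop_cost b F D T x s"
  then have "loop_cost b F D T x (LEAST s. loop_cost b F D T x s)" by (rule LeastI_ex)
  then obtain n where n: "n \<le> (LEAST s. loop_cost b F D T x s)" "\<forall>i < n. b ((F ^^ i) x)" "\<not> b ((F ^^ n) x)"
    "\<forall>i \<le> n. D ((F ^^ i) x) \<and> sz ((F ^^ i) x) + T ((F ^^ i) x) \<le> (LEAST s. loop_cost b F D T x s)"
    unfolding loop_cost_def[of b F D T x "LEAST s. loop_cost b F D T x s"] by (elim exE conjE) (rule that)
  have "loop_result b F x = (F ^^ n) x" using n(2,3) by (intro loop_result_eq) auto
  then show "\<exists>n\<le>LEAST s. loop_cost b F D T x s. (\<forall>i<n. b ((F ^^ i) x)) \<and> \<not> b ((F ^^ n) x) \<and> loop_result b F x = (F ^^ n) x \<and>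
     (\<forall>i\<le>n. D ((F ^^ i) x) \<and> sz ((F ^^ i) x) + T ((F ^^ i) x) \<le> (LEAST s. loop_cost b F D T x s))"
    using n by (intro exI[of _ n] conjI)
qed

definition start_state :: "((nat \<times> nat \<times> nat) \<times> nat) \<times> bool list \<Rightarrow> sparse_state" where
  "start_state x = (let ns = dec_nats (snd x); N = 2 * nth_default 0 ns 0 in
     ((fst (fst x), snd (fst x), N), False, [initial_form N (parse_clauses (tl ns))]))"

definition unfinished :: "sparse_state \<Rightarrow> bool" where "unfinished z \<longleftrightarrow> \<not> snd (snd z) = []"

definition decide :: "nat \<Rightarrow> ((nat \<times> nat \<times> nat) \<times> nat) \<times> bool list \<Rightarrow> bool list" where
  "decide r x = [fst (snd (loop_result unfinished (sparse_step r) (start_state x)))]"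

definition run_cost :: "tm \<Rightarrow> nat \<Rightarrow> sparse_state \<Rightarrow> nat \<Rightarrow> bool" where
  "run_cost M r = loop_cost unfinished (sparse_step r) (step_dom M r) (step_cost M r)"

lemma tc_decide:
  assumes "wf_tm M"
  shows "tc (decide r) (\<lambda>x. \<exists>s. run_cost M r (start_state x) s) (\<lambda>x. LEAST s. run_cost M r (start_state x) s)"
proof -
  have "pt unfinished" unfolding unfinished_def by (intro pt_intros)
  then have "tc unfinished (step_dom M r) (step_cost M r)" by (rule tc_pt)
  from tc_loop[OF this tc_sparse_step[OF assms]]
  have 1: "tc (loop_result unfinished (sparse_step r)) (\<lambda>x. \<exists>s. run_cost M r x s) (\<lambda>x. LEAST s. run_cost M r x s)"
    unfolding run_cost_def .
  have "pt start_state" unfolding start_state_def by (intro pt_intros)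
  then have "tc start_state (\<lambda>x. \<exists>s. run_cost M r (start_state x) s) (\<lambda>_. 0)" by (rule tc_pt)
  from tc_comp[OF this 1]
  have 2: "tc (\<lambda>x. loop_result unfinished (sparse_step r) (start_state x)) (\<lambda>x. \<exists>s. run_cost M r (start_state x) s)
    (\<lambda>x. LEAST s. run_cost M r (start_state x) s)" by simp
  have "pt (\<lambda>z :: sparse_state. [fst (snd z)])" by (intro pt_intros)
  then have "tc (\<lambda>z :: sparse_state. [fst (snd z)]) (\<lambda>_. True) (\<lambda>_. 0)" by (rule tc_pt)
  from tc_comp[OF 2 this] show ?thesis by (simp add: decide_def[abs_def])
qed

section \<open>Correctness and length of the run\<close>

lemma sz_form:
  assumes F: "cform N F" "\<forall>C\<in>set F. length C \<le> 3"
  shows "sz F \<le> 9 * (N + 1) ^ 4"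
proof -
  have "set F \<subseteq> {C. set C \<subseteq> {..<N} \<and> length C \<le> 3}"
  proof
    fix C assume "C \<in> set F"
    then show "C \<in> {C. set C \<subseteq> {..<N} \<and> length C \<le> 3}" using F(2) cformD(2)[OF F(1)] by blast
  qed
  then have "card (set F) \<le> card {C. set C \<subseteq> {..<N} \<and> length C \<le> 3}"
    by (rule card_mono[OF finite_lists_length_le[OF finite_lessThan]])
  also have "\<dots> = (\<Sum>i\<le>3. N ^ i)" using card_lists_length_le[of "{..<N}" 3] by simp
  also have "\<dots> \<le> (N + 1) ^ 3" by (simp add: numeral_3_eq_3 algebra_simps)
  finally have l: "length F \<le> (N + 1) ^ 3" using F(1) by (simp add: cform_def distinct_card)
  have "sz C \<le> 7 * (N + 1)" if C: "C \<in> set F" for C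
  proof -
    have "sz C \<le> 1 + length C * (1 + (1 + 2 * N))"
      by (rule sz_list_le) (use cformD(2)[OF F(1) C] in auto)
    also have "\<dots> \<le> 1 + 3 * (1 + (1 + 2 * N))" using F(2) C by (intro add_left_mono mult_right_mono) auto
    finally show ?thesis by simp
  qed
  then have "sz F \<le> 1 + length F * (1 + 7 * (N + 1))" by (rule sz_list_le)
  also have "\<dots> \<le> 1 + (N + 1) ^ 3 * (1 + 7 * (N + 1))" using l by (intro add_left_mono mult_right_mono) auto
  also have "\<dots> \<le> (N + 1) ^ 4 + (N + 1) ^ 3 * (8 * (N + 1))"
  proof (rule add_mono)
    show "(1 :: nat) \<le> (N + 1) ^ 4" by (rule one_le_power) simp
    show "(N + 1) ^ 3 * (1 + 7 * (N + 1)) \<le> (N + 1) ^ 3 * (8 * (N + 1))" by (rule mult_left_mono) auto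
  qed
  also have "\<dots> = 9 * (N + 1) ^ 4" by (simp add: eval_nat_numeral algebra_simps)
  finally show ?thesis .
qed

lemma measure_loop:
  fixes \<Psi> :: "'a \<Rightarrow> real"
  assumes "\<And>z. I z \<Longrightarrow> 0 \<le> \<Psi> z"
    and step: "\<And>z. I z \<Longrightarrow> b z \<Longrightarrow> I (F z) \<and> \<Psi> (F z) + 1 \<le> \<Psi> z"
    and "I z"
  shows "\<exists>n. real n \<le> \<Psi> z \<and> (\<forall>i < n. b ((F ^^ i) z)) \<and> \<not> b ((F ^^ n) z) \<and>
     (\<forall>i \<le> n. I ((F ^^ i) z) \<and> \<Psi> ((F ^^ i) z) \<le> \<Psi> z)"
  using assms(3)
proof (induction "nat \<lfloor>\<Psi> z\<rfloor>" arbitrary: z rule: less_induct)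
  case less
  show ?case
  proof (cases "b z")
    case False
    then show ?thesis using less.prems assms(1)[OF less.prems] by (intro exI[of _ 0]) simp
  next
    case True
    have s: "I (F z)" "\<Psi> (F z) + 1 \<le> \<Psi> z" using step[OF less.prems True] by simp_all
    have "0 \<le> \<Psi> (F z)" by (rule assms(1)[OF s(1)])
    then have "nat \<lfloor>\<Psi> (F z)\<rfloor> < nat \<lfloor>\<Psi> z\<rfloor>" using s(2) by linarith
    from less.hyps[OF this s(1)] obtain n where n: "real n \<le> \<Psi> (F z)" "\<forall>i < n. b ((F ^^ i) (F z))"
      "\<not> b ((F ^^ n) (F z))" "\<forall>i \<le> n. I ((F ^^ i) (F z)) \<and> \<Psi> ((F ^^ i) (F z)) \<le> \<Psi> (F z)" by blast
    have sh: "(F ^^ i) (F z) = (F ^^ Suc i) z" for i by (simp add: funpow_swap1)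
    show ?thesis
    proof (intro exI[of _ "Suc n"] conjI allI impI)
      show "real (Suc n) \<le> \<Psi> z" using n(1) s(2) by simp
      show "b ((F ^^ i) z)" if "i < Suc n" for i
        using that n(2) True unfolding sh by (cases i) auto
      show "\<not> b ((F ^^ Suc n) z)" using n(3) unfolding sh .
      show "I ((F ^^ i) z)" if "i \<le> Suc n" for i
        using that n(4) less.prems unfolding sh by (cases i) auto
      show "\<Psi> ((F ^^ i) z) \<le> \<Psi> z" if "i \<le> Suc n" for i
      proof (cases i)
        case (Suc j)
        then have "\<Psi> ((F ^^ Suc j) z) \<le> \<Psi> (F z)" using that n(4) unfolding sh by simp
        then show ?thesis using s(2) Suc by simp
      qed simp
    qed
  qed
qed

lemma leaf_iff:
  assumes "3 \<le> r" "1 \<le> m" "\<forall>C\<in>set F. length C \<le> 3"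
  shows "leaf r (m, F) \<longleftrightarrow> sat_sets (clause_sets F)"
proof -
  have "leaf r (m, F) \<longleftrightarrow> (swap_inst choice_adj (leaf_vertices (m, F)) m, 2 * m) \<in> r_swap r"
    by (simp add: leaf_def solution_def leaf_inst_def)
  also have "\<dots> \<longleftrightarrow> list_clique choice_adj (leaf_vertices (m, F)) m" using assms by (intro swap_inst_iff) auto
  also have "\<dots> \<longleftrightarrow> sat_sets (clause_sets F)" unfolding leaf_vertices_def using choice_clique_iff[OF assms(2,3)] by simp
  finally show ?thesis .
qed

lemma length_leaf_vertices: "length (leaf_vertices (m, F)) \<le> m * 3 ^ (length F div m + 1)"
proof -
  define ws where "ws = List.n_lists (length F div m + 1) [0 :: nat, 1, 2]"
  have "length (leaf_vertices (m, F)) =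
    (\<Sum>i\<leftarrow>[0..<m]. length (map (\<lambda>ls. (i, ls)) (filter (\<lambda>ls. lits_compat ls ls)
      (map (\<lambda>w. pick (chunk m F i) w) (filter (\<lambda>w. word_ok (chunk m F i) w) ws)))))"
    by (simp add: leaf_vertices_def choice_vertices_def length_concat comp_def ws_def)
  also have "\<dots> \<le> (\<Sum>i\<leftarrow>[0..<m]. length ws)"
  proof (rule sum_list_mono)
    fix i
    show "length (map (\<lambda>ls. (i, ls)) (filter (\<lambda>ls. lits_compat ls ls)
      (map (\<lambda>w. pick (chunk m F i) w) (filter (\<lambda>w. word_ok (chunk m F i) w) ws)))) \<le> length ws"
      unfolding length_map by (rule order_trans[OF length_filter_le]) simp
  qed
  also have "\<dots> = m * 3 ^ (length F div m + 1)"
    unfolding ws_def length_n_lists by (simp add: sum_list_triv numeral_3_eq_3)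
  finally show ?thesis .
qed

lemma solver_time_leaf:
  assumes r: "3 \<le> r" and m: "1 \<le> m"
    and M: "\<And>n E c k. simple_graph n E \<Longrightarrow> coloring r n c \<Longrightarrow> 0 < k \<Longrightarrow> \<exists>t. real t \<le> T n k \<and>
        computes_within M (enc_inst (enc_colored_graph n E c) k) [swappable n E c k] t"
  shows "solves M r (leaf_inst (m, F))"
    "real (solver_time M r (leaf_inst (m, F))) \<le> T (swap_order (length (leaf_vertices (m, F))) m) (2 * m)"
proof -
  let ?V = "leaf_vertices (m, F)"
  let ?n = "swap_order (length ?V) m" and ?E = "swap_edges (length ?V) (vadj choice_adj ?V) m"
    and ?c = "swap_coloring (length ?V) m"
  have g: "simple_graph ?n ?E" "coloring r ?n ?c" by (rule simple_swap_graph, rule coloring_swap[OF r])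
  obtain t where t: "real t \<le> T ?n (2 * m)"
    "computes_within M (enc_inst (enc_colored_graph ?n ?E ?c) (2 * m)) [swappable ?n ?E ?c (2 * m)] t"
    using M[OF g, of "2 * m"] m by auto
  have "solution r (leaf_inst (m, F)) = [swappable ?n ?E ?c (2 * m)]"
    using m by (simp add: solution_def leaf_inst_def swap_inst_def r_swap_iff[OF g])
  then have c: "computes_within M (leaf_inst (m, F)) (solution r (leaf_inst (m, F))) t"
    using t(2) by (simp add: leaf_inst_def swap_inst_def)
  show "solves M r (leaf_inst (m, F))" unfolding solves_def using c by (rule exI)
  have "solver_time M r (leaf_inst (m, F)) \<le> t" unfolding solver_time_def using c by (rule Least_le)
  then show "real (solver_time M r (leaf_inst (m, F))) \<le> T ?n (2 * m)" using t(1) by simp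
qed

text \<open>A binary branching tree whose leaves are counted by \<open>2 powr potential\<close> at the root has at most this
  many nodes, so the total weight of the work list drops by one with every formula that is processed.\<close>

definition form_weight :: "nat \<Rightarrow> nat \<Rightarrow> real \<Rightarrow> real \<Rightarrow> nat set set \<Rightarrow> nat list list \<Rightarrow> real" where
  "form_weight N D x y G F = 2 * 2 powr potential N D x y G (clause_sets F) - 1"

definition good_form :: "nat \<Rightarrow> nat \<Rightarrow> nat set set \<Rightarrow> nat list list \<Rightarrow> bool" where
  "good_form N D G F \<longleftrightarrow> cform N F \<and> sparse_inv N D G (clause_sets F)"

lemma good_formD:
  assumes "good_form N D G F"
  shows "cform N F" "sparse_inv N D G (clause_sets F)" "\<forall>C\<in>set F. length C \<le> 3" "sz F \<le> 9 * (N + 1) ^ 4"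
proof -
  show c: "cform N F" "sparse_inv N D G (clause_sets F)" using assms by (simp_all add: good_form_def)
  show l: "\<forall>C\<in>set F. length C \<le> 3"
  proof
    fix C assume C: "C \<in> set F"
    then have "set C \<in> clause_sets F" by (simp add: clause_sets_def)
    then have "card (set C) \<le> 3" using c(2) unfolding sparse_inv_def by blast
    then show "length C \<le> 3" unfolding cformD(3)[OF c(1) C] .
  qed
  show "sz F \<le> 9 * (N + 1) ^ 4" by (rule sz_form[OF c(1) l])
qed

lemma form_weight_ge:
  assumes "good_form N D G F" "0 < x" "0 < y"
  shows "1 \<le> form_weight N D x y G F"
proof -
  have "1 \<le> 2 powr potential N D x y G (clause_sets F)"
    using potential_nonneg[OF good_formD(2)[OF assms(1)]] assms(2,3) by (intro ge_one_powr_ge_zero) simp_all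
  then show ?thesis by (simp add: form_weight_def)
qed

definition state_inv :: "nat \<times> nat \<times> nat \<Rightarrow> nat \<Rightarrow> nat \<Rightarrow> nat \<Rightarrow> nat set set \<Rightarrow> bool \<Rightarrow> sparse_state \<Rightarrow> bool" where
  "state_inv t m N D G sat z \<longleftrightarrow> fst z = (t, m, N) \<and> (\<forall>F\<in>set (snd (snd z)). good_form N D G F) \<and>
     (sat \<longleftrightarrow> fst (snd z) \<or> (\<exists>F\<in>set (snd (snd z)). sat_sets (clause_sets F)))"

definition state_weight :: "nat \<Rightarrow> nat \<Rightarrow> real \<Rightarrow> real \<Rightarrow> nat set set \<Rightarrow> sparse_state \<Rightarrow> real" where
  "state_weight N D x y G z = (\<Sum>F\<leftarrow>snd (snd z). form_weight N D x y G F)"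

lemma state_weight_ge:
  assumes "state_inv t m N D G sat z" "0 < x" "0 < y"
  shows "real (length (snd (snd z))) \<le> state_weight N D x y G z"
proof -
  have "(\<Sum>F\<leftarrow>snd (snd z). 1) \<le> (\<Sum>F\<leftarrow>snd (snd z). form_weight N D x y G F)"
    by (rule sum_list_mono) (use assms form_weight_ge in \<open>simp add: state_inv_def\<close>)
  then show ?thesis by (simp add: state_weight_def sum_list_triv)
qed

text \<open>A leaf takes its weight with it, which is at least 1. At a branching the powers of the
  potential do not increase in total, but two formulas replace one, so 1 is subtracted once more in
  the weight; that is the drop.\<close>

lemma sparse_step_inv:
  assumes inv: "state_inv (t1, t2, t3) m N D G sat z" and un: "unfinished z"
    and r: "3 \<le> r" and m: "1 \<le> m" and xy: "0 < x" "0 < y"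
    and D: "D = t1 + t2" and t: "1 \<le> t1" "1 \<le> t2" "1 \<le> t3"
    and w: "2 powr - x + 2 powr - (real t1 * x) \<le> 1" "2 powr - y + 2 powr - (real t2 * x) \<le> 1"
      "2 powr - x + 2 powr - (real t3 * y) \<le> 1"
  shows "state_inv (t1, t2, t3) m N D G sat (sparse_step r z) \<and>
    state_weight N D x y G (sparse_step r z) + 1 \<le> state_weight N D x y G z"
proof -
  obtain res F ws where z: "z = (((t1, t2, t3), m, N), res, F # ws)"
  proof (cases "snd (snd z)")
    case Nil
    then show ?thesis using un by (simp add: unfinished_def)
  next
    case (Cons F ws)
    then have "z = (((t1, t2, t3), m, N), fst (snd z), F # ws)" using inv unfolding state_inv_def by (metis prod.collapse)
    then show ?thesis by (rule that)
  qed
  have F: "good_form N D G F" and ws: "\<forall>F\<in>set ws. good_form N D G F"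
    and sat: "sat \<longleftrightarrow> res \<or> sat_sets (clause_sets F) \<or> (\<exists>F\<in>set ws. sat_sets (clause_sets F))"
    using inv by (auto simp: state_inv_def z)
  note gF = good_formD[OF F]
  have ba: "branch_at z = find_branch (t1, t2, t3) N F" by (simp add: branch_at_def z)
  note fb = find_branch_cases[OF gF(1) t(1,2), of t3]
  show ?thesis
  proof (cases "find_branch (t1, t2, t3) N F")
    case None
    have st: "sparse_step r z = (((t1, t2, t3), m, N), res \<or> sat_sets (clause_sets F), ws)"
      using None by (simp add: sparse_step_def at_leaf_def ba leaf_arg_def leaf_iff[OF r m gF(3), symmetric]) (simp add: z leaf_iff[OF r m gF(3)])
    have "state_weight N D x y G (sparse_step r z) + 1 \<le> state_weight N D x y G z"
      using form_weight_ge[OF F xy] unfolding st by (simp add: state_weight_def z)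
    then show ?thesis using sat ws unfolding st by (simp add: state_inv_def)
  next
    case (Some d)
    obtain c H where d: "d = (c, H)" by (cases d)
    have st: "sparse_step r z = (((t1, t2, t3), m, N), res, heart_list F H # petals_list F c H # ws)"
      by (simp add: sparse_step_def at_leaf_def ba Some branch_step_def d) (simp add: z)
    from fb obtain t where H: "H = canon N H" and t': "t \<le> card (petals (clause_sets F) c (set H))"
       "(c = 2 \<and> card (set H) = 1 \<and> t = t1) \<or>
        (c = 3 \<and> card (set H) = 2 \<and> t = t2 \<and> (\<forall>l. card (petals (clause_sets F) 2 {l}) < t1)) \<or>
        (c = 3 \<and> card (set H) = 1 \<and> t = t3 \<and> (\<forall>l. card (petals (clause_sets F) 2 {l}) < t1) \<and>
          (\<forall>K. card K = 2 \<longrightarrow> card (petals (clause_sets F) 3 K) < t2))"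
      unfolding Some d option.case prod.case by (elim conjE exE) (rule that)
    have HN: "set H \<subseteq> {..<N}" by (subst H) (simp add: set_canon)
    have t1': "1 \<le> t" using t'(2) t by (elim disjE conjE) simp_all
    note bp = branch_potential[OF gF(2) xy D t(1,2) HN t'(1) t1' t'(2) w]
    note h = heart_list[OF gF(1) H] and p = petals_list[OF gF(1), of c H]
    have g1: "good_form N D G (heart_list F H)" "good_form N D G (petals_list F c H)"
      unfolding good_form_def h(1) p(1) using bp(1,2) h(2) p(2) by simp_all
    have s: "sat_sets (clause_sets F) \<longleftrightarrow> sat_sets (clause_sets (heart_list F H)) \<or> sat_sets (clause_sets (petals_list F c H))"
      unfolding h(1) p(1) by (rule sat_branch[OF sparse_inv_finite[OF gF(2)]])
    have "form_weight N D x y G (heart_list F H) + form_weight N D x y G (petals_list F c H) + 1 \<le> form_weight N D x y G F"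
      unfolding form_weight_def h(1) p(1) using bp(3) by simp
    then have "state_weight N D x y G (sparse_step r z) + 1 \<le> state_weight N D x y G z"
      unfolding st by (simp add: state_weight_def z)
    then show ?thesis using sat ws g1 s unfolding st by (simp add: state_inv_def disj_assoc)
  qed
qed

text \<open>The weight bounds both the number of rounds and the length of the work list, whose
  formulas have polynomial size. As \<open>loop_cost\<close> bounds each round separately, the cost
  of a leaf is added only once.\<close>

lemma decide_correct:
  assumes cnf: "is_3cnf n F" and r: "3 \<le> r" and m: "1 \<le> m" and xy: "0 < x" "0 < y"
    and D: "D = t1 + t2" and t: "1 \<le> t1" "1 \<le> t2" "1 \<le> t3"
    and w: "2 powr - x + 2 powr - (real t1 * x) \<le> 1" "2 powr - y + 2 powr - (real t2 * x) \<le> 1"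
      "2 powr - x + 2 powr - (real t3 * y) \<le> 1"
    and M: "\<And>n E c k. simple_graph n E \<Longrightarrow> coloring r n c \<Longrightarrow> 0 < k \<Longrightarrow> \<exists>t. real t \<le> T n k \<and>
        computes_within M (enc_inst (enc_colored_graph n E c) k) [swappable n E c k] t"
    and Q: "Q = (1 + 2 * n * (1 + t1 + t3)) div m + 1"
    and \<tau>: "\<And>v. v \<le> m * 3 ^ Q \<Longrightarrow> T (swap_order v m) (2 * m) \<le> \<tau>"
  defines "z \<equiv> start_state (((t1, t2, t3), m), enc_cnf n F)"
  shows "decide r (((t1, t2, t3), m), enc_cnf n F) = [satisfiable F]"
    "\<exists>s. run_cost M r z s \<and>
      real s \<le> 20 * 2 powr ((x + y * real D) * (2 * real n)) * (2 * real n + 1) ^ 4 + real (sz ((t1, t2, t3), m, 2 * n)) + 7 + 3 ^ Q + \<tau>"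
proof -
  let ?N = "2 * n" and ?F0 = "initial_form (2 * n) (map (map lit_code) F)"
  let ?G = "clause_sets ?F0"
  let ?I = "state_inv (t1, t2, t3) m ?N D ?G (satisfiable F)" and ?\<Psi> = "state_weight ?N D x y ?G"
  have z: "z = (((t1, t2, t3), m, ?N), False, [?F0])"
    unfolding z_def start_state_def fst_conv snd_conv parse_cnf(1) by (simp add: Let_def parse_cnf(2) del: map_map)
  note i = initial_form[OF cnf]
  have Iz: "?I z" using i by (simp add: state_inv_def z good_form_def)
  \<comment> \<open>The potential is largest if none of the \<open>2 * n\<close> literals has a unit
    clause and no pair has been added.\<close>
  define Wt where "Wt = 2 * 2 powr ((x + y * real D) * (2 * real n))"
  have W: "?\<Psi> z \<le> Wt"
  proof -
    have "potential ?N D x y ?G ?G \<le> (x + y * real D) * (2 * real n)"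
    proof -
      have "(x + y * real D) * (real ?N - real (card (unit_lits ?G))) \<le> (x + y * real D) * (2 * real n)"
        using xy by (intro mult_left_mono) simp_all
      moreover have "0 \<le> y * real (card (added ?G ?G))" using xy by simp
      ultimately show ?thesis unfolding potential_def by linarith
    qed
    then have "2 powr potential ?N D x y ?G ?G \<le> 2 powr ((x + y * real D) * (2 * real n))" by (rule powr_mono) simp
    then have "2 * 2 powr potential ?N D x y ?G ?G - 1 \<le> Wt" unfolding Wt_def by linarith
    then show ?thesis by (simp add: state_weight_def z form_weight_def)
  qed
  have "\<exists>k. real k \<le> ?\<Psi> z \<and> (\<forall>i < k. unfinished ((sparse_step r ^^ i) z)) \<and> \<not> unfinished ((sparse_step r ^^ k) z) \<and>
     (\<forall>i \<le> k. ?I ((sparse_step r ^^ i) z) \<and> ?\<Psi> ((sparse_step r ^^ i) z) \<le> ?\<Psi> z)"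
  proof (rule measure_loop[where I = ?I and z = z])
    show "0 \<le> ?\<Psi> z" if "?I z" for z using state_weight_ge[OF that xy] by simp
    show "?I (sparse_step r z) \<and> ?\<Psi> (sparse_step r z) + 1 \<le> ?\<Psi> z" if "?I z" "unfinished z" for z
      by (rule sparse_step_inv[OF that r m xy D t w])
  qed (rule Iz)
  then obtain k where k: "real k \<le> ?\<Psi> z" "\<forall>i < k. unfinished ((sparse_step r ^^ i) z)" "\<not> unfinished ((sparse_step r ^^ k) z)"
    "\<forall>i \<le> k. ?I ((sparse_step r ^^ i) z) \<and> ?\<Psi> ((sparse_step r ^^ i) z) \<le> ?\<Psi> z" by blast
  have res: "loop_result unfinished (sparse_step r) z = (sparse_step r ^^ k) z"
    using k(2,3) by (intro loop_result_eq) auto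
  have "?I ((sparse_step r ^^ k) z)" using k(4) by blast
  then have "satisfiable F = fst (snd ((sparse_step r ^^ k) z))" using k(3) by (simp add: state_inv_def unfinished_def)
  then show "decide r (((t1, t2, t3), m), enc_cnf n F) = [satisfiable F]"
    unfolding decide_def z_def[symmetric] res by simp
  \<comment> \<open>The empty formula is used as a witness: \<open>\<tau>\<close> bounds a running
    time on it.\<close>
  have \<tau>0: "0 \<le> \<tau>"
  proof -
    have "real (solver_time M r (leaf_inst (m, []))) \<le> T (swap_order (length (leaf_vertices (m, []))) m) (2 * m)"
      by (rule solver_time_leaf(2)[OF r m M])
    also have "\<dots> \<le> \<tau>"
    proof (rule \<tau>)
      have "length (leaf_vertices (m, [])) \<le> m * 3 ^ (length ([] :: nat list list) div m + 1)" by (rule length_leaf_vertices)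
      also have "\<dots> \<le> m * 3 ^ Q" unfolding Q by (intro mult_left_mono power_increasing) auto
      finally show "length (leaf_vertices (m, [])) \<le> m * 3 ^ Q" .
    qed
    finally show ?thesis by simp
  qed
  \<comment> \<open>The first summand covers the work list, at \<open>9 * (2 * n + 1) ^ 4\<close>
    per formula by \<open>sz_form\<close> and 1 per list cell. The 6 covers the other constructors
    and the Boolean, and the last bracket one leaf.\<close>
  define B where "B = Wt * (10 * (2 * real n + 1) ^ 4) + real (sz ((t1, t2, t3), m, ?N)) + 6 + (3 ^ Q + \<tau>)"
  have Wt0: "0 \<le> Wt" by (simp add: Wt_def)
  have N1: "1 \<le> (2 * real n + 1) ^ 4" by (rule one_le_power) simp
  have Bk: "?\<Psi> z \<le> B"
  proof -
    have "Wt * 1 \<le> Wt * (10 * (2 * real n + 1) ^ 4)" using Wt0 N1 by (intro mult_left_mono) linarith+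
    moreover have "(0 :: real) \<le> 3 ^ Q" "0 \<le> real (sz ((t1, t2, t3), m, ?N))" by (simp, rule of_nat_0_le_iff)
    ultimately show ?thesis using W \<tau>0 unfolding B_def by linarith
  qed
  have B0: "0 \<le> B" using k(1) Bk by simp
  define s where "s = nat \<lceil>B\<rceil>"
  have sB: "B \<le> real s" "real s \<le> B + 1" using B0 unfolding s_def by linarith+
  have st: "step_dom M r u \<and> sz u + step_cost M r u \<le> s" if u: "?I u" "?\<Psi> u \<le> ?\<Psi> z" for u
  proof -
    have good: "\<forall>F\<in>set (snd (snd u)). good_form ?N D ?G F" and p: "fst u = ((t1, t2, t3), m, ?N)"
      using u(1) by (simp_all add: state_inv_def)
    have "sz (snd (snd u)) \<le> 1 + length (snd (snd u)) * (1 + 9 * (?N + 1) ^ 4)"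
      using good good_formD(4) by (intro sz_list_le) blast
    moreover have "1 + 9 * (?N + 1) ^ 4 \<le> 10 * (?N + 1) ^ 4" using one_le_power[of "?N + 1" 4] by simp
    then have "length (snd (snd u)) * (1 + 9 * (?N + 1) ^ 4) \<le> length (snd (snd u)) * (10 * (?N + 1) ^ 4)" by (rule mult_left_mono) simp
    ultimately have "sz (snd (snd u)) \<le> 1 + length (snd (snd u)) * (10 * (?N + 1) ^ 4)" by linarith
    then have "real (sz (snd (snd u))) \<le> real (1 + length (snd (snd u)) * (10 * (?N + 1) ^ 4))" by (rule of_nat_mono)
    also have "\<dots> = 1 + real (length (snd (snd u))) * (10 * (2 * real n + 1) ^ 4)" by (simp add: add.commute)
    also have "\<dots> \<le> 1 + Wt * (10 * (2 * real n + 1) ^ 4)"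
      using state_weight_ge[OF u(1) xy] u(2) W by (intro add_left_mono mult_right_mono) simp_all
    finally have l: "real (sz (snd (snd u))) \<le> 1 + Wt * (10 * (2 * real n + 1) ^ 4)" .
    have su: "sz u = 2 + sz ((t1, t2, t3), m, ?N) + sz (fst (snd u)) + sz (snd (snd u))"
      unfolding sz_prod[of u] p sz_prod[of "snd u"] by simp
    have c: "step_dom M r u \<and> real (step_cost M r u) \<le> 3 ^ Q + \<tau>"
    proof (cases "at_leaf u")
      case False
      then show ?thesis using \<tau>0 by (simp add: step_dom_def step_cost_def)
    next
      case True
      then obtain F' ws where ws: "snd (snd u) = F' # ws" by (cases "snd (snd u)") (auto simp: at_leaf_def)
      have F': "good_form ?N D ?G F'" using good ws by simp
      have arg: "leaf_arg u = (m, F')" by (simp add: leaf_arg_def p ws)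
      have "find_branch (t1, t2, t3) ?N F' = None" using True by (simp add: at_leaf_def branch_at_def p ws)
      then have "length F' \<le> 1 + ?N * (1 + t1 + t3)"
        using find_branch_cases[OF good_formD(1)[OF F'] t(1,2), of t3] good_formD(1,3)[OF F'] by (intro sparse_length) simp_all
      then have q: "length F' div m + 1 \<le> Q" unfolding Q by (intro add_right_mono div_le_mono) simp
      then have q3: "(3 :: nat) ^ (length F' div m + 1) \<le> 3 ^ Q" by (intro power_increasing) auto
      have "length (leaf_vertices (m, F')) \<le> m * 3 ^ Q"
        by (rule order_trans[OF length_leaf_vertices mult_left_mono[OF q3]]) simp
      from \<tau>[OF this] solver_time_leaf(2)[OF r m M, of F']
      have "real (solver_time M r (leaf_inst (m, F'))) \<le> \<tau>" by linarith
      moreover have "real (3 ^ (length F' div m + 1)) \<le> 3 ^ Q" using of_nat_mono[OF q3, where 'a = real] by simp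
      ultimately show ?thesis using True solver_time_leaf(1)[OF r m M, of F']
        by (simp add: step_dom_def step_cost_def leaf_cost_def arg)
    qed
    have "real (sz u) + real (step_cost M r u) \<le> B"
      using c l sz_bool[of "fst (snd u)"] unfolding su B_def by simp
    then have "real (sz u + step_cost M r u) \<le> real s" using sB(1) by simp
    then show ?thesis using c by (simp only: of_nat_le_iff)
  qed
  have "run_cost M r z s" unfolding run_cost_def loop_cost_def
  proof (intro exI[of _ k] conjI allI impI)
    show "k \<le> s" using k(1) Bk sB(1) by linarith
  qed (use k st in auto)
  moreover have "real s \<le> 20 * 2 powr ((x + y * real D) * (2 * real n)) * (2 * real n + 1) ^ 4 + real (sz ((t1, t2, t3), m, 2 * n)) + 7 + 3 ^ Q + \<tau>"
    using sB(2) unfolding B_def Wt_def by simp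
  ultimately show "\<exists>s. run_cost M r z s \<and>
      real s \<le> 20 * 2 powr ((x + y * real D) * (2 * real n)) * (2 * real n + 1) ^ 4 + real (sz ((t1, t2, t3), m, 2 * n)) + 7 + 3 ^ Q + \<tau>" by blast
qed

section \<open>Choice of the parameters and final estimates\<close>

lemma times_powr_small:
  assumes "0 < x" "0 < e"
  obtains t0 :: nat where "1 \<le> t0" "\<And>t. t0 \<le> t \<Longrightarrow> real t * 2 powr - (real t * x) \<le> e"
proof -
  define \<rho> where "\<rho> = 2 powr - x"
  have \<rho>: "0 < \<rho>" "\<rho> < 1" using assms(1) powr_less_mono[of "- x" 0 2] by (simp_all add: \<rho>_def)
  have p: "2 powr - (real t * x) = \<rho> ^ t" for t
    unfolding \<rho>_def by (simp add: powr_power mult.commute)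
  have "(\<lambda>t. real t * \<rho> ^ t) \<longlonglongrightarrow> 0" by (rule powser_times_n_limit_0) (use \<rho> in simp)
  from LIMSEQ_D[OF this assms(2)] obtain t0 where t0: "\<forall>t\<ge>t0. norm (real t * \<rho> ^ t - 0) < e" by blast
  show thesis
  proof (rule that[of "Suc t0"])
    fix t assume "Suc t0 \<le> t"
    then have "norm (real t * \<rho> ^ t - 0) < e" using t0 by simp
    then show "real t * 2 powr - (real t * x) \<le> e" unfolding p by simp
  qed simp
qed

lemma powr_small:
  assumes "0 < x" "0 < e"
  obtains t :: nat where "1 \<le> t" "2 powr - (real t * x) \<le> e"
proof -
  obtain t0 where t0: "1 \<le> t0" "\<And>t. t0 \<le> t \<Longrightarrow> real t * 2 powr - (real t * x) \<le> e"
    using times_powr_small[OF assms] by blast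
  have "1 * 2 powr - (real t0 * x) \<le> real t0 * 2 powr - (real t0 * x)" using t0(1) by (intro mult_right_mono) simp_all
  then have "2 powr - (real t0 * x) \<le> e" using t0(2)[of t0] by linarith
  then show thesis by (rule that[OF t0(1)])
qed

text \<open>From \<open>1 / 2 \<le> ln 2\<close> follows \<open>1 + y / 2 \<le> 2 powr y\<close>,
  and \<open>(1 - y / 4) * (1 + y / 2)\<close> is at least 1 on the unit interval. The gap
  \<open>y / 4\<close> is the room for the petals branch in case B.\<close>

lemma two_powr_minus_le:
  fixes y :: real
  assumes "0 \<le> y" "y \<le> 1"
  shows "2 powr - y \<le> 1 - y / 4"
proof -
  have "1 / 2 \<le> ln (2 :: real)" by (subst ln_ge_iff) (simp_all only: exp_half_le2 zero_less_numeral)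
  then have "1 + y / 2 \<le> 1 + y * ln 2" using assms(1) mult_left_mono[of "1 / 2" "ln 2" y] by simp
  also have "\<dots> \<le> exp (y * ln 2)" by (rule exp_ge_add_one_self)
  also have "\<dots> = 2 powr y" by (simp add: powr_def)
  finally have h: "1 + y / 2 \<le> 2 powr y" .
  have "y * y \<le> 1 * y" using assms by (intro mult_right_mono) auto
  then have "1 \<le> (1 - y / 4) * (1 + y / 2)" using assms by (simp add: field_simps)
  also have "\<dots> \<le> (1 - y / 4) * 2 powr y" using h assms by (intro mult_left_mono) auto
  finally show ?thesis by (simp add: powr_minus_divide divide_le_eq)
qed

text \<open>The order of choice is \<open>x\<close>, \<open>t1\<close>, \<open>t2\<close>,
  \<open>y\<close>, \<open>t3\<close>. The obstacle lies in \<open>t2\<close>: \<open>y\<close> has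
  to be of order \<open>1 / (t1 + t2)\<close>, and yet \<open>2 powr - (real t2 * x)\<close> must
  not exceed \<open>y / 4\<close>. So \<open>t2\<close> is taken so large that even its product with
  this power is small.\<close>

lemma sparse_parameters:
  assumes "0 < (\<gamma> :: real)"
  obtains x y :: real and t1 t2 t3 :: nat where "0 < x" "0 < y" "1 \<le> t1" "1 \<le> t2" "1 \<le> t3"
    "x + y * real (t1 + t2) \<le> \<gamma> / 2" "2 powr - x + 2 powr - (real t1 * x) \<le> 1"
    "2 powr - y + 2 powr - (real t2 * x) \<le> 1" "2 powr - x + 2 powr - (real t3 * y) \<le> 1"
proof -
  define x where "x = \<gamma> / 4"
  define \<kappa> where "\<kappa> = min (\<gamma> / 4) 1"
  have x: "0 < x" and \<kappa>: "0 < \<kappa>" "\<kappa> \<le> 1" "\<kappa> \<le> \<gamma> / 4" using assms by (auto simp: x_def \<kappa>_def)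
  have \<rho>: "0 < 1 - 2 powr - x" using x powr_less_mono[of "- x" 0 2] by simp
  obtain t1 where t1: "1 \<le> t1" "2 powr - (real t1 * x) \<le> 1 - 2 powr - x" using powr_small[OF x \<rho>] by blast
  obtain t0 where t0: "1 \<le> t0" "\<And>t. t0 \<le> t \<Longrightarrow> real t * 2 powr - (real t * x) \<le> \<kappa> / 8"
    using times_powr_small[OF x, of "\<kappa> / 8"] \<kappa>(1) by auto
  \<comment> \<open>Being at least \<open>t0\<close> makes the product at most
    \<open>\<kappa> / 8\<close>; being at least \<open>t1\<close> gives
    \<open>t1 + t2 \<le> 2 * t2\<close>, which uses up the remaining factor 2.\<close>
  define t2 where "t2 = max t0 t1"
  define y where "y = \<kappa> / real (t1 + t2)"
  have D: "1 \<le> real (t1 + t2)" using t1(1) by simp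
  have y: "0 < y" "y \<le> 1" "y * real (t1 + t2) = \<kappa>"
    using \<kappa> D by (auto simp: y_def divide_le_eq)
  obtain t3 where t3: "1 \<le> t3" "2 powr - (real t3 * y) \<le> 1 - 2 powr - x" using powr_small[OF y(1) \<rho>] by blast
  have "2 powr - (real t2 * x) \<le> y / 4"
  proof -
    have "real (t1 + t2) * 2 powr - (real t2 * x) \<le> (2 * real t2) * 2 powr - (real t2 * x)"
      by (intro mult_right_mono) (simp_all add: t2_def)
    also have "\<dots> \<le> \<kappa> / 4" using t0(2)[of t2] by (simp add: t2_def)
    finally show ?thesis using D by (simp add: y_def field_simps)
  qed
  moreover have "2 powr - y \<le> 1 - y / 4" using y by (intro two_powr_minus_le) simp_all
  ultimately have "2 powr - y + 2 powr - (real t2 * x) \<le> 1" by simp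
  moreover have "x + y * real (t1 + t2) \<le> \<gamma> / 2" using y(3) \<kappa>(3) by (simp add: x_def)
  moreover have "1 \<le> t2" using t1(1) by (simp add: t2_def)
  ultimately show thesis using t1 t3 x y(1) by (intro that[of x y t1 t2 t3]) simp_all
qed

text \<open>\<open>1 + 2 * n * B\<close> bounds the clauses of a leaf, with two literals per
  variable. Rounding costs at most two factors of 3, hence the 9, and replacing 3 by
  \<open>2 powr 2\<close> doubles the exponent.\<close>

lemma three_power_le:
  assumes "1 \<le> m"
  shows "(3 :: real) ^ ((1 + 2 * n * B) div m + 1) \<le> 9 * 2 powr (4 * real B / real m * real n)"
proof -
  let ?Q = "(1 + 2 * n * B) div m + 1"
  have "real ((1 + 2 * n * B) div m) \<le> real (1 + 2 * n * B) / real m" by (rule of_nat_div_le_of_nat)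
  also have "\<dots> = 1 / real m + 2 * real n * real B / real m" by (simp add: add_divide_distrib)
  also have "\<dots> \<le> 1 + 2 * real n * real B / real m" using assms by simp
  finally have q: "real ?Q \<le> 2 + 2 * real n * real B / real m" by simp
  have "(3 :: real) ^ ?Q = 3 powr real ?Q" by (rule powr_realpow[symmetric]) simp
  also have "\<dots> \<le> 3 powr (2 + 2 * real n * real B / real m)" by (rule powr_mono[OF q]) simp
  also have "\<dots> = 9 * 3 powr (2 * real n * real B / real m)" by (simp add: powr_add)
  also have "\<dots> \<le> 9 * (2 powr 2) powr (2 * real n * real B / real m)"
    by (intro mult_left_mono powr_mono2) simp_all
  also have "\<dots> = 9 * 2 powr (4 * real B / real m * real n)" unfolding powr_powr by (simp add: mult.commute mult.left_commute)
  finally show ?thesis .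
qed

text \<open>\<open>swap_order v m\<close> is \<open>3 * v + 13 * m + 3\<close>, so 19 times
  \<open>m * 3 ^ Q\<close> bounds it, and \<open>171 = 19 * 9\<close>. The \<open>1 / m\<close> in
  the exponent of \<open>3 ^ Q\<close> cancels against the exponent \<open>2 * m * \<eta>\<close>;
  the factor that depends on \<open>n\<close> is thus the same for all \<open>m\<close>.\<close>

lemma leaf_time_le:
  fixes g :: real
  assumes m: "1 \<le> m" and v: "v \<le> m * 3 ^ Q" and Q: "3 ^ Q \<le> 9 * 2 powr (4 * real B / real m * real n)"
    and g: "g \<le> \<eta> * (2 * real m)" "0 \<le> \<eta>"
  shows "real (max 1 (swap_order v m)) powr g \<le> (171 * real m) powr (2 * real m * \<eta>) * 2 powr (8 * real B * \<eta> * real n)"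
proof -
  let ?u = "4 * real B / real m * real n"
  have "1 \<le> (3 :: nat) ^ Q" by simp
  then have "m * 1 \<le> m * 3 ^ Q" by (rule mult_left_mono) simp
  moreover define q where "q = m * 3 ^ Q"
  ultimately have "max 1 (swap_order v m) \<le> 19 * (m * 3 ^ Q)"
    using v m unfolding q_def[symmetric] swap_order_def by simp
  then have "real (max 1 (swap_order v m)) \<le> real (19 * (m * 3 ^ Q))" by (rule of_nat_mono)
  also have "\<dots> = 19 * real m * 3 ^ Q" by simp
  also have "\<dots> \<le> 19 * real m * (9 * 2 powr ?u)" by (rule mult_left_mono[OF Q]) simp
  finally have le: "real (max 1 (swap_order v m)) \<le> 171 * real m * 2 powr ?u" by simp
  have "real (max 1 (swap_order v m)) powr g \<le> real (max 1 (swap_order v m)) powr (\<eta> * (2 * real m))"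
    by (rule powr_mono[OF g(1)]) simp
  also have "\<dots> \<le> (171 * real m * 2 powr ?u) powr (\<eta> * (2 * real m))"
    by (rule powr_mono2[OF _ _ le]) (use g(2) in simp_all)
  also have "\<dots> = (171 * real m) powr (\<eta> * (2 * real m)) * 2 powr (?u * (\<eta> * (2 * real m)))"
    by (simp add: powr_mult powr_powr)
  also have "?u * (\<eta> * (2 * real m)) = 8 * real B * \<eta> * real n" using m by (simp add: field_simps)
  finally show ?thesis by (simp add: mult.commute mult.left_commute)
qed

text \<open>The exponent \<open>a\<close> is obtained first, then \<open>\<gamma>\<close>, the
  thresholds, \<open>\<eta>\<close> and \<open>m\<close>, and only then the machine with these data
  hardwired. As \<open>m\<close> does not depend on \<open>n\<close>, \<open>f (2 * m)\<close> is a
  constant factor.\<close>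

theorem subexponential_sat:
  assumes r: "3 \<le> r" and g: "g \<in> o(\<lambda>k. real k)"
    and sol: "r_swap_solvable_in r (\<lambda>n k. real (f k :: nat) * real (max 1 n) powr g k)" and c: "0 < (c :: real)"
  shows "\<exists>M a d. wf_tm M \<and> (\<forall>n F. is_3cnf n F \<longrightarrow> (\<exists>t.
        real t \<le> 2 powr (c * real n) * (real a * real (length (enc_cnf n F)) ^ d) \<and>
        computes_within M (enc_cnf n F) [satisfiable F] t))"
proof -
  let ?T = "\<lambda>n k. real (f k) * real (max 1 n) powr g k"
  obtain M0 where M0: "wf_tm M0" "\<And>n E c k. simple_graph n E \<Longrightarrow> coloring r n c \<Longrightarrow> 0 < k \<Longrightarrow> \<exists>t. real t \<le> ?T n k \<and>
      computes_within M0 (enc_inst (enc_colored_graph n E c) k) [swappable n E c k] t"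
    using sol unfolding r_swap_solvable_in_def by blast
  obtain a where a: "\<And>p. \<exists>M. wf_tm M \<and> (\<forall>w. (\<exists>s. run_cost M0 r (start_state (p, w)) s) \<longrightarrow>
      computes_within M w (decide r (p, w)) ((sz p + length w + (LEAST s. run_cost M0 r (start_state (p, w)) s) + 2) ^ a))"
    using tc_tm_param[OF tc_decide[OF M0(1), of r]] by blast
  \<comment> \<open>The final time is an \<open>a\<close>-th power of a bound of order
    \<open>2 powr (\<gamma> * n)\<close> up to polynomials; the added 1 keeps
    \<open>\<gamma>\<close> positive if \<open>a = 0\<close>.\<close>
  define \<gamma> where "\<gamma> = c / (real a + 1)"
  have \<gamma>: "0 < \<gamma>" using c by (simp add: \<gamma>_def)
  obtain x y t1 t2 t3 where xy: "0 < x" "0 < y" and t: "1 \<le> t1" "1 \<le> t2" "1 \<le> t3"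
    and small: "x + y * real (t1 + t2) \<le> \<gamma> / 2" and w: "2 powr - x + 2 powr - (real t1 * x) \<le> 1"
    "2 powr - y + 2 powr - (real t2 * x) \<le> 1" "2 powr - x + 2 powr - (real t3 * y) \<le> 1"
    by (rule sparse_parameters[OF \<gamma>])
  define B where "B = 1 + t1 + t3"
  \<comment> \<open>This turns the exponent \<open>8 * B * \<eta> * n\<close> of
    \<open>leaf_time_le\<close> into \<open>\<gamma> * n\<close>.\<close>
  define \<eta> where "\<eta> = \<gamma> / (8 * real B)"
  have B: "0 < real B" by (simp add: B_def)
  have \<eta>: "0 < \<eta>" "8 * real B * \<eta> = \<gamma>" using \<gamma> B by (simp_all add: \<eta>_def)
  have "eventually (\<lambda>k. norm (g k) \<le> \<eta> * norm (real k)) at_top" by (rule landau_o.smallD[OF g \<eta>(1)])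
  then obtain k0 where k0: "\<And>k. k0 \<le> k \<Longrightarrow> \<bar>g k\<bar> \<le> \<eta> * real k" by (auto simp: eventually_at_top_linorder)
  \<comment> \<open>Beyond \<open>k0\<close> the function \<open>g\<close> is small relative to its
    argument, and the ceiling makes \<open>4 * B / m\<close>, the exponent for the number of words
    per chunk, at most \<open>\<gamma>\<close>.\<close>
  define m where "m = max 1 (max k0 (nat \<lceil>4 * real B / \<gamma>\<rceil>))"
  have m: "1 \<le> m" "k0 \<le> m" by (simp_all add: m_def)
  have "4 * real B / \<gamma> \<le> real (nat \<lceil>4 * real B / \<gamma>\<rceil>)" by (rule real_nat_ceiling_ge)
  also have "\<dots> \<le> real m" by (rule of_nat_mono) (simp only: m_def max.cobounded2 max.coboundedI2)
  finally have mB: "4 * real B / real m \<le> \<gamma>" using \<gamma> m(1) by (simp add: field_simps)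
  have gm: "g (2 * m) \<le> \<eta> * (2 * real m)" using k0[of "2 * m"] m(2) by simp
  let ?p = "((t1, t2, t3), m)"
  define K0 where "K0 = real (f (2 * m)) * (171 * real m) powr (2 * real m * \<eta>)"
  \<comment> \<open>One summand for each term in the estimate of \<open>X\<close> below, each term
    being at most its coefficient times \<open>Z\<close>; 320 is \<open>20 * 16\<close>, from
    \<open>(2 * L) ^ 4\<close>.\<close>
  define K where "K = real (sz ?p) + 1 + 2 + 320 + (real (sz ?p) + 6) + 7 + 9 + K0"
  have K0: "0 \<le> K0" by (simp add: K0_def)
  obtain M where M: "wf_tm M" "\<And>w. (\<exists>s. run_cost M0 r (start_state (?p, w)) s) \<Longrightarrow>
      computes_within M w (decide r (?p, w)) ((sz ?p + length w + (LEAST s. run_cost M0 r (start_state (?p, w)) s) + 2) ^ a)"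
    using a[of ?p] by blast
  have main: "\<exists>t. real t \<le> 2 powr (c * real n) * (real (nat \<lceil>K ^ a\<rceil>) * real (length (enc_cnf n F)) ^ (4 * a)) \<and>
      computes_within M (enc_cnf n F) [satisfiable F] t" if F: "is_3cnf n F" for n F
  proof -
    define L where "L = length (enc_cnf n F)"
    define E where "E = 2 powr (\<gamma> * real n)"
    define Q where "Q = (1 + 2 * n * (1 + t1 + t3)) div m + 1"
    have L: "n + 1 \<le> L" by (simp add: L_def enc_cnf_def length_enc_nats)
    have E: "1 \<le> E" unfolding E_def using \<gamma> by (intro ge_one_powr_ge_zero) simp_all
    have Q9: "3 ^ Q \<le> 9 * 2 powr (4 * real B / real m * real n)"
      using three_power_le[OF m(1), of n B] by (simp add: Q_def B_def)
    have "2 powr (4 * real B / real m * real n) \<le> E" unfolding E_def using mB by (intro powr_mono mult_right_mono) simp_all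
    then have QE: "3 ^ Q \<le> 9 * E" using Q9 by linarith
    have \<tau>: "?T (swap_order v m) (2 * m) \<le> K0 * E" if v: "v \<le> m * 3 ^ Q" for v
    proof -
      have "real (max 1 (swap_order v m)) powr g (2 * m) \<le> (171 * real m) powr (2 * real m * \<eta>) * 2 powr (8 * real B * \<eta> * real n)"
        by (rule leaf_time_le[OF m(1) v Q9 gm]) (use \<eta>(1) in simp)
      also have "\<dots> = (171 * real m) powr (2 * real m * \<eta>) * E" unfolding \<eta>(2) E_def ..
      finally have "real (f (2 * m)) * real (max 1 (swap_order v m)) powr g (2 * m) \<le>
        real (f (2 * m)) * ((171 * real m) powr (2 * real m * \<eta>) * E)" by (rule mult_left_mono) simp
      then show ?thesis by (simp add: K0_def mult.assoc)
    qed
    note dc = decide_correct[OF F r m(1) xy refl t w M0(2) Q_def \<tau>]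
    have d1: "decide r (?p, enc_cnf n F) = [satisfiable F]" by (rule dc(1))
    obtain s where s: "run_cost M0 r (start_state (?p, enc_cnf n F)) s"
      "real s \<le> 20 * 2 powr ((x + y * real (t1 + t2)) * (2 * real n)) * (2 * real n + 1) ^ 4 + real (sz ((t1, t2, t3), m, 2 * n)) + 7 + 3 ^ Q + K0 * E"
      using dc(2) by blast
    define X where "X = sz ?p + L + (LEAST s. run_cost M0 r (start_state (?p, enc_cnf n F)) s) + 2"
    have le: "(LEAST s. run_cost M0 r (start_state (?p, enc_cnf n F)) s) \<le> s" using s(1) by (rule Least_le)
    have L1: "1 \<le> real L" using L by simp
    define Z where "Z = E * real L ^ 4"
    have L4: "real L \<le> real L ^ 4" using L1 self_le_power[of "real L" 4] by simp
    have L41: "1 \<le> real L ^ 4" using L1 by (rule one_le_power)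
    have ZE: "E \<le> Z" unfolding Z_def using mult_left_mono[OF L41, of E] E by simp
    have ZL: "real L \<le> Z" unfolding Z_def using L4 mult_right_mono[OF E, of "real L ^ 4"] L41 by linarith
    have Z1: "1 \<le> Z" using ZE E by simp
    have t20: "20 * 2 powr ((x + y * real (t1 + t2)) * (2 * real n)) * (2 * real n + 1) ^ 4 \<le> 320 * Z"
    proof -
      have "(x + y * real (t1 + t2)) * (2 * real n) \<le> \<gamma> / 2 * (2 * real n)" by (rule mult_right_mono[OF small]) simp
      then have 1: "2 powr ((x + y * real (t1 + t2)) * (2 * real n)) \<le> E" unfolding E_def by (intro powr_mono) simp_all
      have "(2 * real n + 1) ^ 4 \<le> (2 * real L) ^ 4" using L by (intro power_mono) simp_all
      then have "(2 * real n + 1) ^ 4 \<le> 16 * real L ^ 4" by (simp add: power_mult_distrib)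
      then have "2 powr ((x + y * real (t1 + t2)) * (2 * real n)) * (2 * real n + 1) ^ 4 \<le> E * (16 * real L ^ 4)"
        using 1 E by (intro mult_mono) simp_all
      then show ?thesis by (simp add: Z_def mult.commute mult.left_commute)
    qed
    have szp: "real (sz ((t1, t2, t3), m, 2 * n)) \<le> (real (sz ?p) + 6) * Z"
    proof -
      have "real (sz ((t1, t2, t3), m, 2 * n)) = real (sz ?p) + 2 + 4 * real n" by simp
      also have "\<dots> \<le> real (sz ?p) * 1 + 6 * real L" using L by simp
      also have "\<dots> \<le> real (sz ?p) * Z + 6 * Z" using Z1 ZL by (intro add_mono mult_left_mono) simp_all
      finally show ?thesis by (simp add: distrib_right)
    qed
    have k: "real (sz ?p) \<le> real (sz ?p) * Z" using mult_left_mono[OF Z1, of "real (sz ?p)"] by simp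
    have k0: "K0 * E \<le> K0 * Z" by (rule mult_left_mono[OF ZE K0])
    have "real X \<le> real (sz ?p) + real L + 2 + real s" using le by (simp add: X_def)
    also have "\<dots> \<le> real (sz ?p) * Z + Z + 2 * Z + 320 * Z + (real (sz ?p) + 6) * Z + 7 * Z + 9 * Z + K0 * Z"
      using s(2) t20 szp k k0 ZL Z1 ZE QE by linarith
    also have "\<dots> = K * Z" by (simp add: K_def distrib_right)
    finally have XK: "real X \<le> K * Z" .
    have K00: "0 \<le> K" using K0 by (simp add: K_def)
    have "real (X ^ a) \<le> (K * Z) ^ a" unfolding of_nat_power by (rule power_mono[OF XK]) simp
    also have "\<dots> = K ^ a * (E ^ a * real L ^ (4 * a))" by (simp add: Z_def power_mult_distrib power_mult)
    also have "\<dots> \<le> real (nat \<lceil>K ^ a\<rceil>) * (2 powr (c * real n) * real L ^ (4 * a))"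
    proof (intro mult_mono)
      show "K ^ a \<le> real (nat \<lceil>K ^ a\<rceil>)" by (rule real_nat_ceiling_ge)
      have "\<gamma> * real a \<le> c" using c by (simp add: \<gamma>_def field_simps)
      then have "\<gamma> * real a * real n \<le> c * real n" by (rule mult_right_mono) simp
      then have "\<gamma> * real n * real a \<le> c * real n" by (simp only: mult_ac)
      then have "2 powr (\<gamma> * real n * real a) \<le> 2 powr (c * real n)" by (rule powr_mono) simp
      then show "E ^ a \<le> 2 powr (c * real n)" unfolding E_def by (simp add: powr_power mult.commute mult.left_commute)
    qed (rule of_nat_0_le_iff | (use E K00 in simp))+
    finally have "real (X ^ a) \<le> 2 powr (c * real n) * (real (nat \<lceil>K ^ a\<rceil>) * real L ^ (4 * a))" by (simp add: mult_ac)
    moreover have "computes_within M (enc_cnf n F) [satisfiable F] (X ^ a)"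
      using M(2)[OF exI[of _ s], OF s(1)] by (simp only: d1 X_def L_def)
    ultimately show ?thesis unfolding L_def by blast
  qed
  show ?thesis
    by (rule exI[of _ M], rule exI[of _ "nat \<lceil>K ^ a\<rceil>"], rule exI[of _ "4 * a"]) (use M(1) main in blast)
qed

theorem theorem2:
  fixes r :: nat
  assumes "r \<ge> 3"
  shows "W_hard 1 (r_swap r) \<and>
    (ETH \<longrightarrow> \<not> (\<exists>(f :: nat \<Rightarrow> nat) (g :: nat \<Rightarrow> real).
       computable f \<and> g \<in> o(\<lambda>k. real k) \<and>
       r_swap_solvable_in r (\<lambda>n k. real (f k) * real (max 1 n) powr g k)))"
proof (intro conjI impI notI)
  show "W_hard 1 (r_swap r)" by (rule W1_hard_r_swap[OF assms])
  assume ETH "\<exists>(f :: nat \<Rightarrow> nat) (g :: nat \<Rightarrow> real). computable f \<and> g \<in> o(\<lambda>k. real k) \<and>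
       r_swap_solvable_in r (\<lambda>n k. real (f k) * real (max 1 n) powr g k)"
  then obtain c f g where c: "0 < (c :: real)" "\<not> (\<exists>M a d. wf_tm M \<and> (\<forall>n F. is_3cnf n F \<longrightarrow> (\<exists>t.
        real t \<le> 2 powr (c * real n) * (real a * real (length (enc_cnf n F)) ^ d) \<and>
        computes_within M (enc_cnf n F) [satisfiable F] t)))"
    and g: "g \<in> o(\<lambda>k. real k)" "r_swap_solvable_in r (\<lambda>n k. real (f k :: nat) * real (max 1 n) powr g k)"
    unfolding ETH_def by (elim exE conjE) (rule that)
  show False using c(2) subexponential_sat[OF assms g c(1)] by (rule notE)
qed

end
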